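(* Let $\Omega\subset\mathbb{R}^N$ ($N\ge3$) be a bounded domain, let $f:\mathbb{R}\to\mathbb{R}$ be an odd $\mathcal{C}^1$ function with $f\ge0$ on $[0,\infty)$, and set $F(t)=\int_0^tf(s)\,ds$. Let $a:[0,\infty)\to[0,\infty)$ be $\mathcal{C}^1$ in $(0,\infty)$ and set $A(t)=\int_0^ta(s)\,ds$. Assume that there exist $p\ge q>1$ such that: (1) $k_0\big(1+t^{\frac{q-p}{p}}\big)\le a(t)\le k_1\big(1+t^{\frac{q-p}{p}}\big)$ for all $t>0$, where $k_0,k_1$ are positive constants. (2) $a$ is non-increasing. (3) $t\mapsto a(t^p)t^p$ and $t\mapsto A(t^p)-a(t^p)t^p$ are convex in $(0,\infty)$. (4) $\lim_{t\to0^+}\frac{f(t)}{t^{q-1}}=0$. (5) $\lim_{t\to\infty}\frac{F(t)}{t^p}=\infty$. (6) $\lim_{t\to\infty}\frac{f(t)}{t^{\alpha-1}}=0$ for some $\alpha\in(p,p^* )$. (7) $t\mapsto\frac{f(t)}{t^{p-1}}$ is increasing on $(0,\infty)$. Then the problem $$-\mathrm{div}\left(a(|\nabla u|^p)|\nabla u|^{p-2}\nabla u\right)=f(u),\quad u\in W_0^{1,p}(\Omega),$$ has a nontrivial and non-negative ground state.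
   Context: Solutions are weak solutions, i.e. critical points of the functional $\Phi(u)=\frac1p\int_\Omega A(|\nabla u|^p)-\int_\Omega F(u)$ on $W_0^{1,p}(\Omega)$. A nontrivial ground state is a $u_0\ne0$ with $\Phi'(u_0)=0$ and $\Phi(u_0)=\min\{\Phi(u):\ u\ne0,\ \Phi'(u)=0\}$. Here $p^*=\frac{Np}{N-p}$ if $p<N$ and $p^*=\infty$ if $p\ge N$. The vector $a(|\nabla u|^p)|\nabla u|^{p-2}\nabla u$ is understood as $0$ where $\nabla u=0$. "Increasing" is meant strictly. *)

theory Defs
  imports "HOL-Analysis.Analysis"
begin

text \<open>
  Functions on a domain \<open>\<Omega>\<close> are total functions on the ambient Euclidean space whose values outside
  \<open>\<Omega>\<close> are irrelevant; as usual, elements of Lebesgue and Sobolev spaces are representatives of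
  classes modulo equality almost everywhere in \<open>\<Omega>\<close>.
\<close>

section \<open>Sobolev spaces\<close>

definition Lp_space :: "'a::euclidean_space set \<Rightarrow> real \<Rightarrow> ('a \<Rightarrow> 'b::euclidean_space) set" where
  "Lp_space \<Omega> p = {u. u \<in> borel_measurable (lebesgue_on \<Omega>) \<and>
                      integrable (lebesgue_on \<Omega>) (\<lambda>x. norm (u x) powr p)}"

definition locally_integrable :: "'a::euclidean_space set \<Rightarrow> ('a \<Rightarrow> 'b::euclidean_space) \<Rightarrow> bool" where
  "locally_integrable \<Omega> u \<longleftrightarrow> (\<forall>K. compact K \<and> K \<subseteq> \<Omega> \<longrightarrow> integrable (lebesgue_on K) u)"

primrec C_k :: "nat \<Rightarrow> ('a::euclidean_space \<Rightarrow> real) \<Rightarrow> bool" where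
  "C_k 0 \<phi> = continuous_on UNIV \<phi>"
| "C_k (Suc k) \<phi> = ((\<forall>x. \<phi> differentiable (at x)) \<and>
     (\<forall>i\<in>Basis. C_k k (\<lambda>x. frechet_derivative \<phi> (at x) i)))"

text \<open>The space \<open>C\<^sub>c\<^sup>\<infinity>(\<Omega>)\<close>; its members are extended by zero to the whole space.\<close>

definition test_functions :: "'a::euclidean_space set \<Rightarrow> ('a \<Rightarrow> real) set" where
  "test_functions \<Omega> = {\<phi>. (\<forall>k. C_k k \<phi>) \<and>
     compact (closure {x. \<phi> x \<noteq> 0}) \<and> closure {x. \<phi> x \<noteq> 0} \<subseteq> \<Omega>}"

definition has_weak_gradient ::
    "'a::euclidean_space set \<Rightarrow> ('a \<Rightarrow> real) \<Rightarrow> ('a \<Rightarrow> 'a) \<Rightarrow> bool" where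
  "has_weak_gradient \<Omega> u g \<longleftrightarrow>
     locally_integrable \<Omega> u \<and> locally_integrable \<Omega> g \<and>
     (\<forall>\<phi>\<in>test_functions \<Omega>. \<forall>i\<in>Basis.
        (LINT x|lebesgue_on \<Omega>. u x * frechet_derivative \<phi> (at x) i) =
        - (LINT x|lebesgue_on \<Omega>. (g x \<bullet> i) * \<phi> x))"

text \<open>Weak gradients are unique up to null sets, so the choice made here is immaterial.\<close>

definition weak_gradient :: "'a::euclidean_space set \<Rightarrow> ('a \<Rightarrow> real) \<Rightarrow> 'a \<Rightarrow> 'a" where
  "weak_gradient \<Omega> u = (SOME g. has_weak_gradient \<Omega> u g)"

definition W1p :: "'a::euclidean_space set \<Rightarrow> real \<Rightarrow> ('a \<Rightarrow> real) set" where
  "W1p \<Omega> p = {u \<in> Lp_space \<Omega> p. \<exists>g \<in> Lp_space \<Omega> p. has_weak_gradient \<Omega> u g}"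

definition W1p_norm :: "'a::euclidean_space set \<Rightarrow> real \<Rightarrow> ('a \<Rightarrow> real) \<Rightarrow> real" where
  "W1p_norm \<Omega> p u =
     ((LINT x|lebesgue_on \<Omega>. \<bar>u x\<bar> powr p) +
      (LINT x|lebesgue_on \<Omega>. norm (weak_gradient \<Omega> u x) powr p)) powr (1 / p)"

text \<open>The closure of \<open>C\<^sub>c\<^sup>\<infinity>(\<Omega>)\<close> in \<open>W\<^sup>1\<^sup>,\<^sup>p(\<Omega>)\<close>.\<close>

definition W01p :: "'a::euclidean_space set \<Rightarrow> real \<Rightarrow> ('a \<Rightarrow> real) set" where
  "W01p \<Omega> p = {u \<in> W1p \<Omega> p. \<exists>\<phi>. (\<forall>n::nat. \<phi> n \<in> test_functions \<Omega>) \<and>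
     (\<lambda>n. W1p_norm \<Omega> p (\<lambda>x. u x - \<phi> n x)) \<longlonglongrightarrow> 0}"

definition sobolev_exponent :: "real \<Rightarrow> real \<Rightarrow> ereal" where
  "sobolev_exponent N p = (if p < N then ereal (N * p / (N - p)) else \<infinity>)"


section \<open>Critical points and ground states\<close>

text \<open>
  Frechet differentiability on \<open>W\<^sub>0\<^sup>1\<^sup>,\<^sup>p(\<Omega>)\<close>, written out because the library's derivative needs
  a normed space that is a type.
\<close>

definition has_W01p_derivative ::
    "'a::euclidean_space set \<Rightarrow> real \<Rightarrow> (('a \<Rightarrow> real) \<Rightarrow> real) \<Rightarrow> (('a \<Rightarrow> real) \<Rightarrow> real) \<Rightarrow>
     ('a \<Rightarrow> real) \<Rightarrow> bool" where
  "has_W01p_derivative \<Omega> p J L u \<longleftrightarrow>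
     (\<forall>v\<in>W01p \<Omega> p. \<forall>w\<in>W01p \<Omega> p. L (\<lambda>x. v x + w x) = L v + L w) \<and>
     (\<forall>c. \<forall>v\<in>W01p \<Omega> p. L (\<lambda>x. c * v x) = c * L v) \<and>
     (\<exists>K. \<forall>v\<in>W01p \<Omega> p. \<bar>L v\<bar> \<le> K * W1p_norm \<Omega> p v) \<and>
     (\<forall>\<epsilon>>0. \<exists>\<delta>>0. \<forall>h\<in>W01p \<Omega> p. W1p_norm \<Omega> p h < \<delta> \<longrightarrow>
        \<bar>J (\<lambda>x. u x + h x) - J u - L h\<bar> \<le> \<epsilon> * W1p_norm \<Omega> p h)"

definition critical_point ::
    "'a::euclidean_space set \<Rightarrow> real \<Rightarrow> (('a \<Rightarrow> real) \<Rightarrow> real) \<Rightarrow> ('a \<Rightarrow> real) \<Rightarrow> bool" where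
  "critical_point \<Omega> p J u \<longleftrightarrow> u \<in> W01p \<Omega> p \<and> has_W01p_derivative \<Omega> p J (\<lambda>_. 0) u"

definition nontrivial_on :: "'a::euclidean_space set \<Rightarrow> ('a \<Rightarrow> real) \<Rightarrow> bool" where
  "nontrivial_on \<Omega> u \<longleftrightarrow> \<not> (AE x in lebesgue_on \<Omega>. u x = 0)"

definition nontrivial_ground_state ::
    "'a::euclidean_space set \<Rightarrow> real \<Rightarrow> (('a \<Rightarrow> real) \<Rightarrow> real) \<Rightarrow> ('a \<Rightarrow> real) \<Rightarrow> bool" where
  "nontrivial_ground_state \<Omega> p J u0 \<longleftrightarrow>
     critical_point \<Omega> p J u0 \<and> nontrivial_on \<Omega> u0 \<and>
     (\<forall>u. critical_point \<Omega> p J u \<and> nontrivial_on \<Omega> u \<longrightarrow> J u0 \<le> J u)"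


section \<open>The quasilinear problem\<close>

text \<open>The signed integral from \<open>0\<close> to \<open>t\<close>; the value of the integrand at \<open>0\<close> plays no role.\<close>

definition primitive :: "(real \<Rightarrow> real) \<Rightarrow> real \<Rightarrow> real" where
  "primitive g t = (LBINT s=ereal 0..ereal t. g s)"

definition energy ::
    "'a::euclidean_space set \<Rightarrow> real \<Rightarrow> (real \<Rightarrow> real) \<Rightarrow> (real \<Rightarrow> real) \<Rightarrow> ('a \<Rightarrow> real) \<Rightarrow> real" where
  "energy \<Omega> p a f u =
     1 / p * (LINT x|lebesgue_on \<Omega>. primitive a (norm (weak_gradient \<Omega> u x) powr p)) -
     (LINT x|lebesgue_on \<Omega>. primitive f (u x))"

text \<open>
  Weak solutions of \<open>- div (a(|\<nabla>u|\<^sup>p) |\<nabla>u|\<^sup>p\<^sup>-\<^sup>2 \<nabla>u) = f(u)\<close> in \<open>W\<^sub>0\<^sup>1\<^sup>,\<^sup>p(\<Omega>)\<close>. Where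
  \<open>\<nabla>u = 0\<close> the vector field below vanishes, whatever the value of \<open>a 0\<close>.
\<close>

definition weak_solution ::
    "'a::euclidean_space set \<Rightarrow> real \<Rightarrow> (real \<Rightarrow> real) \<Rightarrow> (real \<Rightarrow> real) \<Rightarrow> ('a \<Rightarrow> real) \<Rightarrow> bool" where
  "weak_solution \<Omega> p a f u \<longleftrightarrow> u \<in> W01p \<Omega> p \<and>
     (\<forall>v\<in>W01p \<Omega> p.
        (LINT x|lebesgue_on \<Omega>.
           ((a (norm (weak_gradient \<Omega> u x) powr p) * norm (weak_gradient \<Omega> u x) powr (p - 2))
              *\<^sub>R weak_gradient \<Omega> u x) \<bullet> weak_gradient \<Omega> v x) =
        (LINT x|lebesgue_on \<Omega>. f (u x) * v x))"

end

theory Submission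
  imports Defs "HOL-Complex_Analysis.Great_Picard" "HOL-Library.Diagonal_Subsequence"
begin

text \<open>
  Write \<open>\<Phi>(u) = P(\<nabla>u) - Q(u)\<close> for the energy. Both parts are convex: \<open>Q\<close> because \<open>f\<close> is increasing, and
  \<open>P\<close> because \<open>s \<mapsto> a(s\<^sup>p)s\<^sup>p\<close> is convex and vanishes at \<open>0\<close>, so that \<open>a(s\<^sup>p)s\<^sup>p\<^sup>-\<^sup>1\<close>, its slope seen from
  the origin, is nondecreasing (\<open>flux_mono\<close>).

  The heart of the matter is the behaviour along rays. Since \<open>a\<close> is non-increasing, \<open>A\<close> is concave, and
  since \<open>f(t)/t\<^sup>p\<^sup>-\<^sup>1\<close> is increasing, \<open>F(ts)\<close> is strictly convex in \<open>t\<^sup>p\<close>. Hence \<open>\<Phi>(tu)\<close> is a strictly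
  concave function of \<open>t\<^sup>p\<close>, and its tangent inequality (\<open>ray_le\<close>) reads
  \<open>\<Phi>(tu) \<le> \<Phi>(u) + (t\<^sup>p - 1)/p \<Phi>'(u)u\<close>. Consequently every nontrivial critical point \<open>v\<close> maximises
  the energy on its own ray, and with \<open>c = inf {sup {\<Phi>(tu): t > 0}: u \<noteq> 0}\<close> it satisfies \<open>\<Phi>(v) \<ge> c\<close>.
  It remains to find a nonnegative critical point with energy \<open>c\<close>.

  The number \<open>c\<close> is positive (\<open>mountain\<close>) and some ray attains it (\<open>minimizing_ray\<close>): minimising
  functions with normalised gradients have a subsequence that converges in \<open>L\<^sup>\<alpha>\<close>, and convexity of \<open>P\<close>
  makes it lower semicontinuous. The limit is not \<open>0\<close>, since otherwise the energies at \<open>t u\<^sub>n\<close>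
  would have lower limits of at least a multiple of \<open>t\<^sup>p\<close> for every \<open>t\<close>. Passing to the absolute value does
  not raise the energy (\<open>abs_function\<close>). At the maximum \<open>u\<close> of such an optimal ray there is no direction
  of descent \<open>v\<close> (\<open>no_descent\<close>): by convexity of \<open>P\<close> and \<open>Q\<close>, replacing \<open>u\<close> by \<open>u + \<epsilon>v\<close> lowers the energy
  uniformly at all dilations near \<open>1\<close>, and concavity along the new ray shows that it has its maximum there,
  below \<open>c\<close>.

  Convexity also stands in for the calculus of differentiable functionals: the tangent inequalities at both
  ends of a segment bound the remainder of the first order expansion (\<open>P_remainder\<close>, \<open>Q_remainder\<close>).
  Weak compactness is replaced by uniform convexity (\<open>W0_weak_closure\<close>). The embeddings into \<open>L\<^sup>\<alpha>\<close> rest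
  on one estimate (\<open>ball_avg_deviation\<close>) for the distance of a test function from its averages over balls: with
  unit balls outside of the domain it is the Sobolev inequality, and as the radius tends to \<open>0\<close> it gives
  compactness.
\<close>

section \<open>Lebesgue spaces\<close>

definition Lp :: "'x measure \<Rightarrow> real \<Rightarrow> ('x \<Rightarrow> 'b::euclidean_space) set" where
  "Lp M p = {u. u \<in> borel_measurable M \<and> integrable M (\<lambda>x. norm (u x) powr p)}"

text \<open>
  The \<open>p\<close>-th power of the norm of \<open>L\<^sup>p\<close>. Without the root, pointwise inequalities can be integrated as they
  are, and all exponents \<open>p > 0\<close> are treated alike; the price is the factor \<open>2 powr p\<close> in the triangle
  inequality.
\<close>

definition Lp_mod :: "'x measure \<Rightarrow> real \<Rightarrow> ('x \<Rightarrow> 'b::euclidean_space) \<Rightarrow> real" where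
  "Lp_mod M p u = (LINT x|M. norm (u x) powr p)"

lemma LpD: "u \<in> Lp M p \<Longrightarrow> u \<in> borel_measurable M" "u \<in> Lp M p \<Longrightarrow> integrable M (\<lambda>x. norm (u x) powr p)"
  by (auto simp: Lp_def)

lemma Lp_mod_nonneg [simp]: "0 \<le> Lp_mod M p u"
  unfolding Lp_mod_def by simp

lemma norm_add_powr_le:
  fixes x y :: "'b::real_normed_vector"
  assumes "p \<ge> 0"
  shows "norm (x + y) powr p \<le> 2 powr p * (norm x powr p + norm y powr p)"
proof -
  have "norm (x + y) powr p \<le> (2 * max (norm x) (norm y)) powr p"
    by (intro powr_mono2) (use assms norm_triangle_ineq[of x y] in auto)
  also have "\<dots> = 2 powr p * max (norm x) (norm y) powr p" by (simp add: powr_mult)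
  also have "max (norm x) (norm y) powr p \<le> norm x powr p + norm y powr p"
    by (auto simp: max_def)
  finally show ?thesis by simp
qed

lemma Lp_bound:
  fixes u :: "'x \<Rightarrow> 'b::euclidean_space"
  assumes "u \<in> borel_measurable M" "integrable M h" "\<And>x. x \<in> space M \<Longrightarrow> norm (u x) powr p \<le> h x"
  shows "u \<in> Lp M p"
proof -
  have "integrable M (\<lambda>x. norm (u x) powr p)"
    by (rule Bochner_Integration.integrable_bound[OF assms(2)])
       (use assms in \<open>auto intro!: AE_I2 order_trans[OF assms(3)]\<close>)
  then show ?thesis using assms by (auto simp: Lp_def)
qed

lemma Lp_add:
  fixes u v :: "'x \<Rightarrow> 'b::euclidean_space"
  assumes "p \<ge> 0" "u \<in> Lp M p" "v \<in> Lp M p"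
  shows "(\<lambda>x. u x + v x) \<in> Lp M p"
    and "Lp_mod M p (\<lambda>x. u x + v x) \<le> 2 powr p * (Lp_mod M p u + Lp_mod M p v)"
proof -
  have i: "integrable M (\<lambda>x. 2 powr p * (norm (u x) powr p + norm (v x) powr p))"
    using assms by (auto simp: Lp_def)
  show m: "(\<lambda>x. u x + v x) \<in> Lp M p"
    by (rule Lp_bound[OF _ i]) (use assms norm_add_powr_le in \<open>auto simp: Lp_def\<close>)
  have "Lp_mod M p (\<lambda>x. u x + v x) \<le> (LINT x|M. 2 powr p * (norm (u x) powr p + norm (v x) powr p))"
    unfolding Lp_mod_def using m i norm_add_powr_le[OF assms(1)]
    by (intro integral_mono) (auto simp: Lp_def)
  also have "\<dots> = 2 powr p * (Lp_mod M p u + Lp_mod M p v)"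
    using assms by (simp add: Lp_def Lp_mod_def)
  finally show "Lp_mod M p (\<lambda>x. u x + v x) \<le> 2 powr p * (Lp_mod M p u + Lp_mod M p v)" .
qed

lemma Lp_scale:
  fixes u :: "'x \<Rightarrow> 'b::euclidean_space"
  assumes "u \<in> Lp M p"
  shows "(\<lambda>x. c *\<^sub>R u x) \<in> Lp M p" "Lp_mod M p (\<lambda>x. c *\<^sub>R u x) = \<bar>c\<bar> powr p * Lp_mod M p u"
  using assms by (auto simp: Lp_def Lp_mod_def powr_mult)

lemma Lp_diff:
  fixes u v :: "'x \<Rightarrow> 'b::euclidean_space"
  assumes "p \<ge> 0" "u \<in> Lp M p" "v \<in> Lp M p"
  shows "(\<lambda>x. u x - v x) \<in> Lp M p"
    and "Lp_mod M p (\<lambda>x. u x - v x) \<le> 2 powr p * (Lp_mod M p u + Lp_mod M p v)"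
  using Lp_add[OF assms(1,2) Lp_scale(1)[OF assms(3), of "-1"]] Lp_scale(2)[OF assms(3), of "-1"] by auto

lemma Lp_mod_diff_triangle:
  fixes u v w :: "'x \<Rightarrow> 'b::euclidean_space"
  assumes "p \<ge> 0" "u \<in> Lp M p" "v \<in> Lp M p" "w \<in> Lp M p"
  shows "Lp_mod M p (\<lambda>x. u x - w x) \<le>
    2 powr p * (Lp_mod M p (\<lambda>x. u x - v x) + Lp_mod M p (\<lambda>x. v x - w x))"
  using Lp_add(2)[OF assms(1) Lp_diff(1)[OF assms(1,2,3)] Lp_diff(1)[OF assms(1,3,4)]] by simp

lemma Lp_mod_minus_commute:
  fixes u v :: "'x \<Rightarrow> 'b::euclidean_space"
  shows "Lp_mod M p (\<lambda>x. u x - v x) = Lp_mod M p (\<lambda>x. v x - u x)"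
  by (simp add: Lp_mod_def norm_minus_commute)

lemma Lp_cong_AE:
  fixes u v :: "'x \<Rightarrow> 'b::euclidean_space"
  assumes "u \<in> Lp M p" "v \<in> borel_measurable M" "AE x in M. u x = v x"
  shows "v \<in> Lp M p" "Lp_mod M p v = Lp_mod M p u"
proof -
  have e: "AE x in M. norm (u x) powr p = norm (v x) powr p" using assms(3) by auto
  show "v \<in> Lp M p" using integrable_cong_AE[OF _ _ e] assms by (auto simp: Lp_def)
  show "Lp_mod M p v = Lp_mod M p u"
    unfolding Lp_mod_def by (rule integral_cong_AE) (use assms in \<open>auto simp: Lp_def\<close>)
qed

text \<open>
  If \<open>s powr r\<close> exceeds \<open>d\<close>, raising both to the nonpositive exponent \<open>1 - p / r\<close> gives the bound by the
  second summand. On a finite measure space the integrated inequality compares Lebesgue exponents.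
\<close>

lemma powr_le_small_add:
  fixes s :: real
  assumes "0 \<le> s" "0 < d" "0 < r" "r \<le> p"
  shows "s powr r \<le> d + d powr (1 - p / r) * s powr p"
proof (cases "s powr r \<le> d")
  case True then show ?thesis by (simp add: add_increasing2)
next
  case False
  then have s: "0 < s" "d < s powr r" using assms by (auto simp: powr_def split: if_splits)
  have "(s powr r) powr (1 - p / r) \<le> d powr (1 - p / r)"
    by (rule powr_mono2') (use s assms in auto)
  moreover have "(s powr r) powr (1 - p / r) = s powr (r - p)"
    using assms by (simp add: powr_powr right_diff_distrib)
  ultimately have "s powr (r - p) * s powr p \<le> d powr (1 - p / r) * s powr p"
    by (intro mult_right_mono) auto
  then have "s powr r \<le> d powr (1 - p / r) * s powr p"
    using s by (simp add: powr_add[symmetric])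
  then show ?thesis using assms by linarith
qed

lemma Lp_lower_exponent:
  fixes u :: "'x \<Rightarrow> 'b::euclidean_space"
  assumes "finite_measure M" "0 < r" "r \<le> p" "u \<in> Lp M p"
  shows "u \<in> Lp M r"
    and "0 < d \<Longrightarrow> Lp_mod M r u \<le> d * measure M (space M) + d powr (1 - p / r) * Lp_mod M p u"
proof -
  interpret finite_measure M by fact
  have i: "integrable M (\<lambda>x. d + d powr (1 - p / r) * norm (u x) powr p)" for d
    using assms by (auto simp: Lp_def)
  show m: "u \<in> Lp M r"
    by (rule Lp_bound[OF _ i[of 1]])
       (use assms powr_le_small_add[of _ 1 r p] in \<open>auto simp: Lp_def\<close>)
  assume d: "0 < d"
  have "Lp_mod M r u \<le> (LINT x|M. d + d powr (1 - p / r) * norm (u x) powr p)"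
    unfolding Lp_mod_def using m i powr_le_small_add[OF _ d, of _ r p] assms
    by (intro integral_mono) (auto simp: Lp_def)
  also have "\<dots> = d * measure M (space M) + d powr (1 - p / r) * Lp_mod M p u"
    using assms by (simp add: Lp_def Lp_mod_def mult.commute)
  finally show "Lp_mod M r u \<le> d * measure M (space M) + d powr (1 - p / r) * Lp_mod M p u" .
qed

lemma Lp_mod_lower_exponent_tendsto:
  fixes u :: "nat \<Rightarrow> 'x \<Rightarrow> 'b::euclidean_space"
  assumes "finite_measure M" "0 < r" "r \<le> p" "\<And>n. u n \<in> Lp M p"
    and lim: "(\<lambda>n. Lp_mod M p (u n)) \<longlonglongrightarrow> 0"
  shows "(\<lambda>n. Lp_mod M r (u n)) \<longlonglongrightarrow> 0"
proof (rule LIMSEQ_I)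
  fix e :: real assume e: "0 < e"
  define m where "m = measure M (space M)"
  have m: "0 \<le> m" by (simp add: m_def)
  define d where "d = e / (2 * (m + 1))"
  have d: "0 < d" using e m by (simp add: d_def)
  have "(\<lambda>n. d powr (1 - p / r) * Lp_mod M p (u n)) \<longlonglongrightarrow> 0"
    using tendsto_mult_right_zero[OF lim] by simp
  then obtain N where N: "\<And>n. n \<ge> N \<Longrightarrow> d powr (1 - p / r) * Lp_mod M p (u n) < e / 2"
    using e order_tendstoD(2)[of _ 0 sequentially "e/2"] by (auto simp: eventually_sequentially)
  have dm: "d * m \<le> e / 2" using e m by (simp add: d_def divide_simps)
  have "Lp_mod M r (u n) < e" if "n \<ge> N" for n
    using Lp_lower_exponent(2)[OF assms(1-3) assms(4)[of n] d] N[OF that] dm by (auto simp: m_def)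
  then show "\<exists>no. \<forall>n\<ge>no. norm (Lp_mod M r (u n) - 0) < e" by auto
qed

lemma Fatou_real:
  fixes f :: "nat \<Rightarrow> 'x \<Rightarrow> real"
  assumes "\<And>k. integrable M (f k)" "\<And>k x. 0 \<le> f k x" "\<And>k. integral\<^sup>L M (f k) \<le> C"
    and g: "g \<in> borel_measurable M" "AE x in M. (\<lambda>k. f k x) \<longlonglongrightarrow> g x"
  shows "integrable M g" "integral\<^sup>L M g \<le> C"
proof -
  have C: "0 \<le> C" using order_trans[OF Bochner_Integration.integral_nonneg assms(3)[of 0]] assms(2) by blast
  have g0: "AE x in M. 0 \<le> g x"
    using g(2) by eventually_elim (rule LIMSEQ_le_const, use assms(2) in auto)
  have "(\<integral>\<^sup>+x. ennreal (g x) \<partial>M) = (\<integral>\<^sup>+x. liminf (\<lambda>k. ennreal (f k x)) \<partial>M)"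
    by (rule nn_integral_cong_AE)
       (use g(2) in \<open>eventually_elim, auto intro!: lim_imp_Liminf[symmetric] tendsto_ennrealI\<close>)
  also have "\<dots> \<le> liminf (\<lambda>k. \<integral>\<^sup>+x. ennreal (f k x) \<partial>M)"
    by (rule nn_integral_liminf) (use assms(1) in auto)
  also have "\<dots> \<le> ennreal C"
  proof (rule Liminf_le)
    show "\<forall>\<^sub>F k in sequentially. (\<integral>\<^sup>+x. ennreal (f k x) \<partial>M) \<le> ennreal C"
      using assms C by (auto simp: nn_integral_eq_integral ennreal_leI)
  qed simp
  finally have le: "(\<integral>\<^sup>+x. ennreal (g x) \<partial>M) \<le> ennreal C" .
  have "(\<integral>\<^sup>+x. ennreal (norm (g x)) \<partial>M) = (\<integral>\<^sup>+x. ennreal (g x) \<partial>M)"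
    by (rule nn_integral_cong_AE) (use g0 in \<open>eventually_elim, simp\<close>)
  also have "\<dots> < \<infinity>" using le by (simp add: le_less_trans)
  finally show i: "integrable M g" by (intro integrableI_bounded g(1))
  show "integral\<^sup>L M g \<le> C"
    using le C nn_integral_eq_integral[OF i g0] by simp
qed

text \<open>
  Riesz and Fischer: along a subsequence whose increments have modulars below \<open>4\<^sup>-\<^sup>p\<^sup>k\<close>, the series of the
  increments with weights \<open>2\<^sup>p\<^sup>k\<close> is integrable, so almost everywhere the \<open>k\<close>-th increment is eventually
  at most \<open>2\<^sup>-\<^sup>k\<close>.
\<close>

lemma Lp_complete:
  fixes g :: "nat \<Rightarrow> 'x \<Rightarrow> 'b::euclidean_space"
  assumes p: "p > 0" and g: "\<And>n. g n \<in> Lp M p"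
    and Cau: "\<And>e. e > 0 \<Longrightarrow> \<exists>N. \<forall>m\<ge>N. \<forall>n\<ge>N. Lp_mod M p (\<lambda>x. g m x - g n x) < e"
  obtains h r where "h \<in> Lp M p" "(\<lambda>n. Lp_mod M p (\<lambda>x. g n x - h x)) \<longlonglongrightarrow> 0"
    "strict_mono r" "AE x in M. (\<lambda>k. g (r k) x) \<longlonglongrightarrow> h x"
proof -
  have "\<exists>N. \<forall>k. \<forall>m\<ge>N k. \<forall>n\<ge>N k. Lp_mod M p (\<lambda>x. g m x - g n x) < (1/4) powr (p * real k)"
    by (intro choice allI Cau) auto
  then obtain N where N: "\<And>k m n. m \<ge> N k \<Longrightarrow> n \<ge> N k \<Longrightarrow>
      Lp_mod M p (\<lambda>x. g m x - g n x) < (1/4) powr (p * real k)" by metis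
  define r where "r k = (\<Sum>i\<le>k. N i) + k" for k
  have r: "strict_mono r" by (rule strict_monoI_Suc) (simp add: r_def)
  have rN: "r k \<ge> N k" for k
    using member_le_sum[of k "{..k}" N] by (simp add: r_def)
  have rN': "r (Suc k) \<ge> N k" for k
    using rN[of k] strict_monoD[OF r, of k "Suc k"] by linarith
  have gm [measurable]: "g n \<in> borel_measurable M" for n using g LpD by blast
  define S where "S k x = 2 powr (p * real k) * norm (g (r (Suc k)) x - g (r k) x) powr p" for k x
  have Si: "integrable M (S k)" for k
    unfolding S_def using Lp_diff(1)[OF _ g g] p by (auto simp: Lp_def)
  have Sle: "integral\<^sup>L M (S k) \<le> ((1/2) powr p) ^ k" for k
  proof -
    have "integral\<^sup>L M (S k) = 2 powr (p * real k) * Lp_mod M p (\<lambda>x. g (r (Suc k)) x - g (r k) x)"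
      by (simp add: S_def[abs_def] Lp_mod_def)
    also have "\<dots> \<le> 2 powr (p * real k) * (1/4) powr (p * real k)"
      using N[OF rN' rN, of k] by (intro mult_left_mono) auto
    also have "\<dots> = ((1/2) powr p) ^ k"
      by (simp add: powr_mult[symmetric] powr_realpow[symmetric] powr_powr)
    finally show ?thesis .
  qed
  have "(\<integral>\<^sup>+x. (\<Sum>k. ennreal (S k x)) \<partial>M) = (\<Sum>k. \<integral>\<^sup>+x. ennreal (S k x) \<partial>M)"
    by (rule nn_integral_suminf) (use Si in auto)
  also have "\<dots> = (\<Sum>k. ennreal (integral\<^sup>L M (S k)))"
    by (intro suminf_cong nn_integral_eq_integral Si) (simp add: S_def)
  also have "\<dots> \<le> (\<Sum>k. ennreal (((1/2) powr p) ^ k))"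
    by (intro suminf_le ennreal_leI Sle) auto
  also have "\<dots> < \<infinity>"
  proof -
    have "summable (\<lambda>k. ((1/2) powr p) ^ k)"
      using p powr_less_mono2[of p "1/2" 1] by (intro summable_geometric) auto
    then show ?thesis by (subst suminf_ennreal2) auto
  qed
  finally have "AE x in M. (\<Sum>k. ennreal (S k x)) \<noteq> \<infinity>"
    by (intro nn_integral_noteq_infinite) (use Si in \<open>auto intro!: borel_measurable_suminf_order\<close>)
  then have conv: "AE x in M. convergent (\<lambda>k. g (r k) x)"
  proof eventually_elim
    case (elim x)
    have "summable (\<lambda>k. S k x)"
      by (rule summable_suminf_not_top) (use elim in \<open>auto simp: S_def\<close>)
    have "(\<lambda>k. S k x) \<longlonglongrightarrow> 0" using \<open>summable (\<lambda>k. S k x)\<close> summable_LIMSEQ_zero by blast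
    then have ev: "\<forall>\<^sub>F k in sequentially. S k x < 1"
      by (rule order_tendstoD) simp
    have "\<forall>\<^sub>F k in sequentially. norm (g (r (Suc k)) x - g (r k) x) \<le> (1/2) ^ k"
      using ev
    proof eventually_elim
      case (elim k)
      have "((2 ^ k) * norm (g (r (Suc k)) x - g (r k) x)) powr p < 1 powr p"
        using elim by (simp add: S_def powr_mult powr_powr powr_realpow[symmetric] mult.commute)
      then have "(2 ^ k) * norm (g (r (Suc k)) x - g (r k) x) < 1"
        using p powr_mono2[of p 1 "(2 ^ k) * norm (g (r (Suc k)) x - g (r k) x)"] by force
      then show ?case by (simp add: field_simps power_one_over)
    qed
    then have "summable (\<lambda>k. g (r (Suc k)) x - g (r k) x)"
      by (rule summable_comparison_test_ev) simp
    then have "convergent (\<lambda>n. \<Sum>k<n. g (r (Suc k)) x - g (r k) x)"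
      by (simp add: summable_iff_convergent)
    then have "convergent (\<lambda>n. g (r n) x - g (r 0) x)"
      by (simp add: sum_lessThan_telescope[of "\<lambda>k. g (r k) x"])
    then have "convergent (\<lambda>n. (g (r n) x - g (r 0) x) + g (r 0) x)"
      by (rule convergent_add[OF _ convergent_const])
    then show ?case by simp
  qed
  define h where "h x = lim (\<lambda>k. g (r k) x)" for x
  have hm [measurable]: "h \<in> borel_measurable M" unfolding h_def by measurable
  have lim: "AE x in M. (\<lambda>k. g (r k) x) \<longlonglongrightarrow> h x"
    using conv by eventually_elim (simp add: h_def convergent_LIMSEQ_iff)
  have key: "integrable M (\<lambda>x. norm (g n x - h x) powr p) \<and> Lp_mod M p (\<lambda>x. g n x - h x) \<le> e"
    if nN: "\<forall>m\<ge>K. \<forall>n\<ge>K. Lp_mod M p (\<lambda>x. g m x - g n x) < e" "n \<ge> K" for n K e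
  proof -
    have rk: "r (k + K) \<ge> K" for k
      using seq_suble[OF r, of "k + K"] by linarith
    have "AE x in M. (\<lambda>k. norm (g n x - g (r (k + K)) x) powr p) \<longlonglongrightarrow> norm (g n x - h x) powr p"
      using lim
    proof eventually_elim
      case (elim x)
      then have "(\<lambda>k. g (r (k + K)) x) \<longlonglongrightarrow> h x" by (rule LIMSEQ_ignore_initial_segment)
      then show ?case using p by (intro tendsto_powr' tendsto_intros) auto
    qed
    note F = Fatou_real[OF _ _ _ _ this, of e]
    have 1: "integrable M (\<lambda>x. norm (g n x - g (r (k + K)) x) powr p)" for k
      using Lp_diff(1)[OF _ g g] p by (auto simp: Lp_def)
    have 2: "(LINT x|M. norm (g n x - g (r (k + K)) x) powr p) \<le> e" for k
      using nN(1)[rule_format, OF nN(2) rk[of k]] by (simp add: Lp_mod_def)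
    have 3: "(\<lambda>x. norm (g n x - h x) powr p) \<in> borel_measurable M" by measurable
    show ?thesis unfolding Lp_mod_def
      using F(1)[OF 1 _ 2 3] F(2)[OF 1 _ 2 3] by simp
  qed
  obtain K where K: "\<forall>m\<ge>K. \<forall>n\<ge>K. Lp_mod M p (\<lambda>x. g m x - g n x) < 1" using Cau[of 1] by auto
  have "(\<lambda>x. g K x - h x) \<in> Lp M p" using key[OF K order_refl] by (auto simp: Lp_def)
  from Lp_diff(1)[OF _ g[of K] this] p have hL: "h \<in> Lp M p" by auto
  have "(\<lambda>n. Lp_mod M p (\<lambda>x. g n x - h x)) \<longlonglongrightarrow> 0"
  proof (rule LIMSEQ_I)
    fix e :: real assume "0 < e"
    then obtain K where "\<forall>m\<ge>K. \<forall>n\<ge>K. Lp_mod M p (\<lambda>x. g m x - g n x) < e / 2" using Cau[of "e/2"] by auto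
    from key[OF this] \<open>0 < e\<close>
    show "\<exists>no. \<forall>n\<ge>no. norm (Lp_mod M p (\<lambda>x. g n x - h x) - 0) < e"
      by (intro exI[of _ K]) (auto intro: le_less_trans[of _ "e/2"])
  qed
  from that[OF hL this r lim] show ?thesis .
qed

lemma Lp_tendsto_AE_subseq:
  fixes g :: "nat \<Rightarrow> 'x \<Rightarrow> 'b::euclidean_space"
  assumes p: "p > 0" and g: "\<And>n. g n \<in> Lp M p" and lim: "(\<lambda>n. Lp_mod M p (g n)) \<longlonglongrightarrow> 0"
  obtains r where "strict_mono r" "AE x in M. (\<lambda>k. g (r k) x) \<longlonglongrightarrow> 0"
proof -
  obtain r :: "nat \<Rightarrow> nat" where r: "strict_mono r" "AE x in M. (\<lambda>n. norm (g (r n) x) powr p) \<longlonglongrightarrow> 0"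
    using tendsto_L1_AE_subseq[of M "\<lambda>n x. norm (g n x) powr p"] g lim by (auto simp: Lp_def Lp_mod_def)
  have "AE x in M. (\<lambda>k. g (r k) x) \<longlonglongrightarrow> 0"
    using r(2)
  proof eventually_elim
    case (elim x)
    then have "(\<lambda>n. (norm (g (r n) x) powr p) powr (1 / p)) \<longlonglongrightarrow> 0 powr (1 / p)"
      using p by (intro tendsto_powr' tendsto_intros) auto
    then show ?case using p by (auto simp: powr_powr tendsto_norm_zero_iff)
  qed
  with r that show ?thesis by blast
qed

text \<open>
  Young's inequality for the normalised functions. If one of the modulars is \<open>0\<close> it cannot be normalised, but
  then the product vanishes almost everywhere.
\<close>

lemma Holder_modular:
  fixes u :: "'x \<Rightarrow> 'b::euclidean_space" and v :: "'x \<Rightarrow> 'c::euclidean_space"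
  assumes p: "p > 1" "q > 1" "1 / p + 1 / q = 1" and u: "u \<in> Lp M p" and v: "v \<in> Lp M q"
  shows "integrable M (\<lambda>x. norm (u x) * norm (v x))"
    and "(LINT x|M. norm (u x) * norm (v x)) \<le> Lp_mod M p u powr (1 / p) * Lp_mod M q v powr (1 / q)"
proof -
  have [measurable]: "u \<in> borel_measurable M" "v \<in> borel_measurable M" using u v LpD by auto
  have Y: "norm (u x) * norm (v x) \<le> norm (u x) powr p / p + norm (v x) powr q / q" for x
    by (rule Youngs_inequality) (use p in auto)
  have iY: "integrable M (\<lambda>x. norm (u x) powr p / p + norm (v x) powr q / q)"
    using u v by (auto simp: Lp_def)
  show i: "integrable M (\<lambda>x. norm (u x) * norm (v x))"
    by (rule Bochner_Integration.integrable_bound[OF iY])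
       (use Y p in \<open>auto intro!: AE_I2 intro: order_trans[OF _ abs_ge_self]\<close>)
  define A where "A = Lp_mod M p u"
  define B where "B = Lp_mod M q v"
  have AB: "0 \<le> A" "0 \<le> B" by (auto simp: A_def B_def)
  show "(LINT x|M. norm (u x) * norm (v x)) \<le> Lp_mod M p u powr (1 / p) * Lp_mod M q v powr (1 / q)"
  proof (cases "A = 0 \<or> B = 0")
    case True
    have "AE x in M. norm (u x) * norm (v x) = 0"
    proof (cases "A = 0")
      case True
      then have "AE x in M. norm (u x) powr p = 0"
        using integral_nonneg_eq_0_iff_AE[OF LpD(2)[OF u]] by (simp add: A_def Lp_mod_def)
      then show ?thesis by eventually_elim auto
    next
      case False
      with True have "AE x in M. norm (v x) powr q = 0"
        using integral_nonneg_eq_0_iff_AE[OF LpD(2)[OF v]] by (simp add: B_def Lp_mod_def)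
      then show ?thesis by eventually_elim auto
    qed
    then have "(LINT x|M. norm (u x) * norm (v x)) = (LINT x|M. 0)"
      by (intro integral_cong_AE) auto
    then show ?thesis by simp
  next
    case False
    define a where "a = A powr (1 / p)"
    define b where "b = B powr (1 / q)"
    have ab: "0 < a" "0 < b" "a powr p = A" "b powr q = B"
      using False AB p by (auto simp: a_def b_def powr_powr)
    have Y: "norm (u x) * norm (v x) \<le> a * b * (norm (u x) powr p / (A * p) + norm (v x) powr q / (B * q))" for x
    proof -
      have "(norm (u x) / a) * (norm (v x) / b) \<le> (norm (u x) / a) powr p / p + (norm (v x) / b) powr q / q"
        by (rule Youngs_inequality) (use p ab in auto)
      also have "\<dots> = norm (u x) powr p / (A * p) + norm (v x) powr q / (B * q)"
        using ab by (simp add: powr_divide)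
      finally show ?thesis using ab by (simp add: field_simps)
    qed
    have "(LINT x|M. norm (u x) * norm (v x)) \<le>
        (LINT x|M. a * b * (norm (u x) powr p / (A * p) + norm (v x) powr q / (B * q)))"
      using Y i u v by (intro integral_mono) (auto simp: Lp_def)
    also have "\<dots> = a * b * (A / (A * p) + B / (B * q))"
      using u v by (simp add: Lp_def A_def B_def Lp_mod_def)
    also have "\<dots> = a * b" using False p by simp
    finally show ?thesis by (simp add: a_def b_def A_def B_def)
  qed
qed

lemma powr_midpoint_strict:
  fixes s t :: real
  assumes "p > 1" "0 \<le> s" "s < t"
  shows "((s + t) / 2) powr p < (s powr p + t powr p) / 2"
proof -
  define m where "m = (s + t) / 2"
  have m: "s < m" "m < t" "0 < m" "m - s = t - m" using assms by (auto simp: m_def field_simps)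
  have c: "continuous_on {x..y} (\<lambda>x. x powr p)" if "0 \<le> x" for x y :: real
    using assms that by (intro continuous_on_powr' continuous_intros) auto
  have d: "((\<lambda>x. x powr p) has_derivative (\<lambda>h. (p * x powr (p - 1)) * h)) (at x)" if "0 < x" for x :: real
    using has_real_derivative_powr[OF that, of p] by (simp add: has_field_derivative_def)
  obtain z where z: "m < z" "z < t" "t powr p - m powr p = (p * z powr (p - 1)) * (t - m)"
    by (rule mvt[OF m(2) c, of "\<lambda>x h. (p * x powr (p - 1)) * h"]) (use d m in auto)
  obtain w where w: "s < w" "w < m" "m powr p - s powr p = (p * w powr (p - 1)) * (m - s)"
    by (rule mvt[OF m(1) c, of "\<lambda>x h. (p * x powr (p - 1)) * h"]) (use d assms in auto)
  have "w powr (p - 1) < z powr (p - 1)" using w z assms by (intro powr_less_mono2) auto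
  then have "(p * w powr (p - 1)) * (m - s) < (p * z powr (p - 1)) * (t - m)"
    unfolding m(4) using m assms by (intro mult_strict_right_mono mult_strict_left_mono) auto
  then show ?thesis using z w by (simp add: m_def[symmetric])
qed

lemma powr_midpoint_le:
  fixes s t :: real
  assumes "p > 1" "0 \<le> s" "0 \<le> t"
  shows "((s + t) / 2) powr p \<le> (s powr p + t powr p) / 2"
  using powr_midpoint_strict[of p s t] powr_midpoint_strict[of p t s] assms
  by (cases s t rule: linorder_cases) (auto simp: add.commute)

text \<open>
  By the parallelogram law the length lost by the midpoint is governed by \<open>norm (x - y)\<close>.
\<close>

lemma norm_midpoint_less:
  fixes x y :: "'b::real_inner"
  assumes "norm x = norm y" "x \<noteq> y"
  shows "norm ((x + y) /\<^sub>R 2) < norm x"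
proof -
  have "norm (x + y) ^ 2 + norm (x - y) ^ 2 = 4 * norm x ^ 2"
    using assms(1) by (simp add: power2_norm_eq_inner algebra_simps inner_commute) (simp add: norm_eq)
  moreover have "norm (x - y) ^ 2 > 0" using assms(2) by simp
  moreover have "(2 * norm x) ^ 2 = 4 * norm x ^ 2" by (simp add: power_mult_distrib)
  ultimately have "norm (x + y) ^ 2 < (2 * norm x) ^ 2" by linarith
  then have "norm (x + y) < 2 * norm x" by (rule power2_less_imp_less) simp
  then show ?thesis by simp
qed

text \<open>
  The deficit in the midpoint convexity of \<open>\<lambda>x. norm x powr p\<close>.
\<close>

definition powr_gap :: "real \<Rightarrow> 'b::euclidean_space \<Rightarrow> 'b \<Rightarrow> real" where
  "powr_gap p x y = (norm x powr p + norm y powr p) / 2 - norm ((x + y) /\<^sub>R 2) powr p"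

lemma powr_gap_nonneg: "p > 1 \<Longrightarrow> 0 \<le> powr_gap p x y"
  and powr_gap_pos: "p > 1 \<Longrightarrow> x \<noteq> y \<Longrightarrow> 0 < powr_gap p x y"
proof -
  assume p: "p > 1"
  have le: "norm ((x + y) /\<^sub>R 2) powr p \<le> ((norm x + norm y) / 2) powr p"
    by (rule powr_mono2) (use p norm_triangle_ineq[of x y] in auto)
  then show "0 \<le> powr_gap p x y"
    using powr_midpoint_le[of p "norm x" "norm y"] p by (simp add: powr_gap_def)
  assume "x \<noteq> y"
  show "0 < powr_gap p x y"
  proof (cases "norm x = norm y")
    case True
    then have "norm ((x + y) /\<^sub>R 2) powr p < norm x powr p"
      using norm_midpoint_less[OF True \<open>x \<noteq> y\<close>] p by (intro powr_less_mono2) auto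
    then show ?thesis using True by (simp add: powr_gap_def)
  next
    case False
    then show ?thesis using le powr_midpoint_strict[of p "norm x" "norm y"]
      powr_midpoint_strict[of p "norm y" "norm x"] p
      by (cases "norm x" "norm y" rule: linorder_cases) (auto simp: powr_gap_def add.commute)
  qed
qed

text \<open>
  Both sides are homogeneous of degree \<open>p\<close>, so it suffices to consider pairs with
  \<open>norm x powr p + norm y powr p = 1\<close>. Among these, the pairs that are not already controlled by \<open>e\<close> form a
  compact set on which the gap is positive, hence bounded away from \<open>0\<close>. After integration this is the
  uniform convexity of \<open>L\<^sup>p\<close>: functions whose midpoints have nearly the same modular as themselves are close
  to each other.
\<close>

lemma norm_powr_uniform_convexity:
  assumes p: "p > 1" and e: "e > 0"
  obtains C where "C \<ge> 0" "\<And>x y::'b::euclidean_space.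
    norm (x - y) powr p \<le> e * (norm x powr p + norm y powr p) + C * powr_gap p x y"
proof -
  define N :: "'b \<times> 'b \<Rightarrow> real" where "N z = norm (fst z) powr p + norm (snd z) powr p" for z
  define K where "K = {z. N z = 1} \<inter> {z. norm (fst z - snd z) powr p \<ge> e}"
  have contN: "continuous_on UNIV N"
    unfolding N_def using p by (intro continuous_intros continuous_on_powr') auto
  have contD: "continuous_on UNIV (\<lambda>z::'b\<times>'b. norm (fst z - snd z) powr p)"
    using p by (intro continuous_intros continuous_on_powr') auto
  have contG: "continuous_on UNIV (\<lambda>z::'b\<times>'b. powr_gap p (fst z) (snd z))"
    unfolding powr_gap_def using p by (intro continuous_intros continuous_on_powr') auto
  have "closed K" unfolding K_def
    by (intro closed_Int closed_Collect_eq closed_Collect_le contN contD continuous_on_const)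
  moreover have "bounded K"
  proof (rule boundedI)
    fix z assume "z \<in> K"
    then have "norm (fst z) powr p \<le> 1" "norm (snd z) powr p \<le> 1"
      by (auto simp: K_def N_def) (smt (verit) powr_ge_zero)+
    then have "norm (fst z) \<le> 1" "norm (snd z) \<le> 1"
      using p powr_less_mono2[of p 1 "norm (fst z)"] powr_less_mono2[of p 1 "norm (snd z)"] by (smt (verit) powr_one_eq_one)+
    then show "norm z \<le> 2" using norm_Pair_le[of "fst z" "snd z"] by simp
  qed
  ultimately have cK: "compact K" by (simp add: compact_eq_bounded_closed)
  obtain m where m: "m > 0" "\<And>z. z \<in> K \<Longrightarrow> m \<le> powr_gap p (fst z) (snd z)"
  proof (cases "K = {}")
    case True then show ?thesis using that[of 1] by auto
  next
    case False
    obtain z where z: "z \<in> K" "\<And>y. y \<in> K \<Longrightarrow> powr_gap p (fst z) (snd z) \<le> powr_gap p (fst y) (snd y)"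
      using continuous_attains_inf[OF cK False continuous_on_subset[OF contG]] by auto
    have "fst z \<noteq> snd z" using z(1) e by (auto simp: K_def)
    then show ?thesis using that[OF powr_gap_pos[OF p] z(2)] by auto
  qed
  define C where "C = 2 powr p / m"
  have C: "C \<ge> 0" using m by (simp add: C_def)
  have unit: "norm (x - y) powr p \<le> e + C * powr_gap p x y" if "N (x, y) = 1" for x y :: 'b
  proof (cases "(x, y) \<in> K")
    case True
    have "norm (x - y) powr p \<le> 2 powr p * (norm x powr p + norm (- y) powr p)"
      using norm_add_powr_le[of p x "- y"] p by simp
    also have "\<dots> = 2 powr p" using that by (simp add: N_def)
    also have "\<dots> \<le> C * powr_gap p x y" using m(2)[OF True] m(1) by (simp add: C_def field_simps)
    finally show ?thesis using e by simp
  next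
    case False
    then have "norm (x - y) powr p \<le> e" using that by (auto simp: K_def)
    then show ?thesis using powr_gap_nonneg[OF p, of x y] C by (simp add: add_increasing2)
  qed
  have "norm (x - y) powr p \<le> e * (norm x powr p + norm y powr p) + C * powr_gap p x y" for x y :: 'b
  proof (cases "N (x, y) = 0")
    case True
    then have "norm x powr p = 0" "norm y powr p = 0"
      unfolding N_def fst_conv snd_conv by (subst (asm) add_nonneg_eq_0_iff; simp)+
    then show ?thesis by (simp add: powr_gap_def)
  next
    case False
    then have N0: "N (x, y) > 0" by (simp add: N_def order_less_le)
    define l where "l = N (x, y) powr (- 1 / p)"
    have "l powr p = N (x, y) powr (- 1)" unfolding l_def powr_powr using p by simp
    also have "\<dots> = 1 / N (x, y)" unfolding powr_minus_divide using N0 by simp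
    finally have l: "l > 0" "l powr p * N (x, y) = 1"
      using N0 by (auto simp: l_def)
    have sc: "norm (l *\<^sub>R z) powr p = l powr p * norm z powr p" for z :: 'b
      using l by (simp add: powr_mult)
    have gap: "powr_gap p (l *\<^sub>R x) (l *\<^sub>R y) = l powr p * powr_gap p x y"
    proof -
      have "(l *\<^sub>R x + l *\<^sub>R y) /\<^sub>R 2 = l *\<^sub>R ((x + y) /\<^sub>R 2)" by (simp add: algebra_simps)
      then show ?thesis unfolding powr_gap_def by (simp only: sc) (simp add: algebra_simps)
    qed
    have "N (l *\<^sub>R x, l *\<^sub>R y) = l powr p * N (x, y)"
      unfolding N_def fst_conv snd_conv sc by (rule distrib_left[symmetric])
    then have "N (l *\<^sub>R x, l *\<^sub>R y) = 1" using l(2) by simp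
    from unit[OF this] have "l powr p * norm (x - y) powr p \<le> e + C * (l powr p * powr_gap p x y)"
      unfolding gap scaleR_diff_right[symmetric] sc .
    also have "e = e * (l powr p * N (x, y))" using l(2) by simp
    finally have "l powr p * norm (x - y) powr p \<le> l powr p * (e * N (x,y) + C * powr_gap p x y)"
      by (simp add: algebra_simps)
    then show ?thesis using l by (simp add: N_def)
  qed
  with C that show ?thesis by blast
qed

lemma LIMSEQ_subsubseq:
  fixes X :: "nat \<Rightarrow> 'c::metric_space"
  assumes "\<And>r. strict_mono (r::nat\<Rightarrow>nat) \<Longrightarrow> \<exists>s. strict_mono (s::nat\<Rightarrow>nat) \<and> (\<lambda>n. X (r (s n))) \<longlonglongrightarrow> L"
  shows "X \<longlonglongrightarrow> L"
proof (rule ccontr)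
  assume "\<not> X \<longlonglongrightarrow> L"
  then obtain e where e: "e > 0" "\<And>N. \<exists>n\<ge>N. dist (X n) L \<ge> e"
    unfolding lim_sequentially by (meson not_le)
  have "infinite {n. dist (X n) L \<ge> e}"
    unfolding infinite_nat_iff_unbounded_le using e(2) by auto
  then obtain r :: "nat \<Rightarrow> nat" where r: "strict_mono r" "\<And>n. dist (X (r n)) L \<ge> e"
    using infinite_enumerate by blast
  obtain s where "strict_mono s" "(\<lambda>n. X (r (s n))) \<longlonglongrightarrow> L" using assms[OF r(1)] by auto
  then obtain n where "dist (X (r (s n))) L < e"
    using e(1) unfolding lim_sequentially by blast
  with r(2)[of "s n"] show False by simp
qed

lemma Nemytskii_Lp:
  fixes T :: "'b::euclidean_space \<Rightarrow> 'c::euclidean_space"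
  assumes M: "finite_measure M" and T: "continuous_on UNIV T"
    and gr: "\<And>x. norm (T x) powr s \<le> C * (1 + norm x powr p)" and u: "u \<in> Lp M p"
  shows "(\<lambda>x. T (u x)) \<in> Lp M s"
proof -
  interpret finite_measure M by fact
  have [measurable]: "T \<in> borel_measurable borel" using T by (rule borel_measurable_continuous_onI)
  have [measurable]: "u \<in> borel_measurable M" using u LpD by auto
  show ?thesis
    by (rule Lp_bound[of _ _ "\<lambda>x. C * (1 + norm (u x) powr p)"]) (use gr u in \<open>auto simp: Lp_def\<close>)
qed

text \<open>
  Every subsequence has a further one along which \<open>h = un - u\<close> tends to \<open>0\<close> almost everywhere. The growth
  condition bounds \<open>norm (T (u + h) - T u) powr s\<close> by \<open>H + D * norm h powr p\<close> with a fixed integrable \<open>H\<close>. Its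
  excess over \<open>D * norm h powr p\<close> is therefore dominated by \<open>H\<close>, and what remains tends to \<open>0\<close> together
  with \<open>h\<close>.
\<close>

lemma Nemytskii_continuous:
  fixes T :: "'b::euclidean_space \<Rightarrow> 'c::euclidean_space"
  assumes M: "finite_measure M" and p: "p > 0" and s: "s > 0" and T: "continuous_on UNIV T"
    and gr: "\<And>x. norm (T x) powr s \<le> C * (1 + norm x powr p)"
    and u: "u \<in> Lp M p" and un: "\<And>n. un n \<in> Lp M p"
    and lim: "(\<lambda>n. Lp_mod M p (\<lambda>x. un n x - u x)) \<longlonglongrightarrow> 0"
  shows "(\<lambda>n. Lp_mod M s (\<lambda>x. T (un n x) - T (u x))) \<longlonglongrightarrow> 0"
proof (rule LIMSEQ_subsubseq)
  fix r :: "nat \<Rightarrow> nat" assume r: "strict_mono r"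
  interpret finite_measure M by fact
  have [measurable]: "T \<in> borel_measurable borel" using T by (rule borel_measurable_continuous_onI)
  have [measurable]: "u \<in> borel_measurable M" "\<And>n. un n \<in> borel_measurable M" using u un LpD by auto
  have C: "C \<ge> 0" using gr[of 0] order_trans[OF powr_ge_zero gr[of 0]] by simp
  have dL: "(\<lambda>x. un n x - u x) \<in> Lp M p" for n using Lp_diff(1)[OF _ un u] p by simp
  have lim': "(\<lambda>n. Lp_mod M p (\<lambda>x. un (r n) x - u x)) \<longlonglongrightarrow> 0"
    using LIMSEQ_subseq_LIMSEQ[OF lim r] by (simp add: o_def)
  obtain t where t: "strict_mono t" "AE x in M. (\<lambda>k. un (r (t k)) x - u x) \<longlonglongrightarrow> 0"
    using Lp_tendsto_AE_subseq[OF p, of "\<lambda>n x. un (r n) x - u x" M] dL lim' by blast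
  define h where "h k x = un (r (t k)) x - u x" for k x
  have hL: "h k \<in> Lp M p" for k using dL by (simp add: h_def[abs_def])
  define R where "R k x = norm (T (u x + h k x) - T (u x)) powr s" for k x
  define D where "D = 2 powr s * C * 2 powr p"
  have D0: "D \<ge> 0" using C by (simp add: D_def)
  define H where "H x = 2 powr s * (2 * C + (C + C * 2 powr p) * norm (u x) powr p)" for x
  have Hi: "integrable M H" unfolding H_def using u by (auto simp: Lp_def)
  have Rle: "R k x \<le> H x + D * norm (h k x) powr p" for k x
  proof -
    have "R k x \<le> 2 powr s * (norm (T (u x + h k x)) powr s + norm (T (u x)) powr s)"
      unfolding R_def using norm_add_powr_le[of s "T (u x + h k x)" "- T (u x)"] s by simp
    also have "\<dots> \<le> 2 powr s * (C * (1 + norm (u x + h k x) powr p) + C * (1 + norm (u x) powr p))"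
      by (intro mult_left_mono add_mono gr) auto
    also have "\<dots> \<le> 2 powr s * (C * (1 + 2 powr p * (norm (u x) powr p + norm (h k x) powr p)) + C * (1 + norm (u x) powr p))"
      using C p by (intro mult_left_mono add_mono order_refl norm_add_powr_le) auto
    finally show ?thesis by (simp add: H_def D_def algebra_simps)
  qed
  have w: "(\<lambda>k. LINT x|M. max 0 (R k x - D * norm (h k x) powr p)) \<longlonglongrightarrow> (LINT x|M. 0)"
  proof (rule integral_dominated_convergence[where w = H])
    show "(\<lambda>x. max 0 (R k x - D * norm (h k x) powr p)) \<in> borel_measurable M" for k
      unfolding R_def h_def by measurable
    show "AE x in M. norm (max 0 (R k x - D * norm (h k x) powr p)) \<le> H x" for k
      using Rle[of k] C by (auto simp: H_def intro!: AE_I2 mult_nonneg_nonneg add_nonneg_nonneg) (smt (verit))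
    show "AE x in M. (\<lambda>k. max 0 (R k x - D * norm (h k x) powr p)) \<longlonglongrightarrow> 0"
      using t(2)
    proof eventually_elim
      case (elim x)
      then have h0: "(\<lambda>k. h k x) \<longlonglongrightarrow> 0" by (simp add: h_def)
      have "(\<lambda>k. T (u x + h k x)) \<longlonglongrightarrow> T (u x + 0)"
        using T by (intro continuous_on_tendsto_compose[OF T] tendsto_intros h0) auto
      then have "(\<lambda>k. R k x) \<longlonglongrightarrow> norm (T (u x + 0) - T (u x)) powr s"
        unfolding R_def using s by (intro tendsto_powr' tendsto_intros) auto
      moreover have "(\<lambda>k. norm (h k x) powr p) \<longlonglongrightarrow> norm (0::'b) powr p"
        using p h0 by (intro tendsto_powr' tendsto_intros) auto
      ultimately have "(\<lambda>k. max 0 (R k x - D * norm (h k x) powr p)) \<longlonglongrightarrow> max 0 (0 - D * 0)"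
        by (intro tendsto_intros) auto
      then show ?case by simp
    qed
  qed (use Hi in auto)
  have [measurable]: "R k \<in> borel_measurable M" for k unfolding R_def h_def by measurable
  have Ri: "integrable M (R k)" for k
    by (rule Bochner_Integration.integrable_bound[of M "\<lambda>x. H x + D * norm (h k x) powr p"])
       (use Hi hL Rle in \<open>auto simp: Lp_def R_def intro!: AE_I2 intro: order_trans[OF _ abs_ge_self]\<close>)
  have up: "integral\<^sup>L M (R k) \<le> (LINT x|M. max 0 (R k x - D * norm (h k x) powr p)) + D * Lp_mod M p (h k)" for k
  proof -
    have i: "integrable M (\<lambda>x. max 0 (R k x - D * norm (h k x) powr p))"
      using Ri[of k] hL[of k] by (intro Bochner_Integration.integrable_max) (auto simp: Lp_def)
    have "integral\<^sup>L M (R k) \<le> (LINT x|M. max 0 (R k x - D * norm (h k x) powr p) + D * norm (h k x) powr p)"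
      using i hL[of k] Ri by (intro integral_mono) (auto simp: Lp_def)
    also have "\<dots> = (LINT x|M. max 0 (R k x - D * norm (h k x) powr p)) + D * Lp_mod M p (h k)"
      using i hL[of k] by (simp add: Lp_def Lp_mod_def)
    finally show ?thesis .
  qed
  have "(\<lambda>k. Lp_mod M p (h k)) \<longlonglongrightarrow> 0"
    using LIMSEQ_subseq_LIMSEQ[OF lim' t(1)] by (simp add: o_def h_def[abs_def])
  then have "(\<lambda>k. (LINT x|M. max 0 (R k x - D * norm (h k x) powr p)) + D * Lp_mod M p (h k)) \<longlonglongrightarrow> 0 + D * 0"
    using w by (intro tendsto_intros) simp_all
  then have "(\<lambda>k. integral\<^sup>L M (R k)) \<longlonglongrightarrow> 0"
    by (intro tendsto_sandwich[of "\<lambda>_. 0" "\<lambda>k. integral\<^sup>L M (R k)", OF always_eventually always_eventually tendsto_const])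
       (use up in \<open>auto simp: R_def\<close>)
  then have "(\<lambda>n. Lp_mod M s (\<lambda>x. T (un (r (t n)) x) - T (u x))) \<longlonglongrightarrow> 0"
    by (simp add: R_def[abs_def] h_def Lp_mod_def)
  with t(1) show "\<exists>t. strict_mono t \<and> (\<lambda>n. Lp_mod M s (\<lambda>x. T (un (r (t n)) x) - T (u x))) \<longlonglongrightarrow> 0"
    by blast
qed

section \<open>Smooth functions with compact support\<close>

lemma C_k_SucI:
  fixes \<phi> :: "'a::euclidean_space \<Rightarrow> real"
  assumes "\<And>x. (\<phi> has_derivative D x) (at x)" "\<And>i. i \<in> Basis \<Longrightarrow> C_k k (\<lambda>x. D x i)"
  shows "C_k (Suc k) \<phi>"
proof -
  have "frechet_derivative \<phi> (at x) = D x" for x using frechet_derivative_at[OF assms(1)] by simp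
  then show ?thesis using assms by (auto simp: differentiable_def)
qed

lemma C_k_Suc_imp: "C_k (Suc k) \<phi> \<Longrightarrow> C_k k \<phi>"
proof (induction k arbitrary: \<phi>)
  case 0
  then show ?case
    by (auto intro!: continuous_at_imp_continuous_on differentiable_imp_continuous_within)
next
  case (Suc k)
  then show ?case by simp
qed

lemma C_k_const: "C_k k (\<lambda>x::'a::euclidean_space. c)"
proof (induction k arbitrary: c)
  case (Suc k) show ?case by (rule C_k_SucI[of _ "\<lambda>x h. 0"]) (auto intro: Suc)
qed simp

lemma C_k_inner: "C_k k (\<lambda>x::'a::euclidean_space. x \<bullet> c)"
proof (cases k)
  case 0 then show ?thesis by (auto intro!: continuous_intros)
next
  case (Suc j) show ?thesis unfolding Suc
    by (rule C_k_SucI[of _ "\<lambda>x h. h \<bullet> c"]) (auto intro!: C_k_const derivative_eq_intros)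
qed

lemma C_k_has_derivative:
  assumes "C_k (Suc k) \<phi>" shows "(\<phi> has_derivative frechet_derivative \<phi> (at x)) (at x)"
  using assms by (auto simp: frechet_derivative_works)

lemma C_k_add: "C_k k \<phi> \<Longrightarrow> C_k k \<psi> \<Longrightarrow> C_k k (\<lambda>x. \<phi> x + \<psi> x)"
proof (induction k arbitrary: \<phi> \<psi>)
  case 0 then show ?case by (auto intro!: continuous_intros)
next
  case (Suc k)
  show ?case
    by (rule C_k_SucI[OF has_derivative_add[OF C_k_has_derivative C_k_has_derivative]])
       (use Suc in auto)
qed

lemma C_k_mult: "C_k k \<phi> \<Longrightarrow> C_k k \<psi> \<Longrightarrow> C_k k (\<lambda>x. \<phi> x * \<psi> x)"
proof (induction k arbitrary: \<phi> \<psi>)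
  case 0 then show ?case by (auto intro!: continuous_intros)
next
  case (Suc k)
  show ?case
  proof (rule C_k_SucI[OF has_derivative_mult[OF C_k_has_derivative C_k_has_derivative]])
    fix i :: 'a assume i: "i \<in> Basis"
    show "C_k k (\<lambda>x. \<phi> x * frechet_derivative \<psi> (at x) i + frechet_derivative \<phi> (at x) i * \<psi> x)"
      by (intro C_k_add Suc.IH C_k_Suc_imp[OF Suc.prems(1)] C_k_Suc_imp[OF Suc.prems(2)])
         (use Suc.prems i in auto)
  qed (use Suc in auto)
qed

lemma C_k_prod: "finite I \<Longrightarrow> (\<And>i. i \<in> I \<Longrightarrow> C_k k (\<phi> i)) \<Longrightarrow> C_k k (\<lambda>x. \<Prod>i\<in>I. \<phi> i x)"
proof (induction I rule: finite_induct)
  case (insert i I)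
  then have "C_k k (\<lambda>x. \<phi> i x * (\<Prod>i\<in>I. \<phi> i x))" by (intro C_k_mult) auto
  with insert show ?case by simp
qed (simp add: C_k_const)

text \<open>
  If \<open>G\<close> is closed under differentiation, the partial derivatives of \<open>g \<circ> \<phi>\<close> are products of derivatives of
  \<open>\<phi>\<close> with functions of the same form, and induction on the order needs no explicit derivatives.
\<close>

lemma C_k_compose:
  assumes G: "\<And>g. g \<in> G \<Longrightarrow> \<exists>g'\<in>G. \<forall>t::real. (g has_real_derivative g' t) (at t)"
  shows "g \<in> G \<Longrightarrow> C_k k \<phi> \<Longrightarrow> C_k k (\<lambda>x. g (\<phi> x))"
proof (induction k arbitrary: g \<phi>)
  case 0
  then have "continuous_on UNIV g"
    using G[OF 0(1)] by (auto intro!: continuous_at_imp_continuous_on DERIV_isCont)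
  then show ?case using 0 by (auto intro: continuous_on_compose2)
next
  case (Suc k)
  obtain g' where g': "g' \<in> G" "\<And>t. (g has_real_derivative g' t) (at t)" using G[OF Suc.prems(1)] by auto
  show ?case
  proof (rule C_k_SucI)
    fix x
    show "((\<lambda>x. g (\<phi> x)) has_derivative (\<lambda>h. frechet_derivative \<phi> (at x) h * g' (\<phi> x))) (at x)"
      using has_derivative_compose[OF C_k_has_derivative[OF Suc.prems(2)] g'(2)[unfolded has_field_derivative_def]]
      by (simp add: mult.commute)
    fix i :: 'a assume "i \<in> Basis"
    then show "C_k k (\<lambda>x. frechet_derivative \<phi> (at x) i * g' (\<phi> x))"
      using Suc.prems by (intro C_k_mult[OF _ Suc.IH[OF g'(1) C_k_Suc_imp[OF Suc.prems(2)]]]) simp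
  qed
qed

text \<open>
  A family closed under differentiation that contains, for \<open>P = 1\<close>, the classical smooth function that is
  positive exactly on the positive half-line.
\<close>

definition flat_exp :: "real poly \<Rightarrow> real \<Rightarrow> real" where
  "flat_exp P t = (if t \<le> 0 then 0 else poly P (1 / t) * exp (- (1 / t)))"

lemma poly_exp_tendsto_0: "((\<lambda>y::real. poly P y * exp (- y)) \<longlongrightarrow> 0) at_top"
proof -
  have "((\<lambda>y::real. \<Sum>i\<le>degree P. coeff P i * (y ^ i / exp y)) \<longlongrightarrow> (\<Sum>i\<le>degree P. coeff P i * 0)) at_top"
    by (intro tendsto_intros tendsto_power_div_exp_0)
  then show ?thesis by (simp add: poly_altdef sum_distrib_right exp_minus divide_inverse mult.assoc)
qed

lemma flat_exp_deriv: "(flat_exp P has_real_derivative flat_exp ([:0,0,1:] * (P - pderiv P)) t) (at t)"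
proof (cases t "0::real" rule: linorder_cases)
  case less
  have "(flat_exp P has_real_derivative 0) (at t)"
    by (rule has_field_derivative_transform_within_open[of "\<lambda>_. 0" _ _ "{..<0}"])
       (use less in \<open>auto simp: flat_exp_def\<close>)
  then show ?thesis using less by (simp add: flat_exp_def)
next
  case greater
  have "((\<lambda>t. poly P (1 / t) * exp (- (1 / t))) has_real_derivative
      flat_exp ([:0,0,1:] * (P - pderiv P)) t) (at t)"
    using greater by (auto intro!: derivative_eq_intros simp: flat_exp_def power2_eq_square field_simps)
  then show ?thesis
    by (rule has_field_derivative_transform_within_open[of _ _ _ "{0<..}"])
       (use greater in \<open>auto simp: flat_exp_def\<close>)
next
  case equal
  have r: "((\<lambda>h. flat_exp P h / h) \<longlongrightarrow> 0) (at_right 0)"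
  proof (rule Lim_transform_eventually)
    show "((\<lambda>h. poly ([:0,1:] * P) (inverse h) * exp (- (inverse h))) \<longlongrightarrow> 0) (at_right (0::real))"
      by (rule filterlim_compose[OF poly_exp_tendsto_0 filterlim_inverse_at_top_right])
    show "\<forall>\<^sub>F h in at_right 0. poly ([:0,1:] * P) (inverse h) * exp (- (inverse h)) = flat_exp P h / h"
      by (auto simp: eventually_at_right_field flat_exp_def field_simps intro!: exI[of _ 1])
  qed
  have l: "((\<lambda>h. flat_exp P h / h) \<longlongrightarrow> 0) (at_left 0)"
  proof (rule Lim_transform_eventually[OF tendsto_const])
    show "\<forall>\<^sub>F h in at_left 0. 0 = flat_exp P h / h"
      by (auto simp: eventually_at_left_field flat_exp_def intro!: exI[of _ "-1"])
  qed
  have "((\<lambda>h. flat_exp P h / h) \<longlongrightarrow> 0) (at 0)" using l r by (rule filterlim_split_at)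
  then show ?thesis using equal by (simp add: DERIV_def flat_exp_def)
qed

lemma flat_exp_smooth: "C_k k \<phi> \<Longrightarrow> C_k k (\<lambda>x. flat_exp P (\<phi> x))"
proof (erule C_k_compose[of "range flat_exp" "flat_exp P", rotated 2])
  fix g assume "g \<in> range flat_exp"
  then obtain Q where "g = flat_exp Q" by blast
  then show "\<exists>g'\<in>range flat_exp. \<forall>t. (g has_real_derivative g' t) (at t)"
    using flat_exp_deriv[of Q] by blast
qed simp

text \<open>
  A family closed under differentiation that contains \<open>sqrt (e\<^sup>2 + t\<^sup>2)\<close>.
\<close>

definition sqrt_family :: "real \<Rightarrow> real poly \<Rightarrow> real \<Rightarrow> real \<Rightarrow> real" where
  "sqrt_family e P b t = poly P t * (e\<^sup>2 + t\<^sup>2) powr b"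

lemma sqrt_family_deriv:
  assumes "e > 0"
  shows "(sqrt_family e P b has_real_derivative
    sqrt_family e (pderiv P * [:e\<^sup>2, 0, 1:] + smult (2 * b) ([:0,1:] * P)) (b - 1) t) (at t)"
proof -
  have pos: "e\<^sup>2 + t\<^sup>2 > 0" for t using assms by (simp add: add_pos_nonneg)
  have "(sqrt_family e P b has_real_derivative
      poly (pderiv P) t * (e\<^sup>2 + t\<^sup>2) powr b + (b * (e\<^sup>2 + t\<^sup>2) powr (b - 1) * (2 * t)) * poly P t) (at t)"
    unfolding sqrt_family_def using pos[of t]
    by (auto intro!: derivative_eq_intros)
  moreover have "(e\<^sup>2 + t\<^sup>2) powr b = (e\<^sup>2 + t\<^sup>2) * (e\<^sup>2 + t\<^sup>2) powr (b - 1)"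
    using pos[of t] by (simp add: powr_mult_base)
  ultimately show ?thesis
    by (simp add: sqrt_family_def algebra_simps power2_eq_square)
qed

lemma sqrt_smooth:
  assumes "e > 0" "C_k k \<phi>" shows "C_k k (\<lambda>x. sqrt (e\<^sup>2 + (\<phi> x)\<^sup>2) - e)"
proof -
  have "C_k k (\<lambda>x. sqrt_family e [:1:] (1/2) (\<phi> x))"
  proof (rule C_k_compose[of "{g. \<exists>P b. g = sqrt_family e P b}" "sqrt_family e [:1:] (1/2)"])
    fix g assume "g \<in> {g. \<exists>P b. g = sqrt_family e P b}"
    then obtain P b where "g = sqrt_family e P b" by auto
    then show "\<exists>g'\<in>{g. \<exists>P b. g = sqrt_family e P b}. \<forall>t. (g has_real_derivative g' t) (at t)"
      using sqrt_family_deriv[OF assms(1), of P b] by blast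
  qed (use assms in auto)
  from C_k_add[OF this C_k_const[of k "-e"]] show ?thesis
    using assms(1) by (simp add: sqrt_family_def powr_half_sqrt)
qed

definition grad :: "('a::euclidean_space \<Rightarrow> real) \<Rightarrow> 'a \<Rightarrow> 'a" where
  "grad \<phi> x = (\<Sum>i\<in>Basis. frechet_derivative \<phi> (at x) i *\<^sub>R i)"

lemma grad_inner_Basis: "i \<in> Basis \<Longrightarrow> grad \<phi> x \<bullet> i = frechet_derivative \<phi> (at x) i"
  by (simp add: grad_def inner_sum_left_Basis)

lemma grad_eqI:
  assumes "(\<phi> has_derivative (\<lambda>h. g \<bullet> h)) (at x)" shows "grad \<phi> x = g"
proof (rule euclidean_eqI)
  fix i :: 'a assume "i \<in> Basis"
  then show "grad \<phi> x \<bullet> i = g \<bullet> i"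
    using frechet_derivative_at[OF assms] by (simp add: grad_inner_Basis fun_eq_iff)
qed

lemma grad_derivative:
  assumes "\<phi> differentiable (at x)" shows "(\<phi> has_derivative (\<lambda>h. grad \<phi> x \<bullet> h)) (at x)"
proof -
  let ?D = "frechet_derivative \<phi> (at x)"
  have D: "(\<phi> has_derivative ?D) (at x)" using assms by (simp add: frechet_derivative_works)
  interpret bounded_linear ?D using D by (rule has_derivative_bounded_linear)
  have "?D h = grad \<phi> x \<bullet> h" for h
  proof -
    have "?D h = ?D (\<Sum>i\<in>Basis. (h \<bullet> i) *\<^sub>R i)" by (simp add: euclidean_representation)
    also have "\<dots> = (\<Sum>i\<in>Basis. (h \<bullet> i) * ?D i)" by (simp add: sum scaleR)
    also have "\<dots> = grad \<phi> x \<bullet> h" by (simp add: grad_def inner_sum_left mult.commute inner_commute[of h])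
    finally show ?thesis .
  qed
  then have "?D = (\<lambda>h. grad \<phi> x \<bullet> h)" by (rule ext)
  with D show ?thesis by simp
qed

lemma test_C_k: "\<phi> \<in> test_functions \<Omega> \<Longrightarrow> C_k k \<phi>"
  by (simp add: test_functions_def)

lemma test_deriv: "\<phi> \<in> test_functions \<Omega> \<Longrightarrow> (\<phi> has_derivative (\<lambda>h. grad \<phi> x \<bullet> h)) (at x)"
  using test_C_k[of \<phi> \<Omega> "Suc 0"] by (intro grad_derivative) simp

lemma test_cont: "\<phi> \<in> test_functions \<Omega> \<Longrightarrow> continuous_on UNIV \<phi>"
  using test_C_k[of \<phi> \<Omega> 0] by simp

lemma test_grad_cont: "\<phi> \<in> test_functions \<Omega> \<Longrightarrow> continuous_on UNIV (grad \<phi>)"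
  unfolding grad_def using test_C_k[of \<phi> \<Omega> "Suc 0"]
  by (intro continuous_on_sum continuous_on_scaleR continuous_on_const) simp

lemma test_zero_outside:
  assumes "\<phi> \<in> test_functions \<Omega>" "x \<notin> closure {x. \<phi> x \<noteq> 0}"
  shows "\<phi> x = 0" "grad \<phi> x = 0"
proof -
  define S where "S = - closure {x. \<phi> x \<noteq> 0}"
  have z: "\<phi> y = 0" if "y \<in> S" for y
    using that closure_subset[of "{x. \<phi> x \<noteq> 0}"] unfolding S_def by blast
  have x: "x \<in> S" "open S" using assms by (auto simp: S_def intro: open_Compl)
  then show "\<phi> x = 0" by (intro z)
  have "(\<phi> has_derivative (\<lambda>h. 0)) (at x)"
    by (rule has_derivative_transform_within_open[OF has_derivative_const[of 0] x(2,1)]) (simp add: z)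
  then show "grad \<phi> x = 0" by (intro grad_eqI) simp
qed

lemma test_zero_outside_domain:
  assumes "\<phi> \<in> test_functions \<Omega>" "x \<notin> \<Omega>" shows "\<phi> x = 0" "grad \<phi> x = 0"
  using test_zero_outside[OF assms(1), of x] assms by (auto simp: test_functions_def)

lemma test_functionsI:
  assumes "\<And>k. C_k k \<phi>" "compact K" "K \<subseteq> \<Omega>" "\<And>x. x \<notin> K \<Longrightarrow> \<phi> x = 0"
  shows "\<phi> \<in> test_functions \<Omega>"
proof -
  have "closure {x. \<phi> x \<noteq> 0} \<subseteq> K" using assms by (intro closure_minimal) (auto simp: compact_imp_closed)
  then show ?thesis using assms compact_Int_closed[OF assms(2) closed_closure[of "{x. \<phi> x \<noteq> 0}"]]
    by (auto simp: test_functions_def Int_absorb1)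
qed

lemma test_support:
  assumes "\<phi> \<in> test_functions \<Omega>"
  shows "\<exists>K. compact K \<and> K \<subseteq> \<Omega> \<and> (\<forall>x. x \<notin> K \<longrightarrow> \<phi> x = 0) \<and> (\<forall>x. x \<notin> K \<longrightarrow> grad \<phi> x = 0)"
proof (intro exI conjI allI impI)
  show "compact (closure {x. \<phi> x \<noteq> 0})" "closure {x. \<phi> x \<noteq> 0} \<subseteq> \<Omega>"
    using assms by (simp_all add: test_functions_def)
qed (fact test_zero_outside[OF assms])+

lemma test_bound:
  assumes "\<phi> \<in> test_functions \<Omega>"
  shows "\<exists>B>0. (\<forall>x. \<bar>\<phi> x\<bar> \<le> B) \<and> (\<forall>x. norm (grad \<phi> x) \<le> B)"
proof -
  obtain K where K': "compact K" "K \<subseteq> \<Omega>" "\<And>x. x \<notin> K \<Longrightarrow> \<phi> x = 0" "\<And>x. x \<notin> K \<Longrightarrow> grad \<phi> x = 0"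
    using test_support[OF assms] by blast
  note K = K'(1,3,4)
  obtain A where A: "\<And>x. x \<in> K \<Longrightarrow> norm (\<phi> x) \<le> A"
    using compact_imp_bounded[OF compact_continuous_image[OF continuous_on_subset[OF test_cont[OF assms]] K(1)]]
    by (auto simp: bounded_iff)
  obtain B where B: "\<And>x. x \<in> K \<Longrightarrow> norm (grad \<phi> x) \<le> B"
    using compact_imp_bounded[OF compact_continuous_image[OF continuous_on_subset[OF test_grad_cont[OF assms]] K(1)]]
    by (auto simp: bounded_iff)
  have "\<bar>\<phi> x\<bar> \<le> \<bar>A\<bar> + \<bar>B\<bar> + 1 \<and> norm (grad \<phi> x) \<le> \<bar>A\<bar> + \<bar>B\<bar> + 1" for x
    using A[of x] B[of x] K(2,3)[of x] by (cases "x \<in> K") auto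
  then show ?thesis by (intro exI[of _ "\<bar>A\<bar> + \<bar>B\<bar> + 1"]) auto
qed

lemma test_zero: "(\<lambda>x. 0) \<in> test_functions \<Omega>"
  by (rule test_functionsI[of _ "{}"]) (auto intro: C_k_const)

lemma test_add:
  assumes "\<phi> \<in> test_functions \<Omega>" "\<psi> \<in> test_functions \<Omega>"
  shows "(\<lambda>x. \<phi> x + \<psi> x) \<in> test_functions \<Omega>" "grad (\<lambda>x. \<phi> x + \<psi> x) x = grad \<phi> x + grad \<psi> x"
proof -
  obtain K where K: "compact K" "K \<subseteq> \<Omega>" "\<And>x. x \<notin> K \<Longrightarrow> \<phi> x = 0" "\<And>x. x \<notin> K \<Longrightarrow> grad \<phi> x = 0"
    using test_support[OF assms(1)] by blast
  obtain L where L: "compact L" "L \<subseteq> \<Omega>" "\<And>x. x \<notin> L \<Longrightarrow> \<psi> x = 0" "\<And>x. x \<notin> L \<Longrightarrow> grad \<psi> x = 0"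
    using test_support[OF assms(2)] by blast
  show "(\<lambda>x. \<phi> x + \<psi> x) \<in> test_functions \<Omega>"
    by (rule test_functionsI[of _ "K \<union> L"]) (use K L assms in \<open>auto intro: C_k_add test_C_k\<close>)
  show "grad (\<lambda>x. \<phi> x + \<psi> x) x = grad \<phi> x + grad \<psi> x"
    using has_derivative_add[OF test_deriv[OF assms(1)] test_deriv[OF assms(2)]]
    by (intro grad_eqI) (simp add: inner_add_left)
qed

lemma test_mult:
  assumes "\<phi> \<in> test_functions \<Omega>" "\<psi> \<in> test_functions \<Omega>"
  shows "(\<lambda>x. \<phi> x * \<psi> x) \<in> test_functions \<Omega>" "grad (\<lambda>x. \<phi> x * \<psi> x) x = \<phi> x *\<^sub>R grad \<psi> x + \<psi> x *\<^sub>R grad \<phi> x"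
proof -
  obtain K where K: "compact K" "K \<subseteq> \<Omega>" "\<And>x. x \<notin> K \<Longrightarrow> \<phi> x = 0" "\<And>x. x \<notin> K \<Longrightarrow> grad \<phi> x = 0"
    using test_support[OF assms(1)] by blast
  show "(\<lambda>x. \<phi> x * \<psi> x) \<in> test_functions \<Omega>"
    by (rule test_functionsI[of _ K]) (use K assms in \<open>auto intro: C_k_mult test_C_k\<close>)
  show "grad (\<lambda>x. \<phi> x * \<psi> x) x = \<phi> x *\<^sub>R grad \<psi> x + \<psi> x *\<^sub>R grad \<phi> x"
    using has_derivative_mult[OF test_deriv[OF assms(1)] test_deriv[OF assms(2)], of x]
    by (intro grad_eqI) (simp add: inner_add_left mult.commute)
qed

lemma test_scale:
  assumes "\<phi> \<in> test_functions \<Omega>"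
  shows "(\<lambda>x. c * \<phi> x) \<in> test_functions \<Omega>" "grad (\<lambda>x. c * \<phi> x) x = c *\<^sub>R grad \<phi> x"
proof -
  obtain K where K: "compact K" "K \<subseteq> \<Omega>" "\<And>x. x \<notin> K \<Longrightarrow> \<phi> x = 0" "\<And>x. x \<notin> K \<Longrightarrow> grad \<phi> x = 0"
    using test_support[OF assms(1)] by blast
  show "(\<lambda>x. c * \<phi> x) \<in> test_functions \<Omega>"
    by (rule test_functionsI[of _ K]) (use K assms in \<open>auto intro: C_k_mult C_k_const test_C_k\<close>)
  show "grad (\<lambda>x. c * \<phi> x) x = c *\<^sub>R grad \<phi> x"
    using has_derivative_mult_right[OF test_deriv[OF assms(1)], of c x]
    by (intro grad_eqI) simp
qed

text \<open>
  A smooth substitute for the absolute value of \<open>\<phi>\<close>: the function \<open>sqrt (e\<^sup>2 + t\<^sup>2) - e\<close> of \<open>t\<close> vanishes at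
  \<open>0\<close>, which preserves the support, and has slope at most \<open>1\<close>, which does not increase gradients.
\<close>

lemma test_sqrt:
  assumes "\<phi> \<in> test_functions \<Omega>" "e > 0"
  defines "\<psi> \<equiv> \<lambda>x. sqrt (e\<^sup>2 + (\<phi> x)\<^sup>2) - e"
  shows "\<psi> \<in> test_functions \<Omega>" "norm (grad \<psi> x) \<le> norm (grad \<phi> x)" "\<bar>\<psi> x - \<bar>\<phi> x\<bar>\<bar> \<le> e"
proof -
  obtain K where K: "compact K" "K \<subseteq> \<Omega>" "\<And>x. x \<notin> K \<Longrightarrow> \<phi> x = 0" "\<And>x. x \<notin> K \<Longrightarrow> grad \<phi> x = 0"
    using test_support[OF assms(1)] by blast
  show "\<psi> \<in> test_functions \<Omega>"
    unfolding \<psi>_def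
    by (rule test_functionsI[of _ K]) (use K assms in \<open>auto intro: sqrt_smooth test_C_k\<close>)
  have pos: "e\<^sup>2 + (\<phi> x)\<^sup>2 > 0" using assms(2) by (simp add: add_pos_nonneg)
  define c where "c = \<phi> x / sqrt (e\<^sup>2 + (\<phi> x)\<^sup>2)"
  have "(\<psi> has_derivative (\<lambda>h. (c *\<^sub>R grad \<phi> x) \<bullet> h)) (at x)"
    unfolding \<psi>_def c_def using pos
    by (auto intro!: derivative_eq_intros test_deriv[OF assms(1)] simp: field_simps)
  then have g: "grad \<psi> x = c *\<^sub>R grad \<phi> x" by (rule grad_eqI)
  have "\<bar>\<phi> x\<bar> \<le> sqrt (e\<^sup>2 + (\<phi> x)\<^sup>2)" by (rule real_le_rsqrt) simp
  then have "\<bar>c\<bar> \<le> 1" using pos by (simp add: c_def abs_divide divide_le_eq)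
  then show "norm (grad \<psi> x) \<le> norm (grad \<phi> x)" unfolding g by (simp add: mult_left_le_one_le)
  have "sqrt (e\<^sup>2 + (\<phi> x)\<^sup>2) \<le> e + \<bar>\<phi> x\<bar>"
    using assms(2) by (intro real_le_lsqrt) (auto simp: power2_sum)
  then show "\<bar>\<psi> x - \<bar>\<phi> x\<bar>\<bar> \<le> e"
    using \<open>\<bar>\<phi> x\<bar> \<le> sqrt (e\<^sup>2 + (\<phi> x)\<^sup>2)\<close> assms(2) by (auto simp: \<psi>_def)
qed

text \<open>Smooth approximations from below of the indicator function of an open box.\<close>

definition box_bump :: "'a::euclidean_space \<Rightarrow> 'a \<Rightarrow> nat \<Rightarrow> 'a \<Rightarrow> real" where
  "box_bump c d m x = (\<Prod>i\<in>Basis. flat_exp 1 (real (Suc m) * (x \<bullet> i - c \<bullet> i)) * flat_exp 1 (real (Suc m) * (d \<bullet> i - x \<bullet> i)))"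

lemma flat_exp_1: "0 \<le> flat_exp 1 t" "flat_exp 1 t \<le> 1" "flat_exp 1 t > 0 \<longleftrightarrow> t > 0"
  by (auto simp: flat_exp_def)

lemma flat_exp_1_lim: "t > 0 \<Longrightarrow> (\<lambda>m. flat_exp 1 (real (Suc m) * t)) \<longlonglongrightarrow> 1"
proof -
  assume t: "t > 0"
  have "(\<lambda>m. exp (- ((1 / t) * inverse (real (Suc m))))) \<longlonglongrightarrow> exp (- ((1 / t) * 0))"
    by (intro tendsto_intros LIMSEQ_inverse_real_of_nat)
  moreover have "flat_exp 1 (real (Suc m) * t) = exp (- ((1 / t) * inverse (real (Suc m))))" for m
  proof -
    have "\<not> real (Suc m) * t \<le> 0" unfolding not_le using t by (intro mult_pos_pos) auto
    moreover have "1 / (real (Suc m) * t) = (1 / t) * inverse (real (Suc m))"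
      unfolding divide_inverse inverse_mult_distrib by (simp only: mult.commute mult_1_left mult_1_right)
    ultimately show ?thesis by (simp only: flat_exp_def if_False poly_1 mult_1_left)
  qed
  ultimately show ?thesis by simp
qed

lemma box_bump_props:
  shows "cbox c d \<subseteq> \<Omega> \<Longrightarrow> box_bump c d m \<in> test_functions \<Omega>"
    and "0 \<le> box_bump c d m x" "box_bump c d m x \<le> 1"
    and "x \<notin> box c d \<Longrightarrow> box_bump c d m x = 0"
    and "x \<in> box c d \<Longrightarrow> box_bump c d m x > 0"
    and "(\<lambda>m. box_bump c d m x) \<longlonglongrightarrow> indicator (box c d) x"
proof -
  show out: "box_bump c d m x = 0" if "x \<notin> box c d" for m x
  proof -
    obtain i where "i \<in> Basis" "\<not> (c \<bullet> i < x \<bullet> i \<and> x \<bullet> i < d \<bullet> i)" using \<open>x \<notin> box c d\<close> by (auto simp: mem_box)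
    then show ?thesis unfolding box_bump_def
      by (intro prod_zero) (auto intro!: bexI[of _ i] simp: flat_exp_def not_less mult_le_0_iff)
  qed
  show "box_bump c d m \<in> test_functions \<Omega>" if "cbox c d \<subseteq> \<Omega>"
  proof (rule test_functionsI[of _ "cbox c d"])
    show "C_k k (box_bump c d m)" for k
    proof -
      have 1: "C_k k (\<lambda>x. real (Suc m) * (x \<bullet> i - c \<bullet> i))" for i
        using C_k_mult[OF C_k_const C_k_add[OF C_k_inner C_k_const[of _ "- (c \<bullet> i)"]]] by simp
      have 2: "C_k k (\<lambda>x. real (Suc m) * (d \<bullet> i - x \<bullet> i))" for i
        using C_k_mult[OF C_k_const C_k_add[OF C_k_const[of _ "d \<bullet> i"] C_k_inner[of _ "- i"]]] by simp
      show ?thesis unfolding box_bump_def[abs_def]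
        by (rule C_k_prod[OF finite_Basis]) (rule C_k_mult[OF flat_exp_smooth[OF 1] flat_exp_smooth[OF 2]])
    qed
    fix x assume "x \<notin> cbox c d"
    then show "box_bump c d m x = 0" using box_subset_cbox[of c d] by (intro out) auto
  qed (use that in auto)
  show "0 \<le> box_bump c d m x" unfolding box_bump_def by (intro prod_nonneg) (auto simp: flat_exp_1)
  show "box_bump c d m x \<le> 1" unfolding box_bump_def
    by (intro prod_le_1) (auto simp: flat_exp_1 intro!: mult_le_one)
  show "x \<in> box c d \<Longrightarrow> box_bump c d m x > 0"
    unfolding box_bump_def by (intro prod_pos) (auto simp: flat_exp_1 mem_box intro!: mult_pos_pos)
  show "(\<lambda>m. box_bump c d m x) \<longlonglongrightarrow> indicator (box c d) x"
  proof (cases "x \<in> box c d")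
    case True
    have "(\<lambda>m. box_bump c d m x) \<longlonglongrightarrow> (\<Prod>i\<in>(Basis::'a set). 1 * 1)"
      unfolding box_bump_def
      by (intro tendsto_prod tendsto_mult flat_exp_1_lim) (use True in \<open>auto simp: mem_box\<close>)
    then show ?thesis using True by simp
  next
    case False then show ?thesis by (simp add: out)
  qed
qed

section \<open>Integration by parts\<close>

locale bounded_domain =
  fixes \<Omega> :: "'a::euclidean_space set"
  assumes open_domain: "open \<Omega>" and bounded_domain: "bounded \<Omega>"
begin

abbreviation "M \<equiv> lebesgue_on \<Omega>"

lemma domain_sets [simp]: "\<Omega> \<in> sets lebesgue" "\<Omega> \<in> sets borel"
proof -
  show "\<Omega> \<in> sets borel" using open_domain by (rule borel_open)
  then show "\<Omega> \<in> sets lebesgue" by (intro sets_completionI_sets) simp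
qed

lemma finite_M: "finite_measure M"
  using open_domain bounded_domain by (intro finite_measure_lebesgue_on lmeasurable_open)

lemma integral_domain_eq_lborel:
  fixes f :: "'a \<Rightarrow> 'b::euclidean_space"
  assumes "f \<in> borel_measurable borel" "\<And>x. x \<notin> \<Omega> \<Longrightarrow> f x = 0"
  shows "integral\<^sup>L M f = integral\<^sup>L lborel f" "integrable M f \<longleftrightarrow> integrable lborel f"
proof -
  have e: "indicator \<Omega> x *\<^sub>R f x = f x" for x using assms(2)[of x] by (cases "x \<in> \<Omega>") auto
  show "integral\<^sup>L M f = integral\<^sup>L lborel f"
    using assms(1) by (simp add: integral_restrict_space e integral_completion)
  show "integrable M f \<longleftrightarrow> integrable lborel f"
    using assms(1) by (simp add: integrable_restrict_space e integrable_completion)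
qed

lemma continuous_measurable_M:
  fixes f :: "'a \<Rightarrow> 'b::euclidean_space"
  assumes "continuous_on UNIV f" shows "f \<in> borel_measurable M"
  using assms by (intro continuous_imp_measurable_on_sets_lebesgue continuous_on_subset[OF assms]) auto

lemma bounded_in_Lp:
  fixes f :: "'a \<Rightarrow> 'b::euclidean_space"
  assumes "f \<in> borel_measurable M" "\<And>x. norm (f x) \<le> B" "p \<ge> 0"
  shows "f \<in> Lp M p"
proof -
  interpret finite_measure M by (rule finite_M)
  show ?thesis
    by (rule Lp_bound[of _ _ "\<lambda>_. B powr p"]) (use assms in \<open>auto intro!: powr_mono2\<close>)
qed

lemma test_in_Lp:
  assumes "\<phi> \<in> test_functions \<Omega>" "p \<ge> 0" shows "\<phi> \<in> Lp M p" "grad \<phi> \<in> Lp M p"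
proof -
  obtain B where B: "\<And>x. \<bar>\<phi> x\<bar> \<le> B" "\<And>x. norm (grad \<phi> x) \<le> B" using test_bound[OF assms(1)] by blast
  show "\<phi> \<in> Lp M p" using B assms
    by (intro bounded_in_Lp[of _ B] continuous_measurable_M test_cont) auto
  show "grad \<phi> \<in> Lp M p" using B assms
    by (intro bounded_in_Lp[of _ B] continuous_measurable_M test_grad_cont) auto
qed

end

lemma test_line_deriv:
  assumes "\<phi> \<in> test_functions \<Omega>"
  shows "((\<lambda>s. \<phi> (x + s *\<^sub>R h)) has_real_derivative (grad \<phi> (x + s *\<^sub>R h) \<bullet> h)) (at s)"
proof -
  have "((\<lambda>s. x + s *\<^sub>R h) has_derivative (\<lambda>r. r *\<^sub>R h)) (at s)"
    by (auto intro!: derivative_eq_intros)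
  from has_derivative_compose[OF this test_deriv[OF assms]]
  moreover have "(\<lambda>r. grad \<phi> (x + s *\<^sub>R h) \<bullet> (r *\<^sub>R h)) = (*) (grad \<phi> (x + s *\<^sub>R h) \<bullet> h)"
    by (auto simp: fun_eq_iff)
  ultimately show ?thesis by (simp only: has_field_derivative_def)
qed

lemma test_line_bound:
  assumes "\<phi> \<in> test_functions \<Omega>" "\<And>x. norm (grad \<phi> x) \<le> B"
  shows "\<bar>\<phi> (x + t *\<^sub>R h) - \<phi> x\<bar> \<le> B * norm h * \<bar>t\<bar>"
proof -
  have "norm (\<phi> (x + t *\<^sub>R h) - \<phi> (x + 0 *\<^sub>R h)) \<le> (B * norm h) * norm (t - 0)"
  proof (rule field_differentiable_bound[of UNIV])
    fix s :: real
    show "((\<lambda>s. \<phi> (x + s *\<^sub>R h)) has_field_derivative (grad \<phi> (x + s *\<^sub>R h) \<bullet> h)) (at s within UNIV)"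
      using test_line_deriv[OF assms(1)] by simp
    show "norm (grad \<phi> (x + s *\<^sub>R h) \<bullet> h) \<le> B * norm h"
      using Cauchy_Schwarz_ineq2[of "grad \<phi> (x + s *\<^sub>R h)" h] mult_right_mono[OF assms(2)[of "x + s *\<^sub>R h"], of "norm h"]
      by auto
  qed auto
  then show ?thesis by simp
qed

lemma lborel_translate:
  fixes f :: "'a::euclidean_space \<Rightarrow> 'b::{banach,second_countable_topology}"
  assumes "f \<in> borel_measurable borel"
  shows "(LINT x|lborel. f (x + c)) = integral\<^sup>L lborel f" "integrable lborel (\<lambda>x. f (x + c)) \<longleftrightarrow> integrable lborel f"
proof -
  have e: "integral\<^sup>L lborel f = integral\<^sup>L (distr lborel borel ((+) c)) f" by (simp add: lborel_distr_plus)
  then show "(LINT x|lborel. f (x + c)) = integral\<^sup>L lborel f"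
    using assms by (subst e, subst integral_distr) (auto simp: add.commute)
  have "integrable lborel f \<longleftrightarrow> integrable (distr lborel borel ((+) c)) f" by (simp add: lborel_distr_plus)
  then show "integrable lborel (\<lambda>x. f (x + c)) \<longleftrightarrow> integrable lborel f"
    using assms by (subst (asm) integrable_distr_eq) (auto simp: add.commute)
qed

lemma test_integrable_lborel:
  assumes "\<phi> \<in> test_functions \<Omega>" shows "integrable lborel \<phi>" "integrable lborel (grad \<phi>)"
proof -
  obtain K where K: "compact K" "\<And>x. x \<notin> K \<Longrightarrow> \<phi> x = 0" "\<And>x. x \<notin> K \<Longrightarrow> grad \<phi> x = 0"
    using test_support[OF assms] by blast
  have "integrable lborel (\<lambda>x. indicator K x *\<^sub>R \<phi> x)"
    by (rule borel_integrable_compact[OF K(1)]) (rule continuous_on_subset[OF test_cont[OF assms]], simp)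
  moreover have "(\<lambda>x. indicator K x *\<^sub>R \<phi> x) = \<phi>"
  proof
    fix x show "indicator K x *\<^sub>R \<phi> x = \<phi> x" using K(2)[of x] by (cases "x \<in> K") auto
  qed
  ultimately show "integrable lborel \<phi>" by simp
  have "integrable lborel (\<lambda>x. indicator K x *\<^sub>R grad \<phi> x)"
    by (rule borel_integrable_compact[OF K(1)]) (rule continuous_on_subset[OF test_grad_cont[OF assms]], simp)
  moreover have "(\<lambda>x. indicator K x *\<^sub>R grad \<phi> x) = grad \<phi>"
  proof
    fix x show "indicator K x *\<^sub>R grad \<phi> x = grad \<phi> x" using K(3)[of x] by (cases "x \<in> K") auto
  qed
  ultimately show "integrable lborel (grad \<phi>)" by simp
qed

text \<open>
  The difference quotients of \<open>\<phi>\<close> have integral \<open>0\<close> by translation invariance, and they are dominated because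
  \<open>\<phi>\<close> is Lipschitz continuous with compact support.
\<close>

lemma test_grad_integral_0:
  assumes "\<phi> \<in> test_functions \<Omega>"
  shows "(LINT x|lborel. grad \<phi> x \<bullet> h) = 0"
proof -
  obtain K where K: "compact K" "\<And>x. x \<notin> K \<Longrightarrow> \<phi> x = 0"
    using test_support[OF assms] by blast
  obtain B where B: "B > 0" "\<And>x. norm (grad \<phi> x) \<le> B" using test_bound[OF assms] by blast
  obtain R where R: "\<And>x. x \<in> K \<Longrightarrow> norm x \<le> R" using compact_imp_bounded[OF K(1)] by (auto simp: bounded_iff)
  define t where "t n = inverse (real (Suc n))" for n
  have t: "0 < t n" "t n \<le> 1" "t \<longlonglongrightarrow> 0" for n
    by (auto simp: t_def field_simps LIMSEQ_inverse_real_of_nat) (use LIMSEQ_inverse_real_of_nat in \<open>simp add: t_def[abs_def]\<close>)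
  have m: "\<phi> \<in> borel_measurable borel" using test_cont[OF assms] by (rule borel_measurable_continuous_onI)
  have mg: "grad \<phi> \<in> borel_measurable borel" using test_grad_cont[OF assms] by (rule borel_measurable_continuous_onI)
  have "(\<lambda>n. LINT x|lborel. (\<phi> (x + t n *\<^sub>R h) - \<phi> x) / t n) \<longlonglongrightarrow> (LINT x|lborel. grad \<phi> x \<bullet> h)"
  proof (rule integral_dominated_convergence[where w = "\<lambda>x. indicator (cball 0 (R + norm h)) x *\<^sub>R (B * norm h)"])
    show "integrable lborel (\<lambda>x::'a. indicator (cball 0 (R + norm h)) x *\<^sub>R (B * norm h))"
      by (rule borel_integrable_compact) auto
    show "(\<lambda>x. (\<phi> (x + t n *\<^sub>R h) - \<phi> x) / t n) \<in> borel_measurable lborel" for n using m by measurable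
    show "(\<lambda>x. grad \<phi> x \<bullet> h) \<in> borel_measurable lborel" using mg by measurable
    show "AE x in lborel. (\<lambda>n. (\<phi> (x + t n *\<^sub>R h) - \<phi> x) / t n) \<longlonglongrightarrow> grad \<phi> x \<bullet> h"
    proof (rule AE_I2)
      fix x
      have "((\<lambda>s. (\<phi> (x + (0 + s) *\<^sub>R h) - \<phi> (x + 0 *\<^sub>R h)) / s) \<longlongrightarrow> grad \<phi> (x + 0 *\<^sub>R h) \<bullet> h) (at 0)"
        using test_line_deriv[OF assms, of x h 0] unfolding DERIV_def .
      then have "((\<lambda>s. (\<phi> (x + s *\<^sub>R h) - \<phi> x) / s) \<longlongrightarrow> grad \<phi> x \<bullet> h) (at 0)" by simp
      moreover have "filterlim t (at 0) sequentially"
        unfolding filterlim_at using t by (auto simp: less_imp_neq[symmetric] intro!: always_eventually)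
      ultimately show "(\<lambda>n. (\<phi> (x + t n *\<^sub>R h) - \<phi> x) / t n) \<longlonglongrightarrow> grad \<phi> x \<bullet> h"
        by (rule filterlim_compose)
    qed
    show "AE x in lborel. norm ((\<phi> (x + t n *\<^sub>R h) - \<phi> x) / t n) \<le> indicator (cball 0 (R + norm h)) x *\<^sub>R (B * norm h)" for n
    proof (rule AE_I2)
      fix x
      show "norm ((\<phi> (x + t n *\<^sub>R h) - \<phi> x) / t n) \<le> indicator (cball 0 (R + norm h)) x *\<^sub>R (B * norm h)"
      proof (cases "x \<in> cball 0 (R + norm h)")
        case True
        have "\<bar>\<phi> (x + t n *\<^sub>R h) - \<phi> x\<bar> \<le> B * norm h * \<bar>t n\<bar>" by (rule test_line_bound[OF assms B(2)])
        then show ?thesis using True t(1)[of n] by (simp add: divide_le_eq)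
      next
        case False
        have "norm (t n *\<^sub>R h) \<le> norm h" using t(1,2)[of n] by (simp add: mult_left_le_one_le)
        then have "norm (x + t n *\<^sub>R h) > R" "norm x > R"
          using False norm_triangle_ineq2[of x "- (t n *\<^sub>R h)"] norm_ge_zero[of h]
          unfolding mem_cball_0 norm_minus_cancel diff_minus_eq_add by linarith+
        then have "x \<notin> K" "x + t n *\<^sub>R h \<notin> K" using R by force+
        then show ?thesis using False by (simp add: K(2))
      qed
    qed
  qed
  moreover have z: "(LINT x|lborel. (\<phi> (x + t n *\<^sub>R h) - \<phi> x) / t n) = 0" for n
    using test_integrable_lborel(1)[OF assms] lborel_translate[OF m, of "t n *\<^sub>R h"] by simp
  ultimately have "(\<lambda>n. 0::real) \<longlonglongrightarrow> (LINT x|lborel. grad \<phi> x \<bullet> h)" by (simp only: z)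
  then show ?thesis by (simp add: LIMSEQ_const_iff)
qed

context bounded_domain begin

lemma locally_integrable_mult_test:
  fixes w :: "'a \<Rightarrow> real"
  assumes "locally_integrable \<Omega> w" "continuous_on UNIV \<psi>" "compact K" "K \<subseteq> \<Omega>" "\<And>x. x \<notin> K \<Longrightarrow> \<psi> x = 0"
  shows "integrable M (\<lambda>x. w x * \<psi> x)"
proof -
  obtain B where B: "\<And>x. x \<in> K \<Longrightarrow> norm (\<psi> x) \<le> B"
    using compact_imp_bounded[OF compact_continuous_image[OF continuous_on_subset[OF assms(2)] assms(3)]]
    by (auto simp: bounded_iff)
  have K: "K \<in> sets lebesgue" using assms(3) by (simp add: compact_imp_closed lmeasurable_compact)
  have i: "integrable (lebesgue_on K) w" using assms(1,3,4) by (simp add: locally_integrable_def)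
  have m: "\<psi> \<in> borel_measurable (lebesgue_on K)"
    using K by (intro continuous_imp_measurable_on_sets_lebesgue continuous_on_subset[OF assms(2)]) auto
  have le: "norm (w x * \<psi> x) \<le> norm (\<bar>B\<bar> * w x)" if "x \<in> K" for x
    using mult_right_mono[of "\<bar>\<psi> x\<bar>" "\<bar>B\<bar>" "\<bar>w x\<bar>"] B[OF that] by (simp add: abs_mult mult.commute)
  have "integrable (lebesgue_on K) (\<lambda>x. w x * \<psi> x)"
  proof (rule Bochner_Integration.integrable_bound)
    show "integrable (lebesgue_on K) (\<lambda>x. \<bar>B\<bar> * w x)" using i by simp
    show "(\<lambda>x. w x * \<psi> x) \<in> borel_measurable (lebesgue_on K)"
      by (rule borel_measurable_times[OF borel_measurable_integrable[OF i] m])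
    show "AE x in lebesgue_on K. norm (w x * \<psi> x) \<le> norm (\<bar>B\<bar> * w x)"
      by (rule AE_I2) (rule le, simp)
  qed
  then have "integrable lebesgue (\<lambda>x. indicator K x *\<^sub>R (w x * \<psi> x))"
    using K by (simp add: integrable_restrict_space)
  moreover have "(\<lambda>x. indicator K x *\<^sub>R (w x * \<psi> x)) = (\<lambda>x. indicator \<Omega> x *\<^sub>R (w x * \<psi> x))"
  proof
    fix x show "indicator K x *\<^sub>R (w x * \<psi> x) = indicator \<Omega> x *\<^sub>R (w x * \<psi> x)"
      using assms(4) assms(5)[of x] by (cases "x \<in> K") (auto simp: indicator_def)
  qed
  ultimately show ?thesis using integrable_restrict_space[of \<Omega> lebesgue "\<lambda>x. w x * \<psi> x"] by simp
qed

lemma locally_integrable_measurable: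
  fixes w :: "'a \<Rightarrow> 'b::euclidean_space"
  assumes "locally_integrable \<Omega> w" shows "w \<in> borel_measurable M"
proof -
  obtain \<D> where D: "countable \<D>" "\<D> \<subseteq> Pow \<Omega>" "\<And>X. X \<in> \<D> \<Longrightarrow> \<exists>a b. X = cbox a b" "\<Union>\<D> = \<Omega>"
    using open_countable_Union_open_cbox[OF open_domain] by blast
  show ?thesis
  proof (rule measurable_piecewise_restrict[OF D(1)])
    fix X assume X: "X \<in> \<D>"
    then obtain a b where ab: "X = cbox a b" using D(3) by blast
    have sub: "X \<subseteq> \<Omega>" using D(2) X by blast
    have Xl: "X \<in> sets lebesgue" by (simp add: ab)
    show "X \<inter> space M \<in> sets M"
      using Xl sub by (auto simp: sets_restrict_space Int_absorb1)
    have "integrable (lebesgue_on X) w" using assms sub by (auto simp: locally_integrable_def ab)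
    then have "w \<in> borel_measurable (lebesgue_on X)" by (rule borel_measurable_integrable)
    moreover have "restrict_space M X = lebesgue_on X"
      using sub Xl by (subst restrict_restrict_space) (auto simp: Int_absorb1)
    ultimately show "w \<in> borel_measurable (restrict_space M X)" by simp
  qed (use D in auto)
qed

text \<open>
  The bump functions of the box converge boundedly to its indicator function.
\<close>

lemma box_integral_zero:
  fixes w :: "'a \<Rightarrow> real"
  assumes w: "locally_integrable \<Omega> w" and z: "\<And>\<phi>. \<phi> \<in> test_functions \<Omega> \<Longrightarrow> (LINT x|M. w x * \<phi> x) = 0"
    and cd: "cbox c d \<subseteq> \<Omega>"
  shows "(LINT x|lebesgue. indicator (box c d) x * w x) = 0"
proof -
  have wm: "w \<in> borel_measurable M" by (rule locally_integrable_measurable[OF w])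
  have iK: "integrable lebesgue (\<lambda>x. indicator (cbox c d) x * w x)"
    using w cd integrable_restrict_space[of "cbox c d" lebesgue w] by (auto simp: locally_integrable_def)
  have iM: "integrable M (\<lambda>x. indicator (cbox c d) x * w x)"
  proof -
    have "(\<lambda>x. indicator (cbox c d) x * w x) = (\<lambda>x. indicator \<Omega> x *\<^sub>R (indicator (cbox c d) x * w x))"
      using cd by (auto simp: indicator_def fun_eq_iff)
    with iK show ?thesis using integrable_restrict_space[of \<Omega> lebesgue "\<lambda>x. indicator (cbox c d) x * w x"] by simp
  qed
  have "(\<lambda>m. LINT x|M. w x * box_bump c d m x) \<longlonglongrightarrow> (LINT x|M. indicator (box c d) x * w x)"
  proof (rule integral_dominated_convergence[where w = "\<lambda>x. \<bar>indicator (cbox c d) x * w x\<bar>"])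
    show "(\<lambda>x. indicator (box c d) x * w x) \<in> borel_measurable M"
      using wm by (intro borel_measurable_times borel_measurable_indicator') (auto simp: sets_restrict_space)
    show "(\<lambda>x. w x * box_bump c d m x) \<in> borel_measurable M" for m
      by (rule borel_measurable_times[OF wm continuous_measurable_M[OF test_cont[OF box_bump_props(1)[OF cd]]]])
    show "integrable M (\<lambda>x. \<bar>indicator (cbox c d) x * w x\<bar>)" using iM by simp
    show "AE x in M. (\<lambda>m. w x * box_bump c d m x) \<longlonglongrightarrow> indicator (box c d) x * w x"
    proof (rule AE_I2)
      fix x show "(\<lambda>m. w x * box_bump c d m x) \<longlonglongrightarrow> indicator (box c d) x * w x"
        using tendsto_mult[OF tendsto_const[of "w x"] box_bump_props(6)[of c d x]] by (simp add: mult.commute)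
    qed
    show "AE x in M. norm (w x * box_bump c d m x) \<le> \<bar>indicator (cbox c d) x * w x\<bar>" for m
    proof (rule AE_I2)
      fix x
      show "norm (w x * box_bump c d m x) \<le> \<bar>indicator (cbox c d) x * w x\<bar>"
      proof (cases "x \<in> box c d")
        case True
        then have "x \<in> cbox c d" using box_subset_cbox by blast
        then show ?thesis using box_bump_props(2,3)[of c d m x] by (simp add: abs_mult mult_left_le)
      qed (simp add: box_bump_props(4))
    qed
  qed
  moreover have "(LINT x|M. w x * box_bump c d m x) = 0" for m by (rule z[OF box_bump_props(1)[OF cd]])
  ultimately have "(LINT x|M. indicator (box c d) x * w x) = 0" by (simp add: LIMSEQ_const_iff)
  moreover have "(LINT x|M. indicator (box c d) x * w x) = (LINT x|lebesgue. indicator (box c d) x * w x)"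
  proof -
    have sub: "box c d \<subseteq> \<Omega>" using cd box_subset_cbox[of c d] by blast
    have "(\<lambda>x. indicator (box c d) x * w x) = (\<lambda>x. indicator \<Omega> x *\<^sub>R (indicator (box c d) x * w x))"
    proof
      fix x show "indicator (box c d) x * w x = indicator \<Omega> x *\<^sub>R (indicator (box c d) x * w x)"
        using sub by (cases "x \<in> box c d") (simp_all add: subset_iff)
    qed
    then show ?thesis using integral_restrict_space[of \<Omega> lebesgue "\<lambda>x. indicator (box c d) x * w x"] by simp
  qed
  ultimately show ?thesis by simp
qed

end

text \<open>
  Boxes generate the Borel sets and are stable under intersection, so the integral of \<open>v\<close> vanishes over every
  Borel set. The whole space is not a box; its integral enters in the step for complements.
\<close>

lemma AE_zero_if_box_integrals_zero:
  fixes v :: "'a::euclidean_space \<Rightarrow> real"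
  assumes v: "integrable lebesgue v" and z: "\<And>c d. (LINT x|lebesgue. indicator (box c d) x * v x) = 0"
    and tot: "integral\<^sup>L lebesgue v = 0"
  shows "AE x in lebesgue. v x = 0"
proof -
  obtain u where u: "u \<in> borel_measurable lborel" "AE x in lborel. v x = u x"
    using completion_ex_borel_measurable_real[of v lborel] v by auto
  have u2: "AE x in lebesgue. v x = u x" using u(2) by (simp add: AE_completion)
  have ul: "u \<in> borel_measurable lebesgue" using u(1) by (rule measurable_completion)
  have iu: "integrable lebesgue u" using integrable_cong_AE_imp[OF v ul] u2 by (simp add: eq_commute)
  have P: "(LINT x:A|lebesgue. u x) = 0" if A: "A \<in> sets borel" for A
  proof -
    have 1: "Int_stable (range (\<lambda>(a::'a, b). box a b))"
      by (auto simp: Int_stable_def box_Int_box)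
    have 2: "range (\<lambda>(a::'a, b). box a b) \<subseteq> Pow UNIV" by simp
    have B: "sigma_sets UNIV (range (\<lambda>(a::'a, b). box a b)) = sets borel"
      by (subst borel_eq_box) (simp add: sets_measure_of)
    then have 3: "A \<in> sigma_sets UNIV (range (\<lambda>(a::'a, b). box a b))" using A by simp
    from 1 2 3 show ?thesis
    proof (induction rule: sigma_sets_induct_disjoint)
      case (basic A)
      then obtain c d where A: "A = box c d" by auto
      have "(LINT x:A|lebesgue. u x) = (LINT x|lebesgue. indicator (box c d) x * v x)"
        unfolding set_lebesgue_integral_def A
        by (intro integral_cong_AE) (use u2 ul v in \<open>auto intro!: borel_measurable_times borel_measurable_indicator'\<close>)
      then show ?case by (simp add: z)
    next
      case empty show ?case by (simp add: set_lebesgue_integral_def)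
    next
      case (compl A)
      then have Ab: "A \<in> sets borel" using B by simp
      then have Al: "A \<in> sets lebesgue" by (intro sets_completionI_sets) simp
      have iA: "set_integrable lebesgue A u" unfolding set_integrable_def using Al iu by (intro integrable_mult_indicator)
      have "(LINT x:UNIV - A|lebesgue. u x) = (LINT x|lebesgue. u x - indicator A x *\<^sub>R u x)"
        unfolding set_lebesgue_integral_def by (intro Bochner_Integration.integral_cong) (auto simp: indicator_def)
      also have "\<dots> = integral\<^sup>L lebesgue u - (LINT x:A|lebesgue. u x)"
        using iA iu by (simp add: set_integrable_def set_lebesgue_integral_def)
      also have "integral\<^sup>L lebesgue u = integral\<^sup>L lebesgue v"
        by (intro integral_cong_AE) (use u2 ul v in auto)
      finally show ?case using compl tot by simp
    next
      case (union A)
      have Ab: "A i \<in> sets borel" for i using union(2) unfolding B by blast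
      then have Al: "A i \<in> sets lebesgue" for i by (intro sets_completionI_sets) simp
      have "(LINT x:(\<Union>i. A i)|lebesgue. u x) = (\<Sum>i. (LINT x:(A i)|lebesgue. u x))"
      proof (rule lebesgue_integral_countable_add)
        show "set_integrable lebesgue (\<Union>i. A i) u"
          unfolding set_integrable_def using Al iu by (intro integrable_mult_indicator) auto
      qed (use Al union(1) in \<open>auto simp: disjoint_family_on_def\<close>)
      then show ?case using union by simp
    qed
  qed
  have "AE x in lborel. u x = 0"
  proof -
    have iul: "integrable lborel u" using iu u(1) by (simp add: integrable_completion)
    have eq: "(LINT x:A|lborel. u x) = 0" if "A \<in> sets borel" for A
    proof -
      have "(\<lambda>x. indicator A x *\<^sub>R u x) \<in> borel_measurable lborel" using u(1) that by measurable
      then show ?thesis using P[OF that] by (simp add: set_lebesgue_integral_def integral_completion)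
    qed
    show ?thesis
      by (rule density_unique_real[of lborel u "\<lambda>_. 0", simplified])
         (use iul eq in \<open>auto simp: set_lebesgue_integral_def\<close>)
  qed
  then have "AE x in lebesgue. u x = 0" by (simp add: AE_completion)
  with u2 show ?thesis by eventually_elim simp
qed

section \<open>Weak gradients and the Sobolev space\<close>

lemma tendsto_zero_le:
  fixes X Y :: "nat \<Rightarrow> real"
  assumes "\<And>n. 0 \<le> X n" "\<And>n. X n \<le> Y n" "Y \<longlonglongrightarrow> 0" shows "X \<longlonglongrightarrow> 0"
  by (rule tendsto_sandwich[of "\<lambda>_. 0" X sequentially Y]) (use assms in auto)

context bounded_domain begin

text \<open>
  The fundamental lemma of the calculus of variations. On a closed box in the domain \<open>w\<close> is integrable, and since
  boxes intersect in boxes its integrals over all smaller boxes vanish. Countably many closed boxes cover the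
  domain.
\<close>

lemma locally_integrable_AE_zero:
  fixes w :: "'a \<Rightarrow> real"
  assumes w: "locally_integrable \<Omega> w" and z: "\<And>\<phi>. \<phi> \<in> test_functions \<Omega> \<Longrightarrow> (LINT x|M. w x * \<phi> x) = 0"
  shows "AE x in M. w x = 0"
proof -
  obtain \<D> where D: "countable \<D>" "\<D> \<subseteq> Pow \<Omega>" "\<And>X. X \<in> \<D> \<Longrightarrow> \<exists>a b. X = cbox a b" "\<Union>\<D> = \<Omega>"
    using open_countable_Union_open_cbox[OF open_domain] by blast
  have box: "AE x in lebesgue. x \<in> X \<longrightarrow> w x = 0" if X: "X \<in> \<D>" for X
  proof -
    obtain a b where ab: "X = cbox a b" using D(3)[OF X] by blast
    have sub: "cbox a b \<subseteq> \<Omega>" using D(2) X ab by blast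
    define v where "v = (\<lambda>x. indicator (box a b) x * w x)"
    have "integrable (lebesgue_on (cbox a b)) w" using w sub by (simp add: locally_integrable_def)
    then have "integrable lebesgue (\<lambda>x. indicator (cbox a b) x *\<^sub>R w x)" by (simp add: integrable_restrict_space)
    then have "integrable lebesgue (\<lambda>x. indicator (box a b) x *\<^sub>R (indicator (cbox a b) x *\<^sub>R w x))"
      by (rule integrable_mult_indicator[rotated]) simp
    moreover have "(\<lambda>x. indicator (box a b) x *\<^sub>R (indicator (cbox a b) x *\<^sub>R w x)) = v"
      using box_subset_cbox[of a b] by (auto simp: v_def indicator_def fun_eq_iff)
    ultimately have iv: "integrable lebesgue v" by simp
    have "AE x in lebesgue. v x = 0"
    proof (rule AE_zero_if_box_integrals_zero[OF iv])
      fix c d :: 'a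
      obtain c' d' where cd': "box c d \<inter> box a b = box c' d'" "cbox c d \<inter> cbox a b = cbox c' d'"
        unfolding box_Int_box Int_interval by blast
      have "(LINT x|lebesgue. indicator (box c' d') x * w x) = 0"
        by (rule box_integral_zero[OF w z]) (use cd'(2) sub in blast)+
      then show "(LINT x|lebesgue. indicator (box c d) x * v x) = 0"
        unfolding v_def cd'(1)[symmetric] indicator_inter_arith by (simp add: mult.assoc)
    next
      show "integral\<^sup>L lebesgue v = 0"
        unfolding v_def by (rule box_integral_zero[OF w z sub])
    qed
    moreover have "AE x in lebesgue. x \<notin> cbox a b - box a b"
      using negligible_frontier_interval[of a b] negligible_iff_null_sets by (intro AE_not_in) blast
    ultimately show ?thesis
      by eventually_elim (auto simp: v_def ab indicator_def split: if_splits)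
  qed
  have "AE x in lebesgue. \<forall>X\<in>\<D>. x \<in> X \<longrightarrow> w x = 0"
    by (subst AE_ball_countable[OF D(1)]) (use box in blast)
  then have "AE x in lebesgue. x \<in> \<Omega> \<longrightarrow> w x = 0"
    by eventually_elim (use D(4) in blast)
  then show ?thesis by (subst AE_restrict_space_iff) auto
qed

lemma locally_integrable_inner:
  fixes g :: "'a \<Rightarrow> 'a"
  shows "locally_integrable \<Omega> g \<Longrightarrow> locally_integrable \<Omega> (\<lambda>x. g x \<bullet> i)"
  by (simp add: locally_integrable_def)

lemma locally_integrable_diff:
  fixes g h :: "'a \<Rightarrow> 'b::euclidean_space"
  shows "locally_integrable \<Omega> g \<Longrightarrow> locally_integrable \<Omega> h \<Longrightarrow> locally_integrable \<Omega> (\<lambda>x. g x - h x)"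
  by (simp add: locally_integrable_def)

lemma test_mult_integrable:
  fixes w :: "'a \<Rightarrow> real"
  assumes "locally_integrable \<Omega> w" "\<phi> \<in> test_functions \<Omega>"
  shows "integrable M (\<lambda>x. w x * \<phi> x)" "integrable M (\<lambda>x. w x * (grad \<phi> x \<bullet> i))"
proof -
  obtain K where K: "compact K" "K \<subseteq> \<Omega>" "\<And>x. x \<notin> K \<Longrightarrow> \<phi> x = 0" "\<And>x. x \<notin> K \<Longrightarrow> grad \<phi> x = 0"
    using test_support[OF assms(2)] by blast
  show "integrable M (\<lambda>x. w x * \<phi> x)"
    by (rule locally_integrable_mult_test[OF assms(1) test_cont[OF assms(2)] K(1,2,3)])
  have c: "continuous_on UNIV (\<lambda>x. grad \<phi> x \<bullet> i)"
    using test_grad_cont[OF assms(2)] by (rule continuous_on_inner) (rule continuous_on_const)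
  show "integrable M (\<lambda>x. w x * (grad \<phi> x \<bullet> i))"
    by (rule locally_integrable_mult_test[OF assms(1) c K(1,2)]) (simp add: K(4))
qed

lemma weak_gradient_unique:
  assumes "has_weak_gradient \<Omega> u g" "has_weak_gradient \<Omega> u g'"
  shows "AE x in M. g x = g' x"
proof -
  have "AE x in M. (g x - g' x) \<bullet> i = 0" if i: "i \<in> Basis" for i
  proof (rule locally_integrable_AE_zero)
    have l: "locally_integrable \<Omega> g" "locally_integrable \<Omega> g'" using assms by (auto simp: has_weak_gradient_def)
    show "locally_integrable \<Omega> (\<lambda>x. (g x - g' x) \<bullet> i)"
      using l by (intro locally_integrable_inner locally_integrable_diff)
    fix \<phi> assume \<phi>: "\<phi> \<in> test_functions \<Omega>"
    have "(LINT x|M. (g x \<bullet> i) * \<phi> x) = (LINT x|M. (g' x \<bullet> i) * \<phi> x)"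
      using assms \<phi> i by (simp add: has_weak_gradient_def)
    moreover have "(LINT x|M. ((g x - g' x) \<bullet> i) * \<phi> x) = (LINT x|M. (g x \<bullet> i) * \<phi> x - (g' x \<bullet> i) * \<phi> x)"
      by (simp add: inner_diff_left left_diff_distrib)
    ultimately show "(LINT x|M. ((g x - g' x) \<bullet> i) * \<phi> x) = 0"
      using test_mult_integrable(1)[OF locally_integrable_inner[OF l(1)] \<phi>, of i]
        test_mult_integrable(1)[OF locally_integrable_inner[OF l(2)] \<phi>, of i] by simp
  qed
  then have "AE x in M. \<forall>i\<in>Basis. (g x - g' x) \<bullet> i = 0" by (intro AE_finite_allI) auto
  then show ?thesis
  proof eventually_elim
    case (elim x)
    show ?case by (rule euclidean_eqI) (use elim in \<open>simp add: inner_diff_left\<close>)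
  qed
qed

lemma weak_gradient_props:
  assumes "has_weak_gradient \<Omega> u g"
  shows "AE x in M. weak_gradient \<Omega> u x = g x" "weak_gradient \<Omega> u \<in> borel_measurable M"
proof -
  have h: "has_weak_gradient \<Omega> u (weak_gradient \<Omega> u)"
    unfolding weak_gradient_def by (rule someI[of "has_weak_gradient \<Omega> u", OF assms])
  show "AE x in M. weak_gradient \<Omega> u x = g x" by (rule weak_gradient_unique[OF h assms])
  show "weak_gradient \<Omega> u \<in> borel_measurable M"
    using h by (intro locally_integrable_measurable) (simp add: has_weak_gradient_def)
qed

lemma Lp_integrable:
  fixes u :: "'a \<Rightarrow> 'b::euclidean_space"
  assumes "p \<ge> 1" "u \<in> Lp M p" shows "integrable M u"
proof -
  have "u \<in> Lp M 1" by (rule Lp_lower_exponent(1)[OF finite_M _ assms]) simp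
  then have "integrable M (\<lambda>x. norm (u x))" "u \<in> borel_measurable M" by (simp_all add: Lp_def)
  then show ?thesis by (simp add: integrable_norm_iff)
qed

lemma Lp_locally_integrable:
  fixes u :: "'a \<Rightarrow> 'b::euclidean_space"
  assumes "p \<ge> 1" "u \<in> Lp M p" shows "locally_integrable \<Omega> u"
  unfolding locally_integrable_def
proof safe
  fix K assume K: "compact K" "K \<subseteq> \<Omega>"
  have Kl: "K \<in> sets lebesgue" using K(1) by (rule lmeasurable_compact[THEN fmeasurableD])
  have "integrable lebesgue (\<lambda>x. indicator \<Omega> x *\<^sub>R u x)"
    using Lp_integrable[OF assms] by (simp add: integrable_restrict_space)
  then have "integrable lebesgue (\<lambda>x. indicator K x *\<^sub>R (indicator \<Omega> x *\<^sub>R u x))"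
    by (rule integrable_mult_indicator[OF Kl])
  moreover have "(\<lambda>x. indicator K x *\<^sub>R (indicator \<Omega> x *\<^sub>R u x)) = (\<lambda>x. indicator K x *\<^sub>R u x)"
  proof
    fix x show "indicator K x *\<^sub>R (indicator \<Omega> x *\<^sub>R u x) = indicator K x *\<^sub>R u x"
      using K(2) by (cases "x \<in> K") (simp_all add: subset_iff)
  qed
  ultimately have "integrable lebesgue (\<lambda>x. indicator K x *\<^sub>R u x)" by simp
  then show "integrable (lebesgue_on K) u" using Kl by (simp add: integrable_restrict_space)
qed

text \<open>
  The derivatives of the test function \<open>\<phi> * \<psi>\<close> have integral \<open>0\<close>.
\<close>

lemma has_weak_gradient_test:
  assumes \<phi>: "\<phi> \<in> test_functions \<Omega>" shows "has_weak_gradient \<Omega> \<phi> (grad \<phi>)"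
  unfolding has_weak_gradient_def
proof (intro conjI ballI)
  show l: "locally_integrable \<Omega> \<phi>" "locally_integrable \<Omega> (grad \<phi>)"
    using test_in_Lp[OF \<phi>, of 1] by (auto intro: Lp_locally_integrable)
  fix \<psi> and i :: 'a assume \<psi>: "\<psi> \<in> test_functions \<Omega>" and i: "i \<in> Basis"
  have t: "(\<lambda>x. \<phi> x * \<psi> x) \<in> test_functions \<Omega>" by (rule test_mult(1)[OF \<phi> \<psi>])
  have g: "grad (\<lambda>x. \<phi> x * \<psi> x) x \<bullet> i = \<phi> x * (grad \<psi> x \<bullet> i) + (grad \<phi> x \<bullet> i) * \<psi> x" for x
    unfolding test_mult(2)[OF \<phi> \<psi>] by (simp add: inner_add_left)
  have "0 = (LINT x|lborel. grad (\<lambda>x. \<phi> x * \<psi> x) x \<bullet> i)" by (simp add: test_grad_integral_0[OF t])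
  also have "\<dots> = (LINT x|M. grad (\<lambda>x. \<phi> x * \<psi> x) x \<bullet> i)"
  proof (rule integral_domain_eq_lborel(1)[symmetric])
    show "(\<lambda>x. grad (\<lambda>x. \<phi> x * \<psi> x) x \<bullet> i) \<in> borel_measurable borel"
      by (intro borel_measurable_continuous_onI continuous_on_inner test_grad_cont[OF t] continuous_on_const)
  qed (simp add: test_zero_outside_domain[OF t])
  also have "\<dots> = (LINT x|M. \<phi> x * (grad \<psi> x \<bullet> i)) + (LINT x|M. (grad \<phi> x \<bullet> i) * \<psi> x)"
    unfolding g by (intro Bochner_Integration.integral_add test_mult_integrable l locally_integrable_inner \<psi>)
  finally show "(LINT x|M. \<phi> x * frechet_derivative \<psi> (at x) i) = - (LINT x|M. (grad \<phi> x \<bullet> i) * \<psi> x)"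
    using i by (simp add: grad_inner_Basis)
qed

lemma Lp_lim_integral:
  fixes v :: "nat \<Rightarrow> 'a \<Rightarrow> real"
  assumes p: "p \<ge> 1" and v: "\<And>n. v n \<in> Lp M p" "v0 \<in> Lp M p"
    and lim: "(\<lambda>n. Lp_mod M p (\<lambda>x. v0 x - v n x)) \<longlonglongrightarrow> 0"
    and b: "b \<in> borel_measurable M" "\<And>x. \<bar>b x\<bar> \<le> B"
  shows "(\<lambda>n. LINT x|M. v n x * b x) \<longlonglongrightarrow> (LINT x|M. v0 x * b x)"
proof -
  have d: "(\<lambda>x. v0 x - v n x) \<in> Lp M p" for n using p v by (intro Lp_diff) auto
  have "(\<lambda>n. Lp_mod M 1 (\<lambda>x. v0 x - v n x)) \<longlonglongrightarrow> 0"
    by (rule Lp_mod_lower_exponent_tendsto[OF finite_M _ p d lim]) simp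
  then have "(\<lambda>n. \<bar>B\<bar> * Lp_mod M 1 (\<lambda>x. v0 x - v n x)) \<longlonglongrightarrow> 0" by (rule tendsto_mult_right_zero)
  then have l: "(\<lambda>n. (LINT x|M. v n x * b x) - (LINT x|M. v0 x * b x)) \<longlonglongrightarrow> 0"
  proof (rule Lim_null_comparison[rotated], intro always_eventually allI)
    fix n
    have i: "integrable M (\<lambda>x. w x * b x)" if "w \<in> Lp M p" for w :: "'a \<Rightarrow> real"
    proof (rule Bochner_Integration.integrable_bound)
      show "integrable M (\<lambda>x. \<bar>B\<bar> * w x)" using Lp_integrable[OF p that] by simp
      show "(\<lambda>x. w x * b x) \<in> borel_measurable M" using that b(1) by (auto simp: Lp_def)
      show "AE x in M. norm (w x * b x) \<le> norm (\<bar>B\<bar> * w x)"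
      proof (rule AE_I2)
        fix x
        show "norm (w x * b x) \<le> norm (\<bar>B\<bar> * w x)"
          using mult_left_mono[OF order_trans[OF b(2) abs_ge_self[of B]], of "\<bar>w x\<bar>" x] by (simp add: abs_mult mult.commute)
      qed
    qed
    have "(LINT x|M. v n x * b x) - (LINT x|M. v0 x * b x) = (LINT x|M. v n x * b x - v0 x * b x)"
      using i v by simp
    also have "norm \<dots> \<le> (LINT x|M. norm (v n x * b x - v0 x * b x))"
      by (rule integral_norm_bound)
    also have "\<dots> \<le> (LINT x|M. \<bar>B\<bar> * \<bar>v0 x - v n x\<bar>)"
    proof (rule integral_mono)
      show "integrable M (\<lambda>x. norm (v n x * b x - v0 x * b x))" using i v by auto
      show "integrable M (\<lambda>x. \<bar>B\<bar> * \<bar>v0 x - v n x\<bar>)" using Lp_integrable[OF p d] by auto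
      fix x
      have "norm (v n x * b x - v0 x * b x) = \<bar>v0 x - v n x\<bar> * \<bar>b x\<bar>"
        by (simp add: left_diff_distrib[symmetric] abs_mult abs_minus_commute)
      also have "\<dots> \<le> \<bar>v0 x - v n x\<bar> * \<bar>B\<bar>"
        by (intro mult_left_mono order_trans[OF b(2) abs_ge_self]) auto
      finally show "norm (v n x * b x - v0 x * b x) \<le> \<bar>B\<bar> * \<bar>v0 x - v n x\<bar>" by (simp add: mult.commute)
    qed
    finally show "norm ((LINT x|M. v n x * b x) - (LINT x|M. v0 x * b x)) \<le> \<bar>B\<bar> * Lp_mod M 1 (\<lambda>x. v0 x - v n x)"
      by (simp add: Lp_mod_def)
  qed
  show ?thesis using tendsto_add[OF l tendsto_const[of "LINT x|M. v0 x * b x"]] by simp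
qed

text \<open>
  Membership of \<open>u\<close> in \<open>W\<^sub>0\<^sup>1\<^sup>,\<^sup>p(\<Omega>)\<close> with gradient \<open>g\<close>, as the closure of the pairs \<open>(\<phi>, \<nabla>\<phi>)\<close> in
  \<open>L\<^sup>p \<times> L\<^sup>p\<close>. With the gradient as a separate argument, sums, multiples and limits need no choice of
  representatives.
\<close>

definition W0 :: "real \<Rightarrow> ('a \<Rightarrow> real) \<Rightarrow> ('a \<Rightarrow> 'a) \<Rightarrow> bool" where
  "W0 p u g \<longleftrightarrow> u \<in> Lp M p \<and> g \<in> Lp M p \<and>
    (\<exists>\<phi>. (\<forall>n::nat. \<phi> n \<in> test_functions \<Omega>) \<and> (\<lambda>n. Lp_mod M p (\<lambda>x. u x - \<phi> n x)) \<longlonglongrightarrow> 0 \<and>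
      (\<lambda>n. Lp_mod M p (\<lambda>x. g x - grad (\<phi> n) x)) \<longlonglongrightarrow> 0)"

text \<open>
  For a fixed test function \<open>\<psi>\<close>, both sides of the integration by parts formula are continuous in \<open>L\<^sup>p\<close>, because
  \<open>\<psi>\<close> and its gradient are bounded.
\<close>

lemma W0_weak:
  assumes p: "p \<ge> 1" and W: "W0 p u g" shows "has_weak_gradient \<Omega> u g"
  unfolding has_weak_gradient_def
proof (intro conjI ballI)
  have L: "u \<in> Lp M p" "g \<in> Lp M p" using W by (auto simp: W0_def)
  show "locally_integrable \<Omega> u" "locally_integrable \<Omega> g" using L by (auto intro: Lp_locally_integrable[OF p])
  obtain \<phi> where \<phi>: "\<And>n::nat. \<phi> n \<in> test_functions \<Omega>" "(\<lambda>n. Lp_mod M p (\<lambda>x. u x - \<phi> n x)) \<longlonglongrightarrow> 0"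
      "(\<lambda>n. Lp_mod M p (\<lambda>x. g x - grad (\<phi> n) x)) \<longlonglongrightarrow> 0" using W unfolding W0_def by blast
  fix \<psi> and i :: 'a assume \<psi>: "\<psi> \<in> test_functions \<Omega>" and i: "i \<in> Basis"
  obtain B where B: "\<And>x. \<bar>\<psi> x\<bar> \<le> B" "\<And>x. norm (grad \<psi> x) \<le> B" using test_bound[OF \<psi>] by blast
  have gb: "\<bar>grad \<psi> x \<bullet> i\<bar> \<le> B" for x
    using Cauchy_Schwarz_ineq2[of "grad \<psi> x" i] B(2)[of x] i by simp
  have p0: "p \<ge> 0" using p by simp
  have 1: "(\<lambda>n. LINT x|M. \<phi> n x * (grad \<psi> x \<bullet> i)) \<longlonglongrightarrow> (LINT x|M. u x * (grad \<psi> x \<bullet> i))"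
    by (rule Lp_lim_integral[OF p test_in_Lp(1)[OF \<phi>(1) p0] L(1) \<phi>(2) _ gb])
       (intro continuous_measurable_M continuous_on_inner test_grad_cont[OF \<psi>] continuous_on_const)
  have ci: "(\<lambda>x. h x \<bullet> i) \<in> Lp M p" if "h \<in> Lp M p" for h
    by (rule Lp_bound[OF _ LpD(2)[OF that]])
       (use that i p0 Basis_le_norm[OF i] in \<open>auto simp: Lp_def intro!: powr_mono2\<close>)
  have "Lp_mod M p (\<lambda>x. g x \<bullet> i - grad (\<phi> n) x \<bullet> i) \<le> Lp_mod M p (\<lambda>x. g x - grad (\<phi> n) x)" for n
  proof -
    have d: "(\<lambda>x. g x - grad (\<phi> n) x) \<in> Lp M p" using L test_in_Lp(2)[OF \<phi>(1) p0] p0 by (intro Lp_diff)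
    show ?thesis unfolding Lp_mod_def inner_diff_left[symmetric]
      using d ci[OF d] p0 Basis_le_norm[OF i] by (intro integral_mono powr_mono2) (auto simp: Lp_def)
  qed
  then have "(\<lambda>n. Lp_mod M p (\<lambda>x. g x \<bullet> i - grad (\<phi> n) x \<bullet> i)) \<longlonglongrightarrow> 0"
    by (intro tendsto_zero_le[OF _ _ \<phi>(3)]) auto
  then have 2: "(\<lambda>n. LINT x|M. (grad (\<phi> n) x \<bullet> i) * \<psi> x) \<longlonglongrightarrow> (LINT x|M. (g x \<bullet> i) * \<psi> x)"
    using B(1) by (intro Lp_lim_integral[OF p ci[OF test_in_Lp(2)[OF \<phi>(1) p0]] ci[OF L(2)]]
      continuous_measurable_M test_cont[OF \<psi>])
  have "(LINT x|M. \<phi> n x * (grad \<psi> x \<bullet> i)) = - (LINT x|M. (grad (\<phi> n) x \<bullet> i) * \<psi> x)" for n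
    using has_weak_gradient_test[OF \<phi>(1)] \<psi> i by (simp add: has_weak_gradient_def grad_inner_Basis)
  then have "(LINT x|M. u x * (grad \<psi> x \<bullet> i)) = - (LINT x|M. (g x \<bullet> i) * \<psi> x)"
    using LIMSEQ_unique[OF 1] tendsto_minus[OF 2] by simp
  then show "(LINT x|M. u x * frechet_derivative \<psi> (at x) i) = - (LINT x|M. (g x \<bullet> i) * \<psi> x)"
    using i by (simp add: grad_inner_Basis)
qed

lemma W0_D: "W0 p u g \<Longrightarrow> u \<in> Lp M p" "W0 p u g \<Longrightarrow> g \<in> Lp M p"
  by (auto simp: W0_def)

lemma W0_cong:
  assumes W: "W0 p u g" and g': "g' \<in> borel_measurable M" "AE x in M. g x = g' x"
  shows "W0 p u g'"
proof -
  obtain \<phi> where \<phi>: "\<And>n::nat. \<phi> n \<in> test_functions \<Omega>" "(\<lambda>n. Lp_mod M p (\<lambda>x. u x - \<phi> n x)) \<longlonglongrightarrow> 0"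
      "(\<lambda>n. Lp_mod M p (\<lambda>x. g x - grad (\<phi> n) x)) \<longlonglongrightarrow> 0" using W unfolding W0_def by blast
  have [measurable]: "grad (\<phi> n) \<in> borel_measurable M" for n by (intro continuous_measurable_M test_grad_cont[OF \<phi>(1)])
  have [measurable]: "g \<in> borel_measurable M" using W by (auto simp: W0_def Lp_def)
  note g'(1) [measurable]
  have "Lp_mod M p (\<lambda>x. g x - grad (\<phi> n) x) = Lp_mod M p (\<lambda>x. g' x - grad (\<phi> n) x)" for n
    unfolding Lp_mod_def by (rule integral_cong_AE) (use g'(2) in auto)
  then have "(\<lambda>n. Lp_mod M p (\<lambda>x. g' x - grad (\<phi> n) x)) \<longlonglongrightarrow> 0" using \<phi>(3) by simp
  moreover have "g' \<in> Lp M p" using W by (intro Lp_cong_AE(1)[OF _ g']) (simp add: W0_def)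
  ultimately show ?thesis using W \<phi>(1,2) unfolding W0_def by blast
qed

lemma W0_weak_gradient:
  assumes p: "p \<ge> 1" and W: "W0 p u g"
  shows "W0 p u (weak_gradient \<Omega> u)" "AE x in M. weak_gradient \<Omega> u x = g x"
    "W1p_norm \<Omega> p u = (Lp_mod M p u + Lp_mod M p g) powr (1 / p)"
proof -
  note w = weak_gradient_props[OF W0_weak[OF p W]]
  show e: "AE x in M. weak_gradient \<Omega> u x = g x" by (rule w(1))
  have e': "AE x in M. g x = weak_gradient \<Omega> u x" using e by eventually_elim simp
  show "W0 p u (weak_gradient \<Omega> u)" by (rule W0_cong[OF W w(2) e'])
  have "Lp_mod M p (weak_gradient \<Omega> u) = Lp_mod M p g"
    using W by (intro Lp_cong_AE(2)[OF _ w(2) e']) (simp add: W0_def)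
  then show "W1p_norm \<Omega> p u = (Lp_mod M p u + Lp_mod M p g) powr (1 / p)"
    by (simp add: W1p_norm_def Lp_mod_def)
qed

lemma W0_add:
  assumes p: "p \<ge> 0" and W: "W0 p u g" "W0 p v h" shows "W0 p (\<lambda>x. u x + c * v x) (\<lambda>x. g x + c *\<^sub>R h x)"
proof -
  obtain \<phi> where \<phi>: "\<And>n::nat. \<phi> n \<in> test_functions \<Omega>" "(\<lambda>n. Lp_mod M p (\<lambda>x. u x - \<phi> n x)) \<longlonglongrightarrow> 0"
      "(\<lambda>n. Lp_mod M p (\<lambda>x. g x - grad (\<phi> n) x)) \<longlonglongrightarrow> 0" using W(1) unfolding W0_def by blast
  obtain \<psi> where \<psi>: "\<And>n::nat. \<psi> n \<in> test_functions \<Omega>" "(\<lambda>n. Lp_mod M p (\<lambda>x. v x - \<psi> n x)) \<longlonglongrightarrow> 0"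
      "(\<lambda>n. Lp_mod M p (\<lambda>x. h x - grad (\<psi> n) x)) \<longlonglongrightarrow> 0" using W(2) unfolding W0_def by blast
  have L: "u \<in> Lp M p" "g \<in> Lp M p" "v \<in> Lp M p" "h \<in> Lp M p" using W by (auto simp: W0_def)
  have key: "(\<lambda>n. Lp_mod M p (\<lambda>x. (a x + c *\<^sub>R b x) - (an n x + c *\<^sub>R bn n x))) \<longlonglongrightarrow> 0"
    if "a \<in> Lp M p" "b \<in> Lp M p" "\<And>n. an n \<in> Lp M p" "\<And>n. bn n \<in> Lp M p"
      "(\<lambda>n. Lp_mod M p (\<lambda>x. a x - an n x)) \<longlonglongrightarrow> 0" "(\<lambda>n. Lp_mod M p (\<lambda>x. b x - bn n x)) \<longlonglongrightarrow> 0"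
    for a b :: "'a \<Rightarrow> 'b::euclidean_space" and an bn :: "nat \<Rightarrow> 'a \<Rightarrow> 'b"
  proof -
    have d: "(\<lambda>x. a x - an n x) \<in> Lp M p" "(\<lambda>x. b x - bn n x) \<in> Lp M p" for n
      using that p by (auto intro: Lp_diff)
    have le: "Lp_mod M p (\<lambda>x. (a x + c *\<^sub>R b x) - (an n x + c *\<^sub>R bn n x)) \<le>
        2 powr p * (Lp_mod M p (\<lambda>x. a x - an n x) + \<bar>c\<bar> powr p * Lp_mod M p (\<lambda>x. b x - bn n x))" for n
      using Lp_add(2)[OF p d(1)[of n] Lp_scale(1)[OF d(2)[of n], of c]]
      unfolding Lp_scale(2)[OF d(2)[of n]] by (simp add: algebra_simps)
    have lim: "(\<lambda>n. 2 powr p * (Lp_mod M p (\<lambda>x. a x - an n x) + \<bar>c\<bar> powr p * Lp_mod M p (\<lambda>x. b x - bn n x))) \<longlonglongrightarrow> 2 powr p * (0 + \<bar>c\<bar> powr p * 0)"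
      by (intro tendsto_intros that)
    show ?thesis by (rule tendsto_zero_le[OF Lp_mod_nonneg le]) (use lim in simp)
  qed
  have t: "(\<lambda>x. \<phi> n x + c * \<psi> n x) \<in> test_functions \<Omega>" for n by (rule test_add(1)[OF \<phi>(1) test_scale(1)[OF \<psi>(1)]])
  have gt: "grad (\<lambda>x. \<phi> n x + c * \<psi> n x) x = grad (\<phi> n) x + c *\<^sub>R grad (\<psi> n) x" for n x
    using test_add(2)[OF \<phi>(1)[of n] test_scale(1)[OF \<psi>(1)[of n]]] test_scale(2)[OF \<psi>(1)[of n]] by simp
  have 1: "(\<lambda>n. Lp_mod M p (\<lambda>x. u x + c * v x - (\<phi> n x + c * \<psi> n x))) \<longlonglongrightarrow> 0"
    using key[of u v \<phi> \<psi>] L \<phi> \<psi> test_in_Lp(1)[OF _ p] by simp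
  have 2: "(\<lambda>n. Lp_mod M p (\<lambda>x. g x + c *\<^sub>R h x - grad (\<lambda>x. \<phi> n x + c * \<psi> n x) x)) \<longlonglongrightarrow> 0"
    unfolding gt using key[of g h "\<lambda>n. grad (\<phi> n)" "\<lambda>n. grad (\<psi> n)"] L \<phi> \<psi> test_in_Lp(2)[OF _ p] by simp
  have 3: "(\<lambda>x. u x + c * v x) \<in> Lp M p" "(\<lambda>x. g x + c *\<^sub>R h x) \<in> Lp M p"
    using Lp_add(1)[OF p L(1) Lp_scale(1)[OF L(3), of c]] Lp_add(1)[OF p L(2) Lp_scale(1)[OF L(4), of c]] by simp_all
  show ?thesis unfolding W0_def using t 1 2 3 by (intro conjI exI[of _ "\<lambda>n x. \<phi> n x + c * \<psi> n x"]) auto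
qed

lemma W0_test:
  assumes "p \<ge> 0" "\<phi> \<in> test_functions \<Omega>" shows "W0 p \<phi> (grad \<phi>)"
  unfolding W0_def using test_in_Lp[OF assms(2,1)] assms
  by (intro conjI exI[of _ "\<lambda>n. \<phi>"]) (auto simp: Lp_mod_def)

lemma W0_zero: "p \<ge> 0 \<Longrightarrow> W0 p (\<lambda>x. 0) (\<lambda>x. 0)"
proof -
  assume p: "p \<ge> 0"
  have "grad (\<lambda>x::'a. 0::real) = (\<lambda>x. 0)" by (rule ext) (rule grad_eqI, simp)
  then show ?thesis using W0_test[OF p test_zero] by simp
qed

lemma W0_scale: "p \<ge> 0 \<Longrightarrow> W0 p u g \<Longrightarrow> W0 p (\<lambda>x. c * u x) (\<lambda>x. c *\<^sub>R g x)"
  using W0_add[OF _ W0_zero, of p u g c] by simp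

text \<open>
  A diagonal choice of test functions, the \<open>n\<close>-th within \<open>1 / (n + 1)\<close> of the \<open>n\<close>-th pair.
\<close>

lemma W0_closed:
  assumes p: "p \<ge> 0" and W: "\<And>n::nat. W0 p (un n) (gn n)" and L: "u \<in> Lp M p" "g \<in> Lp M p"
    and lim: "(\<lambda>n. Lp_mod M p (\<lambda>x. u x - un n x)) \<longlonglongrightarrow> 0" "(\<lambda>n. Lp_mod M p (\<lambda>x. g x - gn n x)) \<longlonglongrightarrow> 0"
  shows "W0 p u g"
proof -
  have "\<exists>\<phi>\<in>test_functions \<Omega>. Lp_mod M p (\<lambda>x. un n x - \<phi> x) < inverse (real (Suc n)) \<and>
      Lp_mod M p (\<lambda>x. gn n x - grad \<phi> x) < inverse (real (Suc n))" for n
  proof -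
    obtain \<phi> where \<phi>: "\<And>m::nat. \<phi> m \<in> test_functions \<Omega>" "(\<lambda>m. Lp_mod M p (\<lambda>x. un n x - \<phi> m x)) \<longlonglongrightarrow> 0"
      "(\<lambda>m. Lp_mod M p (\<lambda>x. gn n x - grad (\<phi> m) x)) \<longlonglongrightarrow> 0" using W[of n] unfolding W0_def by blast
    have pos: "0 < inverse (real (Suc n))" by simp
    have "\<forall>\<^sub>F m in sequentially. Lp_mod M p (\<lambda>x. un n x - \<phi> m x) < inverse (real (Suc n)) \<and>
        Lp_mod M p (\<lambda>x. gn n x - grad (\<phi> m) x) < inverse (real (Suc n))"
      by (intro eventually_conj order_tendstoD(2)[OF \<phi>(2) pos] order_tendstoD(2)[OF \<phi>(3) pos])
    then obtain m where "Lp_mod M p (\<lambda>x. un n x - \<phi> m x) < inverse (real (Suc n)) \<and>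
        Lp_mod M p (\<lambda>x. gn n x - grad (\<phi> m) x) < inverse (real (Suc n))"
      using eventually_happens' sequentially_bot by blast
    then show ?thesis using \<phi>(1) by blast
  qed
  then obtain \<phi> where \<phi>: "\<And>n. \<phi> n \<in> test_functions \<Omega>"
      "\<And>n. Lp_mod M p (\<lambda>x. un n x - \<phi> n x) < inverse (real (Suc n))"
      "\<And>n. Lp_mod M p (\<lambda>x. gn n x - grad (\<phi> n) x) < inverse (real (Suc n))" by metis
  have key: "(\<lambda>n. Lp_mod M p (\<lambda>x. a x - bn n x)) \<longlonglongrightarrow> 0"
    if "a \<in> Lp M p" "\<And>n. an n \<in> Lp M p" "\<And>n. bn n \<in> Lp M p"
      "(\<lambda>n. Lp_mod M p (\<lambda>x. a x - an n x)) \<longlonglongrightarrow> 0" "\<And>n. Lp_mod M p (\<lambda>x. an n x - bn n x) < inverse (real (Suc n))"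
    for a :: "'a \<Rightarrow> 'b::euclidean_space" and an bn :: "nat \<Rightarrow> 'a \<Rightarrow> 'b"
  proof -
    have le: "Lp_mod M p (\<lambda>x. a x - bn n x) \<le> 2 powr p * (Lp_mod M p (\<lambda>x. a x - an n x) + inverse (real (Suc n)))" for n
      using Lp_mod_diff_triangle[OF p that(1) that(2)[of n] that(3)[of n]] that(5)[of n]
      by (smt (verit) mult_left_mono powr_ge_zero)
    have lim: "(\<lambda>n. 2 powr p * (Lp_mod M p (\<lambda>x. a x - an n x) + inverse (real (Suc n)))) \<longlonglongrightarrow> 2 powr p * (0 + 0)"
      by (intro tendsto_intros that(4) LIMSEQ_inverse_real_of_nat)
    show ?thesis by (rule tendsto_zero_le[OF Lp_mod_nonneg le]) (use lim in simp)
  qed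
  have Ln: "un n \<in> Lp M p" "gn n \<in> Lp M p" for n using W[of n] by (auto simp: W0_def)
  have "(\<lambda>n. Lp_mod M p (\<lambda>x. u x - \<phi> n x)) \<longlonglongrightarrow> 0"
    by (rule key[OF L(1) Ln(1) test_in_Lp(1)[OF \<phi>(1) p] lim(1) \<phi>(2)])
  moreover have "(\<lambda>n. Lp_mod M p (\<lambda>x. g x - grad (\<phi> n) x)) \<longlonglongrightarrow> 0"
    by (rule key[OF L(2) Ln(2) test_in_Lp(2)[OF \<phi>(1) p] lim(2) \<phi>(3)])
  ultimately show ?thesis unfolding W0_def using L \<phi>(1) by blast
qed

text \<open>
  The norm in the definition of \<open>W01p\<close> refers to the chosen weak gradient of a difference, which agrees almost
  everywhere with the difference of the gradients.
\<close>

lemma W01p_iff: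
  assumes p: "p \<ge> 1" shows "u \<in> W01p \<Omega> p \<longleftrightarrow> (\<exists>g. W0 p u g)"
proof
  assume "u \<in> W01p \<Omega> p"
  then obtain g \<phi> where u: "u \<in> Lp M p" and g: "g \<in> Lp M p" "has_weak_gradient \<Omega> u g"
    and \<phi>: "\<And>n::nat. \<phi> n \<in> test_functions \<Omega>" "(\<lambda>n. W1p_norm \<Omega> p (\<lambda>x. u x - \<phi> n x)) \<longlonglongrightarrow> 0"
    unfolding W01p_def W1p_def by (auto simp: Lp_space_def Lp_def)
  have p0: "p \<ge> 0" "p > 0" using p by auto
  have w: "has_weak_gradient \<Omega> (\<lambda>x. u x - \<phi> n x) (\<lambda>x. g x - grad (\<phi> n) x)" for n
  proof -
    note t = has_weak_gradient_test[OF \<phi>(1)[of n]]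
    have l: "locally_integrable \<Omega> u" "locally_integrable \<Omega> g" "locally_integrable \<Omega> (\<phi> n)" "locally_integrable \<Omega> (grad (\<phi> n))"
      using t g(2) by (auto simp: has_weak_gradient_def)
    show ?thesis unfolding has_weak_gradient_def
    proof (intro conjI ballI locally_integrable_diff l)
      fix \<psi> and i :: 'a assume \<psi>: "\<psi> \<in> test_functions \<Omega>" and i: "i \<in> Basis"
      have "(LINT x|M. (u x - \<phi> n x) * (grad \<psi> x \<bullet> i)) = (LINT x|M. u x * (grad \<psi> x \<bullet> i)) - (LINT x|M. \<phi> n x * (grad \<psi> x \<bullet> i))"
        unfolding left_diff_distrib by (intro Bochner_Integration.integral_diff test_mult_integrable l \<psi>)
      also have "\<dots> = - (LINT x|M. (g x \<bullet> i) * \<psi> x) + (LINT x|M. (grad (\<phi> n) x \<bullet> i) * \<psi> x)"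
        using g(2) t \<psi> i by (simp add: has_weak_gradient_def grad_inner_Basis)
      also have "\<dots> = - ((LINT x|M. (g x \<bullet> i) * \<psi> x) - (LINT x|M. (grad (\<phi> n) x \<bullet> i) * \<psi> x))" by simp
      also have "\<dots> = - (LINT x|M. ((g x - grad (\<phi> n) x) \<bullet> i) * \<psi> x)"
        unfolding inner_diff_left left_diff_distrib
        by (subst Bochner_Integration.integral_diff) (intro test_mult_integrable locally_integrable_inner l \<psi> refl)+
      finally show "(LINT x|M. (u x - \<phi> n x) * frechet_derivative \<psi> (at x) i) = - (LINT x|M. ((g x - grad (\<phi> n) x) \<bullet> i) * \<psi> x)"
        using i by (simp add: grad_inner_Basis)
    qed
  qed
  have N: "W1p_norm \<Omega> p (\<lambda>x. u x - \<phi> n x) powr p = Lp_mod M p (\<lambda>x. u x - \<phi> n x) + Lp_mod M p (\<lambda>x. g x - grad (\<phi> n) x)" for n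
  proof -
    note wp = weak_gradient_props[OF w[of n]]
    have "Lp_mod M p (weak_gradient \<Omega> (\<lambda>x. u x - \<phi> n x)) = Lp_mod M p (\<lambda>x. g x - grad (\<phi> n) x)"
    proof (rule Lp_cong_AE(2)[OF _ wp(2)])
      show "(\<lambda>x. g x - grad (\<phi> n) x) \<in> Lp M p" using g(1) test_in_Lp(2)[OF \<phi>(1) p0(1)] p0 by (intro Lp_diff)
      show "AE x in M. g x - grad (\<phi> n) x = weak_gradient \<Omega> (\<lambda>x. u x - \<phi> n x) x"
        using wp(1) by eventually_elim simp
    qed
    then have "W1p_norm \<Omega> p (\<lambda>x. u x - \<phi> n x) = (Lp_mod M p (\<lambda>x. u x - \<phi> n x) + Lp_mod M p (\<lambda>x. g x - grad (\<phi> n) x)) powr (1 / p)"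
      by (simp add: W1p_norm_def Lp_mod_def)
    then show ?thesis using p0 by (simp add: powr_powr)
  qed
  have "(\<lambda>n. W1p_norm \<Omega> p (\<lambda>x. u x - \<phi> n x) powr p) \<longlonglongrightarrow> 0 powr p"
    using \<phi>(2) p0 by (intro tendsto_powr' tendsto_const) (auto simp: W1p_norm_def)
  then have lim: "(\<lambda>n. Lp_mod M p (\<lambda>x. u x - \<phi> n x) + Lp_mod M p (\<lambda>x. g x - grad (\<phi> n) x)) \<longlonglongrightarrow> 0"
    unfolding N by simp
  have "(\<lambda>n. Lp_mod M p (\<lambda>x. u x - \<phi> n x)) \<longlonglongrightarrow> 0" "(\<lambda>n. Lp_mod M p (\<lambda>x. g x - grad (\<phi> n) x)) \<longlonglongrightarrow> 0"
    by (rule tendsto_sandwich[OF _ _ tendsto_const lim]; simp)+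
  then show "\<exists>g. W0 p u g" unfolding W0_def using u g(1) \<phi>(1) by blast
next
  assume "\<exists>g. W0 p u g"
  then obtain g where W: "W0 p u g" by blast
  then obtain \<phi> where \<phi>: "\<And>n::nat. \<phi> n \<in> test_functions \<Omega>" "(\<lambda>n. Lp_mod M p (\<lambda>x. u x - \<phi> n x)) \<longlonglongrightarrow> 0"
      "(\<lambda>n. Lp_mod M p (\<lambda>x. g x - grad (\<phi> n) x)) \<longlonglongrightarrow> 0" unfolding W0_def by blast
  have p0: "p \<ge> 0" "p > 0" using p by auto
  have "W0 p (\<lambda>x. u x - \<phi> n x) (\<lambda>x. g x - grad (\<phi> n) x)" for n
    using W0_add[OF p0(1) W W0_test[OF p0(1) \<phi>(1)[of n]], of "-1"] by simp
  from W0_weak_gradient(3)[OF p this]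
  have "W1p_norm \<Omega> p (\<lambda>x. u x - \<phi> n x) = (Lp_mod M p (\<lambda>x. u x - \<phi> n x) + Lp_mod M p (\<lambda>x. g x - grad (\<phi> n) x)) powr (1 / p)" for n .
  moreover have "(\<lambda>n. (Lp_mod M p (\<lambda>x. u x - \<phi> n x) + Lp_mod M p (\<lambda>x. g x - grad (\<phi> n) x)) powr (1 / p)) \<longlonglongrightarrow> (0 + 0) powr (1 / p)"
    using p0 by (intro tendsto_powr' tendsto_add \<phi> tendsto_const) auto
  ultimately have "(\<lambda>n. W1p_norm \<Omega> p (\<lambda>x. u x - \<phi> n x)) \<longlonglongrightarrow> 0" by simp
  moreover have "u \<in> W1p \<Omega> p"
    unfolding W1p_def using W W0_weak[OF p W] by (auto simp: W0_def Lp_space_def Lp_def)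
  ultimately show "u \<in> W01p \<Omega> p" unfolding W01p_def using \<phi>(1) by blast
qed

end

section \<open>Averages over balls\<close>

lemma nn_integral_dilate:
  fixes f :: "'a::euclidean_space \<Rightarrow> ennreal"
  assumes [measurable]: "f \<in> borel_measurable borel" and t: "t \<noteq> 0"
  shows "(\<integral>\<^sup>+z. f z \<partial>lborel) = ennreal (\<bar>t\<bar> ^ DIM('a)) * (\<integral>\<^sup>+h. f (x + t *\<^sub>R h) \<partial>lborel)"
  by (subst lborel_affine[OF t, of x]) (simp add: nn_integral_density nn_integral_distr nn_integral_cmult)

lemma nn_integral_translate:
  fixes f :: "'a::euclidean_space \<Rightarrow> ennreal"
  assumes [measurable]: "f \<in> borel_measurable borel"
  shows "(\<integral>\<^sup>+z. f (z + c) \<partial>lborel) = (\<integral>\<^sup>+z. f z \<partial>lborel)"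
proof -
  have "(\<integral>\<^sup>+z. f z \<partial>lborel) = (\<integral>\<^sup>+z. f z \<partial>distr lborel borel ((+) c))" by (simp add: lborel_distr_plus)
  then show ?thesis by (simp add: nn_integral_distr add.commute)
qed

text \<open>
  The mean of \<open>\<phi>\<close> over the ball of radius \<open>e\<close> around \<open>x + e c\<close>. The offset \<open>c\<close> makes it possible to
  place the ball outside of the support of \<open>\<phi>\<close>.
\<close>

definition ball_avg :: "'a::euclidean_space \<Rightarrow> ('a \<Rightarrow> real) \<Rightarrow> real \<Rightarrow> 'a \<Rightarrow> real" where
  "ball_avg c \<phi> e x = (LINT h|lborel. indicator (cball c 1) h * \<phi> (x + e *\<^sub>R h)) / measure lborel (cball c 1)"

lemma test_measurable_borel:
  assumes "\<phi> \<in> test_functions \<Omega>" shows "\<phi> \<in> borel_measurable borel" "grad \<phi> \<in> borel_measurable borel"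
  using test_cont[OF assms] test_grad_cont[OF assms] by (auto intro: borel_measurable_continuous_onI)

lemma indicator_cball_integrable:
  fixes g :: "'a::euclidean_space \<Rightarrow> real"
  assumes "continuous_on UNIV g" shows "integrable lborel (\<lambda>h. indicator (cball c r) h * g h)"
  using borel_integrable_compact[OF compact_cball continuous_on_subset[OF assms], of c r] by simp

text \<open>
  The fundamental theorem of calculus on a segment, with a nonnegative integral so that Tonelli's theorem applies
  to it without integrability conditions.
\<close>

lemma test_line_nn_bound:
  assumes \<phi>: "\<phi> \<in> test_functions \<Omega>" and e: "e \<ge> 0"
  shows "ennreal \<bar>\<phi> (x + e *\<^sub>R h) - \<phi> x\<bar> \<le> (\<integral>\<^sup>+t. ennreal (indicator {0..e} t * (norm h * norm (grad \<phi> (x + t *\<^sub>R h)))) \<partial>lborel)"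
proof -
  have cg: "continuous_on {0..e} (\<lambda>t. grad \<phi> (x + t *\<^sub>R h))"
    by (rule continuous_on_compose2[OF test_grad_cont[OF \<phi>]]) (auto intro!: continuous_intros)
  have "integral\<^sup>L lborel (\<lambda>t. indicator {0..e} t *\<^sub>R (grad \<phi> (x + t *\<^sub>R h) \<bullet> h)) = \<phi> (x + e *\<^sub>R h) - \<phi> (x + 0 *\<^sub>R h)"
  proof (rule integral_FTC_atLeastAtMost[OF e])
    show "((\<lambda>t. \<phi> (x + t *\<^sub>R h)) has_vector_derivative grad \<phi> (x + t *\<^sub>R h) \<bullet> h) (at t within {0..e})" for t
      using test_line_deriv[OF \<phi>, of x h t]
      by (simp add: has_real_derivative_iff_has_vector_derivative has_vector_derivative_at_within)
    show "continuous_on {0..e} (\<lambda>t. grad \<phi> (x + t *\<^sub>R h) \<bullet> h)" using cg by (intro continuous_intros)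
  qed
  then have "\<bar>\<phi> (x + e *\<^sub>R h) - \<phi> x\<bar> = norm (integral\<^sup>L lborel (\<lambda>t. indicator {0..e} t *\<^sub>R (grad \<phi> (x + t *\<^sub>R h) \<bullet> h)))" by simp
  also have "\<dots> \<le> (LINT t|lborel. norm (indicator {0..e} t *\<^sub>R (grad \<phi> (x + t *\<^sub>R h) \<bullet> h)))" by (rule integral_norm_bound)
  also have "\<dots> \<le> (LINT t|lborel. indicator {0..e} t *\<^sub>R (norm h * norm (grad \<phi> (x + t *\<^sub>R h))))"
  proof (rule integral_mono)
    have "integrable lborel (\<lambda>t. indicator {0..e} t *\<^sub>R (grad \<phi> (x + t *\<^sub>R h) \<bullet> h))"
      by (rule borel_integrable_compact) (use cg in \<open>auto intro: continuous_intros\<close>)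
    then show "integrable lborel (\<lambda>t. norm (indicator {0..e} t *\<^sub>R (grad \<phi> (x + t *\<^sub>R h) \<bullet> h)))" by (rule integrable_norm)
    show "integrable lborel (\<lambda>t. indicator {0..e} t *\<^sub>R (norm h * norm (grad \<phi> (x + t *\<^sub>R h))))"
      by (rule borel_integrable_compact) (use cg in \<open>auto intro: continuous_intros\<close>)
    show "norm (indicator {0..e} t *\<^sub>R (grad \<phi> (x + t *\<^sub>R h) \<bullet> h)) \<le> indicator {0..e} t *\<^sub>R (norm h * norm (grad \<phi> (x + t *\<^sub>R h)))" for t
      using Cauchy_Schwarz_ineq2[of "grad \<phi> (x + t *\<^sub>R h)" h] by (auto simp: indicator_def mult.commute)
  qed
  finally have "ennreal \<bar>\<phi> (x + e *\<^sub>R h) - \<phi> x\<bar> \<le> ennreal (LINT t|lborel. indicator {0..e} t *\<^sub>R (norm h * norm (grad \<phi> (x + t *\<^sub>R h))))"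
    by (rule ennreal_leI)
  also have "\<dots> = (\<integral>\<^sup>+t. ennreal (indicator {0..e} t *\<^sub>R (norm h * norm (grad \<phi> (x + t *\<^sub>R h)))) \<partial>lborel)"
    by (rule nn_integral_eq_integral[symmetric], rule borel_integrable_compact) (use cg in \<open>auto intro: continuous_intros\<close>)
  finally show ?thesis by simp
qed

text \<open>
  Let \<open>N\<close> be the dimension, \<open>E\<close> the integral of \<open>|\<nabla>\<phi>|\<^sup>p\<close> and \<open>P(x,t)\<close> the integral of
  \<open>|\<nabla>\<phi>(x + th)|\<^sup>p\<close> over \<open>h\<close> in the ball \<open>B\<close>. There are two ways to bound it: \<open>P(x,t) \<le> t\<^sup>-\<^sup>N E\<close> by
  the substitution \<open>z = x + th\<close>, and \<open>\<integral> P(x,t) dx = V E\<close> by translation invariance. The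
  deviation at \<open>x\<close> is at most a multiple of the integral of \<open>P(x,t) powr (1/p)\<close> over \<open>0 < t < e\<close>. The first bound is
  applied to the power \<open>1/p - 1/\<alpha>\<close> of \<open>P\<close>, which leaves \<open>t powr - \<theta>\<close> times \<open>P(x,t) powr (1/\<alpha>)\<close>. The
  weight is integrable near \<open>0\<close> exactly because \<open>\<theta> < 1\<close>, that is, because \<open>\<alpha>\<close> is subcritical. Hoelder's inequality in \<open>t\<close>
  with this weight and then the second bound give the assertion.
\<close>

lemma ball_avg_deviation:
  fixes c :: "'a::euclidean_space"
  assumes \<phi>: "\<phi> \<in> test_functions \<Omega>" and p: "1 < p" "p \<le> \<alpha>" and e: "0 < e"
    and th: "\<theta> = DIM('a) * (1 / p - 1 / \<alpha>)" "\<theta> < 1"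
  defines "V \<equiv> measure lborel (cball c 1)"
  defines "E \<equiv> Lp_mod lborel p (grad \<phi>)"
  defines "I \<equiv> e powr (1 - \<theta>) / (1 - \<theta>)"
  shows "(\<integral>\<^sup>+x. ennreal (\<bar>\<phi> x - ball_avg c \<phi> e x\<bar> powr \<alpha>) \<partial>lborel) \<le>
    ennreal (((norm c + 1) / V * V powr (1 - 1 / p)) powr \<alpha> * V * I powr \<alpha> * E powr (\<alpha> / p))"
proof -
  note [measurable] = test_measurable_borel[OF \<phi>]
  define B where "B = cball c 1"
  have B [measurable]: "B \<in> sets borel" by (simp add: B_def)
  have V: "V > 0" unfolding V_def by (simp add: content_ball_pos content_cball_pos)
  have VB: "(\<integral>\<^sup>+h. indicator B h \<partial>lborel) = ennreal V"
    using emeasure_bounded_finite[of B] by (simp add: V_def B_def emeasure_eq_ennreal_measure)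
  define R where "R = norm c + 1"
  have R: "R > 0" using norm_ge_zero[of c] unfolding R_def by linarith
  have hR: "norm h \<le> R" if "h \<in> B" for h
    using that norm_triangle_ineq2[of h c] by (simp add: B_def R_def dist_norm norm_minus_commute)
  obtain b where b: "b > 0" "\<And>x. norm (grad \<phi> x) \<le> b" using test_bound[OF \<phi>] by blast
  have \<alpha>: "\<alpha> > 1" using p by simp
  have \<theta>0: "\<theta> \<ge> 0" unfolding th(1) using p by (auto simp: field_simps)
  define W where "W x = norm (grad \<phi> x) powr p" for x
  have [measurable]: "W \<in> borel_measurable borel" unfolding W_def by measurable
  have W0: "W x \<ge> 0" for x by (simp add: W_def)
  have Wb: "W x \<le> b powr p" for x unfolding W_def using b p by (intro powr_mono2) auto
  have iW: "integrable lborel W"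
  proof -
    obtain K where K: "compact K" "\<And>x. x \<notin> K \<Longrightarrow> grad \<phi> x = 0" using test_support[OF \<phi>] by blast
    have "integrable lborel (\<lambda>x. indicator K x *\<^sub>R W x)"
      unfolding W_def using p by (intro borel_integrable_compact[OF K(1)] continuous_on_powr' continuous_on_norm
        continuous_on_subset[OF test_grad_cont[OF \<phi>]] continuous_on_const) auto
    moreover have "(\<lambda>x. indicator K x *\<^sub>R W x) = W"
    proof
      fix x show "indicator K x *\<^sub>R W x = W x" by (cases "x \<in> K") (auto simp: W_def K(2))
    qed
    ultimately show ?thesis by simp
  qed
  have E0: "E \<ge> 0" by (simp add: E_def)
  have EW: "(\<integral>\<^sup>+x. ennreal (W x) \<partial>lborel) = ennreal E"
    using nn_integral_eq_integral[OF iW] W0 by (simp add: E_def Lp_mod_def W_def[abs_def])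
  define P' where "P' x t = (\<integral>\<^sup>+h. ennreal (indicator B h * W (x + t *\<^sub>R h)) \<partial>lborel)" for x t
  define P where "P x t = enn2real (P' x t)" for x t
  have P'_le: "P' x t \<le> ennreal (b powr p * V)" for x t
  proof -
    have "P' x t \<le> (\<integral>\<^sup>+h. ennreal (b powr p) * indicator B h \<partial>lborel)"
      unfolding P'_def using Wb W0 by (intro nn_integral_mono) (auto simp: indicator_def intro!: ennreal_leI)
    also have "\<dots> = ennreal (b powr p * V)" by (subst nn_integral_cmult) (auto simp: VB ennreal_mult' V less_imp_le)
    finally show ?thesis .
  qed
  have P'P: "P' x t = ennreal (P x t)" for x t
    unfolding P_def using le_less_trans[OF P'_le ennreal_less_top, of x t] by simp
  have P0: "P x t \<ge> 0" for x t by (simp add: P_def)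
  have Pb: "P x t \<le> b powr p * V" for x t
    using P'_le[of x t] V by (simp add: P'P)
  have [measurable]: "(\<lambda>(x, t). P' x t) \<in> borel_measurable (borel \<Otimes>\<^sub>M borel)"
  proof -
    have "(\<lambda>z. \<integral>\<^sup>+h. ennreal (indicator B h * W (fst z + snd z *\<^sub>R h)) \<partial>lborel) \<in> borel_measurable (borel \<Otimes>\<^sub>M borel)"
      by measurable
    then show ?thesis by (simp add: P'_def case_prod_beta')
  qed
  have Pm [measurable]: "(\<lambda>(x, t). P x t) \<in> borel_measurable (borel \<Otimes>\<^sub>M borel)"
    unfolding P_def case_prod_beta' by measurable
  have Pa: "P x t \<le> t powr (- DIM('a)) * E" if t: "t > 0" for x t
  proof -
    have "ennreal (t ^ DIM('a)) * P' x t \<le> ennreal (t ^ DIM('a)) * (\<integral>\<^sup>+h. ennreal (W (x + t *\<^sub>R h)) \<partial>lborel)"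
      unfolding P'_def using W0 by (intro mult_left_mono nn_integral_mono) (auto simp: indicator_def)
    also have "\<dots> = (\<integral>\<^sup>+z. ennreal (W z) \<partial>lborel)"
      using t by (subst nn_integral_dilate[of "\<lambda>z. ennreal (W z)" t x]) auto
    finally have "t ^ DIM('a) * P x t \<le> E"
      using t E0 P0 by (simp add: EW P'P ennreal_mult'[symmetric])
    then show ?thesis using t by (simp add: powr_minus powr_realpow field_simps)
  qed
  have Pint: "(\<integral>\<^sup>+x. ennreal (P x t) \<partial>lborel) = ennreal (V * E)" for t
  proof -
    have "(\<integral>\<^sup>+x. ennreal (P x t) \<partial>lborel) = (\<integral>\<^sup>+x. \<integral>\<^sup>+h. ennreal (indicator B h * W (x + t *\<^sub>R h)) \<partial>lborel \<partial>lborel)"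
      by (simp add: P'P[symmetric] P'_def)
    also have "\<dots> = (\<integral>\<^sup>+h. \<integral>\<^sup>+x. ennreal (indicator B h * W (x + t *\<^sub>R h)) \<partial>lborel \<partial>lborel)"
      by (rule lborel_pair.Fubini'[symmetric]) measurable
    also have "\<dots> = (\<integral>\<^sup>+h. indicator B h * (\<integral>\<^sup>+x. ennreal (W (x + t *\<^sub>R h)) \<partial>lborel) \<partial>lborel)"
      by (intro nn_integral_cong) (auto simp: indicator_def)
    also have "\<dots> = (\<integral>\<^sup>+h. indicator B h * ennreal E \<partial>lborel)"
      using nn_integral_translate[of "\<lambda>x. ennreal (W x)"] by (simp add: EW)
    also have "\<dots> = ennreal (V * E)"
      by (subst nn_integral_multc) (use V E0 in \<open>auto simp: VB ennreal_mult'\<close>)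
    finally show ?thesis .
  qed
  \<comment> \<open>Hoelder's inequality in the averaging variable turns the mean of the gradient into \<open>P\<close>.\<close>
  define J where "J x t = (LINT h|lborel. indicator B h * norm (grad \<phi> (x + t *\<^sub>R h)))" for x t
  have cgh: "continuous_on UNIV (\<lambda>h. grad \<phi> (x + t *\<^sub>R h))" for x t
    by (rule continuous_on_compose2[OF test_grad_cont[OF \<phi>]]) (auto intro!: continuous_intros)
  have iJ: "integrable lborel (\<lambda>h. indicator B h * norm (grad \<phi> (x + t *\<^sub>R h)))" for x t
    unfolding B_def by (intro indicator_cball_integrable continuous_on_norm cgh)
  have J: "J x t \<le> P x t powr (1 / p) * V powr (1 - 1 / p)" for x t
  proof -
    define p' where "p' = p / (p - 1)"
    have p': "p' > 1" "1 / p + 1 / p' = 1" "1 / p' = 1 - 1 / p" using p by (auto simp: p'_def field_simps)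
    have ip: "integrable lborel (\<lambda>h. indicator B h * W (x + t *\<^sub>R h))"
      unfolding B_def W_def using p
      by (intro indicator_cball_integrable continuous_on_powr' continuous_on_norm cgh continuous_on_const) auto
    have e1: "norm (indicator B h *\<^sub>R grad \<phi> (x + t *\<^sub>R h)) powr p = indicator B h * W (x + t *\<^sub>R h)" for h
      using p by (auto simp: indicator_def W_def)
    have u: "(\<lambda>h. indicator B h *\<^sub>R grad \<phi> (x + t *\<^sub>R h)) \<in> Lp lborel p"
      unfolding Lp_def mem_Collect_eq e1 by (intro conjI ip) measurable
    have iB: "integrable lborel (indicator B :: 'a \<Rightarrow> real)"
      using indicator_cball_integrable[of "\<lambda>_. 1" c 1] by (simp add: B_def)
    have e2: "norm (indicator B h :: real) powr p' = indicator B h" for h by (auto simp: indicator_def)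
    have v: "(indicator B :: 'a \<Rightarrow> real) \<in> Lp lborel p'"
      unfolding Lp_def mem_Collect_eq e2 by (intro conjI iB) measurable
    have H: "(LINT h|lborel. norm (indicator B h *\<^sub>R grad \<phi> (x + t *\<^sub>R h)) * norm (indicator B h :: real)) \<le>
        Lp_mod lborel p (\<lambda>h. indicator B h *\<^sub>R grad \<phi> (x + t *\<^sub>R h)) powr (1 / p) * Lp_mod lborel p' (indicator B :: 'a \<Rightarrow> real) powr (1 / p')"
      by (rule Holder_modular(2)[OF p(1) p'(1,2) u v])
    have e3: "norm (indicator B h *\<^sub>R grad \<phi> (x + t *\<^sub>R h)) * norm (indicator B h :: real) = indicator B h * norm (grad \<phi> (x + t *\<^sub>R h))" for h
      by (auto simp: indicator_def)
    have e4: "Lp_mod lborel p (\<lambda>h. indicator B h *\<^sub>R grad \<phi> (x + t *\<^sub>R h)) = P x t"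
      unfolding Lp_mod_def e1 P_def P'_def using nn_integral_eq_integral[OF ip] W0 by simp
    have e5: "Lp_mod lborel p' (indicator B :: 'a \<Rightarrow> real) = V"
      unfolding Lp_mod_def e2 by (simp add: V_def B_def)
    from H[unfolded e3 e4 e5 p'(3)] show ?thesis by (simp only: J_def)
  qed
  \<comment> \<open>The weight \<open>w\<close> has finite mass \<open>I\<close>; Hoelder's inequality in the scale is applied with respect to it.\<close>
  have I0: "I > 0" using e th(2) by (simp add: I_def)
  define w where "w t = indicator {0..e} t * t powr (- \<theta>)" for t :: real
  have [measurable]: "w \<in> borel_measurable borel" unfolding w_def by measurable
  have w0: "w t \<ge> 0" for t by (simp add: w_def)
  have wI: "(\<integral>\<^sup>+t. ennreal (w t) \<partial>lborel) = ennreal I"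
  proof -
    have "((\<lambda>t. t powr (- \<theta>)) has_integral I) {0..e}"
      using has_integral_powr_from_0[of "- \<theta>" e] th(2) e by (simp add: I_def add.commute)
    from nn_integral_has_integral_lebesgue[OF _ this] show ?thesis by (simp add: w_def)
  qed
  have iw: "integrable lborel w" using w0 wI by (intro integrableI_nonneg) auto
  define Q where "Q x = (LINT t|lborel. w t * P x t)" for x
  have iQ: "integrable lborel (\<lambda>t. w t * P x t)" for x
    by (rule Bochner_Integration.integrable_bound[OF integrable_mult_right[OF iw, of "b powr p * V"]])
       (use P0 Pb w0 V in \<open>auto simp: abs_mult mult.commute[of _ "w _"] intro!: AE_I2 mult_left_mono\<close>)
  define K where "K = V powr (1 - 1 / p) * E powr (1 / p - 1 / \<alpha>)"
  have K0: "K \<ge> 0" by (simp add: K_def)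
  have Jw: "indicator {0..e} t * J x t \<le> K * (w t * P x t powr (1 / \<alpha>))" if "t \<noteq> 0" for x t
  proof (cases "t \<in> {0..e}")
    case True
    with that have t: "t > 0" by auto
    have "P x t powr (1 / p - 1 / \<alpha>) \<le> (t powr (- DIM('a)) * E) powr (1 / p - 1 / \<alpha>)"
      using Pa[OF t, of x] P0[of x t] p by (intro powr_mono2) (auto simp: field_simps)
    also have "\<dots> = t powr (- \<theta>) * E powr (1 / p - 1 / \<alpha>)"
      using E0 by (simp add: powr_mult powr_powr th(1))
    finally have 1: "P x t powr (1 / p - 1 / \<alpha>) \<le> t powr (- \<theta>) * E powr (1 / p - 1 / \<alpha>)" .
    have "P x t powr (1 / p) = P x t powr (1 / p - 1 / \<alpha>) * P x t powr (1 / \<alpha>)"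
      by (simp add: powr_add[symmetric])
    also have "\<dots> \<le> (t powr (- \<theta>) * E powr (1 / p - 1 / \<alpha>)) * P x t powr (1 / \<alpha>)"
      by (rule mult_right_mono[OF 1]) simp
    finally have "P x t powr (1 / p) * V powr (1 - 1 / p) \<le> (t powr (- \<theta>) * E powr (1 / p - 1 / \<alpha>)) * P x t powr (1 / \<alpha>) * V powr (1 - 1 / p)"
      by (rule mult_right_mono) simp
    with J[of x t] True show ?thesis by (simp add: K_def w_def mult_ac)
  qed (use K0 w0 in \<open>simp add: w_def\<close>)
  have Hw: "(\<integral>\<^sup>+t. ennreal (w t * P x t powr (1 / \<alpha>)) \<partial>lborel) \<le> ennreal (Q x powr (1 / \<alpha>) * I powr (1 - 1 / \<alpha>))" for x
  proof -
    define a' where "a' = \<alpha> / (\<alpha> - 1)"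
    have a': "a' > 1" "1 / \<alpha> + 1 / a' = 1" "1 / a' = 1 - 1 / \<alpha>" using \<alpha> by (auto simp: a'_def field_simps)
    define u where "u t = (w t * P x t) powr (1 / \<alpha>)" for t
    define v where "v t = w t powr (1 / a')" for t
    have [measurable]: "u \<in> borel_measurable borel" "v \<in> borel_measurable borel" unfolding u_def v_def by measurable
    have e1: "norm (u t) powr \<alpha> = w t * P x t" for t using \<alpha> w0 P0 by (simp add: u_def powr_powr)
    have e2: "norm (v t) powr a' = w t" for t using a'(1) w0 by (simp add: v_def powr_powr)
    have u: "u \<in> Lp lborel \<alpha>" unfolding Lp_def mem_Collect_eq e1 by (intro conjI iQ) measurable
    have v: "v \<in> Lp lborel a'" unfolding Lp_def mem_Collect_eq e2 by (intro conjI iw) measurable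
    note H = Holder_modular[OF \<alpha> a'(1,2) u v]
    have uv: "norm (u t) * norm (v t) = w t * P x t powr (1 / \<alpha>)" for t
    proof -
      have "norm (u t) * norm (v t) = P x t powr (1 / \<alpha>) * (w t powr (1 / \<alpha>) * w t powr (1 / a'))"
        using w0 P0 by (simp add: u_def v_def powr_mult)
      also have "w t powr (1 / \<alpha>) * w t powr (1 / a') = w t" using w0 a'(2) by (simp add: powr_add[symmetric])
      finally show ?thesis by simp
    qed
    have "(\<integral>\<^sup>+t. ennreal (w t * P x t powr (1 / \<alpha>)) \<partial>lborel) = ennreal (LINT t|lborel. w t * P x t powr (1 / \<alpha>))"
      using H(1)[unfolded uv] w0 by (intro nn_integral_eq_integral) auto
    also have "\<dots> \<le> ennreal (Lp_mod lborel \<alpha> u powr (1 / \<alpha>) * Lp_mod lborel a' v powr (1 / a'))"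
      using H(2) unfolding uv by (rule ennreal_leI)
    also have "Lp_mod lborel \<alpha> u = Q x" by (simp only: Lp_mod_def e1 Q_def)
    also have "Lp_mod lborel a' v = I"
      unfolding Lp_mod_def e2 using nn_integral_eq_integral[OF iw] w0 wI I0 by simp
    finally show ?thesis by (simp add: a'(3))
  qed
  define D where "D x = \<bar>\<phi> x - ball_avg c \<phi> e x\<bar>" for x
  have ch: "continuous_on UNIV (\<lambda>h. \<phi> (x + e *\<^sub>R h))" for x
    by (rule continuous_on_compose2[OF test_cont[OF \<phi>]]) (auto intro!: continuous_intros)
  have DV: "V * D x \<le> (LINT h|lborel. indicator B h * \<bar>\<phi> (x + e *\<^sub>R h) - \<phi> x\<bar>)" for x
  proof -
    have i1: "integrable lborel (\<lambda>h. indicator B h * \<phi> (x + e *\<^sub>R h))" "integrable lborel (\<lambda>h. indicator B h * \<phi> x)"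
      unfolding B_def by (intro indicator_cball_integrable ch continuous_on_const)+
    have "(LINT h|lborel. indicator B h * (\<phi> (x + e *\<^sub>R h) - \<phi> x)) =
        (LINT h|lborel. indicator B h * \<phi> (x + e *\<^sub>R h)) - (LINT h|lborel. indicator B h * \<phi> x)"
      unfolding right_diff_distrib by (rule Bochner_Integration.integral_diff[OF i1])
    also have "(LINT h|lborel. indicator B h * \<phi> x) = V * \<phi> x" by (simp add: V_def B_def)
    also have "(LINT h|lborel. indicator B h * \<phi> (x + e *\<^sub>R h)) = V * ball_avg c \<phi> e x"
      using V by (simp add: ball_avg_def B_def V_def)
    finally have "V * D x = norm (LINT h|lborel. indicator B h * (\<phi> (x + e *\<^sub>R h) - \<phi> x))"
      using V by (simp add: D_def right_diff_distrib[symmetric] abs_mult abs_minus_commute)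
    also have "\<dots> \<le> (LINT h|lborel. norm (indicator B h * (\<phi> (x + e *\<^sub>R h) - \<phi> x)))" by (rule integral_norm_bound)
    finally show ?thesis by (simp add: abs_mult)
  qed
  have Dmain: "V * D x \<le> R * K * (Q x powr (1 / \<alpha>) * I powr (1 - 1 / \<alpha>))" for x
  proof -
    have i1: "integrable lborel (\<lambda>h. indicator B h * \<bar>\<phi> (x + e *\<^sub>R h) - \<phi> x\<bar>)"
      unfolding B_def by (intro indicator_cball_integrable continuous_intros ch)
    have "ennreal (V * D x) \<le> (\<integral>\<^sup>+h. ennreal (indicator B h * \<bar>\<phi> (x + e *\<^sub>R h) - \<phi> x\<bar>) \<partial>lborel)"
      using nn_integral_eq_integral[OF i1] DV[of x] by (simp add: ennreal_leI)
    also have "\<dots> \<le> (\<integral>\<^sup>+h. \<integral>\<^sup>+t. ennreal (indicator B h * (indicator {0..e} t * (R * norm (grad \<phi> (x + t *\<^sub>R h))))) \<partial>lborel \<partial>lborel)"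
    proof (rule nn_integral_mono)
      fix h :: 'a
      show "ennreal (indicator B h * \<bar>\<phi> (x + e *\<^sub>R h) - \<phi> x\<bar>) \<le>
        (\<integral>\<^sup>+t. ennreal (indicator B h * (indicator {0..e} t * (R * norm (grad \<phi> (x + t *\<^sub>R h))))) \<partial>lborel)"
      proof (cases "h \<in> B")
        case True
        have "ennreal \<bar>\<phi> (x + e *\<^sub>R h) - \<phi> x\<bar> \<le> (\<integral>\<^sup>+t. ennreal (indicator {0..e} t * (norm h * norm (grad \<phi> (x + t *\<^sub>R h)))) \<partial>lborel)"
          using e by (intro test_line_nn_bound[OF \<phi>]) simp
        also have "\<dots> \<le> (\<integral>\<^sup>+t. ennreal (indicator {0..e} t * (R * norm (grad \<phi> (x + t *\<^sub>R h)))) \<partial>lborel)"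
          using hR[OF True] by (intro nn_integral_mono ennreal_leI mult_left_mono mult_right_mono) auto
        finally show ?thesis using True by simp
      qed simp
    qed
    also have "\<dots> = (\<integral>\<^sup>+t. \<integral>\<^sup>+h. ennreal (indicator B h * (indicator {0..e} t * (R * norm (grad \<phi> (x + t *\<^sub>R h))))) \<partial>lborel \<partial>lborel)"
      by (rule lborel_pair.Fubini') measurable
    also have "\<dots> = (\<integral>\<^sup>+t. ennreal (R * (indicator {0..e} t * J x t)) \<partial>lborel)"
    proof (rule nn_integral_cong)
      fix t :: real
      have "(\<integral>\<^sup>+h. ennreal (indicator B h * (indicator {0..e} t * (R * norm (grad \<phi> (x + t *\<^sub>R h))))) \<partial>lborel) =
          (\<integral>\<^sup>+h. ennreal ((R * indicator {0..e} t) * (indicator B h * norm (grad \<phi> (x + t *\<^sub>R h)))) \<partial>lborel)"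
        by (simp add: mult_ac)
      also have "\<dots> = ennreal (LINT h|lborel. (R * indicator {0..e} t) * (indicator B h * norm (grad \<phi> (x + t *\<^sub>R h))))"
        by (rule nn_integral_eq_integral) (use iJ[of x t] R in auto)
      finally show "(\<integral>\<^sup>+h. ennreal (indicator B h * (indicator {0..e} t * (R * norm (grad \<phi> (x + t *\<^sub>R h))))) \<partial>lborel) = ennreal (R * (indicator {0..e} t * J x t))"
        by (simp add: J_def mult.assoc)
    qed
    also have "\<dots> \<le> (\<integral>\<^sup>+t. ennreal (R * K) * ennreal (w t * P x t powr (1 / \<alpha>)) \<partial>lborel)"
    proof (rule nn_integral_mono_AE)
      show "AE t in lborel. ennreal (R * (indicator {0..e} t * J x t)) \<le> ennreal (R * K) * ennreal (w t * P x t powr (1 / \<alpha>))"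
        using AE_lborel_singleton[of "0::real"]
      proof eventually_elim
        case (elim t)
        show ?case
          using mult_left_mono[OF Jw[OF elim, of x], of R] R K0 w0
          by (subst ennreal_mult'[symmetric]) (auto intro!: ennreal_leI simp: mult.assoc)
      qed
    qed
    also have "\<dots> = ennreal (R * K) * (\<integral>\<^sup>+t. ennreal (w t * P x t powr (1 / \<alpha>)) \<partial>lborel)"
      by (rule nn_integral_cmult) measurable
    also have "\<dots> \<le> ennreal (R * K) * ennreal (Q x powr (1 / \<alpha>) * I powr (1 - 1 / \<alpha>))"
      by (intro mult_left_mono Hw) simp
    also have "\<dots> = ennreal (R * K * (Q x powr (1 / \<alpha>) * I powr (1 - 1 / \<alpha>)))"
      using R K0 by (subst ennreal_mult'[symmetric]) auto
    finally show ?thesis using R K0 by simp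
  qed
  have Q0: "Q x \<ge> 0" for x unfolding Q_def using w0 P0 by (intro Bochner_Integration.integral_nonneg) auto
  have D\<alpha>: "D x powr \<alpha> \<le> (R * K / V) powr \<alpha> * I powr (\<alpha> - 1) * Q x" for x
  proof -
    have "D x \<le> (R * K / V) * (Q x powr (1 / \<alpha>) * I powr (1 - 1 / \<alpha>))"
      using Dmain[of x] V by (simp add: field_simps)
    then have "D x powr \<alpha> \<le> ((R * K / V) * (Q x powr (1 / \<alpha>) * I powr (1 - 1 / \<alpha>))) powr \<alpha>"
      using \<alpha> by (intro powr_mono2) (auto simp: D_def)
    also have "\<dots> = (R * K / V) powr \<alpha> * (Q x * I powr (\<alpha> - 1))"
      unfolding powr_mult powr_powr using Q0[of x] \<alpha> by (simp add: left_diff_distrib)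
    finally show ?thesis by (simp add: mult_ac)
  qed
  have Qint: "(\<integral>\<^sup>+x. ennreal (Q x) \<partial>lborel) = ennreal (I * (V * E))"
  proof -
    have "(\<integral>\<^sup>+x. ennreal (Q x) \<partial>lborel) = (\<integral>\<^sup>+x. \<integral>\<^sup>+t. ennreal (w t * P x t) \<partial>lborel \<partial>lborel)"
      unfolding Q_def using w0 P0 by (intro nn_integral_cong nn_integral_eq_integral[symmetric] iQ) auto
    also have "\<dots> = (\<integral>\<^sup>+t. \<integral>\<^sup>+x. ennreal (w t * P x t) \<partial>lborel \<partial>lborel)"
      by (rule lborel_pair.Fubini'[symmetric]) measurable
    also have "\<dots> = (\<integral>\<^sup>+t. ennreal (w t) * ennreal (V * E) \<partial>lborel)"
      using w0 by (simp add: ennreal_mult' nn_integral_cmult Pint)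
    also have "\<dots> = ennreal (I * (V * E))"
      using I0 by (subst nn_integral_multc) (auto simp: wI ennreal_mult')
    finally show ?thesis .
  qed
  have "(\<integral>\<^sup>+x. ennreal (D x powr \<alpha>) \<partial>lborel) \<le> (\<integral>\<^sup>+x. ennreal ((R * K / V) powr \<alpha> * I powr (\<alpha> - 1)) * ennreal (Q x) \<partial>lborel)"
    using D\<alpha> Q0 by (intro nn_integral_mono) (auto simp: ennreal_mult'[symmetric] intro!: ennreal_leI)
  also have "\<dots> = ennreal ((R * K / V) powr \<alpha> * I powr (\<alpha> - 1)) * ennreal (I * (V * E))"
    unfolding Qint[symmetric] by (rule nn_integral_cmult) (simp add: Q_def)
  also have "\<dots> = ennreal ((R * K / V) powr \<alpha> * I powr (\<alpha> - 1) * (I * (V * E)))"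
    by (subst ennreal_mult'[symmetric]) auto
  also have "(R * K / V) powr \<alpha> * I powr (\<alpha> - 1) * (I * (V * E)) =
      (R / V * V powr (1 - 1 / p)) powr \<alpha> * V * I powr \<alpha> * E powr (\<alpha> / p)"
  proof (cases "E = 0")
    case False
    then have E: "E > 0" using E0 by simp
    have "(R * K / V) powr \<alpha> = (R / V * V powr (1 - 1 / p)) powr \<alpha> * E powr (\<alpha> / p - 1)"
    proof -
      have "R * K / V = (R / V * V powr (1 - 1 / p)) * E powr (1 / p - 1 / \<alpha>)" by (simp add: K_def)
      moreover have "(E powr (1 / p - 1 / \<alpha>)) powr \<alpha> = E powr (\<alpha> / p - 1)"
        using \<alpha> by (simp add: powr_powr left_diff_distrib)
      ultimately show ?thesis using R V by (simp only: powr_mult)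
    qed
    note 1 = this
    have 2: "E powr (\<alpha> / p - 1) * E = E powr (\<alpha> / p)" using E by (simp add: powr_diff)
    have 3: "I powr (\<alpha> - 1) * I = I powr \<alpha>" using I0 by (simp add: powr_diff)
    have "(R * K / V) powr \<alpha> * I powr (\<alpha> - 1) * (I * (V * E)) =
      (R / V * V powr (1 - 1 / p)) powr \<alpha> * V * (I powr (\<alpha> - 1) * I) * (E powr (\<alpha> / p - 1) * E)"
      unfolding 1 by (simp only: mult_ac)
    then show ?thesis unfolding 2 3 .
  qed (use p \<alpha> in simp)
  finally show ?thesis by (simp add: D_def R_def)
qed

section \<open>Sobolev inequality and compactness for test functions\<close>

lemma Lp_mod_tendsto:
  fixes u :: "'x \<Rightarrow> 'b::euclidean_space"
  assumes M: "finite_measure M" and p: "p > 0" and u: "u \<in> Lp M p" and un: "\<And>n. un n \<in> Lp M p"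
    and lim: "(\<lambda>n. Lp_mod M p (\<lambda>x. un n x - u x)) \<longlonglongrightarrow> 0"
  shows "(\<lambda>n. Lp_mod M p (un n)) \<longlonglongrightarrow> Lp_mod M p u"
proof -
  have "(\<lambda>n. Lp_mod M 1 (\<lambda>x. norm (un n x) powr p - norm (u x) powr p)) \<longlonglongrightarrow> 0"
  proof (rule Nemytskii_continuous[OF M p _ _ _ u un lim, where C = 1])
    show "continuous_on UNIV (\<lambda>x::'b. norm x powr p)" using p by (intro continuous_intros continuous_on_powr') auto
  qed auto
  moreover have "\<bar>Lp_mod M p (un n) - Lp_mod M p u\<bar> \<le> Lp_mod M 1 (\<lambda>x. norm (un n x) powr p - norm (u x) powr p)" for n
  proof -
    have "Lp_mod M p (un n) - Lp_mod M p u = (LINT x|M. norm (un n x) powr p - norm (u x) powr p)"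
      using u un[of n] by (simp add: Lp_mod_def Lp_def)
    also have "\<bar>\<dots>\<bar> \<le> (LINT x|M. \<bar>norm (un n x) powr p - norm (u x) powr p\<bar>)"
      using integral_norm_bound[of M "\<lambda>x. norm (un n x) powr p - norm (u x) powr p"] by simp
    finally show ?thesis by (simp add: Lp_mod_def)
  qed
  ultimately have "(\<lambda>n. \<bar>Lp_mod M p (un n) - Lp_mod M p u\<bar>) \<longlonglongrightarrow> 0"
    by (intro tendsto_zero_le[of "\<lambda>n. \<bar>Lp_mod M p (un n) - Lp_mod M p u\<bar>" "\<lambda>n. Lp_mod M 1 (\<lambda>x. norm (un n x) powr p - norm (u x) powr p)"]) auto
  then show ?thesis by (simp add: tendsto_rabs_zero_iff LIM_zero_iff)
qed

lemma Lp_limits_AE_eq: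
  fixes u v :: "'x \<Rightarrow> 'b::euclidean_space"
  assumes "p > 0" "q > 0" "\<And>n. (\<lambda>x. w n x - u x) \<in> Lp M p" "\<And>n. (\<lambda>x. w n x - v x) \<in> Lp M q"
    and "(\<lambda>n. Lp_mod M p (\<lambda>x. w n x - u x)) \<longlonglongrightarrow> 0" "(\<lambda>n. Lp_mod M q (\<lambda>x. w n x - v x)) \<longlonglongrightarrow> 0"
  shows "AE x in M. u x = v x"
proof -
  obtain r where r: "strict_mono r" "AE x in M. (\<lambda>k. w (r k) x - u x) \<longlonglongrightarrow> 0"
    using Lp_tendsto_AE_subseq[OF assms(1,3,5)] by blast
  have "(\<lambda>n. Lp_mod M q (\<lambda>x. w (r n) x - v x)) \<longlonglongrightarrow> 0"
    using LIMSEQ_subseq_LIMSEQ[OF assms(6) r(1)] by (simp add: o_def)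
  then obtain s where s: "strict_mono s" "AE x in M. (\<lambda>k. w (r (s k)) x - v x) \<longlonglongrightarrow> 0"
    using Lp_tendsto_AE_subseq[of q "\<lambda>n x. w (r n) x - v x" M] assms(2,4) by blast
  show ?thesis using r(2) s(2)
  proof eventually_elim
    case (elim x)
    have "(\<lambda>k. w (r (s k)) x - u x) \<longlonglongrightarrow> 0" using LIMSEQ_subseq_LIMSEQ[OF elim(1) s(1)] by (simp add: o_def)
    from tendsto_diff[OF this elim(2)] have "(\<lambda>k. v x - u x) \<longlonglongrightarrow> 0" by simp
    then show ?case by (simp add: LIMSEQ_const_iff)
  qed
qed

lemma test_translation_L1:
  assumes \<phi>: "\<phi> \<in> test_functions \<Omega>"
  shows "(LINT z|lborel. \<bar>\<phi> (z + d) - \<phi> z\<bar>) \<le> norm d * (LINT z|lborel. norm (grad \<phi> z))"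
proof -
  note [measurable] = test_measurable_borel[OF \<phi>]
  have ig: "integrable lborel (\<lambda>z. norm (grad \<phi> z))" using test_integrable_lborel(2)[OF \<phi>] by (rule integrable_norm)
  have i: "integrable lborel (\<lambda>z. \<bar>\<phi> (z + d) - \<phi> z\<bar>)"
    using test_integrable_lborel(1)[OF \<phi>] lborel_translate(2)[of \<phi> d] by auto
  have "ennreal (LINT z|lborel. \<bar>\<phi> (z + d) - \<phi> z\<bar>) = (\<integral>\<^sup>+z. ennreal \<bar>\<phi> (z + d) - \<phi> z\<bar> \<partial>lborel)"
    by (rule nn_integral_eq_integral[symmetric, OF i]) simp
  also have "\<dots> \<le> (\<integral>\<^sup>+z. \<integral>\<^sup>+t. ennreal (indicator {0..1} t * (norm d * norm (grad \<phi> (z + t *\<^sub>R d)))) \<partial>lborel \<partial>lborel)"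
  proof (rule nn_integral_mono)
    fix z
    show "ennreal \<bar>\<phi> (z + d) - \<phi> z\<bar> \<le> (\<integral>\<^sup>+t. ennreal (indicator {0..1} t * (norm d * norm (grad \<phi> (z + t *\<^sub>R d)))) \<partial>lborel)"
      using test_line_nn_bound[OF \<phi>, of 1 z d] by simp
  qed
  also have "\<dots> = (\<integral>\<^sup>+t. \<integral>\<^sup>+z. ennreal (indicator {0..1} t * (norm d * norm (grad \<phi> (z + t *\<^sub>R d)))) \<partial>lborel \<partial>lborel)"
    by (rule lborel_pair.Fubini'[symmetric]) measurable
  also have "\<dots> = (\<integral>\<^sup>+t. ennreal (norm d * (LINT z|lborel. norm (grad \<phi> z))) * indicator {0..1::real} t \<partial>lborel)"
  proof (rule nn_integral_cong)
    fix t :: real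
    have "(\<integral>\<^sup>+z. ennreal (indicator {0..1} t * (norm d * norm (grad \<phi> (z + t *\<^sub>R d)))) \<partial>lborel) =
        (\<integral>\<^sup>+z. ennreal (indicator {0..1} t * (norm d * norm (grad \<phi> z))) \<partial>lborel)"
      by (rule nn_integral_translate[of "\<lambda>z. ennreal (indicator {0..1} t * (norm d * norm (grad \<phi> z)))"]) measurable
    also have "\<dots> = ennreal (LINT z|lborel. indicator {0..1} t * (norm d * norm (grad \<phi> z)))"
      by (rule nn_integral_eq_integral) (use ig in auto)
    also have "\<dots> = ennreal (norm d * (LINT z|lborel. norm (grad \<phi> z))) * indicator {0..1} t"
      by (simp add: indicator_def)
    finally show "(\<integral>\<^sup>+z. ennreal (indicator {0..1} t * (norm d * norm (grad \<phi> (z + t *\<^sub>R d)))) \<partial>lborel) =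
        ennreal (norm d * (LINT z|lborel. norm (grad \<phi> z))) * indicator {0..1} t" .
  qed
  also have "\<dots> = ennreal (norm d * (LINT z|lborel. norm (grad \<phi> z)))"
    by (subst nn_integral_cmult) auto
  finally show ?thesis by simp
qed

text \<open>
  The difference of two averages is at most the integral of \<open>|\<phi>(z + x - y) - \<phi>(z)|\<close> over all \<open>z\<close>, divided by
  the volume of the ball. At a fixed scale \<open>e\<close> the averages of functions with bounded gradients are thus
  equicontinuous.
\<close>

lemma ball_avg_lipschitz:
  fixes \<phi> :: "'a::euclidean_space \<Rightarrow> real"
  assumes \<phi>: "\<phi> \<in> test_functions \<Omega>" and e: "0 < e"
  shows "\<bar>ball_avg c \<phi> e x - ball_avg c \<phi> e y\<bar> \<le>
    norm (x - y) * (LINT z|lborel. norm (grad \<phi> z)) / (e ^ DIM('a) * measure lborel (cball c 1))"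
proof -
  note [measurable] = test_measurable_borel[OF \<phi>]
  define B where "B = cball c 1"
  define V where "V = measure lborel B"
  have V: "V > 0" unfolding V_def B_def by (simp add: content_cball_pos)
  have ch: "continuous_on UNIV (\<lambda>h. \<phi> (x + e *\<^sub>R h))" for x
    by (rule continuous_on_compose2[OF test_cont[OF \<phi>]]) (auto intro!: continuous_intros)
  have i1: "integrable lborel (\<lambda>h. indicator B h * \<phi> (x + e *\<^sub>R h))" for x
    unfolding B_def by (intro indicator_cball_integrable ch)
  define \<psi> where "\<psi> z = \<bar>\<phi> (z + (x - y)) - \<phi> z\<bar>" for z
  have [measurable]: "\<psi> \<in> borel_measurable borel" unfolding \<psi>_def by measurable
  have i\<psi>: "integrable lborel \<psi>"
    unfolding \<psi>_def using test_integrable_lborel(1)[OF \<phi>] lborel_translate(2)[of \<phi> "x - y"] by auto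
  have c\<psi>: "continuous_on UNIV (\<lambda>h. \<psi> (y + e *\<^sub>R h))"
    unfolding \<psi>_def by (intro continuous_intros continuous_on_compose2[OF test_cont[OF \<phi>]]) auto
  have "V * \<bar>ball_avg c \<phi> e x - ball_avg c \<phi> e y\<bar> =
      \<bar>(LINT h|lborel. indicator B h * \<phi> (x + e *\<^sub>R h)) - (LINT h|lborel. indicator B h * \<phi> (y + e *\<^sub>R h))\<bar>"
    using V by (simp add: ball_avg_def B_def V_def diff_divide_distrib[symmetric] abs_divide)
  also have "\<dots> = norm (LINT h|lborel. indicator B h * (\<phi> (x + e *\<^sub>R h) - \<phi> (y + e *\<^sub>R h)))"
    unfolding right_diff_distrib by (subst Bochner_Integration.integral_diff[OF i1 i1]) simp
  also have "\<dots> \<le> (LINT h|lborel. norm (indicator B h * (\<phi> (x + e *\<^sub>R h) - \<phi> (y + e *\<^sub>R h))))"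
    by (rule integral_norm_bound)
  also have "\<dots> = (LINT h|lborel. indicator B h * \<psi> (y + e *\<^sub>R h))"
    by (simp add: \<psi>_def abs_mult add.commute add.left_commute)
  finally have 1: "V * \<bar>ball_avg c \<phi> e x - ball_avg c \<phi> e y\<bar> \<le> (LINT h|lborel. indicator B h * \<psi> (y + e *\<^sub>R h))" .
  have "ennreal (e ^ DIM('a) * (LINT h|lborel. indicator B h * \<psi> (y + e *\<^sub>R h))) =
      ennreal (e ^ DIM('a)) * (\<integral>\<^sup>+h. ennreal (indicator B h * \<psi> (y + e *\<^sub>R h)) \<partial>lborel)"
    using nn_integral_eq_integral[OF indicator_cball_integrable[OF c\<psi>], of c 1] e
    by (subst ennreal_mult') (auto simp: B_def \<psi>_def)
  also have "\<dots> \<le> ennreal (e ^ DIM('a)) * (\<integral>\<^sup>+h. ennreal (\<psi> (y + e *\<^sub>R h)) \<partial>lborel)"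
    by (intro mult_left_mono nn_integral_mono) (auto simp: indicator_def \<psi>_def)
  also have "\<dots> = (\<integral>\<^sup>+z. ennreal (\<psi> z) \<partial>lborel)"
    using nn_integral_dilate[of "\<lambda>z. ennreal (\<psi> z)" e y] e by simp
  also have "\<dots> = ennreal (integral\<^sup>L lborel \<psi>)"
    by (rule nn_integral_eq_integral[OF i\<psi>]) (simp add: \<psi>_def)
  also have "\<dots> \<le> ennreal (norm (x - y) * (LINT z|lborel. norm (grad \<phi> z)))"
    unfolding \<psi>_def by (intro ennreal_leI test_translation_L1[OF \<phi>])
  finally have "e ^ DIM('a) * (LINT h|lborel. indicator B h * \<psi> (y + e *\<^sub>R h)) \<le> norm (x - y) * (LINT z|lborel. norm (grad \<phi> z))"
    by simp
  moreover have "e ^ DIM('a) * (V * \<bar>ball_avg c \<phi> e x - ball_avg c \<phi> e y\<bar>) \<le> e ^ DIM('a) * (LINT h|lborel. indicator B h * \<psi> (y + e *\<^sub>R h))"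
    by (rule mult_left_mono[OF 1]) (use e in simp)
  ultimately have "e ^ DIM('a) * (V * \<bar>ball_avg c \<phi> e x - ball_avg c \<phi> e y\<bar>) \<le> norm (x - y) * (LINT z|lborel. norm (grad \<phi> z))"
    by (rule order_trans[rotated])
  then show ?thesis using e V by (simp add: B_def V_def field_simps)
qed

lemma ball_avg_diff:
  assumes "\<phi> \<in> test_functions \<Omega>" "\<psi> \<in> test_functions \<Omega>"
  shows "ball_avg c (\<lambda>x. \<phi> x - \<psi> x) e x = ball_avg c \<phi> e x - ball_avg c \<psi> e x"
proof -
  have i1: "integrable lborel (\<lambda>h. indicator (cball c 1) h * \<phi> (x + e *\<^sub>R h))" if "\<phi> \<in> test_functions \<Omega>" for \<phi>
    by (intro indicator_cball_integrable continuous_on_compose2[OF test_cont[OF that]]) (auto intro!: continuous_intros)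
  show ?thesis
    unfolding ball_avg_def right_diff_distrib
    by (subst Bochner_Integration.integral_diff[OF i1[OF assms(1)] i1[OF assms(2)]]) (simp add: diff_divide_distrib)
qed

lemma test_diff:
  assumes "\<phi> \<in> test_functions \<Omega>" "\<psi> \<in> test_functions \<Omega>"
  shows "(\<lambda>x. \<phi> x - \<psi> x) \<in> test_functions \<Omega>" "grad (\<lambda>x. \<phi> x - \<psi> x) x = grad \<phi> x - grad \<psi> x"
  using test_add[OF assms(1) test_scale(1)[OF assms(2), of "-1"]] test_scale(2)[OF assms(2), of "-1"] by simp_all

context bounded_domain begin

lemma Lp_mod_test:
  assumes "\<phi> \<in> test_functions \<Omega>" "p > 0"
  shows "Lp_mod M p \<phi> = Lp_mod lborel p \<phi>" "Lp_mod M p (grad \<phi>) = Lp_mod lborel p (grad \<phi>)"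
proof -
  note [measurable] = test_measurable_borel[OF assms(1)]
  show "Lp_mod M p \<phi> = Lp_mod lborel p \<phi>"
    unfolding Lp_mod_def by (rule integral_domain_eq_lborel(1)) (use assms test_zero_outside_domain[OF assms(1)] in auto)
  show "Lp_mod M p (grad \<phi>) = Lp_mod lborel p (grad \<phi>)"
    unfolding Lp_mod_def by (rule integral_domain_eq_lborel(1)) (use assms test_zero_outside_domain[OF assms(1)] in auto)
qed

lemma Lp_mod_le_of_nn_integral:
  fixes v :: "'a \<Rightarrow> real"
  assumes [measurable]: "v \<in> borel_measurable M" and le: "(\<integral>\<^sup>+x. ennreal (\<bar>v x\<bar> powr p) \<partial>M) \<le> ennreal C" and C: "C \<ge> 0"
  shows "v \<in> Lp M p" "Lp_mod M p v \<le> C"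
proof -
  have i: "integrable M (\<lambda>x. \<bar>v x\<bar> powr p)"
    by (rule integrableI_nonneg) (use le in \<open>auto intro: le_less_trans\<close>)
  then show "v \<in> Lp M p" by (simp add: Lp_def)
  show "Lp_mod M p v \<le> C" using nn_integral_eq_integral[OF i] le C by (simp add: Lp_mod_def)
qed

lemma nn_integral_M_le:
  assumes "f \<in> borel_measurable borel"
  shows "(\<integral>\<^sup>+x. f x \<partial>M) \<le> (\<integral>\<^sup>+x. f x \<partial>lborel)"
proof -
  have "(\<integral>\<^sup>+x. f x \<partial>M) = (\<integral>\<^sup>+x. f x * indicator \<Omega> x \<partial>lebesgue)"
    by (subst nn_integral_restrict_space) auto
  also have "\<dots> \<le> (\<integral>\<^sup>+x. f x \<partial>lebesgue)" by (intro nn_integral_mono) (auto simp: indicator_def)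
  also have "\<dots> = (\<integral>\<^sup>+x. f x \<partial>lborel)" using assms by (simp add: nn_integral_completion)
  finally show ?thesis .
qed

lemma domain_norm_bound: obtains r where "r > 0" "\<And>x. x \<in> \<Omega> \<Longrightarrow> norm x \<le> r"
  using bounded_domain unfolding bounded_pos by blast

text \<open>
  The offset \<open>c\<close> is so large that \<open>x + c\<close> has distance more than \<open>1\<close> from the domain for every \<open>x\<close> in it. Then
  all averages vanish, and the deviation from the average is the function itself.
\<close>

lemma sobolev_test:
  assumes p: "1 < p" "p \<le> \<alpha>" and th: "DIM('a) * (1 / p - 1 / \<alpha>) < 1"
  shows "\<exists>C\<ge>0. \<forall>\<phi>\<in>test_functions \<Omega>. Lp_mod M \<alpha> \<phi> \<le> C * Lp_mod M p (grad \<phi>) powr (\<alpha> / p)"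
proof -
  obtain r where r: "r > 0" "\<And>x. x \<in> \<Omega> \<Longrightarrow> norm x \<le> r" by (rule domain_norm_bound) blast
  obtain i :: 'a where i: "i \<in> Basis" using nonempty_Basis by blast
  define c where "c = (2 * r + 2) *\<^sub>R i"
  have nc: "norm c = 2 * r + 2" using r i by (simp add: c_def)
  define C where "C = ((norm c + 1) / measure lborel (cball c 1) * measure lborel (cball c 1) powr (1 - 1 / p)) powr \<alpha> *
    measure lborel (cball c 1) * (1 powr (1 - DIM('a) * (1 / p - 1 / \<alpha>)) / (1 - DIM('a) * (1 / p - 1 / \<alpha>))) powr \<alpha>"
  have C: "C \<ge> 0" by (simp add: C_def)
  have "Lp_mod M \<alpha> \<phi> \<le> C * Lp_mod M p (grad \<phi>) powr (\<alpha> / p)" if \<phi>: "\<phi> \<in> test_functions \<Omega>" for \<phi>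
  proof (rule Lp_mod_le_of_nn_integral(2))
    note [measurable] = test_measurable_borel[OF \<phi>]
    show "\<phi> \<in> borel_measurable M" by (rule continuous_measurable_M[OF test_cont[OF \<phi>]])
    have avg0: "ball_avg c \<phi> 1 x = 0" if "x \<in> \<Omega>" for x
    proof -
      have "indicator (cball c 1) h * \<phi> (x + 1 *\<^sub>R h) = 0" for h
      proof (cases "h \<in> cball c 1")
        case True
        have "norm c - norm h \<le> 1" using True norm_triangle_ineq2[of c h] by (simp add: dist_norm)
        moreover have "norm h - norm x \<le> norm (x + h)" using norm_triangle_ineq2[of h "- x"] by (simp add: add.commute)
        ultimately have "norm (x + h) > r" using r(2)[OF that] nc r(1) by linarith
        then have "x + h \<notin> \<Omega>" using r(2) by force
        then show ?thesis using test_zero_outside_domain(1)[OF \<phi>] by simp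
      qed simp
      then show ?thesis unfolding ball_avg_def by (simp only: Bochner_Integration.integral_zero div_0)
    qed
    have "(\<integral>\<^sup>+x. ennreal (\<bar>\<phi> x\<bar> powr \<alpha>) \<partial>M) \<le> (\<integral>\<^sup>+x. ennreal (\<bar>\<phi> x\<bar> powr \<alpha>) \<partial>lborel)"
      by (rule nn_integral_M_le) measurable
    also have "\<dots> \<le> (\<integral>\<^sup>+x. ennreal (\<bar>\<phi> x - ball_avg c \<phi> 1 x\<bar> powr \<alpha>) \<partial>lborel)"
    proof (rule nn_integral_mono)
      fix x show "ennreal (\<bar>\<phi> x\<bar> powr \<alpha>) \<le> ennreal (\<bar>\<phi> x - ball_avg c \<phi> 1 x\<bar> powr \<alpha>)"
        using avg0[of x] test_zero_outside_domain(1)[OF \<phi>, of x] by (cases "x \<in> \<Omega>") auto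
    qed
    also have "\<dots> \<le> ennreal (C * Lp_mod lborel p (grad \<phi>) powr (\<alpha> / p))"
      unfolding C_def by (rule ball_avg_deviation[OF \<phi> p _ refl th]) simp
    finally show "(\<integral>\<^sup>+x. ennreal (\<bar>\<phi> x\<bar> powr \<alpha>) \<partial>M) \<le> ennreal (C * Lp_mod M p (grad \<phi>) powr (\<alpha> / p))"
      using p by (simp add: Lp_mod_test(2)[OF \<phi>])
    show "0 \<le> C * Lp_mod M p (grad \<phi>) powr (\<alpha> / p)" using C by simp
  qed
  then show ?thesis using C by blast
qed

text \<open>
  The positive power of \<open>e\<close> makes the averages approximate all test functions with bounded gradients
  uniformly.
\<close>

lemma deviation_test:
  assumes p: "1 < p" "p \<le> \<alpha>" and th: "DIM('a) * (1 / p - 1 / \<alpha>) < 1"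
  shows "\<exists>C\<ge>0. \<exists>s>0. \<forall>\<phi>\<in>test_functions \<Omega>. \<forall>e>0. (\<lambda>x. \<phi> x - ball_avg 0 \<phi> e x) \<in> Lp M \<alpha> \<and>
    Lp_mod M \<alpha> (\<lambda>x. \<phi> x - ball_avg 0 \<phi> e x) \<le> C * e powr s * Lp_mod M p (grad \<phi>) powr (\<alpha> / p)"
proof -
  define \<theta> where "\<theta> = DIM('a) * (1 / p - 1 / \<alpha>)"
  define V where "V = measure lborel (cball (0::'a) 1)"
  define C where "C = ((norm (0::'a) + 1) / V * V powr (1 - 1 / p)) powr \<alpha> * V * (1 / (1 - \<theta>)) powr \<alpha>"
  have V: "V \<ge> 0" by (simp add: V_def)
  have C: "C \<ge> 0" using V by (simp add: C_def)
  define s where "s = (1 - \<theta>) * \<alpha>"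
  have s: "s > 0" using th p by (simp add: s_def \<theta>_def)
  have "(\<lambda>x. \<phi> x - ball_avg 0 \<phi> e x) \<in> Lp M \<alpha> \<and>
      Lp_mod M \<alpha> (\<lambda>x. \<phi> x - ball_avg 0 \<phi> e x) \<le> C * e powr s * Lp_mod M p (grad \<phi>) powr (\<alpha> / p)"
    if \<phi>: "\<phi> \<in> test_functions \<Omega>" and e: "e > 0" for \<phi> e
  proof -
    note [measurable] = test_measurable_borel[OF \<phi>]
    have [measurable]: "cball (0::'a) 1 \<in> sets borel" by simp
    have "(\<lambda>x. LINT h|lborel. indicator (cball 0 1) h * \<phi> (x + e *\<^sub>R h)) \<in> borel_measurable borel" by measurable
    then have [measurable]: "ball_avg 0 \<phi> e \<in> borel_measurable borel"
      unfolding ball_avg_def by (rule borel_measurable_divide) simp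
    have m: "(\<lambda>x. \<phi> x - ball_avg 0 \<phi> e x) \<in> borel_measurable M"
      by (rule measurable_restrict_space1[OF measurable_completion]) measurable
    have "(\<integral>\<^sup>+x. ennreal (\<bar>\<phi> x - ball_avg 0 \<phi> e x\<bar> powr \<alpha>) \<partial>M) \<le> (\<integral>\<^sup>+x. ennreal (\<bar>\<phi> x - ball_avg 0 \<phi> e x\<bar> powr \<alpha>) \<partial>lborel)"
      by (rule nn_integral_M_le) measurable
    also have "\<dots> \<le> ennreal (((norm (0::'a) + 1) / V * V powr (1 - 1 / p)) powr \<alpha> * V * (e powr (1 - \<theta>) / (1 - \<theta>)) powr \<alpha> * Lp_mod lborel p (grad \<phi>) powr (\<alpha> / p))"
      unfolding V_def by (rule ball_avg_deviation[OF \<phi> p e]) (use th in \<open>simp_all add: \<theta>_def\<close>)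
    also have "(e powr (1 - \<theta>) / (1 - \<theta>)) powr \<alpha> = e powr s * (1 / (1 - \<theta>)) powr \<alpha>"
    proof -
      have "e powr (1 - \<theta>) / (1 - \<theta>) = e powr (1 - \<theta>) * (1 / (1 - \<theta>))" by simp
      then show ?thesis by (simp only: powr_mult powr_powr s_def)
    qed
    finally have le: "(\<integral>\<^sup>+x. ennreal (\<bar>\<phi> x - ball_avg 0 \<phi> e x\<bar> powr \<alpha>) \<partial>M) \<le> ennreal (C * e powr s * Lp_mod M p (grad \<phi>) powr (\<alpha> / p))"
      using p by (simp add: C_def Lp_mod_test(2)[OF \<phi>] mult_ac)
    show ?thesis using Lp_mod_le_of_nn_integral[OF m le] C by simp
  qed
  then show ?thesis using C s by blast
qed

text \<open>
  At each scale \<open>1 / (m + 1)\<close> the averages are Lipschitz with a common constant, and they vanish at a point \<open>y0\<close>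
  outside of the domain, hence they are uniformly bounded. By the theorem of Arzela and Ascoli a subsequence
  converges uniformly, and a diagonal sequence does so for all scales. The deviation from the averages is
  uniformly small in \<open>L\<^sup>\<alpha>\<close> as the scale tends to \<open>0\<close>.
\<close>

lemma rellich_test:
  assumes p: "1 < p" "p \<le> \<alpha>" and th: "DIM('a) * (1 / p - 1 / \<alpha>) < 1"
    and \<phi>: "\<And>n. \<phi> n \<in> test_functions \<Omega>" and K: "\<And>n. Lp_mod M p (grad (\<phi> n)) \<le> K"
  shows "\<exists>r. strict_mono (r :: nat \<Rightarrow> nat) \<and>
    (\<forall>\<epsilon>>0. \<exists>N. \<forall>m\<ge>N. \<forall>n\<ge>N. Lp_mod M \<alpha> (\<lambda>x. \<phi> (r m) x - \<phi> (r n) x) < \<epsilon>)"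
proof -
  interpret finite_measure M by (rule finite_M)
  obtain R where R: "R > 0" "\<And>x. x \<in> \<Omega> \<Longrightarrow> norm x \<le> R" by (rule domain_norm_bound) blast
  have p0: "p > 0" "p \<ge> 0" "\<alpha> > 0" using p by auto
  have K0: "K \<ge> 0" using order_trans[OF Lp_mod_nonneg K] .
  define V where "V = measure lborel (cball (0::'a) 1)"
  have V: "V > 0" unfolding V_def by (simp add: content_cball_pos)
  define G where "G = measure M (space M) + K"
  have G0: "G \<ge> 0" using K0 by (simp add: G_def)
  have G: "(LINT z|lborel. norm (grad (\<phi> n) z)) \<le> G" for n
  proof -
    have "(LINT z|lborel. norm (grad (\<phi> n) z)) = Lp_mod M 1 (grad (\<phi> n))"
      unfolding Lp_mod_test(2)[OF \<phi> zero_less_one] by (simp add: Lp_mod_def)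
    also have "\<dots> \<le> 1 * measure M (space M) + 1 powr (1 - p / 1) * Lp_mod M p (grad (\<phi> n))"
      using p by (intro Lp_lower_exponent(2)[OF finite_M _ _ test_in_Lp(2)[OF \<phi> p0(2)]]) auto
    also have "\<dots> \<le> G" using K[of n] by (simp add: G_def)
    finally show ?thesis .
  qed
  define T where "T m n x = ball_avg 0 (\<phi> n) (inverse (real (Suc m))) x" for m n x
  define L where "L m = G / (inverse (real (Suc m)) ^ DIM('a) * V)" for m
  have L0: "L m \<ge> 0" for m using G0 V by (simp add: L_def)
  have lip: "\<bar>T m n x - T m n y\<bar> \<le> L m * norm (x - y)" for m n x y
  proof -
    have "\<bar>T m n x - T m n y\<bar> \<le> norm (x - y) * (LINT z|lborel. norm (grad (\<phi> n) z)) / (inverse (real (Suc m)) ^ DIM('a) * V)"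
      unfolding T_def V_def by (rule ball_avg_lipschitz[OF \<phi>]) simp
    also have "\<dots> \<le> norm (x - y) * G / (inverse (real (Suc m)) ^ DIM('a) * V)"
      using V by (intro divide_right_mono mult_left_mono G) auto
    finally show ?thesis by (simp add: L_def mult.commute)
  qed
  obtain i :: 'a where i: "i \<in> Basis" using nonempty_Basis by blast
  define y0 where "y0 = (R + 2) *\<^sub>R i"
  have ny0: "norm y0 = R + 2" using R i by (simp add: y0_def)
  have Ty0: "T m n y0 = 0" for m n
  proof -
    have "indicator (cball 0 1) h * \<phi> n (y0 + inverse (real (Suc m)) *\<^sub>R h) = 0" for h
    proof (cases "h \<in> cball 0 1")
      case True
      have "norm (inverse (real (Suc m)) *\<^sub>R h) \<le> 1 * 1"
        unfolding norm_scaleR using True by (intro mult_mono) (auto simp: inverse_le_1_iff)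
      then have "norm (y0 + inverse (real (Suc m)) *\<^sub>R h) > R"
        using norm_triangle_ineq2[of y0 "- (inverse (real (Suc m)) *\<^sub>R h)"] ny0 by simp
      then have "y0 + inverse (real (Suc m)) *\<^sub>R h \<notin> \<Omega>" using R(2) by force
      then show ?thesis using test_zero_outside_domain(1)[OF \<phi>] by simp
    qed simp
    then show ?thesis unfolding T_def ball_avg_def by (simp only: Bochner_Integration.integral_zero div_0)
  qed
  define P where "P m s \<longleftrightarrow> (\<forall>\<epsilon>>0. \<exists>N::nat. \<forall>k\<ge>N. \<forall>l\<ge>N. \<forall>x\<in>\<Omega>. \<bar>T m (s k) x - T m (s l) x\<bar> < \<epsilon>)" for m and s :: "nat \<Rightarrow> nat"
  interpret subseqs P
  proof
    fix m and s :: "nat \<Rightarrow> nat" assume s: "strict_mono s"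
    obtain g k where gk: "strict_mono (k :: nat \<Rightarrow> nat)"
        "\<And>e. 0 < e \<Longrightarrow> \<exists>N. \<forall>n x. n \<ge> N \<and> x \<in> cball 0 R \<longrightarrow> norm (T m (s (k n)) x - g x) < e"
    proof (rule Arzela_Ascoli[of "cball 0 R" "\<lambda>n. T m (s n)" "L m * (2 * R + 2)"])
      fix n and x :: 'a assume x: "x \<in> cball 0 R"
      have "norm (x - y0) \<le> 2 * R + 2" using norm_triangle_ineq4[of x y0] x ny0 by simp
      then have "L m * norm (x - y0) \<le> L m * (2 * R + 2)" using L0 by (intro mult_left_mono) auto
      then show "norm (T m (s n) x) \<le> L m * (2 * R + 2)" using lip[of m "s n" x y0] Ty0 by simp
    next
      fix x :: 'a and e :: real assume e: "0 < e"
      show "\<exists>d. 0 < d \<and> (\<forall>n y. y \<in> cball 0 R \<and> norm (x - y) < d \<longrightarrow> norm (T m (s n) x - T m (s n) y) < e)"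
      proof (intro exI[of _ "e / (L m + 1)"] conjI allI impI)
        show "0 < e / (L m + 1)" using e L0[of m] by simp
        fix n y assume y: "y \<in> cball 0 R \<and> norm (x - y) < e / (L m + 1)"
        have "L m * norm (x - y) \<le> (L m + 1) * norm (x - y)" by (simp add: distrib_right)
        also have "\<dots> < e" using y L0[of m] by (simp add: field_simps)
        finally show "norm (T m (s n) x - T m (s n) y) < e" using lip[of m "s n" x y] by simp
      qed
    qed auto
    have "P m (s \<circ> k)"
      unfolding P_def o_def
    proof (intro allI impI)
      fix e :: real assume "e > 0"
      then obtain N where N: "\<And>n x. n \<ge> N \<Longrightarrow> x \<in> cball 0 R \<Longrightarrow> norm (T m (s (k n)) x - g x) < e / 2"
        using gk(2)[of "e / 2"] by auto
      show "\<exists>N. \<forall>ka\<ge>N. \<forall>l\<ge>N. \<forall>x\<in>\<Omega>. \<bar>T m (s (k ka)) x - T m (s (k l)) x\<bar> < e"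
      proof (intro exI[of _ N] allI impI ballI)
        fix a b x assume "N \<le> a" "N \<le> b" "x \<in> \<Omega>"
        then have "\<bar>T m (s (k a)) x - g x\<bar> < e / 2" "\<bar>T m (s (k b)) x - g x\<bar> < e / 2"
          using N[of a x] N[of b x] R(2)[of x] by auto
        then show "\<bar>T m (s (k a)) x - T m (s (k b)) x\<bar> < e" by linarith
      qed
    qed
    then show "\<exists>r'. strict_mono r' \<and> P m (s \<circ> r')" using gk(1) by blast
  qed
  define r where "r = diagseq"
  have r: "strict_mono r" unfolding r_def by (rule subseq_diagseq)
  have Pr: "\<exists>N. \<forall>k\<ge>N. \<forall>l\<ge>N. \<forall>x\<in>\<Omega>. \<bar>T m (r k) x - T m (r l) x\<bar> < \<epsilon>" if \<epsilon>: "\<epsilon> > 0" for m \<epsilon>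
  proof -
    have "P m (diagseq \<circ> ((+) (Suc m)))"
    proof (rule diagseq_holds)
      fix q s :: "nat \<Rightarrow> nat" and n assume q: "strict_mono q" "P n s"
      show "P n (s \<circ> q)" unfolding P_def o_def
      proof (intro allI impI)
        fix e :: real assume "e > 0"
        then obtain N where N: "\<forall>k\<ge>N. \<forall>l\<ge>N. \<forall>x\<in>\<Omega>. \<bar>T n (s k) x - T n (s l) x\<bar> < e" using q(2) unfolding P_def by blast
        have "q k \<ge> N" if "k \<ge> N" for k using seq_suble[OF q(1), of k] that by linarith
        then show "\<exists>N. \<forall>k\<ge>N. \<forall>l\<ge>N. \<forall>x\<in>\<Omega>. \<bar>T n (s (q k)) x - T n (s (q l)) x\<bar> < e" using N by blast
      qed
    qed
    then obtain N where N: "\<forall>k\<ge>N. \<forall>l\<ge>N. \<forall>x\<in>\<Omega>. \<bar>T m (r (Suc m + k)) x - T m (r (Suc m + l)) x\<bar> < \<epsilon>"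
      using \<epsilon> unfolding P_def r_def o_def by blast
    show ?thesis
    proof (intro exI[of _ "N + Suc m"] allI impI ballI)
      fix k l x assume kl: "N + Suc m \<le> k" "N + Suc m \<le> l" "x \<in> \<Omega>"
      have e: "Suc m + (k - Suc m) = k" "Suc m + (l - Suc m) = l" using kl by auto
      have "k - Suc m \<ge> N" "l - Suc m \<ge> N" using kl by auto
      then show "\<bar>T m (r k) x - T m (r l) x\<bar> < \<epsilon>" using N kl(3) e by metis
    qed
  qed
  obtain C s where Cs: "C \<ge> 0" "s > 0" "\<And>\<psi> e. \<psi> \<in> test_functions \<Omega> \<Longrightarrow> e > 0 \<Longrightarrow> (\<lambda>x. \<psi> x - ball_avg 0 \<psi> e x) \<in> Lp M \<alpha> \<and>
    Lp_mod M \<alpha> (\<lambda>x. \<psi> x - ball_avg 0 \<psi> e x) \<le> C * e powr s * Lp_mod M p (grad \<psi>) powr (\<alpha> / p)"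
    using deviation_test[OF p th] by blast
  define H where "H = (2 powr p * (K + K)) powr (\<alpha> / p)"
  have "\<exists>N. \<forall>m\<ge>N. \<forall>n\<ge>N. Lp_mod M \<alpha> (\<lambda>x. \<phi> (r m) x - \<phi> (r n) x) < \<epsilon>" if \<epsilon>: "\<epsilon> > 0" for \<epsilon>
  proof -
    have "(\<lambda>m. inverse (real (Suc m)) powr s) \<longlonglongrightarrow> 0 powr s"
      using Cs(2) by (intro tendsto_powr' LIMSEQ_inverse_real_of_nat tendsto_const) auto
    then have "(\<lambda>m. 2 powr \<alpha> * (C * inverse (real (Suc m)) powr s * H)) \<longlonglongrightarrow> 2 powr \<alpha> * (C * 0 powr s * H)"
      by (intro tendsto_mult tendsto_const)
    then have "(\<lambda>m. 2 powr \<alpha> * (C * inverse (real (Suc m)) powr s * H)) \<longlonglongrightarrow> 0" by simp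
    from order_tendstoD(2)[OF this, of "\<epsilon> / 2"] \<epsilon>
    obtain m where m: "2 powr \<alpha> * (C * inverse (real (Suc m)) powr s * H) < \<epsilon> / 2"
      by (auto simp: eventually_sequentially)
    obtain \<mu> where \<mu>: "\<mu> = measure M (space M)" and mM: "\<mu> \<ge> 0" by simp
    define q where "q = \<epsilon> / (2 * 2 powr \<alpha> * (\<mu> + 1))"
    define d where "d = q powr (1 / \<alpha>)"
    have d: "d > 0" "2 powr \<alpha> * (d powr \<alpha> * \<mu>) \<le> \<epsilon> / 2"
    proof -
      have pos: "0 < q" unfolding q_def using \<epsilon> mM by (intro divide_pos_pos mult_pos_pos) auto
      then show "d > 0" by (simp add: d_def)
      have "d powr \<alpha> = q" using pos p0 by (simp add: d_def powr_powr)
      then have "2 powr \<alpha> * (d powr \<alpha> * \<mu>) = \<epsilon> / 2 * (\<mu> / (\<mu> + 1))"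
        by (simp add: q_def)
      also have "\<dots> \<le> \<epsilon> / 2 * 1" using \<epsilon> mM by (intro mult_left_mono) (auto simp: divide_le_eq)
      finally show "2 powr \<alpha> * (d powr \<alpha> * \<mu>) \<le> \<epsilon> / 2" by simp
    qed
    obtain N where N: "\<And>k l x. k \<ge> N \<Longrightarrow> l \<ge> N \<Longrightarrow> x \<in> \<Omega> \<Longrightarrow> \<bar>T m (r k) x - T m (r l) x\<bar> < d" using Pr[OF d(1), of m] by blast
    have "Lp_mod M \<alpha> (\<lambda>x. \<phi> (r k) x - \<phi> (r l) x) < \<epsilon>" if kl: "k \<ge> N" "l \<ge> N" for k l
    proof -
      define \<psi> where "\<psi> x = \<phi> (r k) x - \<phi> (r l) x" for x
      define e where "e = inverse (real (Suc m))"
      have \<psi>: "\<psi> \<in> test_functions \<Omega>" unfolding \<psi>_def by (rule test_diff(1)[OF \<phi> \<phi>])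
      have avg: "ball_avg 0 \<psi> e x = T m (r k) x - T m (r l) x" for x
        unfolding \<psi>_def T_def e_def by (rule ball_avg_diff[OF \<phi> \<phi>])
      have g: "grad \<psi> = (\<lambda>x. grad (\<phi> (r k)) x - grad (\<phi> (r l)) x)"
        unfolding \<psi>_def by (rule ext) (rule test_diff(2)[OF \<phi> \<phi>])
      have "Lp_mod M p (grad \<psi>) \<le> 2 powr p * (Lp_mod M p (grad (\<phi> (r k))) + Lp_mod M p (grad (\<phi> (r l))))"
        unfolding g by (intro Lp_diff p0 test_in_Lp \<phi>)
      also have "\<dots> \<le> 2 powr p * (K + K)" by (intro mult_left_mono add_mono K) auto
      finally have "Lp_mod M p (grad \<psi>) powr (\<alpha> / p) \<le> H" unfolding H_def using p0 by (intro powr_mono2) auto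
      moreover have "(\<lambda>x. \<psi> x - ball_avg 0 \<psi> e x) \<in> Lp M \<alpha> \<and>
          Lp_mod M \<alpha> (\<lambda>x. \<psi> x - ball_avg 0 \<psi> e x) \<le> C * e powr s * Lp_mod M p (grad \<psi>) powr (\<alpha> / p)"
        by (rule Cs(3)[OF \<psi>]) (simp add: e_def)
      moreover have "C * e powr s * Lp_mod M p (grad \<psi>) powr (\<alpha> / p) \<le> C * e powr s * H"
        by (rule mult_left_mono) (use \<open>Lp_mod M p (grad \<psi>) powr (\<alpha> / p) \<le> H\<close> Cs(1) in auto)
      ultimately have dev: "(\<lambda>x. \<psi> x - ball_avg 0 \<psi> e x) \<in> Lp M \<alpha>"
          "Lp_mod M \<alpha> (\<lambda>x. \<psi> x - ball_avg 0 \<psi> e x) \<le> C * e powr s * H" by auto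
      have \<psi>L: "\<psi> \<in> Lp M \<alpha>" using \<psi> p0 by (intro test_in_Lp) auto
      from Lp_diff(1)[OF _ \<psi>L dev(1)] have aL: "ball_avg 0 \<psi> e \<in> Lp M \<alpha>" using p0 by simp
      have "Lp_mod M \<alpha> (ball_avg 0 \<psi> e) \<le> (LINT x|M. d powr \<alpha>)"
        unfolding Lp_mod_def using aL d p0 N[OF kl]
        by (intro integral_mono powr_mono2) (auto simp: Lp_def avg less_imp_le)
      then have a: "Lp_mod M \<alpha> (ball_avg 0 \<psi> e) \<le> d powr \<alpha> * \<mu>" by (simp add: \<mu> mult.commute)
      have "Lp_mod M \<alpha> \<psi> \<le> 2 powr \<alpha> * (Lp_mod M \<alpha> (\<lambda>x. \<psi> x - ball_avg 0 \<psi> e x) + Lp_mod M \<alpha> (ball_avg 0 \<psi> e))"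
        using Lp_add(2)[OF _ dev(1) aL] p0 by simp
      also have "\<dots> \<le> 2 powr \<alpha> * (C * e powr s * H + d powr \<alpha> * \<mu>)"
        by (intro mult_left_mono add_mono dev(2) a) auto
      also have "\<dots> < \<epsilon>" using m d(2) by (simp add: e_def distrib_left)
      finally show ?thesis unfolding \<psi>_def .
    qed
    then show ?thesis by blast
  qed
  then show ?thesis using r by blast
qed

end

section \<open>Embeddings and weak limits in the Sobolev space\<close>

lemma Lp_powr_gap:
  fixes g h :: "'x \<Rightarrow> 'b::euclidean_space"
  assumes p: "p > 1" and g: "g \<in> Lp M p" and h: "h \<in> Lp M p"
  shows "(\<lambda>x. (g x + h x) /\<^sub>R 2) \<in> Lp M p"
    and "integrable M (\<lambda>x. powr_gap p (g x) (h x))"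
    and "(LINT x|M. powr_gap p (g x) (h x)) = (Lp_mod M p g + Lp_mod M p h) / 2 - Lp_mod M p (\<lambda>x. (g x + h x) /\<^sub>R 2)"
    and "Lp_mod M p (\<lambda>x. (g x + h x) /\<^sub>R 2) \<le> (Lp_mod M p g + Lp_mod M p h) / 2"
proof -
  have p0: "p \<ge> 0" using p by simp
  show m: "(\<lambda>x. (g x + h x) /\<^sub>R 2) \<in> Lp M p"
    by (rule Lp_scale(1)[OF Lp_add(1)[OF p0 g h]])
  have i: "integrable M (\<lambda>x. norm (g x) powr p)" "integrable M (\<lambda>x. norm (h x) powr p)"
      "integrable M (\<lambda>x. norm ((g x + h x) /\<^sub>R 2) powr p)"
    using g h m by (simp_all only: Lp_def mem_Collect_eq)
  have i2: "integrable M (\<lambda>x. (norm (g x) powr p + norm (h x) powr p) / 2)" using i(1,2) by simp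
  have e: "(\<lambda>x. powr_gap p (g x) (h x)) = (\<lambda>x. (norm (g x) powr p + norm (h x) powr p) / 2 - norm ((g x + h x) /\<^sub>R 2) powr p)"
    by (rule ext) (rule powr_gap_def)
  show ig: "integrable M (\<lambda>x. powr_gap p (g x) (h x))"
    unfolding e by (rule Bochner_Integration.integrable_diff[OF i2 i(3)])
  have "(LINT x|M. (norm (g x) powr p + norm (h x) powr p) / 2) = (Lp_mod M p g + Lp_mod M p h) / 2"
    unfolding Lp_mod_def Bochner_Integration.integral_add[OF i(1,2), symmetric] by (rule Bochner_Integration.integral_divide_zero)
  then show eq: "(LINT x|M. powr_gap p (g x) (h x)) = (Lp_mod M p g + Lp_mod M p h) / 2 - Lp_mod M p (\<lambda>x. (g x + h x) /\<^sub>R 2)"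
    unfolding e Bochner_Integration.integral_diff[OF i2 i(3)] by (simp only: Lp_mod_def)
  have "0 \<le> (LINT x|M. powr_gap p (g x) (h x))"
    by (rule Bochner_Integration.integral_nonneg) (rule powr_gap_nonneg[OF p])
  then show "Lp_mod M p (\<lambda>x. (g x + h x) /\<^sub>R 2) \<le> (Lp_mod M p g + Lp_mod M p h) / 2"
    unfolding eq by simp
qed

context bounded_domain begin

lemma W0_approx:
  "W0 p u g \<Longrightarrow> \<exists>\<phi>. (\<forall>n::nat. \<phi> n \<in> test_functions \<Omega>) \<and> (\<lambda>n. Lp_mod M p (\<lambda>x. u x - \<phi> n x)) \<longlonglongrightarrow> 0 \<and>
      (\<lambda>n. Lp_mod M p (\<lambda>x. g x - grad (\<phi> n) x)) \<longlonglongrightarrow> 0"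
  unfolding W0_def by (elim conjE)

lemma W0_lower_exponent:
  assumes "0 < q" "q \<le> p" and W: "W0 p u g" shows "W0 q u g"
proof -
  obtain \<phi> where \<phi>': "(\<forall>n::nat. \<phi> n \<in> test_functions \<Omega>) \<and> (\<lambda>n. Lp_mod M p (\<lambda>x. u x - \<phi> n x)) \<longlonglongrightarrow> 0 \<and>
      (\<lambda>n. Lp_mod M p (\<lambda>x. g x - grad (\<phi> n) x)) \<longlonglongrightarrow> 0" using W0_approx[OF W] ..
  note \<phi> = \<phi>'[THEN conjunct1, rule_format] \<phi>'[THEN conjunct2, THEN conjunct1] \<phi>'[THEN conjunct2, THEN conjunct2]
  have p0: "p \<ge> 0" using assms by simp
  note L = W0_D[OF W]
  have "(\<lambda>n. Lp_mod M q (\<lambda>x. u x - \<phi> n x)) \<longlonglongrightarrow> 0"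
    by (rule Lp_mod_lower_exponent_tendsto[OF finite_M assms(1,2) Lp_diff(1)[OF p0 L(1) test_in_Lp(1)[OF \<phi>(1) p0]] \<phi>(2)])
  moreover have "(\<lambda>n. Lp_mod M q (\<lambda>x. g x - grad (\<phi> n) x)) \<longlonglongrightarrow> 0"
    by (rule Lp_mod_lower_exponent_tendsto[OF finite_M assms(1,2) Lp_diff(1)[OF p0 L(2) test_in_Lp(2)[OF \<phi>(1) p0]] \<phi>(3)])
  ultimately show ?thesis unfolding W0_def
    using \<phi>(1) Lp_lower_exponent(1)[OF finite_M assms(1,2) L(1)] Lp_lower_exponent(1)[OF finite_M assms(1,2) L(2)] by blast
qed

text \<open>
  Applied to differences, the inequality for test functions shows that an approximating sequence is Cauchy in
  \<open>L\<^sup>\<alpha>\<close>; its limit there coincides with the limit in \<open>L\<^sup>p\<close>.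
\<close>

lemma sobolev_W0:
  assumes p: "1 < p" "p \<le> \<alpha>" and th: "DIM('a) * (1 / p - 1 / \<alpha>) < 1"
  shows "\<exists>C\<ge>0. \<forall>u g. W0 p u g \<longrightarrow> u \<in> Lp M \<alpha> \<and> Lp_mod M \<alpha> u \<le> C * Lp_mod M p g powr (\<alpha> / p)"
proof -
  obtain C where C: "C \<ge> 0" "\<And>\<phi>. \<phi> \<in> test_functions \<Omega> \<Longrightarrow> Lp_mod M \<alpha> \<phi> \<le> C * Lp_mod M p (grad \<phi>) powr (\<alpha> / p)"
    using sobolev_test[OF p th] by blast
  have p0: "p > 0" "p \<ge> 0" "\<alpha> > 0" "\<alpha> \<ge> 0" "\<alpha> / p > 0" using p by auto
  have "u \<in> Lp M \<alpha> \<and> Lp_mod M \<alpha> u \<le> C * Lp_mod M p g powr (\<alpha> / p)" if W: "W0 p u g" for u g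
  proof -
    obtain \<phi> where \<phi>': "(\<forall>n::nat. \<phi> n \<in> test_functions \<Omega>) \<and> (\<lambda>n. Lp_mod M p (\<lambda>x. u x - \<phi> n x)) \<longlonglongrightarrow> 0 \<and>
      (\<lambda>n. Lp_mod M p (\<lambda>x. g x - grad (\<phi> n) x)) \<longlonglongrightarrow> 0" using W0_approx[OF W] ..
    note \<phi> = \<phi>'[THEN conjunct1, rule_format] \<phi>'[THEN conjunct2, THEN conjunct1] \<phi>'[THEN conjunct2, THEN conjunct2]
    note L = W0_D[OF W]
    have \<phi>L: "\<phi> n \<in> Lp M p" "grad (\<phi> n) \<in> Lp M p" "\<phi> n \<in> Lp M \<alpha>" for n
      using test_in_Lp[OF \<phi>(1)] p0 by auto
    define a where "a n = Lp_mod M p (\<lambda>x. g x - grad (\<phi> n) x)" for n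
    have Cau: "\<exists>N. \<forall>m\<ge>N. \<forall>n\<ge>N. Lp_mod M \<alpha> (\<lambda>x. \<phi> m x - \<phi> n x) < e" if e: "e > 0" for e
    proof -
      have "(\<lambda>k. 2 powr p * (2 * inverse (real (Suc k)))) \<longlonglongrightarrow> 2 powr p * (2 * 0)"
        by (intro tendsto_mult tendsto_const LIMSEQ_inverse_real_of_nat)
      then have "(\<lambda>k. (2 powr p * (2 * inverse (real (Suc k)))) powr (\<alpha> / p)) \<longlonglongrightarrow> (2 powr p * (2 * 0)) powr (\<alpha> / p)"
        by (rule tendsto_powr'[OF _ tendsto_const]) (use p0 in auto)
      then have "(\<lambda>k. C * (2 powr p * (2 * inverse (real (Suc k)))) powr (\<alpha> / p)) \<longlonglongrightarrow> 0"
        by (intro tendsto_mult_right_zero) simp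
      from order_tendstoD(2)[OF this e] obtain k where k: "C * (2 powr p * (2 * inverse (real (Suc k)))) powr (\<alpha> / p) < e"
        by (auto simp: eventually_sequentially)
      have "0 < inverse (real (Suc k))" by simp
      from order_tendstoD(2)[OF \<phi>(3) this] obtain N where N: "\<And>n. n \<ge> N \<Longrightarrow> a n < inverse (real (Suc k))"
        by (auto simp: eventually_sequentially a_def)
      have "Lp_mod M \<alpha> (\<lambda>x. \<phi> m x - \<phi> n x) < e" if "m \<ge> N" "n \<ge> N" for m n
      proof -
        have "Lp_mod M p (grad (\<lambda>x. \<phi> m x - \<phi> n x)) = Lp_mod M p (\<lambda>x. grad (\<phi> m) x - grad (\<phi> n) x)"
          using test_diff(2)[OF \<phi>(1) \<phi>(1)] by (simp add: Lp_mod_def)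
        also have "\<dots> \<le> 2 powr p * (Lp_mod M p (\<lambda>x. grad (\<phi> m) x - g x) + a n)"
          unfolding a_def by (rule Lp_mod_diff_triangle[OF p0(2) \<phi>L(2) L(2) \<phi>L(2)])
        also have "Lp_mod M p (\<lambda>x. grad (\<phi> m) x - g x) = a m" unfolding a_def by (rule Lp_mod_minus_commute)
        also have "2 powr p * (a m + a n) \<le> 2 powr p * (2 * inverse (real (Suc k)))"
          using N[OF that(1)] N[OF that(2)] by (intro mult_left_mono) auto
        finally have "Lp_mod M p (grad (\<lambda>x. \<phi> m x - \<phi> n x)) powr (\<alpha> / p) \<le> (2 powr p * (2 * inverse (real (Suc k)))) powr (\<alpha> / p)"
          using p0 by (intro powr_mono2) auto
        then have "C * Lp_mod M p (grad (\<lambda>x. \<phi> m x - \<phi> n x)) powr (\<alpha> / p) \<le> C * (2 powr p * (2 * inverse (real (Suc k)))) powr (\<alpha> / p)"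
          using C(1) by (rule mult_left_mono)
        with C(2)[OF test_diff(1)[OF \<phi>(1)[of m] \<phi>(1)[of n]]] k show ?thesis by linarith
      qed
      then show ?thesis by blast
    qed
    obtain h where h: "h \<in> Lp M \<alpha>" "(\<lambda>n. Lp_mod M \<alpha> (\<lambda>x. \<phi> n x - h x)) \<longlonglongrightarrow> 0"
      using Lp_complete[of \<alpha> \<phi>, OF p0(3) \<phi>L(3) Cau] by blast
    have \<phi>2: "(\<lambda>n. Lp_mod M p (\<lambda>x. \<phi> n x - u x)) \<longlonglongrightarrow> 0"
      using \<phi>(2) by (simp add: Lp_mod_minus_commute[of M p u])
    have e: "AE x in M. h x = u x"
      by (rule Lp_limits_AE_eq[OF p0(3) p0(1) Lp_diff(1)[OF p0(4) \<phi>L(3) h(1)] Lp_diff(1)[OF p0(2) \<phi>L(1) L(1)] h(2) \<phi>2])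
    have u: "u \<in> Lp M \<alpha>" "Lp_mod M \<alpha> u = Lp_mod M \<alpha> h" using Lp_cong_AE[OF h(1) LpD(1)[OF L(1)] e] by auto
    have g2: "(\<lambda>n. Lp_mod M p (\<lambda>x. grad (\<phi> n) x - g x)) \<longlonglongrightarrow> 0"
      using \<phi>(3) by (simp add: Lp_mod_minus_commute[of M p g])
    have "(\<lambda>n. Lp_mod M p (grad (\<phi> n))) \<longlonglongrightarrow> Lp_mod M p g"
      by (rule Lp_mod_tendsto[OF finite_M p0(1) L(2) \<phi>L(2) g2])
    then have "(\<lambda>n. Lp_mod M p (grad (\<phi> n)) powr (\<alpha> / p)) \<longlonglongrightarrow> Lp_mod M p g powr (\<alpha> / p)"
      by (rule tendsto_powr'[OF _ tendsto_const]) (use p0 in auto)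
    then have "(\<lambda>n. C * Lp_mod M p (grad (\<phi> n)) powr (\<alpha> / p)) \<longlonglongrightarrow> C * Lp_mod M p g powr (\<alpha> / p)"
      by (rule tendsto_mult[OF tendsto_const])
    from LIMSEQ_le[OF Lp_mod_tendsto[OF finite_M p0(3) h(1) \<phi>L(3) h(2)] this]
    have "Lp_mod M \<alpha> h \<le> C * Lp_mod M p g powr (\<alpha> / p)" using C(2)[OF \<phi>(1)] by blast
    with u show ?thesis by simp
  qed
  then show ?thesis using C(1) by blast
qed

text \<open>
  Each \<open>u n\<close> is replaced by a test function whose gradient is within \<open>1 / (n + 1)\<close> of \<open>g n\<close>. By the Sobolev
  inequality the error tends to \<open>0\<close> in \<open>L\<^sup>\<alpha>\<close>.
\<close>

lemma rellich_W0:
  assumes p: "1 < p" "p \<le> \<alpha>" and th: "DIM('a) * (1 / p - 1 / \<alpha>) < 1"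
    and W: "\<And>n. W0 p (u n) (g n)" and K: "\<And>n. Lp_mod M p (g n) \<le> K"
  shows "\<exists>r v. strict_mono (r :: nat \<Rightarrow> nat) \<and> v \<in> Lp M \<alpha> \<and> (\<lambda>n. Lp_mod M \<alpha> (\<lambda>x. u (r n) x - v x)) \<longlonglongrightarrow> 0"
proof -
  obtain C where C: "C \<ge> 0" "\<And>u g. W0 p u g \<Longrightarrow> u \<in> Lp M \<alpha> \<and> Lp_mod M \<alpha> u \<le> C * Lp_mod M p g powr (\<alpha> / p)"
    using sobolev_W0[OF p th] by blast
  have p0: "p > 0" "p \<ge> 0" "\<alpha> > 0" "\<alpha> \<ge> 0" "\<alpha> / p > 0" using p by auto
  have "\<exists>\<phi>\<in>test_functions \<Omega>. Lp_mod M p (\<lambda>x. g n x - grad \<phi> x) < inverse (real (Suc n))" for n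
  proof -
    obtain \<phi> where \<phi>': "(\<forall>m::nat. \<phi> m \<in> test_functions \<Omega>) \<and> (\<lambda>m. Lp_mod M p (\<lambda>x. u n x - \<phi> m x)) \<longlonglongrightarrow> 0 \<and>
      (\<lambda>m. Lp_mod M p (\<lambda>x. g n x - grad (\<phi> m) x)) \<longlonglongrightarrow> 0" using W0_approx[OF W] ..
    note \<phi> = \<phi>'[THEN conjunct1, rule_format] \<phi>'[THEN conjunct2, THEN conjunct2]
    have "0 < inverse (real (Suc n))" by simp
    from order_tendstoD(2)[OF \<phi>(2) this] show ?thesis using \<phi>(1) by (auto simp: eventually_sequentially)
  qed
  then obtain \<phi> where \<phi>: "\<And>n. \<phi> n \<in> test_functions \<Omega>" "\<And>n. Lp_mod M p (\<lambda>x. g n x - grad (\<phi> n) x) < inverse (real (Suc n))"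
    by metis
  have gL: "grad (\<phi> n) \<in> Lp M p" for n by (rule test_in_Lp(2)[OF \<phi>(1) p0(2)])
  have "Lp_mod M p (grad (\<phi> n)) \<le> 2 powr p * (K + 1)" for n
  proof -
    have d: "(\<lambda>x. grad (\<phi> n) x - g n x) \<in> Lp M p" by (rule Lp_diff(1)[OF p0(2) gL W0_D(2)[OF W]])
    have "Lp_mod M p (grad (\<phi> n)) \<le> 2 powr p * (Lp_mod M p (g n) + Lp_mod M p (\<lambda>x. grad (\<phi> n) x - g n x))"
      using Lp_add(2)[OF p0(2) W0_D(2)[OF W[of n]] d] by simp
    also have "Lp_mod M p (\<lambda>x. grad (\<phi> n) x - g n x) \<le> 1"
      using \<phi>(2)[of n] Lp_mod_minus_commute[of M p "grad (\<phi> n)" "g n"] le_imp_inverse_le[of 1 "real (Suc n)"] by simp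
    finally have "Lp_mod M p (grad (\<phi> n)) \<le> 2 powr p * (Lp_mod M p (g n) + 1)" by simp
    also have "\<dots> \<le> 2 powr p * (K + 1)" using K[of n] by (intro mult_left_mono) auto
    finally show ?thesis .
  qed
  from rellich_test[of p \<alpha> \<phi>, OF p th \<phi>(1) this] obtain r where r': "strict_mono (r :: nat \<Rightarrow> nat) \<and>
    (\<forall>\<epsilon>>0. \<exists>N. \<forall>m\<ge>N. \<forall>n\<ge>N. Lp_mod M \<alpha> (\<lambda>x. \<phi> (r m) x - \<phi> (r n) x) < \<epsilon>)" ..
  note r = r'[THEN conjunct1] r'[THEN conjunct2, rule_format]
  have \<phi>L: "\<phi> n \<in> Lp M \<alpha>" for n by (rule test_in_Lp(1)[OF \<phi>(1) p0(4)])
  obtain v where v: "v \<in> Lp M \<alpha>" "(\<lambda>n. Lp_mod M \<alpha> (\<lambda>x. \<phi> (r n) x - v x)) \<longlonglongrightarrow> 0"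
    using Lp_complete[of \<alpha> "\<lambda>n. \<phi> (r n)", OF p0(3) \<phi>L r(2)] by blast
  have "W0 p (\<lambda>x. u n x - \<phi> n x) (\<lambda>x. g n x - grad (\<phi> n) x)" for n
    using W0_add[OF p0(2) W[of n] W0_test[OF p0(2) \<phi>(1)[of n]], of "-1"] by simp
  from C(2)[OF this] have S: "Lp_mod M \<alpha> (\<lambda>x. u n x - \<phi> n x) \<le> C * Lp_mod M p (\<lambda>x. g n x - grad (\<phi> n) x) powr (\<alpha> / p)" for n by blast
  have "Lp_mod M \<alpha> (\<lambda>x. u n x - \<phi> n x) \<le> C * inverse (real (Suc n)) powr (\<alpha> / p)" for n
    by (rule order_trans[OF S mult_left_mono[OF powr_mono2 C(1)]]) (use \<phi>(2)[of n] p0 in auto)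
  moreover have "(\<lambda>n. C * inverse (real (Suc n)) powr (\<alpha> / p)) \<longlonglongrightarrow> 0"
  proof (rule tendsto_mult_right_zero)
    have "(\<lambda>n. inverse (real (Suc n)) powr (\<alpha> / p)) \<longlonglongrightarrow> 0 powr (\<alpha> / p)"
      by (rule tendsto_powr'[OF LIMSEQ_inverse_real_of_nat tendsto_const]) (use p0 in auto)
    then show "(\<lambda>n. inverse (real (Suc n)) powr (\<alpha> / p)) \<longlonglongrightarrow> 0" by simp
  qed
  ultimately have "(\<lambda>n. Lp_mod M \<alpha> (\<lambda>x. u n x - \<phi> n x)) \<longlonglongrightarrow> 0" by (rule tendsto_zero_le[OF Lp_mod_nonneg])
  from LIMSEQ_subseq_LIMSEQ[OF this r(1)] have u\<phi>: "(\<lambda>n. Lp_mod M \<alpha> (\<lambda>x. u (r n) x - \<phi> (r n) x)) \<longlonglongrightarrow> 0" by (simp add: o_def)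
  have uL: "u n \<in> Lp M \<alpha>" for n using C(2)[OF W] by blast
  have "(\<lambda>n. 2 powr \<alpha> * (Lp_mod M \<alpha> (\<lambda>x. u (r n) x - \<phi> (r n) x) + Lp_mod M \<alpha> (\<lambda>x. \<phi> (r n) x - v x))) \<longlonglongrightarrow> 2 powr \<alpha> * (0 + 0)"
    by (intro tendsto_mult tendsto_const tendsto_add u\<phi> v(2))
  then have "(\<lambda>n. Lp_mod M \<alpha> (\<lambda>x. u (r n) x - v x)) \<longlonglongrightarrow> 0"
    by (intro tendsto_zero_le[OF Lp_mod_nonneg Lp_mod_diff_triangle[OF p0(4) uL \<phi>L v(1)]]) simp
  with r(1) v(1) show ?thesis by blast
qed

text \<open>
  A substitute for weak compactness and weak lower semicontinuity. The sets \<open>S k\<close> of the pairs that are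
  admissible up to an error of \<open>1 / (k + 1)\<close> are nonempty, decreasing in \<open>k\<close> and closed under midpoints.
  Let \<open>d k\<close> be the infimum of the modulars of the gradients in \<open>S k\<close>; these numbers increase to a limit. Gradients
  that nearly attain the infima have midpoints of nearly the same modular, so they form a Cauchy sequence by
  uniform convexity. Its limit is the gradient of \<open>v\<close>, and \<open>\<Psi>\<close> is continuous along it.
\<close>

lemma W0_weak_closure:
  fixes \<Psi> :: "('a \<Rightarrow> 'a) \<Rightarrow> real"
  assumes p: "1 < p"
    and W: "\<And>n. W0 p (u n) (g n)" and K: "\<And>n. Lp_mod M p (g n) \<le> K"
    and v: "v \<in> Lp M p" and lim: "(\<lambda>n. Lp_mod M p (\<lambda>x. u n x - v x)) \<longlonglongrightarrow> 0"
    and conv: "\<And>g h. g \<in> Lp M p \<Longrightarrow> h \<in> Lp M p \<Longrightarrow> \<Psi> (\<lambda>x. (g x + h x) /\<^sub>R 2) \<le> (\<Psi> g + \<Psi> h) / 2"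
    and cont: "\<And>h hn. h \<in> Lp M p \<Longrightarrow> (\<And>n::nat. hn n \<in> Lp M p) \<Longrightarrow> (\<lambda>n. Lp_mod M p (\<lambda>x. hn n x - h x)) \<longlonglongrightarrow> 0 \<Longrightarrow> (\<lambda>n. \<Psi> (hn n)) \<longlonglongrightarrow> \<Psi> h"
    and bound: "\<And>e. e > 0 \<Longrightarrow> \<exists>N. \<forall>n\<ge>N. \<Psi> (g n) \<le> l + e"
  shows "\<exists>h. W0 p v h \<and> \<Psi> h \<le> l"
proof -
  have p0: "p > 0" "p \<ge> 0" "p \<ge> 1" using p by auto
  define i where "i k = inverse (real (Suc k))" for k :: nat
  have i0: "i k > 0" for k by (simp add: i_def)
  have ilim: "i \<longlonglongrightarrow> 0" unfolding i_def[abs_def] by (rule LIMSEQ_inverse_real_of_nat)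
  have imono: "i j \<le> i k" if "k \<le> j" for j k using that by (simp add: i_def field_simps)
  define S where "S k w h \<longleftrightarrow> W0 p w h \<and> Lp_mod M p (\<lambda>x. w x - v x) \<le> i k \<and> \<Psi> h \<le> l + i k \<and> Lp_mod M p h \<le> K" for k w h
  have Smono: "S k w h" if "S j w h" "k \<le> j" for j k w h using that imono[OF that(2)] unfolding S_def by fastforce
  have Smid: "S k (\<lambda>x. (w x + w' x) / 2) (\<lambda>x. (h x + h' x) /\<^sub>R 2)" if "S k w h" "S k w' h'" for k w h w' h'
  proof -
    have Ws: "W0 p w h" "W0 p w' h'" using that by (auto simp: S_def)
    have W': "W0 p (\<lambda>x. (w x + w' x) / 2) (\<lambda>x. (h x + h' x) /\<^sub>R 2)"
    proof -
      have e: "(\<lambda>x. inverse 2 * (w x + 1 * w' x)) = (\<lambda>x. (w x + w' x) / 2)"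
        by (rule ext) (simp only: divide_inverse mult.commute mult_1_left)
      have e': "(\<lambda>x. inverse 2 *\<^sub>R (h x + 1 *\<^sub>R h' x)) = (\<lambda>x. (h x + h' x) /\<^sub>R 2)"
        by (rule ext) (simp only: scaleR_one)
      from W0_scale[OF p0(2) W0_add[OF p0(2) Ws, of 1], of "inverse 2"] show ?thesis unfolding e e' .
    qed
    have d: "(\<lambda>x. w x - v x) \<in> Lp M p" "(\<lambda>x. w' x - v x) \<in> Lp M p"
      using Lp_diff(1)[OF p0(2) W0_D(1)[OF Ws(1)] v] Lp_diff(1)[OF p0(2) W0_D(1)[OF Ws(2)] v] by auto
    have "Lp_mod M p (\<lambda>x. (w x + w' x) / 2 - v x) = Lp_mod M p (\<lambda>x. ((w x - v x) + (w' x - v x)) /\<^sub>R 2)"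
      by (simp add: Lp_mod_def field_simps)
    also have "\<dots> \<le> (Lp_mod M p (\<lambda>x. w x - v x) + Lp_mod M p (\<lambda>x. w' x - v x)) / 2"
      by (rule Lp_powr_gap(4)[OF p d])
    also have "\<dots> \<le> i k" using that by (simp add: S_def)
    finally have 1: "Lp_mod M p (\<lambda>x. (w x + w' x) / 2 - v x) \<le> i k" .
    have 2: "\<Psi> (\<lambda>x. (h x + h' x) /\<^sub>R 2) \<le> l + i k"
      using conv[OF W0_D(2)[OF Ws(1)] W0_D(2)[OF Ws(2)]] that unfolding S_def by argo
    have 3: "Lp_mod M p (\<lambda>x. (h x + h' x) /\<^sub>R 2) \<le> K"
      using Lp_powr_gap(4)[OF p W0_D(2)[OF Ws(1)] W0_D(2)[OF Ws(2)]] that unfolding S_def by argo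
    show ?thesis unfolding S_def using W' 1 2 3 by blast
  qed
  have Sne: "\<exists>n. S k (u n) (g n)" for k
  proof -
    obtain N1 where N1: "\<And>n. n \<ge> N1 \<Longrightarrow> Lp_mod M p (\<lambda>x. u n x - v x) < i k"
      using order_tendstoD(2)[OF lim i0[of k]] by (auto simp: eventually_sequentially)
    obtain N2 where N2: "\<And>n. n \<ge> N2 \<Longrightarrow> \<Psi> (g n) \<le> l + i k" using bound[OF i0[of k]] by blast
    have "S k (u (max N1 N2)) (g (max N1 N2))"
      unfolding S_def using W K N1[of "max N1 N2"] N2[of "max N1 N2"] by (simp add: less_imp_le)
    then show ?thesis by blast
  qed
  define A where "A k = {Lp_mod M p h | w h. S k w h}" for k
  define d where "d k = Inf (A k)" for k
  have Abdd: "bdd_below (A k)" for k unfolding A_def by (rule bdd_belowI[of _ 0]) auto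
  have Ane: "A k \<noteq> {}" for k using Sne[of k] unfolding A_def by blast
  have dle: "d k \<le> Lp_mod M p h" if "S k w h" for k w h
    unfolding d_def by (rule cInf_lower[OF _ Abdd]) (use that in \<open>auto simp: A_def\<close>)
  have dmono: "incseq d"
  proof (rule incseq_SucI)
    fix k show "d k \<le> d (Suc k)"
      unfolding d_def by (rule cInf_superset_mono[OF Ane Abdd]) (use Smono[of "Suc k" _ _ k] in \<open>auto simp: A_def\<close>)
  qed
  have "\<exists>w h. S k w h \<and> Lp_mod M p h < d k + i k" for k
  proof -
    have "\<exists>y\<in>A k. y < d k + i k"
      unfolding d_def by (rule cInf_lessD[OF Ane]) (simp add: i0)
    then show ?thesis unfolding A_def by blast
  qed
  then obtain w h where wh: "\<And>k. S k (w k) (h k)" "\<And>k. Lp_mod M p (h k) < d k + i k" by metis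
  have Wwh: "W0 p (w k) (h k)" for k using wh(1)[of k] by (simp add: S_def)
  note hL = W0_D(2)[OF Wwh] and wL = W0_D(1)[OF Wwh]
  have hK: "Lp_mod M p (h k) \<le> K" for k using wh(1)[of k] by (simp add: S_def)
  have "d k \<le> K" for k using dle[OF wh(1)[of k]] hK[of k] by linarith
  then obtain D where D: "d \<longlonglongrightarrow> D" "\<And>k. d k \<le> D" using incseq_convergent[OF dmono] by blast
  have Cau: "\<exists>N. \<forall>m\<ge>N. \<forall>n\<ge>N. Lp_mod M p (\<lambda>x. h m x - h n x) < e" if e: "e > 0" for e
  proof -
    define e' where "e' = e / (4 * (\<bar>K\<bar> + 1))"
    have e': "e' > 0" using e by (simp add: e'_def)
    obtain C where C: "C \<ge> 0" "\<And>x y::'a. norm (x - y) powr p \<le> e' * (norm x powr p + norm y powr p) + C * powr_gap p x y"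
      using norm_powr_uniform_convexity[OF p e'] by blast
    define \<delta> where "\<delta> = e / (8 * (C + 1))"
    have \<delta>: "\<delta> > 0" "C * (2 * \<delta>) < e / 2"
    proof -
      show "\<delta> > 0" using e C(1) by (simp add: \<delta>_def)
      then have "C * (2 * \<delta>) \<le> (C + 1) * (2 * \<delta>)" by (intro mult_right_mono) auto
      also have "\<dots> = e / 4" using C(1) by (simp add: \<delta>_def field_simps)
      finally show "C * (2 * \<delta>) < e / 2" using e by simp
    qed
    have "\<forall>\<^sub>F k in sequentially. D - \<delta> < d k \<and> i k < \<delta>"
      by (intro eventually_conj order_tendstoD(1)[OF D(1)] order_tendstoD(2)[OF ilim]) (use \<delta> in auto)
    then obtain N where N: "\<And>k. k \<ge> N \<Longrightarrow> D - \<delta> < d k \<and> i k < \<delta>" by (auto simp: eventually_sequentially)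
    have "Lp_mod M p (\<lambda>x. h m x - h n x) < e" if mn: "m \<ge> N" "n \<ge> N" for m n
    proof -
      note gap = Lp_powr_gap[OF p hL[of m] hL[of n]]
      have "S N (\<lambda>x. (w m x + w n x) / 2) (\<lambda>x. (h m x + h n x) /\<^sub>R 2)"
        using Smid[OF Smono[OF wh(1) mn(1)] Smono[OF wh(1) mn(2)]] .
      from dle[OF this] have "D - \<delta> < Lp_mod M p (\<lambda>x. (h m x + h n x) /\<^sub>R 2)" using N[of N] by simp
      moreover have "Lp_mod M p (h m) < D + \<delta>" "Lp_mod M p (h n) < D + \<delta>"
        using wh(2)[of m] wh(2)[of n] D(2)[of m] D(2)[of n] N[OF mn(1)] N[OF mn(2)] by linarith+
      ultimately have small: "(LINT x|M. powr_gap p (h m x) (h n x)) \<le> 2 * \<delta>" unfolding gap(3) by argo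
      have i: "integrable M (\<lambda>x. norm (h m x) powr p)" "integrable M (\<lambda>x. norm (h n x) powr p)"
        using hL by (auto simp: Lp_def)
      have "Lp_mod M p (\<lambda>x. h m x - h n x) \<le> (LINT x|M. e' * (norm (h m x) powr p + norm (h n x) powr p) + C * powr_gap p (h m x) (h n x))"
        unfolding Lp_mod_def using Lp_diff(1)[OF p0(2) hL[of m] hL[of n]] C(2) i gap(2)
        by (intro integral_mono) (auto simp: Lp_def)
      also have "\<dots> = e' * (Lp_mod M p (h m) + Lp_mod M p (h n)) + C * (LINT x|M. powr_gap p (h m x) (h n x))"
        using i gap(2) by (simp add: Lp_mod_def)
      also have "\<dots> \<le> e' * (2 * (\<bar>K\<bar> + 1)) + C * (2 * \<delta>)"
        using hK[of m] hK[of n] e' C(1) small by (intro add_mono mult_left_mono) auto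
      also have "e' * (2 * (\<bar>K\<bar> + 1)) = e / 2" by (simp add: e'_def field_simps)
      finally show ?thesis using \<delta>(2) by simp
    qed
    then show ?thesis by blast
  qed
  obtain g0 where g0: "g0 \<in> Lp M p" "(\<lambda>n. Lp_mod M p (\<lambda>x. h n x - g0 x)) \<longlonglongrightarrow> 0"
    using Lp_complete[of p h, OF p0(1) hL Cau] by blast
  have "Lp_mod M p (\<lambda>x. w k x - v x) \<le> i k" for k using wh(1)[of k] by (simp add: S_def)
  then have wlim: "(\<lambda>k. Lp_mod M p (\<lambda>x. w k x - v x)) \<longlonglongrightarrow> 0"
    using ilim by (rule tendsto_zero_le[OF Lp_mod_nonneg])
  have "W0 p v g0"
    by (rule W0_closed[OF p0(2) Wwh v g0(1)])
       (use wlim g0(2) in \<open>simp_all add: Lp_mod_minus_commute[of M p v] Lp_mod_minus_commute[of M p g0]\<close>)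
  moreover have "\<Psi> g0 \<le> l"
  proof (rule LIMSEQ_le)
    show "(\<lambda>n. \<Psi> (h n)) \<longlonglongrightarrow> \<Psi> g0" by (rule cont[OF g0(1) hL g0(2)])
    show "(\<lambda>n. l + i n) \<longlonglongrightarrow> l" using tendsto_add[OF tendsto_const[of l] ilim] by simp
    show "\<exists>N. \<forall>n\<ge>N. \<Psi> (h n) \<le> l + i n" using wh(1) by (auto simp: S_def)
  qed
  ultimately show ?thesis by blast
qed

end

section \<open>Convex functionals and their behaviour along rays\<close>

text \<open>
  Here \<open>V\<close> is the gradient of \<open>\<Gamma>\<close>, and \<open>f\<close> is the derivative of \<open>F\<close>. The derivatives enter through the
  tangent inequalities \<open>\<Gamma>_convex\<close> and \<open>F_convex\<close>. The conditions \<open>\<Gamma>_dilate\<close> and \<open>F_dilate\<close> are tangent inequalities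
  at \<open>t = 1\<close> in the variable \<open>t powr p\<close>, for which \<open>\<Gamma> (t *\<^sub>R x)\<close> is concave and \<open>F (t * s)\<close> is strictly
  convex.
\<close>

locale variational = bounded_domain \<Omega> for \<Omega> :: "'a::euclidean_space set" +
  fixes p q \<alpha> k K :: real and \<Gamma> :: "'a \<Rightarrow> real" and V :: "'a \<Rightarrow> 'a" and F f :: "real \<Rightarrow> real"
  assumes q: "1 < q" "q \<le> p" and \<alpha>: "p < \<alpha>" "DIM('a) * (1 / p - 1 / \<alpha>) < 1" and kK: "k > 0" "K > 0"
    and \<Gamma>_cont: "continuous_on UNIV \<Gamma>" and V_cont: "continuous_on UNIV V"
    and \<Gamma>_lower: "\<And>x. k * (norm x powr p + norm x powr q) \<le> \<Gamma> x"
    and \<Gamma>_upper: "\<And>x. \<Gamma> x \<le> K * (norm x powr p + norm x powr q)"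
    and \<Gamma>_convex: "\<And>x y. \<Gamma> x + V x \<bullet> (y - x) \<le> \<Gamma> y"
    and \<Gamma>_mono: "\<And>x y. norm x \<le> norm y \<Longrightarrow> \<Gamma> x \<le> \<Gamma> y"
    and V_growth: "\<And>x. norm (V x) powr (p / (p - 1)) \<le> K * (1 + norm x powr p)"
    and \<Gamma>_dilate: "\<And>t x. t > 0 \<Longrightarrow> \<Gamma> (t *\<^sub>R x) - \<Gamma> x \<le> (t powr p - 1) / p * (V x \<bullet> x)"
    and F_cont: "continuous_on UNIV F" and f_cont: "continuous_on UNIV f"
    and F_0: "F 0 = 0" and F_even: "\<And>s. F (- s) = F s" and f_0: "f 0 = 0"
    and F_convex: "\<And>s t. F s + f s * (t - s) \<le> F t"
    and F_small: "\<And>e. e > 0 \<Longrightarrow> \<exists>C. \<forall>t. F t \<le> e * \<bar>t\<bar> powr q + C * \<bar>t\<bar> powr \<alpha>"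
    and F_large: "\<And>L. \<exists>C. \<forall>t. L * \<bar>t\<bar> powr p - C \<le> F t"
    and f_growth: "\<And>t. \<bar>f t\<bar> powr (\<alpha> / (\<alpha> - 1)) \<le> K * (1 + \<bar>t\<bar> powr \<alpha>)"
    and F_growth: "\<And>t. F t \<le> K * (1 + \<bar>t\<bar> powr \<alpha>)"
    and F_dilate: "\<And>t s. t > 0 \<Longrightarrow> t \<noteq> 1 \<Longrightarrow> s \<noteq> 0 \<Longrightarrow> (t powr p - 1) / p * (f s * s) < F (t * s) - F s"
begin

lemma exponents: "p > 1" "p > 0" "p \<ge> 0" "p \<ge> 1" "\<alpha> > 1" "\<alpha> > 0" "\<alpha> \<ge> 0" "p \<le> \<alpha>" "q > 0"
    "p / (p - 1) > 1" "\<alpha> / (\<alpha> - 1) > 1" "p / (p - 1) > 0" "\<alpha> / (\<alpha> - 1) > 0"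
    "1 / p + 1 / (p / (p - 1)) = 1" "1 / \<alpha> + 1 / (\<alpha> / (\<alpha> - 1)) = 1"
    "1 / (p / (p - 1)) + 1 / p = 1" "1 / (\<alpha> / (\<alpha> - 1)) + 1 / \<alpha> = 1"
  using q \<alpha> by (auto simp: field_simps)

text \<open>
  The pair \<open>(u, g)\<close> consists of a function and its gradient; \<open>DP g h - DQ u v\<close> is the derivative of \<open>\<Phi>\<close> at
  \<open>(u, g)\<close> in the direction \<open>(v, h)\<close>.
\<close>

definition P :: "('a \<Rightarrow> 'a) \<Rightarrow> real" where "P g = (LINT x|M. \<Gamma> (g x))"
definition Q :: "('a \<Rightarrow> real) \<Rightarrow> real" where "Q u = (LINT x|M. F (u x))"
definition DP :: "('a \<Rightarrow> 'a) \<Rightarrow> ('a \<Rightarrow> 'a) \<Rightarrow> real" where "DP g h = (LINT x|M. V (g x) \<bullet> h x)"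
definition DQ :: "('a \<Rightarrow> real) \<Rightarrow> ('a \<Rightarrow> real) \<Rightarrow> real" where "DQ u v = (LINT x|M. f (u x) * v x)"
definition \<Phi> :: "('a \<Rightarrow> real) \<Rightarrow> ('a \<Rightarrow> 'a) \<Rightarrow> real" where "\<Phi> u g = P g - Q u"

lemma powr_le_1_add: "0 \<le> s \<Longrightarrow> s powr q \<le> 1 + s powr p" for s :: real
  using powr_le_small_add[of s 1 q p] q by simp

lemma \<Gamma>_nonneg: "0 \<le> \<Gamma> x"
  using order_trans[OF _ \<Gamma>_lower[of x]] kK by simp

lemma F_nonneg: "0 \<le> F t"
  using F_convex[of 0 t] by (simp add: F_0 f_0)

lemma \<Gamma>_growth: "norm (\<Gamma> x) powr 1 \<le> (2 * K) * (1 + norm x powr p)"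
proof -
  have "\<Gamma> x \<le> K * (norm x powr p + (1 + norm x powr p))"
    by (rule order_trans[OF \<Gamma>_upper mult_left_mono]) (use powr_le_1_add[of "norm x"] kK in auto)
  also have "\<dots> \<le> (2 * K) * (1 + norm x powr p)" using kK by (simp add: algebra_simps)
  finally show ?thesis using \<Gamma>_nonneg[of x] by simp
qed

lemma Lp1_integrable: "u \<in> Lp M 1 \<Longrightarrow> integrable M u" for u :: "'a \<Rightarrow> real"
  by (rule Lp_integrable[of 1]) auto

lemma integrable_\<Gamma>: "g \<in> Lp M p \<Longrightarrow> integrable M (\<lambda>x. \<Gamma> (g x))"
  by (rule Lp1_integrable, rule Nemytskii_Lp[OF finite_M \<Gamma>_cont \<Gamma>_growth])

lemma integrable_F: "u \<in> Lp M \<alpha> \<Longrightarrow> integrable M (\<lambda>x. F (u x))"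
  by (rule Lp1_integrable, rule Nemytskii_Lp[OF finite_M F_cont]) (use F_growth F_nonneg in auto)

lemma V_Lp: "g \<in> Lp M p \<Longrightarrow> (\<lambda>x. V (g x)) \<in> Lp M (p / (p - 1))"
  by (rule Nemytskii_Lp[OF finite_M V_cont V_growth])

lemma f_Lp: "u \<in> Lp M \<alpha> \<Longrightarrow> (\<lambda>x. f (u x)) \<in> Lp M (\<alpha> / (\<alpha> - 1))"
  by (rule Nemytskii_Lp[OF finite_M f_cont]) (use f_growth in auto)

lemma inner_Holder:
  fixes v :: "'a \<Rightarrow> 'b::euclidean_space"
  assumes "1 < r" "1 < s" "1 / r + 1 / s = 1" "v \<in> Lp M r" "h \<in> Lp M s"
  shows "integrable M (\<lambda>x. v x \<bullet> h x)"
    "\<bar>LINT x|M. v x \<bullet> h x\<bar> \<le> Lp_mod M r v powr (1 / r) * Lp_mod M s h powr (1 / s)"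
proof -
  note H = Holder_modular[OF assms]
  show i: "integrable M (\<lambda>x. v x \<bullet> h x)"
    by (rule Bochner_Integration.integrable_bound[OF H(1)])
       (use assms Cauchy_Schwarz_ineq2 in \<open>auto simp: Lp_def intro!: AE_I2 borel_measurable_inner\<close>)
  have "\<bar>LINT x|M. v x \<bullet> h x\<bar> \<le> (LINT x|M. \<bar>v x \<bullet> h x\<bar>)"
    using integral_norm_bound[of M "\<lambda>x. v x \<bullet> h x"] by simp
  also have "\<dots> \<le> (LINT x|M. norm (v x) * norm (h x))"
    using i H(1) by (intro integral_mono Cauchy_Schwarz_ineq2) auto
  also note H(2)
  finally show "\<bar>LINT x|M. v x \<bullet> h x\<bar> \<le> Lp_mod M r v powr (1 / r) * Lp_mod M s h powr (1 / s)" .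
qed

lemma DP_integrable: "g \<in> Lp M p \<Longrightarrow> h \<in> Lp M p \<Longrightarrow> integrable M (\<lambda>x. V (g x) \<bullet> h x)"
  by (rule inner_Holder(1)[OF exponents(10,1,16) V_Lp])

lemma DQ_integrable: "u \<in> Lp M \<alpha> \<Longrightarrow> v \<in> Lp M \<alpha> \<Longrightarrow> integrable M (\<lambda>x. f (u x) * v x)"
  using inner_Holder(1)[OF exponents(11,5,17) f_Lp] by simp

lemma P_tendsto:
  assumes "h \<in> Lp M p" "\<And>n. hn n \<in> Lp M p" "(\<lambda>n. Lp_mod M p (\<lambda>x. hn n x - h x)) \<longlonglongrightarrow> 0"
  shows "(\<lambda>n. P (hn n)) \<longlonglongrightarrow> P h"
proof -
  have lim: "(\<lambda>n. Lp_mod M 1 (\<lambda>x. \<Gamma> (hn n x) - \<Gamma> (h x))) \<longlonglongrightarrow> 0"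
    by (rule Nemytskii_continuous[OF finite_M exponents(2) zero_less_one \<Gamma>_cont \<Gamma>_growth assms])
  have le: "\<bar>P (hn n) - P h\<bar> \<le> Lp_mod M 1 (\<lambda>x. \<Gamma> (hn n x) - \<Gamma> (h x))" for n
    using integral_norm_bound[of M "\<lambda>x. \<Gamma> (hn n x) - \<Gamma> (h x)"] integrable_\<Gamma>[OF assms(1)] integrable_\<Gamma>[OF assms(2)]
    by (simp add: P_def Lp_mod_def)
  have "(\<lambda>n. \<bar>P (hn n) - P h\<bar>) \<longlonglongrightarrow> 0" by (rule tendsto_zero_le[OF abs_ge_zero le lim])
  then show ?thesis by (simp add: tendsto_rabs_zero_iff LIM_zero_iff)
qed

lemma Q_tendsto:
  assumes "u \<in> Lp M \<alpha>" "\<And>n. un n \<in> Lp M \<alpha>" "(\<lambda>n. Lp_mod M \<alpha> (\<lambda>x. un n x - u x)) \<longlonglongrightarrow> 0"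
  shows "(\<lambda>n. Q (un n)) \<longlonglongrightarrow> Q u"
proof -
  have g: "norm (F t) powr 1 \<le> K * (1 + norm t powr \<alpha>)" for t using F_growth[of t] F_nonneg[of t] by simp
  have lim: "(\<lambda>n. Lp_mod M 1 (\<lambda>x. F (un n x) - F (u x))) \<longlonglongrightarrow> 0"
    by (rule Nemytskii_continuous[OF finite_M exponents(6) zero_less_one F_cont g assms])
  have le: "\<bar>Q (un n) - Q u\<bar> \<le> Lp_mod M 1 (\<lambda>x. F (un n x) - F (u x))" for n
    using integral_norm_bound[of M "\<lambda>x. F (un n x) - F (u x)"] integrable_F[OF assms(1)] integrable_F[OF assms(2)]
    by (simp add: Q_def Lp_mod_def)
  have "(\<lambda>n. \<bar>Q (un n) - Q u\<bar>) \<longlonglongrightarrow> 0" by (rule tendsto_zero_le[OF abs_ge_zero le lim])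
  then show ?thesis by (simp add: tendsto_rabs_zero_iff LIM_zero_iff)
qed

lemma P_convex:
  assumes "g \<in> Lp M p" "h \<in> Lp M p"
  shows "P g + DP g (\<lambda>x. h x - g x) \<le> P h"
proof -
  have d: "(\<lambda>x. h x - g x) \<in> Lp M p" using Lp_diff(1)[OF exponents(3) assms(2,1)] .
  have "P g + DP g (\<lambda>x. h x - g x) = (LINT x|M. \<Gamma> (g x) + V (g x) \<bullet> (h x - g x))"
    using integrable_\<Gamma>[OF assms(1)] DP_integrable[OF assms(1) d] by (simp add: P_def DP_def)
  also have "\<dots> \<le> P h"
    unfolding P_def by (intro integral_mono integrable_\<Gamma> assms \<Gamma>_convex Bochner_Integration.integrable_add DP_integrable d)
  finally show ?thesis .
qed

lemma Q_convex:
  assumes "u \<in> Lp M \<alpha>" "v \<in> Lp M \<alpha>"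
  shows "Q u + DQ u (\<lambda>x. v x - u x) \<le> Q v"
proof -
  have d: "(\<lambda>x. v x - u x) \<in> Lp M \<alpha>" using Lp_diff(1)[OF exponents(7) assms(2,1)] .
  have "Q u + DQ u (\<lambda>x. v x - u x) = (LINT x|M. F (u x) + f (u x) * (v x - u x))"
    using integrable_F[OF assms(1)] DQ_integrable[OF assms(1) d] by (simp add: Q_def DQ_def)
  also have "\<dots> \<le> Q v"
    unfolding Q_def by (intro integral_mono integrable_F assms F_convex Bochner_Integration.integrable_add DQ_integrable d)
  finally show ?thesis .
qed

lemma P_midpoint:
  assumes "g \<in> Lp M p" "h \<in> Lp M p" shows "P (\<lambda>x. (g x + h x) /\<^sub>R 2) \<le> (P g + P h) / 2"
proof -
  have m: "(\<lambda>x. (g x + h x) /\<^sub>R 2) \<in> Lp M p" by (rule Lp_powr_gap(1)[OF exponents(1) assms])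
  have "\<Gamma> ((x + y) /\<^sub>R 2) \<le> (\<Gamma> x + \<Gamma> y) / 2" for x y
  proof -
    have "x - (x + y) /\<^sub>R 2 = (x - y) /\<^sub>R 2" "y - (x + y) /\<^sub>R 2 = - ((x - y) /\<^sub>R 2)"
      by (rule euclidean_eqI, simp add: inner_diff_left inner_add_left field_simps)+
    then show ?thesis
      using \<Gamma>_convex[of "(x + y) /\<^sub>R 2" x] \<Gamma>_convex[of "(x + y) /\<^sub>R 2" y] by simp
  qed
  then have "P (\<lambda>x. (g x + h x) /\<^sub>R 2) \<le> (LINT x|M. (\<Gamma> (g x) + \<Gamma> (h x)) / 2)"
    unfolding P_def using integrable_\<Gamma> assms m by (intro integral_mono) auto
  also have "\<dots> = (P g + P h) / 2" using integrable_\<Gamma> assms by (simp add: P_def)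
  finally show ?thesis .
qed

lemma W0_Lalpha: "W0 p u g \<Longrightarrow> u \<in> Lp M \<alpha>"
  using sobolev_W0[OF exponents(1,8) \<alpha>(2)] by blast

text \<open>
  The Sobolev inequality with \<open>\<alpha> = p\<close>.
\<close>

lemma poincare: "\<exists>C\<ge>0. \<forall>u g. W0 p u g \<longrightarrow> Lp_mod M p u \<le> C * Lp_mod M p g"
  using sobolev_W0[of p p] exponents by force

lemma nontrivial_gradient: "W0 p u g \<Longrightarrow> Lp_mod M p u > 0 \<Longrightarrow> Lp_mod M p g > 0"
  using poincare Lp_mod_nonneg[of M p g] by (metis linorder_not_le mult_not_zero order_antisym_conv)

lemma scaled: "W0 p u g \<Longrightarrow> W0 p (\<lambda>x. t * u x) (\<lambda>x. t *\<^sub>R g x)"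
  by (rule W0_scale[OF exponents(3)])

text \<open>
  The conditions on dilations integrate to the tangent inequality of \<open>\<Phi>\<close> as a strictly concave function of
  \<open>t powr p\<close> along a ray. If \<open>DP g g = DQ u u\<close>, the ray has its maximum at \<open>t = 1\<close>. Strictness comes from \<open>Q\<close>,
  on the set where \<open>u\<close> does not vanish.
\<close>

lemma ray_le:
  assumes W: "W0 p u g" and t: "t > 0"
  shows "\<Phi> (\<lambda>x. t * u x) (\<lambda>x. t *\<^sub>R g x) \<le> \<Phi> u g + (t powr p - 1) / p * (DP g g - DQ u u)"
    and "Lp_mod M p u > 0 \<Longrightarrow> t \<noteq> 1 \<Longrightarrow>
      \<Phi> (\<lambda>x. t * u x) (\<lambda>x. t *\<^sub>R g x) < \<Phi> u g + (t powr p - 1) / p * (DP g g - DQ u u)"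
proof -
  define s where "s = (t powr p - 1) / p"
  note g = W0_D(2)[OF W] and u = W0_Lalpha[OF W]
  note tg = W0_D(2)[OF scaled[OF W, of t]] and tu = W0_Lalpha[OF scaled[OF W, of t]]
  have "P (\<lambda>x. t *\<^sub>R g x) - P g = (LINT x|M. \<Gamma> (t *\<^sub>R g x) - \<Gamma> (g x))"
    unfolding P_def using integrable_\<Gamma>[OF g] integrable_\<Gamma>[OF tg] by simp
  also have "\<dots> \<le> (LINT x|M. s * (V (g x) \<bullet> g x))"
    unfolding s_def using integrable_\<Gamma>[OF g] integrable_\<Gamma>[OF tg] DP_integrable[OF g g] \<Gamma>_dilate[OF t]
    by (intro integral_mono) auto
  finally have 1: "P (\<lambda>x. t *\<^sub>R g x) - P g \<le> s * DP g g" by (simp add: DP_def)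
  have le: "0 \<le> F (t * y) - F y - s * (f y * y)" for y
    using F_dilate[OF t, of y] unfolding s_def by (cases "y = 0 \<or> t = 1") (auto simp: F_0 f_0)
  have i: "integrable M (\<lambda>x. F (t * u x) - F (u x) - s * (f (u x) * u x))"
    using integrable_F[OF u] integrable_F[OF tu] DQ_integrable[OF u u] by simp
  have 2: "Q (\<lambda>x. t * u x) - Q u - s * DQ u u = (LINT x|M. F (t * u x) - F (u x) - s * (f (u x) * u x))"
    unfolding Q_def DQ_def using integrable_F[OF u] integrable_F[OF tu] DQ_integrable[OF u u] by simp
  have 3: "0 \<le> Q (\<lambda>x. t * u x) - Q u - s * DQ u u" unfolding 2 using le by simp
  have e: "s * (DP g g - DQ u u) = s * DP g g - s * DQ u u" by (rule right_diff_distrib)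
  show "\<Phi> (\<lambda>x. t * u x) (\<lambda>x. t *\<^sub>R g x) \<le> \<Phi> u g + (t powr p - 1) / p * (DP g g - DQ u u)"
    unfolding s_def[symmetric] e \<Phi>_def using 1 3 by linarith
  assume nt: "Lp_mod M p u > 0" and t1: "t \<noteq> 1"
  have "Q (\<lambda>x. t * u x) - Q u - s * DQ u u \<noteq> 0"
  proof
    assume "Q (\<lambda>x. t * u x) - Q u - s * DQ u u = 0"
    then have "AE x in M. F (t * u x) - F (u x) - s * (f (u x) * u x) = 0"
      unfolding 2 using integral_nonneg_eq_0_iff_AE[OF i] le by simp
    then have "AE x in M. norm (u x) powr p = 0"
    proof eventually_elim
      case (elim x) then show ?case using F_dilate[OF t t1, of "u x"] unfolding s_def by (cases "u x = 0") auto
    qed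
    then have "Lp_mod M p u = 0" unfolding Lp_mod_def by (rule integral_eq_zero_AE)
    with nt show False by simp
  qed
  then show "\<Phi> (\<lambda>x. t * u x) (\<lambda>x. t *\<^sub>R g x) < \<Phi> u g + (t powr p - 1) / p * (DP g g - DQ u u)"
    unfolding s_def[symmetric] e \<Phi>_def using 1 3 by linarith
qed

lemma P_lower: "g \<in> Lp M p \<Longrightarrow> k * (Lp_mod M p g + Lp_mod M q g) \<le> P g"
proof -
  assume g: "g \<in> Lp M p"
  have gq: "g \<in> Lp M q" by (rule Lp_lower_exponent(1)[OF finite_M exponents(9) q(2) g])
  have "k * (Lp_mod M p g + Lp_mod M q g) = (LINT x|M. k * (norm (g x) powr p + norm (g x) powr q))"
    using g gq by (simp add: Lp_def Lp_mod_def)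
  also have "\<dots> \<le> P g"
    unfolding P_def using g gq \<Gamma>_lower integrable_\<Gamma>[OF g] by (intro integral_mono) (auto simp: Lp_def)
  finally show ?thesis .
qed

lemma P_upper: "g \<in> Lp M p \<Longrightarrow> P g \<le> K * (Lp_mod M p g + Lp_mod M q g)"
proof -
  assume g: "g \<in> Lp M p"
  have gq: "g \<in> Lp M q" by (rule Lp_lower_exponent(1)[OF finite_M exponents(9) q(2) g])
  have "P g \<le> (LINT x|M. K * (norm (g x) powr p + norm (g x) powr q))"
    unfolding P_def using g gq \<Gamma>_upper integrable_\<Gamma>[OF g] by (intro integral_mono) (auto simp: Lp_def)
  also have "\<dots> = K * (Lp_mod M p g + Lp_mod M q g)" using g gq by (simp add: Lp_def Lp_mod_def)
  finally show ?thesis .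
qed

lemma Q_le:
  assumes e: "\<And>t. F t \<le> e * \<bar>t\<bar> powr q + C * \<bar>t\<bar> powr \<alpha>" and W: "W0 p u g"
  shows "Q u \<le> e * Lp_mod M q u + C * Lp_mod M \<alpha> u"
proof -
  note u = W0_Lalpha[OF W]
  have uq: "u \<in> Lp M q" by (rule Lp_lower_exponent(1)[OF finite_M exponents(9) _ u]) (use q \<alpha> in simp)
  have "Q u \<le> (LINT x|M. e * \<bar>u x\<bar> powr q + C * \<bar>u x\<bar> powr \<alpha>)"
    unfolding Q_def using e integrable_F[OF u] u uq by (intro integral_mono) (auto simp: Lp_def)
  also have "\<dots> = e * Lp_mod M q u + C * Lp_mod M \<alpha> u"
    using u uq by (simp add: Lp_def Lp_mod_def)
  finally show ?thesis .
qed

text \<open>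
  The part of \<open>Q\<close> with exponent \<open>q\<close> is absorbed by the corresponding part of \<open>P\<close> through the Poincare
  inequality for \<open>q\<close>. The part with exponent \<open>\<alpha>\<close> is by the Sobolev inequality of higher order than the modular of \<open>g\<close>,
  since \<open>\<alpha> > p\<close>.
\<close>

lemma mountain:
  obtains \<kappa> \<rho> where "\<kappa> > 0" "\<rho> > 0" "\<And>u g. W0 p u g \<Longrightarrow> Lp_mod M p g = \<rho> \<Longrightarrow> \<kappa> \<le> \<Phi> u g"
proof -
  obtain Cq where Cq: "Cq \<ge> 0" "\<And>u g. W0 q u g \<Longrightarrow> Lp_mod M q u \<le> Cq * Lp_mod M q g"
    using sobolev_W0[of q q] q by force
  obtain Ca where Ca: "Ca \<ge> 0" "\<And>u g. W0 p u g \<Longrightarrow> Lp_mod M \<alpha> u \<le> Ca * Lp_mod M p g powr (\<alpha> / p)"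
    using sobolev_W0[OF exponents(1,8) \<alpha>(2)] by blast
  define e where "e = k / (Cq + 1)"
  have e: "e > 0" "e * Cq \<le> k" using kK Cq(1) by (auto simp: e_def field_simps)
  obtain C0 where C0: "\<And>t. F t \<le> e * \<bar>t\<bar> powr q + C0 * \<bar>t\<bar> powr \<alpha>" using F_small[OF e(1)] by blast
  define C where "C = \<bar>C0\<bar>"
  have C: "F t \<le> e * \<bar>t\<bar> powr q + C * \<bar>t\<bar> powr \<alpha>" for t
    by (rule order_trans[OF C0]) (auto simp: C_def intro!: mult_right_mono)
  have C0': "C \<ge> 0" by (simp add: C_def)
  define D where "D = C * Ca + 1"
  have D: "D > 0" using C0' Ca(1) by (simp add: D_def add_nonneg_pos)
  define b where "b = \<alpha> / p - 1"
  have b: "b > 0" using \<alpha> exponents(2) by (simp add: b_def)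
  \<comment> \<open>This \<open>\<rho>\<close> balances the superlinear term \<open>D * \<rho> powr (1 + b)\<close> against half of \<open>k * \<rho>\<close>.\<close>
  define \<rho> where "\<rho> = (k / (2 * D)) powr (1 / b)"
  have \<rho>: "\<rho> > 0" "D * \<rho> powr b = k / 2"
    using kK D b by (auto simp: \<rho>_def powr_powr)
  have "k / 2 * \<rho> \<le> \<Phi> u g" if W: "W0 p u g" and E: "Lp_mod M p g = \<rho>" for u g
  proof -
    have Wq: "W0 q u g" by (rule W0_lower_exponent[OF exponents(9) q(2) W])
    have "Q u \<le> e * Lp_mod M q u + C * Lp_mod M \<alpha> u" by (rule Q_le[OF C W])
    also have "\<dots> \<le> e * (Cq * Lp_mod M q g) + C * (Ca * \<rho> powr (\<alpha> / p))"
      using Cq(2)[OF Wq] Ca(2)[OF W] e(1) C0' by (intro add_mono mult_left_mono) (auto simp: E)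
    also have "\<dots> \<le> k * Lp_mod M q g + D * \<rho> powr (\<alpha> / p)"
    proof (rule add_mono)
      show "e * (Cq * Lp_mod M q g) \<le> k * Lp_mod M q g"
        using mult_right_mono[OF e(2), of "Lp_mod M q g"] by (simp add: mult.assoc)
      show "C * (Ca * \<rho> powr (\<alpha> / p)) \<le> D * \<rho> powr (\<alpha> / p)"
        by (simp add: D_def mult.assoc[symmetric] mult_right_mono)
    qed
    also have "D * \<rho> powr (\<alpha> / p) = k / 2 * \<rho>"
    proof -
      have "\<rho> powr (\<alpha> / p) = \<rho> powr b * \<rho>" using \<rho>(1) by (simp add: b_def powr_diff)
      then show ?thesis using \<rho>(2) by simp
    qed
    finally have "Q u \<le> k * Lp_mod M q g + k / 2 * \<rho>" .
    moreover have "k * (\<rho> + Lp_mod M q g) \<le> P g" using P_lower[OF W0_D(2)[OF W]] E by simp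
    ultimately show ?thesis by (simp add: \<Phi>_def algebra_simps)
  qed
  then show ?thesis using that[of "k / 2 * \<rho>" \<rho>] kK(1) \<rho>(1) by simp
qed

text \<open>
  For \<open>t \<ge> 1\<close> the term \<open>P (t *\<^sub>R g)\<close> is at most a multiple of \<open>t powr p\<close>, and \<open>F\<close> exceeds every such multiple
  up to a constant.
\<close>

lemma ray_bounded:
  assumes W: "W0 p u g" and nt: "Lp_mod M p u > 0"
  shows "\<exists>T\<ge>1. \<forall>t\<ge>T. \<Phi> (\<lambda>x. t * u x) (\<lambda>x. t *\<^sub>R g x) \<le> 0"
proof -
  interpret finite_measure M by (rule finite_M)
  note g = W0_D(2)[OF W] and u = W0_Lalpha[OF W]
  have up: "u \<in> Lp M p" by (rule W0_D(1)[OF W])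
  define B where "B = K * (Lp_mod M p g + Lp_mod M q g)"
  have B: "B \<ge> 0" using kK by (simp add: B_def)
  \<comment> \<open>With this \<open>L\<close> the lower bound of \<open>Q\<close> exceeds the bound \<open>t powr p * B\<close> of \<open>P\<close> by \<open>t powr p\<close>, up to a constant.\<close>
  define L where "L = (B + 1) / Lp_mod M p u"
  obtain c0 where c0: "\<And>t. L * \<bar>t\<bar> powr p - c0 \<le> F t" using F_large[of L] by blast
  define c where "c = \<bar>c0\<bar>"
  have c: "L * \<bar>t\<bar> powr p - c \<le> F t" for t using c0[of t] by (simp add: c_def)
  define m where "m = measure M (space M)"
  have m: "m \<ge> 0" by (simp add: m_def)
  have key: "\<Phi> (\<lambda>x. t * u x) (\<lambda>x. t *\<^sub>R g x) \<le> c * m - t powr p" if t: "t \<ge> 1" for t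
  proof -
    note tg = W0_D(2)[OF scaled[OF W, of t]] and tu = W0_Lalpha[OF scaled[OF W, of t]]
    have gq: "g \<in> Lp M q" by (rule Lp_lower_exponent(1)[OF finite_M exponents(9) q(2) g])
    have "P (\<lambda>x. t *\<^sub>R g x) \<le> K * (t powr p * Lp_mod M p g + t powr q * Lp_mod M q g)"
      using P_upper[OF tg] Lp_scale(2)[OF g, of t] Lp_scale(2)[OF gq, of t] t by simp
    also have "\<dots> \<le> K * (t powr p * Lp_mod M p g + t powr p * Lp_mod M q g)"
      using kK t q by (intro mult_left_mono add_mono mult_right_mono powr_mono) auto
    also have "\<dots> = t powr p * B" by (simp add: B_def algebra_simps)
    finally have 1: "P (\<lambda>x. t *\<^sub>R g x) \<le> t powr p * B" .
    have "(LINT x|M. L * \<bar>t * u x\<bar> powr p - c) \<le> Q (\<lambda>x. t * u x)"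
      unfolding Q_def using c integrable_F[OF tu] W0_D(1)[OF scaled[OF W, of t]]
      by (intro integral_mono) (auto simp: Lp_def)
    also have "(LINT x|M. L * \<bar>t * u x\<bar> powr p - c) = L * (t powr p * Lp_mod M p u) - c * m"
      using Lp_scale[OF up, of t] t by (simp add: Lp_def Lp_mod_def m_def mult.commute)
    also have "L * (t powr p * Lp_mod M p u) = t powr p * (B + 1)" using nt by (simp add: L_def)
    finally show ?thesis using 1 by (simp add: \<Phi>_def algebra_simps)
  qed
  define T where "T = max 1 ((c * m) powr (1 / p))"
  have "\<Phi> (\<lambda>x. t * u x) (\<lambda>x. t *\<^sub>R g x) \<le> 0" if t: "t \<ge> T" for t
  proof -
    have "c * m = ((c * m) powr (1 / p)) powr p" using exponents(2) m by (simp add: powr_powr c_def)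
    also have "\<dots> \<le> t powr p" using t exponents(3) by (intro powr_mono2) (auto simp: T_def)
    finally show ?thesis using key[of t] t by (simp add: T_def)
  qed
  then show ?thesis by (intro exI[of _ T]) (simp add: T_def)
qed

end

section \<open>The minimax level over rays\<close>

context variational begin

text \<open>
  The infimum of this set is the minimax value of \<open>\<Phi>\<close>, the infimum over nontrivial rays of the supremum along the
  ray. With upper bounds instead of suprema, unbounded rays need no convention.
\<close>

definition ray_bounds :: "real set" where
  "ray_bounds = {b. \<exists>u g. W0 p u g \<and> Lp_mod M p g > 0 \<and> (\<forall>t>0. \<Phi> (\<lambda>x. t * u x) (\<lambda>x. t *\<^sub>R g x) \<le> b)}"

definition level :: real where "level = Inf ray_bounds"

lemma ray_boundsI:
  "W0 p u g \<Longrightarrow> Lp_mod M p g > 0 \<Longrightarrow> (\<And>t. t > 0 \<Longrightarrow> \<Phi> (\<lambda>x. t * u x) (\<lambda>x. t *\<^sub>R g x) \<le> b) \<Longrightarrow> b \<in> ray_bounds"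
  unfolding ray_bounds_def by blast

text \<open>
  Every nontrivial ray meets the sphere of the mountain pass estimate.
\<close>

lemma ray_bounds_pos: "\<exists>\<kappa>>0. \<forall>b\<in>ray_bounds. \<kappa> \<le> b"
proof -
  obtain \<kappa> \<rho> where \<kappa>: "\<kappa> > 0" "\<rho> > 0" and m: "\<And>u g. W0 p u g \<Longrightarrow> Lp_mod M p g = \<rho> \<Longrightarrow> \<kappa> \<le> \<Phi> u g"
    using mountain by metis
  have "\<kappa> \<le> b" if b: "b \<in> ray_bounds" for b
  proof -
    obtain u g where W: "W0 p u g" and g: "Lp_mod M p g > 0" and le: "\<forall>t>0. \<Phi> (\<lambda>x. t * u x) (\<lambda>x. t *\<^sub>R g x) \<le> b"
      using b unfolding ray_bounds_def by blast
    define t where "t = (\<rho> / Lp_mod M p g) powr (1 / p)"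
    have t: "t > 0" using \<kappa>(2) g by (simp add: t_def)
    have tp: "t powr p = \<rho> / Lp_mod M p g" using \<kappa>(2) g exponents(2) by (simp add: t_def powr_powr)
    have "Lp_mod M p (\<lambda>x. t *\<^sub>R g x) = \<rho>"
      unfolding Lp_scale(2)[OF W0_D(2)[OF W]] using t g by (simp add: tp)
    from m[OF scaled[OF W] this] le t show ?thesis by fastforce
  qed
  with \<kappa>(1) show ?thesis by blast
qed

lemma level_le: "b \<in> ray_bounds \<Longrightarrow> level \<le> b"
proof -
  assume b: "b \<in> ray_bounds"
  obtain \<kappa> where \<kappa>: "\<And>b. b \<in> ray_bounds \<Longrightarrow> \<kappa> \<le> b" using ray_bounds_pos by blast
  show ?thesis unfolding level_def by (rule cInf_lower[OF b bdd_belowI[OF \<kappa>]])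
qed

text \<open>
  Convergence of the gradients implies convergence of the functions in \<open>L\<^sup>\<alpha>\<close>, by the Sobolev inequality.
\<close>

lemma \<Phi>_tendsto:
  assumes W: "W0 p u g" "\<And>n. W0 p (un n) (gn n)"
    and lim: "(\<lambda>n. Lp_mod M p (\<lambda>x. gn n x - g x)) \<longlonglongrightarrow> 0"
  shows "(\<lambda>n. \<Phi> (un n) (gn n)) \<longlonglongrightarrow> \<Phi> u g"
proof -
  obtain C where C: "C \<ge> 0" "\<And>u g. W0 p u g \<Longrightarrow> Lp_mod M \<alpha> u \<le> C * Lp_mod M p g powr (\<alpha> / p)"
    using sobolev_W0[OF exponents(1,8) \<alpha>(2)] by blast
  have W1: "W0 p (\<lambda>x. un n x - u x) (\<lambda>x. gn n x - g x)" for n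
    using W0_add[OF exponents(3) W(2)[of n] W(1), of "-1"] by simp
  have "(\<lambda>n. Lp_mod M p (\<lambda>x. gn n x - g x) powr (\<alpha> / p)) \<longlonglongrightarrow> 0 powr (\<alpha> / p)"
    by (rule tendsto_powr'[OF lim tendsto_const]) (use exponents(2,6) in auto)
  then have "(\<lambda>n. Lp_mod M p (\<lambda>x. gn n x - g x) powr (\<alpha> / p)) \<longlonglongrightarrow> 0" by simp
  then have "(\<lambda>n. C * Lp_mod M p (\<lambda>x. gn n x - g x) powr (\<alpha> / p)) \<longlonglongrightarrow> 0" by (rule tendsto_mult_right_zero)
  then have "(\<lambda>n. Lp_mod M \<alpha> (\<lambda>x. un n x - u x)) \<longlonglongrightarrow> 0" by (rule tendsto_zero_le[OF Lp_mod_nonneg C(2)[OF W1]])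
  then have "(\<lambda>n. Q (un n)) \<longlonglongrightarrow> Q u" by (intro Q_tendsto W0_Lalpha[OF W(1)] W0_Lalpha[OF W(2)])
  moreover have "(\<lambda>n. P (gn n)) \<longlonglongrightarrow> P g" by (intro P_tendsto W0_D(2)[OF W(1)] W0_D(2)[OF W(2)] lim)
  ultimately show ?thesis unfolding \<Phi>_def by (intro tendsto_diff)
qed

lemma combination:
  assumes "W0 p u g" "W0 p v h"
  shows "W0 p (\<lambda>x. t * (u x + e * v x)) (\<lambda>x. t *\<^sub>R (g x + e *\<^sub>R h x))"
  by (intro W0_scale W0_add exponents(3) assms)

lemma combination_lim:
  assumes g: "g \<in> Lp M p" and h: "h \<in> Lp M p" and lim: "t \<longlonglongrightarrow> (t0::real)" "e \<longlonglongrightarrow> (0::real)"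
  shows "(\<lambda>n. Lp_mod M p (\<lambda>x. t n *\<^sub>R (g x + e n *\<^sub>R h x) - t0 *\<^sub>R g x)) \<longlonglongrightarrow> 0"
proof -
  have "Lp_mod M p (\<lambda>x. t n *\<^sub>R (g x + e n *\<^sub>R h x) - t0 *\<^sub>R g x) \<le>
      2 powr p * (\<bar>t n - t0\<bar> powr p * Lp_mod M p g + \<bar>t n * e n\<bar> powr p * Lp_mod M p h)" for n
    using Lp_add(2)[OF exponents(3) Lp_scale(1)[OF g, of "t n - t0"] Lp_scale(1)[OF h, of "t n * e n"]]
    unfolding Lp_scale(2)[OF g] Lp_scale(2)[OF h] by (simp add: algebra_simps)
  moreover have "(\<lambda>n. 2 powr p * (\<bar>t n - t0\<bar> powr p * Lp_mod M p g + \<bar>t n * e n\<bar> powr p * Lp_mod M p h)) \<longlonglongrightarrow>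
      2 powr p * (\<bar>t0 - t0\<bar> powr p * Lp_mod M p g + \<bar>t0 * 0\<bar> powr p * Lp_mod M p h)"
    using lim exponents(2)
    by (intro tendsto_mult tendsto_add tendsto_const tendsto_powr' tendsto_rabs tendsto_diff) auto
  then have "(\<lambda>n. 2 powr p * (\<bar>t n - t0\<bar> powr p * Lp_mod M p g + \<bar>t n * e n\<bar> powr p * Lp_mod M p h)) \<longlonglongrightarrow> 0" by simp
  ultimately show ?thesis by (rule tendsto_zero_le[OF Lp_mod_nonneg])
qed

lemma \<Phi>_combination_tendsto:
  assumes "W0 p u g" "W0 p v h" "t \<longlonglongrightarrow> t0" "e \<longlonglongrightarrow> 0"
  shows "(\<lambda>n. \<Phi> (\<lambda>x. t n * (u x + e n * v x)) (\<lambda>x. t n *\<^sub>R (g x + e n *\<^sub>R h x))) \<longlonglongrightarrow> \<Phi> (\<lambda>x. t0 * u x) (\<lambda>x. t0 *\<^sub>R g x)"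
  by (rule \<Phi>_tendsto[OF scaled[OF assms(1)] combination[OF assms(1,2)] combination_lim[OF W0_D(2)[OF assms(1)] W0_D(2)[OF assms(2)] assms(3,4)]])

lemma ray_continuous:
  assumes W: "W0 p u g" shows "continuous_on S (\<lambda>t. \<Phi> (\<lambda>x. t * u x) (\<lambda>x. t *\<^sub>R g x))"
proof (rule continuous_on_sequentiallyI)
  fix t :: "nat \<Rightarrow> real" and t0 assume "\<forall>n. t n \<in> S" "t0 \<in> S" "t \<longlonglongrightarrow> t0"
  from \<Phi>_combination_tendsto[OF W W this(3) tendsto_const]
  show "(\<lambda>n. \<Phi> (\<lambda>x. t n * u x) (\<lambda>x. t n *\<^sub>R g x)) \<longlonglongrightarrow> \<Phi> (\<lambda>x. t0 * u x) (\<lambda>x. t0 *\<^sub>R g x)" by simp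
qed

lemma \<Phi>_zero: "\<Phi> (\<lambda>x. 0) (\<lambda>x. 0) = 0"
proof -
  have "\<Gamma> 0 = 0" using \<Gamma>_upper[of 0] \<Gamma>_nonneg[of 0] by simp
  then show ?thesis by (simp add: \<Phi>_def P_def Q_def F_0)
qed

lemma ray_small:
  assumes W: "W0 p u g" and e: "e > 0"
  shows "\<exists>d>0. \<forall>t. 0 < t \<and> t < d \<longrightarrow> \<Phi> (\<lambda>x. t * u x) (\<lambda>x. t *\<^sub>R g x) < e"
proof -
  have "continuous (at 0) (\<lambda>t. \<Phi> (\<lambda>x. t * u x) (\<lambda>x. t *\<^sub>R g x))"
    using ray_continuous[OF W, of UNIV] by (simp add: continuous_on_eq_continuous_at)
  then obtain d where "d > 0" "\<And>t. dist t 0 < d \<Longrightarrow> dist (\<Phi> (\<lambda>x. t * u x) (\<lambda>x. t *\<^sub>R g x)) (\<Phi> (\<lambda>x. 0 * u x) (\<lambda>x. 0 *\<^sub>R g x)) < e"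
    unfolding continuous_at_eps_delta using e by blast
  then show ?thesis by (intro exI[of _ d]) (auto simp: \<Phi>_zero dist_real_def abs_less_iff)
qed

text \<open>
  The energy is smaller than half of the positive lower bound \<open>\<kappa>\<close> of \<open>ray_bounds\<close> near \<open>t = 0\<close>, and it is
  nonpositive for large \<open>t\<close>. So the maximum over the compact interval in between is the maximum over the ray,
  for otherwise \<open>\<kappa> / 2\<close> would be an upper bound.
\<close>

lemma ray_sup_attained:
  assumes W: "W0 p u g" and nt: "Lp_mod M p u > 0"
  shows "\<exists>t0>0. \<forall>t>0. \<Phi> (\<lambda>x. t * u x) (\<lambda>x. t *\<^sub>R g x) \<le> \<Phi> (\<lambda>x. t0 * u x) (\<lambda>x. t0 *\<^sub>R g x)"
proof -
  define J where "J t = \<Phi> (\<lambda>x. t * u x) (\<lambda>x. t *\<^sub>R g x)" for t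
  have Jc: "continuous_on S J" for S unfolding J_def by (rule ray_continuous[OF W])
  obtain \<kappa> where \<kappa>: "\<kappa> > 0" "\<And>b. b \<in> ray_bounds \<Longrightarrow> \<kappa> \<le> b" using ray_bounds_pos by blast
  obtain T where T: "T \<ge> 1" "\<And>t. t \<ge> T \<Longrightarrow> J t \<le> 0" using ray_bounded[OF W nt] unfolding J_def by blast
  obtain d where d: "d > 0" "\<And>t. 0 < t \<Longrightarrow> t < d \<Longrightarrow> J t < \<kappa> / 2"
    using ray_small[OF W, of "\<kappa> / 2"] \<kappa>(1) unfolding J_def by auto
  define d' where "d' = min d 1"
  have d': "0 < d'" "d' \<le> T" "d' \<le> d" using d(1) T(1) by (auto simp: d'_def)
  obtain t0 where t0: "t0 \<in> {d'..T}" "\<And>t. t \<in> {d'..T} \<Longrightarrow> J t \<le> J t0"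
    using continuous_attains_sup[OF compact_Icc _ Jc, of d' T] d'(2) by force
  have le: "J t \<le> max (\<kappa> / 2) (J t0)" if "t > 0" for t
  proof -
    consider "t < d'" | "t \<in> {d'..T}" | "T \<le> t" by fastforce
    then show ?thesis
    proof cases
      case 1 then show ?thesis using d(2)[of t] that d'(3) by simp
    next
      case 2 then show ?thesis using t0(2)[of t] by simp
    next
      case 3 then show ?thesis using T(2)[of t] \<kappa>(1) by simp
    qed
  qed
  have "max (\<kappa> / 2) (J t0) \<in> ray_bounds"
    by (rule ray_boundsI[OF W nontrivial_gradient[OF W nt]]) (use le in \<open>simp add: J_def\<close>)
  from \<kappa>(2)[OF this] \<kappa>(1) have "max (\<kappa> / 2) (J t0) = J t0" by (auto simp: max_def split: if_splits)
  with le t0(1) d'(1) show ?thesis unfolding J_def by (intro exI[of _ t0]) auto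
qed

lemma ray_bounds_nonempty:
  assumes "\<Omega> \<noteq> {}" shows "ray_bounds \<noteq> {}"
proof -
  obtain x0 where "x0 \<in> \<Omega>" using assms by blast
  then obtain a b where ab: "x0 \<in> box a b" "cbox a b \<subseteq> \<Omega>" using open_contains_cbox[THEN iffD1, OF open_domain] by metis
  define u where "u = box_bump a b 0"
  have u: "u \<in> test_functions \<Omega>" unfolding u_def by (rule box_bump_props(1)[OF ab(2)])
  have W: "W0 p u (grad u)" by (rule W0_test[OF exponents(3) u])
  have "Lp_mod M p u > 0"
  proof (rule ccontr)
    assume "\<not> Lp_mod M p u > 0"
    then have "Lp_mod M p u = 0" using Lp_mod_nonneg[of M p u] by linarith
    then have "AE x in M. norm (u x) powr p = 0"
      using integral_nonneg_eq_0_iff_AE[OF LpD(2)[OF W0_D(1)[OF W]]] by (simp add: Lp_mod_def)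
    then have "AE x in lebesgue. x \<in> \<Omega> \<longrightarrow> norm (u x) powr p = 0"
      by (subst (asm) AE_restrict_space_iff) auto
    then have "AE x in lebesgue. x \<notin> box a b"
    proof eventually_elim
      case (elim x)
      show ?case using elim box_bump_props(5)[of x a b 0] ab(2) box_subset_cbox[of a b] by (auto simp: u_def)
    qed
    then have "negligible (box a b)"
      by (simp add: negligible_iff_null_sets AE_iff_null_sets)
    then show False using open_not_negligible[OF open_box, of a b] ab(1) by blast
  qed
  from ray_sup_attained[OF W this] nontrivial_gradient[OF W this]
  show ?thesis using ray_boundsI[OF W] by blast
qed

lemma level_pos: assumes "\<Omega> \<noteq> {}" shows "0 < level"
proof -
  obtain \<kappa> where \<kappa>: "\<kappa> > 0" "\<And>b. b \<in> ray_bounds \<Longrightarrow> \<kappa> \<le> b" using ray_bounds_pos by blast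
  have "\<kappa> \<le> level" unfolding level_def by (rule cInf_greatest[OF ray_bounds_nonempty[OF assms] \<kappa>(2)])
  with \<kappa>(1) show ?thesis by linarith
qed

lemma P_ray_midpoint:
  assumes "g \<in> Lp M p" "h \<in> Lp M p"
  shows "P (\<lambda>x. t *\<^sub>R ((g x + h x) /\<^sub>R 2)) \<le> (P (\<lambda>x. t *\<^sub>R g x) + P (\<lambda>x. t *\<^sub>R h x)) / 2"
proof -
  have "(\<lambda>x. t *\<^sub>R ((g x + h x) /\<^sub>R 2)) = (\<lambda>x. (t *\<^sub>R g x + t *\<^sub>R h x) /\<^sub>R 2)"
    by (simp add: scaleR_add_right mult.commute)
  then show ?thesis using P_midpoint[OF Lp_scale(1)[OF assms(1), of t] Lp_scale(1)[OF assms(2), of t]] by simp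
qed

lemma P_ray_tendsto:
  assumes h: "h \<in> Lp M p" "\<And>n. hn n \<in> Lp M p" and l: "(\<lambda>n. Lp_mod M p (\<lambda>x. hn n x - h x)) \<longlonglongrightarrow> 0"
  shows "(\<lambda>n. P (\<lambda>x. t *\<^sub>R hn n x)) \<longlonglongrightarrow> P (\<lambda>x. t *\<^sub>R h x)"
proof (rule P_tendsto[OF Lp_scale(1)[OF h(1)] Lp_scale(1)[OF h(2)]])
  have "Lp_mod M p (\<lambda>x. t *\<^sub>R hn n x - t *\<^sub>R h x) = \<bar>t\<bar> powr p * Lp_mod M p (\<lambda>x. hn n x - h x)" for n
    using Lp_scale(2)[OF Lp_diff(1)[OF exponents(3) h(2)[of n] h(1)], of t] by (simp add: scaleR_diff_right)
  then show "(\<lambda>n. Lp_mod M p (\<lambda>x. t *\<^sub>R hn n x - t *\<^sub>R h x)) \<longlonglongrightarrow> 0" using tendsto_mult_right_zero[OF l] by simp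
qed

lemma P_ray_unique:
  assumes "W0 p w h" "W0 p w h'" shows "P (\<lambda>x. t *\<^sub>R h x) = P (\<lambda>x. t *\<^sub>R h' x)"
proof -
  have "AE x in M. h x = h' x"
    by (rule weak_gradient_unique[OF W0_weak[OF exponents(4) assms(1)] W0_weak[OF exponents(4) assms(2)]])
  then show ?thesis
    unfolding P_def using integrable_\<Gamma>[OF Lp_scale(1)[OF W0_D(2)[OF assms(1)], of t]] integrable_\<Gamma>[OF Lp_scale(1)[OF W0_D(2)[OF assms(2)], of t]]
    by (intro integral_cong_AE) auto
qed

text \<open>
  Let \<open>u n\<close> have normalised gradients and rays whose energies are bounded by \<open>level + 1 / (n + 1)\<close>. A
  subsequence converges in \<open>L\<^sup>\<alpha>\<close> to some \<open>w\<close>, so \<open>Q\<close> converges at each dilation, and the weak closure lemma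
  bounds \<open>P\<close> at each dilation of \<open>w\<close>. If \<open>w\<close> were trivial, the limit of \<open>Q\<close> would be \<open>0\<close>, and the energy of \<open>t * u n\<close>
  would be at least \<open>k * t powr p\<close> in the limit, which is unbounded in \<open>t\<close>.
\<close>

lemma minimizing_ray:
  assumes ne: "\<Omega> \<noteq> {}"
  shows "\<exists>u g. W0 p u g \<and> Lp_mod M p u > 0 \<and> (\<forall>t>0. \<Phi> (\<lambda>x. t * u x) (\<lambda>x. t *\<^sub>R g x) \<le> level)"
proof -
  define i where "i n = inverse (real (Suc n))" for n
  have i: "i n > 0" "i n \<le> 1" "i \<longlonglongrightarrow> 0" for n
    using LIMSEQ_inverse_real_of_nat by (simp_all add: i_def[abs_def] inverse_le_1_iff)
  have "\<exists>u g. W0 p u g \<and> Lp_mod M p g = 1 \<and> (\<forall>t>0. \<Phi> (\<lambda>x. t * u x) (\<lambda>x. t *\<^sub>R g x) \<le> level + i n)" for n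
  proof -
    have "\<exists>b\<in>ray_bounds. b < level + i n"
      unfolding level_def by (rule cInf_lessD[OF ray_bounds_nonempty[OF ne]]) (simp add: i)
    then obtain b u g where b: "b < level + i n" and W: "W0 p u g" and g: "Lp_mod M p g > 0"
      and le: "\<And>t. t > 0 \<Longrightarrow> \<Phi> (\<lambda>x. t * u x) (\<lambda>x. t *\<^sub>R g x) \<le> b" unfolding ray_bounds_def by blast
    define s where "s = (1 / Lp_mod M p g) powr (1 / p)"
    have s: "s > 0" using g by (simp add: s_def)
    have sp: "s powr p = 1 / Lp_mod M p g" using g exponents(2) by (simp add: s_def powr_powr)
    have n1: "Lp_mod M p (\<lambda>x. s *\<^sub>R g x) = 1"
      unfolding Lp_scale(2)[OF W0_D(2)[OF W]] using s g by (simp add: sp)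
    have "\<Phi> (\<lambda>x. t * (s * u x)) (\<lambda>x. t *\<^sub>R (s *\<^sub>R g x)) \<le> level + i n" if "t > 0" for t
      using le[of "t * s"] that s b by (simp add: mult.assoc)
    then show ?thesis using scaled[OF W, of s] n1 by blast
  qed
  then obtain u g where ug: "\<And>n. W0 p (u n) (g n)" "\<And>n. Lp_mod M p (g n) = 1"
    "\<And>n t. t > 0 \<Longrightarrow> \<Phi> (\<lambda>x. t * u n x) (\<lambda>x. t *\<^sub>R g n x) \<le> level + i n" by metis
  have "\<exists>r v. strict_mono (r :: nat \<Rightarrow> nat) \<and> v \<in> Lp M \<alpha> \<and> (\<lambda>n. Lp_mod M \<alpha> (\<lambda>x. u (r n) x - v x)) \<longlonglongrightarrow> 0"
    by (rule rellich_W0[OF exponents(1,8) \<alpha>(2), of u g 1]) (use ug in auto)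
  then obtain r w where r: "strict_mono (r :: nat \<Rightarrow> nat)" and w: "w \<in> Lp M \<alpha>"
    and lim: "(\<lambda>n. Lp_mod M \<alpha> (\<lambda>x. u (r n) x - w x)) \<longlonglongrightarrow> 0" by blast
  have uL: "u n \<in> Lp M \<alpha>" for n by (rule W0_Lalpha[OF ug(1)])
  have wp: "w \<in> Lp M p" by (rule Lp_lower_exponent(1)[OF finite_M exponents(2,8) w])
  have limp: "(\<lambda>n. Lp_mod M p (\<lambda>x. u (r n) x - w x)) \<longlonglongrightarrow> 0"
    by (rule Lp_mod_lower_exponent_tendsto[OF finite_M exponents(2,8) Lp_diff(1)[OF exponents(7) uL w] lim])
  have Qlim: "(\<lambda>n. Q (\<lambda>x. t * u (r n) x)) \<longlonglongrightarrow> Q (\<lambda>x. t * w x)" for t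
  proof (rule Q_tendsto)
    have s: "(\<lambda>x. t * v x) \<in> Lp M \<alpha>" if "v \<in> Lp M \<alpha>" for v using Lp_scale(1)[OF that, of t] by simp
    show "(\<lambda>x. t * w x) \<in> Lp M \<alpha>" "(\<lambda>x. t * u (r n) x) \<in> Lp M \<alpha>" for n using s w uL by auto
    have "Lp_mod M \<alpha> (\<lambda>x. t * u (r n) x - t * w x) = \<bar>t\<bar> powr \<alpha> * Lp_mod M \<alpha> (\<lambda>x. u (r n) x - w x)" for n
      using Lp_scale(2)[OF Lp_diff(1)[OF exponents(7) uL[of "r n"] w], of t] by (simp add: right_diff_distrib)
    then show "(\<lambda>n. Lp_mod M \<alpha> (\<lambda>x. t * u (r n) x - t * w x)) \<longlonglongrightarrow> 0"
      using tendsto_mult_right_zero[OF lim] by simp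
  qed
  have clos: "\<exists>h. W0 p w h \<and> P (\<lambda>x. t *\<^sub>R h x) \<le> level + Q (\<lambda>x. t * w x)" if t: "t > 0" for t
  proof (rule W0_weak_closure[OF exponents(1), of "\<lambda>n. u (r n)" "\<lambda>n. g (r n)" 1 w "\<lambda>h. P (\<lambda>x. t *\<^sub>R h x)"])
    show "W0 p (u (r n)) (g (r n))" "Lp_mod M p (g (r n)) \<le> 1" for n using ug by auto
    show "P (\<lambda>x. t *\<^sub>R ((g x + h x) /\<^sub>R 2)) \<le> (P (\<lambda>x. t *\<^sub>R g x) + P (\<lambda>x. t *\<^sub>R h x)) / 2"
      if "g \<in> Lp M p" "h \<in> Lp M p" for g h
      by (rule P_ray_midpoint[OF that])
    show "(\<lambda>n. P (\<lambda>x. t *\<^sub>R hn n x)) \<longlonglongrightarrow> P (\<lambda>x. t *\<^sub>R h x)"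
      if "h \<in> Lp M p" "\<And>n. hn n \<in> Lp M p" "(\<lambda>n. Lp_mod M p (\<lambda>x. hn n x - h x)) \<longlonglongrightarrow> 0" for h hn
      by (rule P_ray_tendsto[OF that])
    fix e :: real assume e: "e > 0"
    have "(\<lambda>n. i (r n)) \<longlonglongrightarrow> 0" using LIMSEQ_subseq_LIMSEQ[OF i(3) r] by (simp add: o_def)
    then have "(\<lambda>n. level + i (r n) + Q (\<lambda>x. t * u (r n) x)) \<longlonglongrightarrow> level + 0 + Q (\<lambda>x. t * w x)"
      by (intro tendsto_add tendsto_const Qlim)
    then have "\<forall>\<^sub>F n in sequentially. level + i (r n) + Q (\<lambda>x. t * u (r n) x) < level + Q (\<lambda>x. t * w x) + e"
      using e by (intro order_tendstoD(2)) auto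
    then obtain N where N: "\<And>n. n \<ge> N \<Longrightarrow> level + i (r n) + Q (\<lambda>x. t * u (r n) x) < level + Q (\<lambda>x. t * w x) + e"
      by (auto simp: eventually_sequentially)
    have "P (\<lambda>x. t *\<^sub>R g (r n) x) \<le> level + Q (\<lambda>x. t * w x) + e" if "n \<ge> N" for n
      using N[OF that] ug(3)[OF t, of "r n"] unfolding \<Phi>_def by linarith
    then show "\<exists>N. \<forall>n\<ge>N. P (\<lambda>x. t *\<^sub>R g (r n) x) \<le> level + Q (\<lambda>x. t * w x) + e" by blast
  qed (use wp limp in auto)
  obtain h where h: "W0 p w h" using clos[of 1] by auto
  have ray: "\<Phi> (\<lambda>x. t * w x) (\<lambda>x. t *\<^sub>R h x) \<le> level" if t: "t > 0" for t
  proof -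
    obtain h' where h': "W0 p w h'" "P (\<lambda>x. t *\<^sub>R h' x) \<le> level + Q (\<lambda>x. t * w x)" using clos[OF t] by blast
    from P_ray_unique[OF h h'(1), of t] h'(2) show ?thesis by (simp add: \<Phi>_def)
  qed
  have "Lp_mod M p w > 0"
  proof (rule ccontr)
    assume "\<not> Lp_mod M p w > 0"
    then have "Lp_mod M p w = 0" using Lp_mod_nonneg[of M p w] by linarith
    then have "AE x in M. norm (w x) powr p = 0"
      using integral_nonneg_eq_0_iff_AE[OF LpD(2)[OF wp]] by (simp add: Lp_mod_def)
    then have w0: "AE x in M. w x = 0" by eventually_elim auto
    have "k * t powr p \<le> level + 1" if t: "t > 0" for t
    proof (rule LIMSEQ_le)
      have "Q (\<lambda>x. t * w x) = (LINT x|M. 0)"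
        unfolding Q_def using integrable_F[OF Lp_scale(1)[OF w, of t]] w0 F_0
        by (intro integral_cong_AE) auto
      then have "(\<lambda>n. Q (\<lambda>x. t * u (r n) x)) \<longlonglongrightarrow> 0" using Qlim[of t] by simp
      from tendsto_diff[OF tendsto_const this]
      show "(\<lambda>n. k * t powr p - Q (\<lambda>x. t * u (r n) x)) \<longlonglongrightarrow> k * t powr p" by simp
      show "(\<lambda>n. level + 1) \<longlonglongrightarrow> level + 1" by simp
      have "k * t powr p - Q (\<lambda>x. t * u (r n) x) \<le> level + 1" for n
      proof -
        have "Lp_mod M p (\<lambda>x. t *\<^sub>R g (r n) x) = t powr p"
          unfolding Lp_scale(2)[OF W0_D(2)[OF ug(1)]] using t ug(2) by simp
        then have "k * (t powr p + Lp_mod M q (\<lambda>x. t *\<^sub>R g (r n) x)) \<le> P (\<lambda>x. t *\<^sub>R g (r n) x)"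
          using P_lower[OF Lp_scale(1)[OF W0_D(2)[OF ug(1)[of "r n"]], of t]] by simp
        moreover have "0 \<le> k * Lp_mod M q (\<lambda>x. t *\<^sub>R g (r n) x)" using kK by simp
        ultimately show ?thesis using ug(3)[OF t, of "r n"] i(2)[of "r n"] unfolding \<Phi>_def distrib_left by linarith
      qed
      then show "\<exists>N. \<forall>n\<ge>N. k * t powr p - Q (\<lambda>x. t * u (r n) x) \<le> level + 1" by blast
    qed
    note bound = this
    define t where "t = ((level + 2) / k) powr (1 / p)"
    have pos: "level + 2 > 0" using level_pos[OF ne] by simp
    then have "t > 0" "k * t powr p = level + 2" using exponents(2) kK by (simp_all add: t_def powr_powr)
    with bound[of t] show False by simp
  qed
  with h ray show ?thesis by blast
qed

end

section \<open>Differentiability and absolute values\<close>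

lemma Nemytskii_eps:
  fixes T :: "'b::euclidean_space \<Rightarrow> 'c::euclidean_space"
  assumes M: "finite_measure M" and p: "p > 0" and s: "s > 0" and T: "continuous_on UNIV T"
    and gr: "\<And>x. norm (T x) powr s \<le> C * (1 + norm x powr p)"
    and u: "u \<in> Lp M p" and e: "e > 0"
  shows "\<exists>d>0. \<forall>h\<in>Lp M p. Lp_mod M p h < d \<longrightarrow> Lp_mod M s (\<lambda>x. T (u x + h x) - T (u x)) < e"
proof (rule ccontr)
  assume "\<not> ?thesis"
  then have "\<exists>h\<in>Lp M p. Lp_mod M p h < inverse (real (Suc n)) \<and> e \<le> Lp_mod M s (\<lambda>x. T (u x + h x) - T (u x))" for n
    by (meson inverse_positive_iff_positive not_le of_nat_0_less_iff zero_less_Suc)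
  then obtain h where h: "\<And>n. h n \<in> Lp M p" "\<And>n. Lp_mod M p (h n) < inverse (real (Suc n))"
    "\<And>n. e \<le> Lp_mod M s (\<lambda>x. T (u x + h n x) - T (u x))" by metis
  have "(\<lambda>n. Lp_mod M p (h n)) \<longlonglongrightarrow> 0"
    by (rule tendsto_zero_le[OF Lp_mod_nonneg less_imp_le[OF h(2)] LIMSEQ_inverse_real_of_nat])
  then have l: "(\<lambda>n. Lp_mod M p (\<lambda>x. (u x + h n x) - u x)) \<longlonglongrightarrow> 0" by simp
  have uh: "(\<lambda>x. u x + h n x) \<in> Lp M p" for n using p by (intro Lp_add(1) u h(1)) auto
  have "(\<lambda>n. Lp_mod M s (\<lambda>x. T (u x + h n x) - T (u x))) \<longlonglongrightarrow> 0"
    by (rule Nemytskii_continuous[OF M p s T gr u uh l])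
  from order_tendstoD(2)[OF this e] show False using h(3) by (auto simp: eventually_sequentially not_less[symmetric])
qed

context variational begin

definition nrm :: "('a \<Rightarrow> real) \<Rightarrow> ('a \<Rightarrow> 'a) \<Rightarrow> real" where
  "nrm v h = (Lp_mod M p v + Lp_mod M p h) powr (1 / p)"

lemma nrm_nonneg: "0 \<le> nrm v h" by (simp add: nrm_def)

lemma nrm_gradient: "Lp_mod M p h powr (1 / p) \<le> nrm v h" "Lp_mod M p h \<le> nrm v h powr p"
proof -
  show "Lp_mod M p h powr (1 / p) \<le> nrm v h"
    unfolding nrm_def using exponents(3) by (intro powr_mono2) auto
  show "Lp_mod M p h \<le> nrm v h powr p"
    unfolding nrm_def using exponents(2) by (simp add: powr_powr)
qed

lemma nrm_scale: "W0 p v h \<Longrightarrow> nrm (\<lambda>x. s * v x) (\<lambda>x. s *\<^sub>R h x) = \<bar>s\<bar> * nrm v h"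
proof -
  assume W: "W0 p v h"
  have e: "Lp_mod M p (\<lambda>x. s * v x) + Lp_mod M p (\<lambda>x. s *\<^sub>R h x) = \<bar>s\<bar> powr p * (Lp_mod M p v + Lp_mod M p h)"
    using Lp_scale(2)[OF W0_D(1)[OF W], of s] Lp_scale(2)[OF W0_D(2)[OF W], of s] by (simp add: distrib_left)
  show ?thesis unfolding nrm_def e powr_mult powr_powr using exponents(2) by simp
qed

text \<open>
  Convexity at both ends of the segment from \<open>g\<close> to \<open>g + h\<close> encloses the remainder between \<open>0\<close> and
  \<open>DP (g + h) h - DP g h\<close>.
\<close>

lemma P_remainder:
  assumes g: "g \<in> Lp M p" and h: "h \<in> Lp M p"
  shows "\<bar>P (\<lambda>x. g x + h x) - P g - DP g h\<bar> \<le>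
    Lp_mod M (p / (p - 1)) (\<lambda>x. V (g x + h x) - V (g x)) powr (1 / (p / (p - 1))) * Lp_mod M p h powr (1 / p)"
proof -
  have gh: "(\<lambda>x. g x + h x) \<in> Lp M p" by (rule Lp_add(1)[OF exponents(3) g h])
  have 1: "P g + DP g h \<le> P (\<lambda>x. g x + h x)" using P_convex[OF g gh] by simp
  have "DP (\<lambda>x. g x + h x) (\<lambda>x. g x - (g x + h x)) = - DP (\<lambda>x. g x + h x) h"
    by (simp add: DP_def)
  then have 2: "P (\<lambda>x. g x + h x) - P g \<le> DP (\<lambda>x. g x + h x) h" using P_convex[OF gh g] by simp
  have d: "(\<lambda>x. V (g x + h x) - V (g x)) \<in> Lp M (p / (p - 1))"
    using V_Lp[OF gh] V_Lp[OF g] exponents(12) by (intro Lp_diff(1)) auto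
  have "DP (\<lambda>x. g x + h x) h - DP g h = (LINT x|M. (V (g x + h x) - V (g x)) \<bullet> h x)"
    unfolding DP_def inner_diff_left using DP_integrable[OF gh h] DP_integrable[OF g h] by simp
  with inner_Holder(2)[OF exponents(10,1,16) d h] 1 2 show ?thesis by linarith
qed

lemma Q_remainder:
  assumes u: "u \<in> Lp M \<alpha>" and v: "v \<in> Lp M \<alpha>"
  shows "\<bar>Q (\<lambda>x. u x + v x) - Q u - DQ u v\<bar> \<le>
    Lp_mod M (\<alpha> / (\<alpha> - 1)) (\<lambda>x. f (u x + v x) - f (u x)) powr (1 / (\<alpha> / (\<alpha> - 1))) * Lp_mod M \<alpha> v powr (1 / \<alpha>)"
proof -
  have uv: "(\<lambda>x. u x + v x) \<in> Lp M \<alpha>" by (rule Lp_add(1)[OF exponents(7) u v])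
  have 1: "Q u + DQ u v \<le> Q (\<lambda>x. u x + v x)" using Q_convex[OF u uv] by simp
  have "DQ (\<lambda>x. u x + v x) (\<lambda>x. u x - (u x + v x)) = - DQ (\<lambda>x. u x + v x) v"
    by (simp add: DQ_def)
  then have 2: "Q (\<lambda>x. u x + v x) - Q u \<le> DQ (\<lambda>x. u x + v x) v" using Q_convex[OF uv u] by simp
  have d: "(\<lambda>x. f (u x + v x) - f (u x)) \<in> Lp M (\<alpha> / (\<alpha> - 1))"
    using f_Lp[OF uv] f_Lp[OF u] exponents(13) by (intro Lp_diff(1)) auto
  have "DQ (\<lambda>x. u x + v x) v - DQ u v = (LINT x|M. (f (u x + v x) - f (u x)) * v x)"
    unfolding DQ_def left_diff_distrib using DQ_integrable[OF uv v] DQ_integrable[OF u v] by simp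
  with inner_Holder(2)[OF exponents(11,5,17) d v] 1 2 show ?thesis unfolding inner_real_def by linarith
qed

text \<open>
  In the remainder bounds, the factors with \<open>V\<close> and \<open>f\<close> tend to \<open>0\<close> by continuity of superposition operators,
  and the other factors are bounded by a multiple of the norm, for \<open>v\<close> by the Sobolev inequality.
\<close>

lemma frechet:
  assumes W: "W0 p u g" and e: "e > 0"
  shows "\<exists>d>0. \<forall>v h. W0 p v h \<and> nrm v h < d \<longrightarrow>
    \<bar>\<Phi> (\<lambda>x. u x + v x) (\<lambda>x. g x + h x) - \<Phi> u g - (DP g h - DQ u v)\<bar> \<le> e * nrm v h"
proof -
  note g = W0_D(2)[OF W] and u = W0_Lalpha[OF W]
  let ?p' = "p / (p - 1)" and ?a' = "\<alpha> / (\<alpha> - 1)"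
  obtain C where C: "C \<ge> 0" "\<And>u g. W0 p u g \<Longrightarrow> Lp_mod M \<alpha> u \<le> C * Lp_mod M p g powr (\<alpha> / p)"
    using sobolev_W0[OF exponents(1,8) \<alpha>(2)] by blast
  define c where "c = C powr (1 / \<alpha>) + 1"
  have c: "c > 0" by (simp add: c_def add_nonneg_pos)
  define e1 where "e1 = (e / 2) powr ?p'"
  define e2 where "e2 = (e / (2 * c)) powr ?a'"
  have pos: "e1 > 0" "e2 > 0" using e c by (simp_all add: e1_def e2_def)
  have r1: "e1 powr (1 / ?p') = e / 2" unfolding e1_def powr_powr using e exponents(1,2) by simp
  have r2: "e2 powr (1 / ?a') * c = e / 2" unfolding e2_def powr_powr using e c exponents(5,6) by simp
  obtain d1 where d1: "d1 > 0" "\<And>h. h \<in> Lp M p \<Longrightarrow> Lp_mod M p h < d1 \<Longrightarrow> Lp_mod M ?p' (\<lambda>x. V (g x + h x) - V (g x)) < e1"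
    using Nemytskii_eps[OF finite_M exponents(2,12) V_cont V_growth g pos(1)] by blast
  have fg: "norm (f t) powr ?a' \<le> K * (1 + norm t powr \<alpha>)" for t using f_growth[of t] by simp
  obtain d2 where d2: "d2 > 0" "\<And>v. v \<in> Lp M \<alpha> \<Longrightarrow> Lp_mod M \<alpha> v < d2 \<Longrightarrow> Lp_mod M ?a' (\<lambda>x. f (u x + v x) - f (u x)) < e2"
    using Nemytskii_eps[OF finite_M exponents(6,13) f_cont fg u pos(2)] by blast
  define d3 where "d3 = (d2 / (C + 1)) powr (p / \<alpha>)"
  have d3: "d3 > 0" "d3 powr (\<alpha> / p) = d2 / (C + 1)"
    using d2(1) C(1) exponents by (simp_all add: d3_def powr_powr)
  define d where "d = min d1 d3 powr (1 / p)"
  have d: "d > 0" "d powr p = min d1 d3" using d1(1) d3(1) exponents(2) by (simp_all add: d_def powr_powr)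
  have "\<bar>\<Phi> (\<lambda>x. u x + v x) (\<lambda>x. g x + h x) - \<Phi> u g - (DP g h - DQ u v)\<bar> \<le> e * nrm v h"
    if Wv: "W0 p v h" and small: "nrm v h < d" for v h
  proof -
    note h = W0_D(2)[OF Wv] and v = W0_Lalpha[OF Wv]
    have "nrm v h powr p < d powr p" using small nrm_nonneg exponents(2) by (intro powr_less_mono2)
    then have hm: "Lp_mod M p h < d1" "Lp_mod M p h < d3" using nrm_gradient(2)[of h v] d(2) by auto
    have "Lp_mod M p h powr (\<alpha> / p) \<le> d3 powr (\<alpha> / p)" using hm exponents by (intro powr_mono2) auto
    then have "C * Lp_mod M p h powr (\<alpha> / p) \<le> C * (d2 / (C + 1))" using C(1) d3(2) by (intro mult_left_mono) auto
    also have "\<dots> < d2" using C(1) d2(1) by (simp add: field_simps)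
    finally have vm: "Lp_mod M \<alpha> v < d2" using C(2)[OF Wv] by simp
    have va: "Lp_mod M \<alpha> v powr (1 / \<alpha>) \<le> c * nrm v h"
    proof -
      have "Lp_mod M \<alpha> v powr (1 / \<alpha>) \<le> (C * Lp_mod M p h powr (\<alpha> / p)) powr (1 / \<alpha>)"
        using C(2)[OF Wv] exponents by (intro powr_mono2) auto
      also have "\<dots> = C powr (1 / \<alpha>) * Lp_mod M p h powr (1 / p)"
        unfolding powr_mult powr_powr using exponents by simp
      also have "\<dots> \<le> c * nrm v h"
        using nrm_gradient(1)[of h v] by (intro mult_mono) (auto simp: c_def)
      finally show ?thesis .
    qed
    have 1: "\<bar>P (\<lambda>x. g x + h x) - P g - DP g h\<bar> \<le> e / 2 * nrm v h"
    proof (rule order_trans[OF P_remainder[OF g h] mult_mono])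
      show "Lp_mod M ?p' (\<lambda>x. V (g x + h x) - V (g x)) powr (1 / ?p') \<le> e / 2"
        unfolding r1[symmetric] using d1(2)[OF h hm(1)] exponents(1,2,12) by (intro powr_mono2) auto
    qed (use nrm_gradient(1) e in auto)
    have "\<bar>Q (\<lambda>x. u x + v x) - Q u - DQ u v\<bar> \<le> e2 powr (1 / ?a') * (c * nrm v h)"
    proof (rule order_trans[OF Q_remainder[OF u v] mult_mono[OF _ va]])
      show "Lp_mod M ?a' (\<lambda>x. f (u x + v x) - f (u x)) powr (1 / ?a') \<le> e2 powr (1 / ?a')"
        using d2(2)[OF v vm] exponents(5,6,13) by (intro powr_mono2) auto
    qed auto
    also have "\<dots> = e / 2 * nrm v h" unfolding r2[symmetric] by simp
    finally show ?thesis using 1 unfolding \<Phi>_def by linarith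
  qed
  with d(1) show ?thesis by blast
qed

lemma directional_derivative:
  assumes W: "W0 p u g" "W0 p v h"
  shows "((\<lambda>s. \<Phi> (\<lambda>x. u x + s * v x) (\<lambda>x. g x + s *\<^sub>R h x)) has_real_derivative (DP g h - DQ u v)) (at 0)"
  unfolding DERIV_def
proof (rule LIM_I)
  fix r :: real assume r: "0 < r"
  define N where "N = DP g h - DQ u v"
  define n where "n = nrm v h"
  have n: "n \<ge> 0" by (simp add: n_def nrm_nonneg)
  define e where "e = r / (2 * (n + 1))"
  have e: "e > 0" "e * n < r" using r n by (auto simp: e_def field_simps add_nonneg_pos)
  obtain d where d: "d > 0" "\<And>v h. W0 p v h \<Longrightarrow> nrm v h < d \<Longrightarrow>
      \<bar>\<Phi> (\<lambda>x. u x + v x) (\<lambda>x. g x + h x) - \<Phi> u g - (DP g h - DQ u v)\<bar> \<le> e * nrm v h"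
    using frechet[OF W(1) e(1)] by blast
  have "\<bar>(\<Phi> (\<lambda>x. u x + s * v x) (\<lambda>x. g x + s *\<^sub>R h x) - \<Phi> u g) / s - N\<bar> < r"
    if s: "s \<noteq> 0" "\<bar>s\<bar> < d / (n + 1)" for s
  proof -
    have ns: "nrm (\<lambda>x. s * v x) (\<lambda>x. s *\<^sub>R h x) = \<bar>s\<bar> * n" unfolding n_def by (rule nrm_scale[OF W(2)])
    have "\<bar>s\<bar> * n \<le> \<bar>s\<bar> * (n + 1)" by (intro mult_left_mono) auto
    also have "\<dots> < d" using s(2) n by (simp add: field_simps)
    finally have "nrm (\<lambda>x. s * v x) (\<lambda>x. s *\<^sub>R h x) < d" unfolding ns .
    from d(2)[OF scaled[OF W(2)] this]
    have "\<bar>\<Phi> (\<lambda>x. u x + s * v x) (\<lambda>x. g x + s *\<^sub>R h x) - \<Phi> u g - (DP g (\<lambda>x. s *\<^sub>R h x) - DQ u (\<lambda>x. s * v x))\<bar> \<le> e * (\<bar>s\<bar> * n)"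
      unfolding ns .
    also have "DP g (\<lambda>x. s *\<^sub>R h x) - DQ u (\<lambda>x. s * v x) = s * N"
      by (simp add: DP_def DQ_def N_def right_diff_distrib mult.left_commute)
    finally have le: "\<bar>\<Phi> (\<lambda>x. u x + s * v x) (\<lambda>x. g x + s *\<^sub>R h x) - \<Phi> u g - s * N\<bar> \<le> \<bar>s\<bar> * (e * n)" by (simp add: mult_ac)
    have "(\<Phi> (\<lambda>x. u x + s * v x) (\<lambda>x. g x + s *\<^sub>R h x) - \<Phi> u g) / s - N = (\<Phi> (\<lambda>x. u x + s * v x) (\<lambda>x. g x + s *\<^sub>R h x) - \<Phi> u g - s * N) / s"
      using s(1) by (simp add: field_simps)
    also have "\<bar>\<dots>\<bar> \<le> e * n" using le s(1) by (simp add: abs_divide divide_le_eq mult.commute)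
    finally show ?thesis using e(2) by simp
  qed
  then show "\<exists>s>0. \<forall>x. x \<noteq> 0 \<and> norm (x - 0) < s \<longrightarrow>
      norm ((\<Phi> (\<lambda>xa. u xa + (0 + x) * v xa) (\<lambda>xa. g xa + (0 + x) *\<^sub>R h xa) - \<Phi> (\<lambda>x. u x + 0 * v x) (\<lambda>x. g x + 0 *\<^sub>R h x)) / x - (DP g h - DQ u v)) < r"
    using d(1) n by (intro exI[of _ "d / (n + 1)"]) (simp add: N_def)
qed

text \<open>
  The smoothed absolute values of test functions approximate \<open>\<bar>u\<bar>\<close>, and their gradients are pointwise no longer
  than before, which does not increase \<open>P\<close> since \<open>\<Gamma>\<close> is monotone in the norm. The weak closure lemma gives a
  gradient of \<open>\<bar>u\<bar>\<close> for each \<open>t\<close> separately; they all agree almost everywhere.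
\<close>

lemma abs_function:
  assumes W: "W0 p u g"
  shows "\<exists>g'. W0 p (\<lambda>x. \<bar>u x\<bar>) g' \<and> (\<forall>t>0. P (\<lambda>x. t *\<^sub>R g' x) \<le> P (\<lambda>x. t *\<^sub>R g x))"
proof -
  interpret finite_measure M by (rule finite_M)
  note up = W0_D(1)[OF W] and g = W0_D(2)[OF W]
  obtain \<phi> where \<phi>': "(\<forall>n::nat. \<phi> n \<in> test_functions \<Omega>) \<and> (\<lambda>n. Lp_mod M p (\<lambda>x. u x - \<phi> n x)) \<longlonglongrightarrow> 0 \<and>
      (\<lambda>n. Lp_mod M p (\<lambda>x. g x - grad (\<phi> n) x)) \<longlonglongrightarrow> 0" using W0_approx[OF W] ..
  note \<phi> = \<phi>'[THEN conjunct1, rule_format] \<phi>'[THEN conjunct2, THEN conjunct1] \<phi>'[THEN conjunct2, THEN conjunct2]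
  define i where "i n = inverse (real (Suc n))" for n
  have i: "i n > 0" "i \<longlonglongrightarrow> 0" for n using LIMSEQ_inverse_real_of_nat by (simp_all add: i_def[abs_def])
  define \<psi> where "\<psi> n x = sqrt ((i n)\<^sup>2 + (\<phi> n x)\<^sup>2) - i n" for n x
  have \<psi>: "\<psi> n \<in> test_functions \<Omega>" "norm (grad (\<psi> n) x) \<le> norm (grad (\<phi> n) x)" "\<bar>\<psi> n x - \<bar>\<phi> n x\<bar>\<bar> \<le> i n" for n x
    unfolding \<psi>_def by (rule test_sqrt[OF \<phi>(1) i(1)])+
  have \<phi>L: "\<phi> n \<in> Lp M p" "grad (\<phi> n) \<in> Lp M p" and \<psi>L: "\<psi> n \<in> Lp M p" "grad (\<psi> n) \<in> Lp M p" for n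
    using test_in_Lp[OF \<phi>(1) exponents(3)] test_in_Lp[OF \<psi>(1) exponents(3)] by auto
  have g\<phi>: "(\<lambda>n. Lp_mod M p (\<lambda>x. grad (\<phi> n) x - g x)) \<longlonglongrightarrow> 0"
    using \<phi>(3) by (simp add: Lp_mod_minus_commute[of M p g])
  have "convergent (\<lambda>n. Lp_mod M p (grad (\<phi> n)))"
    using Lp_mod_tendsto[OF finite_M exponents(2) g \<phi>L(2) g\<phi>] by (rule convergentI)
  then obtain B where B: "\<And>n. Lp_mod M p (grad (\<phi> n)) \<le> B"
    using convergent_imp_Bseq[of "\<lambda>n. Lp_mod M p (grad (\<phi> n))"] unfolding Bseq_def by (auto intro: order_trans[OF abs_ge_self])
  have mono: "Lp_mod M p (grad (\<psi> n)) \<le> Lp_mod M p (grad (\<phi> n))" for n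
    unfolding Lp_mod_def using \<psi>L(2) \<phi>L(2) \<psi>(2) exponents(3) by (intro integral_mono powr_mono2) (auto simp: Lp_def)
  have au: "(\<lambda>x. \<bar>u x\<bar>) \<in> Lp M p" using up by (auto simp: Lp_def intro: borel_measurable_abs)
  have lim: "(\<lambda>n. Lp_mod M p (\<lambda>x. \<psi> n x - \<bar>u x\<bar>)) \<longlonglongrightarrow> 0"
  proof (rule tendsto_zero_le[OF Lp_mod_nonneg])
    fix n
    have d: "(\<lambda>x. u x - \<phi> n x) \<in> Lp M p" by (rule Lp_diff(1)[OF exponents(3) up \<phi>L(1)])
    have "norm (\<psi> n x - \<bar>u x\<bar>) powr p \<le> 2 powr p * (i n powr p + norm (u x - \<phi> n x) powr p)" for x
    proof -
      have "norm (\<psi> n x - \<bar>u x\<bar>) \<le> norm (i n + \<bar>u x - \<phi> n x\<bar>)" using \<psi>(3)[of n x] by simp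
      then have "norm (\<psi> n x - \<bar>u x\<bar>) powr p \<le> norm (i n + \<bar>u x - \<phi> n x\<bar>) powr p" using exponents(3) by (intro powr_mono2) auto
      also have "\<dots> \<le> 2 powr p * (norm (i n) powr p + norm \<bar>u x - \<phi> n x\<bar> powr p)" by (rule norm_add_powr_le[OF exponents(3)])
      finally show ?thesis using i(1)[of n] by simp
    qed
    then have "Lp_mod M p (\<lambda>x. \<psi> n x - \<bar>u x\<bar>) \<le> (LINT x|M. 2 powr p * (i n powr p + norm (u x - \<phi> n x) powr p))"
      unfolding Lp_mod_def using Lp_diff(1)[OF exponents(3) \<psi>L(1) au] d by (intro integral_mono) (auto simp: Lp_def)
    also have "\<dots> = 2 powr p * (i n powr p * measure M (space M) + Lp_mod M p (\<lambda>x. u x - \<phi> n x))"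
      using d by (simp add: Lp_def Lp_mod_def mult.commute)
    finally show "Lp_mod M p (\<lambda>x. \<psi> n x - \<bar>u x\<bar>) \<le> 2 powr p * (i n powr p * measure M (space M) + Lp_mod M p (\<lambda>x. u x - \<phi> n x))" .
  next
    have "(\<lambda>n. i n powr p) \<longlonglongrightarrow> 0 powr p"
      by (rule tendsto_powr'[OF i(2) tendsto_const]) (use exponents(2) less_imp_le[OF i(1)] in \<open>auto intro!: always_eventually\<close>)
    then have "(\<lambda>n. 2 powr p * (i n powr p * measure M (space M) + Lp_mod M p (\<lambda>x. u x - \<phi> n x))) \<longlonglongrightarrow> 2 powr p * (0 powr p * measure M (space M) + 0)"
      by (intro tendsto_mult tendsto_const tendsto_add \<phi>(2))
    then show "(\<lambda>n. 2 powr p * (i n powr p * measure M (space M) + Lp_mod M p (\<lambda>x. u x - \<phi> n x))) \<longlonglongrightarrow> 0" by simp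
  qed
  have clos: "\<exists>h. W0 p (\<lambda>x. \<bar>u x\<bar>) h \<and> P (\<lambda>x. t *\<^sub>R h x) \<le> P (\<lambda>x. t *\<^sub>R g x)" if t: "t > 0" for t
  proof (rule W0_weak_closure[OF exponents(1), of \<psi> "\<lambda>n. grad (\<psi> n)" B "\<lambda>x. \<bar>u x\<bar>" "\<lambda>h. P (\<lambda>x. t *\<^sub>R h x)"])
    show "W0 p (\<psi> n) (grad (\<psi> n))" for n by (rule W0_test[OF exponents(3) \<psi>(1)])
    show "Lp_mod M p (grad (\<psi> n)) \<le> B" for n using mono[of n] B[of n] by linarith
    show "P (\<lambda>x. t *\<^sub>R ((g x + h x) /\<^sub>R 2)) \<le> (P (\<lambda>x. t *\<^sub>R g x) + P (\<lambda>x. t *\<^sub>R h x)) / 2"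
      if "g \<in> Lp M p" "h \<in> Lp M p" for g h
      by (rule P_ray_midpoint[OF that])
    show "(\<lambda>n. P (\<lambda>x. t *\<^sub>R hn n x)) \<longlonglongrightarrow> P (\<lambda>x. t *\<^sub>R h x)"
      if "h \<in> Lp M p" "\<And>n. hn n \<in> Lp M p" "(\<lambda>n. Lp_mod M p (\<lambda>x. hn n x - h x)) \<longlonglongrightarrow> 0" for h hn
      by (rule P_ray_tendsto[OF that])
    fix e :: real assume e: "e > 0"
    have "(\<lambda>n. P (\<lambda>x. t *\<^sub>R grad (\<phi> n) x)) \<longlonglongrightarrow> P (\<lambda>x. t *\<^sub>R g x)" by (rule P_ray_tendsto[OF g \<phi>L(2) g\<phi>])
    from order_tendstoD(2)[OF this, of "P (\<lambda>x. t *\<^sub>R g x) + e"] e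
    obtain N where N: "\<And>n. n \<ge> N \<Longrightarrow> P (\<lambda>x. t *\<^sub>R grad (\<phi> n) x) < P (\<lambda>x. t *\<^sub>R g x) + e" by (auto simp: eventually_sequentially)
    have "P (\<lambda>x. t *\<^sub>R grad (\<psi> n) x) \<le> P (\<lambda>x. t *\<^sub>R grad (\<phi> n) x)" for n
      unfolding P_def using \<psi>(2)
      by (intro integral_mono integrable_\<Gamma> Lp_scale(1) \<psi>L \<phi>L \<Gamma>_mono) (simp add: mult_left_mono)
    then show "\<exists>N. \<forall>n\<ge>N. P (\<lambda>x. t *\<^sub>R grad (\<psi> n) x) \<le> P (\<lambda>x. t *\<^sub>R g x) + e"
      using N by (meson less_imp_le order_trans)
  qed (use au lim in auto)
  obtain g' where g': "W0 p (\<lambda>x. \<bar>u x\<bar>) g'" using clos[of 1] by auto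
  have "P (\<lambda>x. t *\<^sub>R g' x) \<le> P (\<lambda>x. t *\<^sub>R g x)" if t: "t > 0" for t
  proof -
    obtain h where h: "W0 p (\<lambda>x. \<bar>u x\<bar>) h" "P (\<lambda>x. t *\<^sub>R h x) \<le> P (\<lambda>x. t *\<^sub>R g x)" using clos[OF t] by blast
    from P_ray_unique[OF g' h(1)] h(2) show ?thesis by simp
  qed
  with g' show ?thesis by blast
qed

end

section \<open>Existence of a ground state\<close>

context variational begin

lemma DP_tendsto:
  assumes g: "g \<in> Lp M p" "\<And>n. gn n \<in> Lp M p" and lim: "(\<lambda>n. Lp_mod M p (\<lambda>x. gn n x - g x)) \<longlonglongrightarrow> 0" and h: "h \<in> Lp M p"
  shows "(\<lambda>n. DP (gn n) h) \<longlonglongrightarrow> DP g h"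
proof -
  have "(\<lambda>n. Lp_mod M (p / (p - 1)) (\<lambda>x. V (gn n x) - V (g x))) \<longlonglongrightarrow> 0"
    by (rule Nemytskii_continuous[OF finite_M exponents(2,12) V_cont V_growth g lim])
  then have "(\<lambda>n. Lp_mod M (p / (p - 1)) (\<lambda>x. V (gn n x) - V (g x)) powr (1 / (p / (p - 1)))) \<longlonglongrightarrow> 0 powr (1 / (p / (p - 1)))"
    by (rule tendsto_powr'[OF _ tendsto_const]) (use exponents(1,12) in auto)
  then have "(\<lambda>n. Lp_mod M (p / (p - 1)) (\<lambda>x. V (gn n x) - V (g x)) powr (1 / (p / (p - 1)))) \<longlonglongrightarrow> 0" by simp
  then have l: "(\<lambda>n. Lp_mod M (p / (p - 1)) (\<lambda>x. V (gn n x) - V (g x)) powr (1 / (p / (p - 1))) * Lp_mod M p h powr (1 / p)) \<longlonglongrightarrow> 0"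
    by (rule tendsto_mult_left_zero)
  have "\<bar>DP (gn n) h - DP g h\<bar> \<le> Lp_mod M (p / (p - 1)) (\<lambda>x. V (gn n x) - V (g x)) powr (1 / (p / (p - 1))) * Lp_mod M p h powr (1 / p)" for n
  proof -
    have d: "(\<lambda>x. V (gn n x) - V (g x)) \<in> Lp M (p / (p - 1))"
      using V_Lp[OF g(2)] V_Lp[OF g(1)] exponents(12) by (intro Lp_diff(1)) auto
    have "DP (gn n) h - DP g h = (LINT x|M. (V (gn n x) - V (g x)) \<bullet> h x)"
      unfolding DP_def inner_diff_left using DP_integrable[OF g(2) h] DP_integrable[OF g(1) h] by simp
    then show ?thesis using inner_Holder(2)[OF exponents(10,1,16) d h] by simp
  qed
  from tendsto_zero_le[OF abs_ge_zero this l] show ?thesis by (simp add: tendsto_rabs_zero_iff LIM_zero_iff)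
qed

lemma DQ_tendsto:
  assumes u: "u \<in> Lp M \<alpha>" "\<And>n. un n \<in> Lp M \<alpha>" and lim: "(\<lambda>n. Lp_mod M \<alpha> (\<lambda>x. un n x - u x)) \<longlonglongrightarrow> 0" and v: "v \<in> Lp M \<alpha>"
  shows "(\<lambda>n. DQ (un n) v) \<longlonglongrightarrow> DQ u v"
proof -
  have fg: "norm (f t) powr (\<alpha> / (\<alpha> - 1)) \<le> K * (1 + norm t powr \<alpha>)" for t using f_growth[of t] by simp
  have "(\<lambda>n. Lp_mod M (\<alpha> / (\<alpha> - 1)) (\<lambda>x. f (un n x) - f (u x))) \<longlonglongrightarrow> 0"
    by (rule Nemytskii_continuous[OF finite_M exponents(6,13) f_cont fg u lim])
  then have "(\<lambda>n. Lp_mod M (\<alpha> / (\<alpha> - 1)) (\<lambda>x. f (un n x) - f (u x)) powr (1 / (\<alpha> / (\<alpha> - 1)))) \<longlonglongrightarrow> 0 powr (1 / (\<alpha> / (\<alpha> - 1)))"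
    by (rule tendsto_powr'[OF _ tendsto_const]) (use exponents(5,13) in auto)
  then have "(\<lambda>n. Lp_mod M (\<alpha> / (\<alpha> - 1)) (\<lambda>x. f (un n x) - f (u x)) powr (1 / (\<alpha> / (\<alpha> - 1)))) \<longlonglongrightarrow> 0" by simp
  then have l: "(\<lambda>n. Lp_mod M (\<alpha> / (\<alpha> - 1)) (\<lambda>x. f (un n x) - f (u x)) powr (1 / (\<alpha> / (\<alpha> - 1))) * Lp_mod M \<alpha> v powr (1 / \<alpha>)) \<longlonglongrightarrow> 0"
    by (rule tendsto_mult_left_zero)
  have "\<bar>DQ (un n) v - DQ u v\<bar> \<le> Lp_mod M (\<alpha> / (\<alpha> - 1)) (\<lambda>x. f (un n x) - f (u x)) powr (1 / (\<alpha> / (\<alpha> - 1))) * Lp_mod M \<alpha> v powr (1 / \<alpha>)" for n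
  proof -
    have d: "(\<lambda>x. f (un n x) - f (u x)) \<in> Lp M (\<alpha> / (\<alpha> - 1))"
      using f_Lp[OF u(2)] f_Lp[OF u(1)] exponents(13) by (intro Lp_diff(1)) auto
    have "DQ (un n) v - DQ u v = (LINT x|M. (f (un n x) - f (u x)) * v x)"
      unfolding DQ_def left_diff_distrib using DQ_integrable[OF u(2) v] DQ_integrable[OF u(1) v] by simp
    then show ?thesis using inner_Holder(2)[OF exponents(11,5,17) d v] by simp
  qed
  from tendsto_zero_le[OF abs_ge_zero this l] show ?thesis by (simp add: tendsto_rabs_zero_iff LIM_zero_iff)
qed

text \<open>
  If the value at \<open>a\<close> is below the one at \<open>1\<close>, the tangent at \<open>a\<close> in the variable \<open>t powr p\<close> rises towards \<open>1\<close>,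
  and so it falls on the other side of \<open>a\<close>.
\<close>

lemma ray_monotone:
  assumes W: "W0 p u g" and a: "a > 0" and less: "\<Phi> (\<lambda>x. a * u x) (\<lambda>x. a *\<^sub>R g x) < \<Phi> u g"
    and t: "t > 0" "t \<le> a \<and> a < 1 \<or> 1 < a \<and> a \<le> t"
  shows "\<Phi> (\<lambda>x. t * u x) (\<lambda>x. t *\<^sub>R g x) \<le> \<Phi> (\<lambda>x. a * u x) (\<lambda>x. a *\<^sub>R g x)"
proof -
  define N where "N = DP (\<lambda>x. a *\<^sub>R g x) (\<lambda>x. a *\<^sub>R g x) - DQ (\<lambda>x. a * u x) (\<lambda>x. a * u x)"
  have ray: "\<Phi> (\<lambda>x. s * u x) (\<lambda>x. s *\<^sub>R g x) \<le> \<Phi> (\<lambda>x. a * u x) (\<lambda>x. a *\<^sub>R g x) + ((s / a) powr p - 1) / p * N" if "s > 0" for s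
    using ray_le(1)[OF scaled[OF W, of a], of "s / a"] that a by (simp add: N_def)
  have N: "0 < ((1 / a) powr p - 1) / p * N" using ray[of 1] less by simp
  have "((t / a) powr p - 1) / p * N \<le> 0"
  proof (cases "a < 1")
    case True
    then have "1 powr p < (1 / a) powr p" using a exponents(2) by (intro powr_less_mono2) auto
    then have "((1 / a) powr p - 1) / p > 0" using exponents(2) by (intro divide_pos_pos) auto
    with N have "N > 0" by (simp only: zero_less_mult_pos)
    moreover have "(t / a) powr p \<le> 1 powr p" using t a True exponents(3) by (intro powr_mono2) auto
    ultimately show ?thesis using exponents(2) by (intro mult_nonpos_nonneg divide_nonpos_pos) auto
  next
    case False
    then have a1: "1 < a" "a \<le> t" using t by auto
    then have "(1 / a) powr p < 1 powr p" using a exponents(2) by (intro powr_less_mono2) auto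
    then have "((1 / a) powr p - 1) / p < 0" using exponents(2) by (intro divide_neg_pos) auto
    with N have "N < 0" by (meson not_less_iff_gr_or_eq zero_less_mult_iff)
    moreover have "1 powr p \<le> (t / a) powr p" using a1 a exponents(3) by (intro powr_mono2) auto
    ultimately show ?thesis using exponents(2) by (intro mult_nonneg_nonpos divide_nonneg_pos) auto
  qed
  with ray[OF t(1)] show ?thesis by linarith
qed

text \<open>
  The tangent inequality is used for \<open>P\<close> at the perturbed point and for \<open>Q\<close> at the original one: only these choices
  bound the difference of \<open>P\<close> and \<open>Q\<close> from above.
\<close>

lemma \<Phi>_perturb_le:
  assumes W: "W0 p u g" "W0 p v h" and t: "t > 0" and e: "e > 0"
  shows "\<Phi> (\<lambda>x. t * (u x + e * v x)) (\<lambda>x. t *\<^sub>R (g x + e *\<^sub>R h x)) \<le>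
    \<Phi> (\<lambda>x. t * u x) (\<lambda>x. t *\<^sub>R g x) + t * e * (DP (\<lambda>x. t *\<^sub>R (g x + e *\<^sub>R h x)) h - DQ (\<lambda>x. t * u x) v)"
proof -
  note W' = combination[OF W, of t e]
  have "DP (\<lambda>x. t *\<^sub>R (g x + e *\<^sub>R h x)) (\<lambda>x. t *\<^sub>R g x - t *\<^sub>R (g x + e *\<^sub>R h x)) = - (t * e * DP (\<lambda>x. t *\<^sub>R (g x + e *\<^sub>R h x)) h)"
    unfolding DP_def by (simp add: scaleR_add_right mult.assoc)
  then have 1: "P (\<lambda>x. t *\<^sub>R (g x + e *\<^sub>R h x)) - t * e * DP (\<lambda>x. t *\<^sub>R (g x + e *\<^sub>R h x)) h \<le> P (\<lambda>x. t *\<^sub>R g x)"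
    using P_convex[OF W0_D(2)[OF W'] W0_D(2)[OF scaled[OF W(1), of t]]] by simp
  have "DQ (\<lambda>x. t * u x) (\<lambda>x. t * (u x + e * v x) - t * u x) = t * e * DQ (\<lambda>x. t * u x) v"
    unfolding DQ_def by (simp add: distrib_left mult_ac flip: integral_mult_right_zero)
  then have 2: "Q (\<lambda>x. t * u x) + t * e * DQ (\<lambda>x. t * u x) v \<le> Q (\<lambda>x. t * (u x + e * v x))"
    using Q_convex[OF W0_Lalpha[OF scaled[OF W(1), of t]] W0_Lalpha[OF W']] by simp
  show ?thesis using 1 2 unfolding \<Phi>_def right_diff_distrib by linarith
qed

text \<open>
  Suppose that the derivative \<open>N\<close> in the direction \<open>v\<close> is negative. Near \<open>t = 1\<close> and for small \<open>e > 0\<close> the derivative at the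
  perturbed point is below \<open>N / 2\<close>, so the energy at \<open>t * (u + e * v)\<close> stays below \<open>level\<close> by a
  fixed amount as long as \<open>\<bar>t - 1\<bar> \<le> \<delta>\<close>. For small \<open>e\<close> the perturbed ray is still larger at \<open>1\<close> than at \<open>1 - \<delta>\<close> and
  \<open>1 + \<delta>\<close>, hence by \<open>ray_monotone\<close> the values further away are no larger than those at \<open>1 \<plusminus> \<delta>\<close>. So the whole
  ray stays below \<open>level\<close>, a contradiction.
\<close>

lemma no_descent:
  assumes W: "W0 p u g" and nt: "Lp_mod M p u > 0"
    and max: "\<And>t. t > 0 \<Longrightarrow> \<Phi> (\<lambda>x. t * u x) (\<lambda>x. t *\<^sub>R g x) \<le> \<Phi> u g" and lvl: "\<Phi> u g = level"
    and Wv: "W0 p v h"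
  shows "0 \<le> DP g h - DQ u v"
proof (rule ccontr)
  define N where "N = DP g h - DQ u v"
  assume "\<not> ?thesis"
  then have N: "N < 0" by (simp add: N_def)
  note g = W0_D(2)[OF W] and u = W0_Lalpha[OF W] and h = W0_D(2)[OF Wv] and v = W0_Lalpha[OF Wv]
  have Nu: "DP g g - DQ u u = 0"
  proof (rule DERIV_local_max[OF directional_derivative[OF W W], of 1])
    show "\<forall>y. \<bar>0 - y\<bar> < 1 \<longrightarrow> \<Phi> (\<lambda>x. u x + y * u x) (\<lambda>x. g x + y *\<^sub>R g x) \<le> \<Phi> (\<lambda>x. u x + 0 * u x) (\<lambda>x. g x + 0 *\<^sub>R g x)"
    proof (intro allI impI)
      fix y :: real assume "\<bar>0 - y\<bar> < 1"
      then have "1 + y > 0" by linarith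
      from max[OF this] show "\<Phi> (\<lambda>x. u x + y * u x) (\<lambda>x. g x + y *\<^sub>R g x) \<le> \<Phi> (\<lambda>x. u x + 0 * u x) (\<lambda>x. g x + 0 *\<^sub>R g x)"
        by (simp add: distrib_right scaleR_add_left)
    qed
  qed simp
  have strict: "\<Phi> (\<lambda>x. t * u x) (\<lambda>x. t *\<^sub>R g x) < \<Phi> u g" if "t > 0" "t \<noteq> 1" for t
    using ray_le(2)[OF W that(1) nt that(2)] by (simp add: Nu)
  \<comment> \<open>The derivative in the direction \<open>v\<close> depends continuously on the dilation and on the perturbation.\<close>
  have "\<exists>\<delta>>0. \<delta> \<le> 1 / 2 \<and> (\<forall>t e. \<bar>t - 1\<bar> \<le> \<delta> \<and> 0 < e \<and> e < \<delta> \<longrightarrow>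
      DP (\<lambda>x. t *\<^sub>R (g x + e *\<^sub>R h x)) h - DQ (\<lambda>x. t * u x) v < N / 2)"
  proof (rule ccontr)
    assume neg: "\<not> ?thesis"
    define \<delta> where "\<delta> n = inverse (real (Suc n)) / 2" for n
    have \<delta>: "\<delta> n > 0" "\<delta> n \<le> 1 / 2" for n by (simp_all add: \<delta>_def inverse_le_1_iff)
    have \<delta>lim: "\<delta> \<longlonglongrightarrow> 0" unfolding \<delta>_def[abs_def] using tendsto_divide[OF LIMSEQ_inverse_real_of_nat tendsto_const[of 2]] by simp
    define S where "S t e = DP (\<lambda>x. t *\<^sub>R (g x + e *\<^sub>R h x)) h - DQ (\<lambda>x. t * u x) v" for t e
    have "\<exists>z. \<bar>fst z - 1\<bar> \<le> \<delta> n \<and> 0 < snd z \<and> snd z < \<delta> n \<and> N / 2 \<le> S (fst z) (snd z)" for n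
      using neg \<delta>[of n] unfolding S_def[symmetric] not_ex de_Morgan_conj not_all not_imp by (auto simp: not_less)
    then have "\<exists>z. \<forall>n. \<bar>fst (z n) - 1\<bar> \<le> \<delta> n \<and> 0 < snd (z n) \<and> snd (z n) < \<delta> n \<and> N / 2 \<le> S (fst (z n)) (snd (z n))"
      by (intro choice allI)
    then obtain z where z: "\<And>n. \<bar>fst (z n) - 1\<bar> \<le> \<delta> n \<and> 0 < snd (z n) \<and> snd (z n) < \<delta> n \<and> N / 2 \<le> S (fst (z n)) (snd (z n))" by blast
    define t e where "t n = fst (z n)" and "e n = snd (z n)" for n
    have te: "\<bar>t n - 1\<bar> \<le> \<delta> n" "0 < e n" "e n < \<delta> n"
      "N / 2 \<le> DP (\<lambda>x. t n *\<^sub>R (g x + e n *\<^sub>R h x)) h - DQ (\<lambda>x. t n * u x) v" for n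
      using z[of n] by (auto simp: t_def e_def S_def)
    have "(\<lambda>n. \<bar>t n - 1\<bar>) \<longlonglongrightarrow> 0" by (rule tendsto_zero_le[of "\<lambda>n. \<bar>t n - 1\<bar>" \<delta>, OF abs_ge_zero te(1) \<delta>lim])
    then have tl: "t \<longlonglongrightarrow> 1" by (simp add: tendsto_rabs_zero_iff LIM_zero_iff)
    have el: "e \<longlonglongrightarrow> 0" by (rule tendsto_zero_le[of e \<delta>, OF less_imp_le[OF te(2)] less_imp_le[OF te(3)] \<delta>lim])
    have 1: "(\<lambda>n. DP (\<lambda>x. t n *\<^sub>R (g x + e n *\<^sub>R h x)) h) \<longlonglongrightarrow> DP (\<lambda>x. 1 *\<^sub>R g x) h"
      by (rule DP_tendsto[of "\<lambda>x. 1 *\<^sub>R g x" "\<lambda>n x. t n *\<^sub>R (g x + e n *\<^sub>R h x)", OF Lp_scale(1)[OF g] W0_D(2)[OF combination[OF W Wv]] combination_lim[OF g h tl el] h])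
    have tu: "(\<lambda>x. t n * u x) \<in> Lp M \<alpha>" for n using Lp_scale(1)[OF u, of "t n"] by simp
    have "Lp_mod M \<alpha> (\<lambda>x. t n * u x - u x) = \<bar>t n - 1\<bar> powr \<alpha> * Lp_mod M \<alpha> u" for n
      using Lp_scale(2)[OF u, of "t n - 1"] by (simp add: left_diff_distrib)
    moreover have "(\<lambda>n. \<bar>t n - 1\<bar> powr \<alpha> * Lp_mod M \<alpha> u) \<longlonglongrightarrow> \<bar>1 - 1\<bar> powr \<alpha> * Lp_mod M \<alpha> u"
      using tl exponents(6) by (intro tendsto_mult tendsto_const tendsto_powr' tendsto_rabs tendsto_diff) auto
    ultimately have "(\<lambda>n. Lp_mod M \<alpha> (\<lambda>x. t n * u x - u x)) \<longlonglongrightarrow> 0" by simp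
    then have 2: "(\<lambda>n. DQ (\<lambda>x. t n * u x) v) \<longlonglongrightarrow> DQ u v" by (rule DQ_tendsto[of u "\<lambda>n x. t n * u x", OF u tu _ v])
    have "(\<lambda>n. DP (\<lambda>x. t n *\<^sub>R (g x + e n *\<^sub>R h x)) h - DQ (\<lambda>x. t n * u x) v) \<longlonglongrightarrow> N"
      using tendsto_diff[OF 1 2] by (simp add: N_def)
    then have "N / 2 \<le> N" by (rule LIMSEQ_le_const) (use te(4) in blast)
    with N show False by linarith
  qed
  then obtain \<delta> where \<delta>: "\<delta> > 0" "\<delta> \<le> 1 / 2" "\<And>t e. \<bar>t - 1\<bar> \<le> \<delta> \<Longrightarrow> 0 < e \<Longrightarrow> e < \<delta> \<Longrightarrow>
      DP (\<lambda>x. t *\<^sub>R (g x + e *\<^sub>R h x)) h - DQ (\<lambda>x. t * u x) v < N / 2" by blast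
  define e where "e n = \<delta> * (inverse (real (Suc n)) / 2)" for n
  have e: "0 < e n" "e n < \<delta>" for n
  proof -
    show "0 < e n" using \<delta>(1) by (simp add: e_def)
    have "inverse (real (Suc n)) \<le> 1" by (simp add: inverse_le_1_iff)
    then have "inverse (real (Suc n)) / 2 < 1" by simp
    then have "\<delta> * (inverse (real (Suc n)) / 2) < \<delta> * 1" using \<delta>(1) by (rule mult_strict_left_mono)
    then show "e n < \<delta>" by (simp add: e_def)
  qed
  have el: "e \<longlonglongrightarrow> 0"
    unfolding e_def[abs_def] using tendsto_mult[OF tendsto_const[of \<delta>] tendsto_divide[OF LIMSEQ_inverse_real_of_nat tendsto_const[of 2]]] by simp
  define J where "J a n = \<Phi> (\<lambda>x. a * (u x + e n * v x)) (\<lambda>x. a *\<^sub>R (g x + e n *\<^sub>R h x))" for a n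
  have Jlim: "J a \<longlonglongrightarrow> \<Phi> (\<lambda>x. a * u x) (\<lambda>x. a *\<^sub>R g x)" for a
    unfolding J_def[abs_def] by (rule \<Phi>_combination_tendsto[OF W Wv tendsto_const el])
  have ev: "\<forall>\<^sub>F n in sequentially. J a n < J 1 n" if "a > 0" "a \<noteq> 1" for a
  proof -
    have "(\<lambda>n. J a n - J 1 n) \<longlonglongrightarrow> \<Phi> (\<lambda>x. a * u x) (\<lambda>x. a *\<^sub>R g x) - \<Phi> (\<lambda>x. 1 * u x) (\<lambda>x. 1 *\<^sub>R g x)"
      by (intro tendsto_diff Jlim)
    moreover have "\<Phi> (\<lambda>x. a * u x) (\<lambda>x. a *\<^sub>R g x) - \<Phi> (\<lambda>x. 1 * u x) (\<lambda>x. 1 *\<^sub>R g x) < 0" using strict[OF that] by simp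
    ultimately have "\<forall>\<^sub>F n in sequentially. J a n - J 1 n < 0" by (rule order_tendstoD(2))
    then show ?thesis by eventually_elim simp
  qed
  have gL: "(\<lambda>x. g x + e n *\<^sub>R h x) \<in> Lp M p" for n by (intro Lp_add(1) exponents(3) g Lp_scale(1) h)
  have "(\<lambda>n. Lp_mod M p (\<lambda>x. g x + e n *\<^sub>R h x - g x)) \<longlonglongrightarrow> 0"
    using combination_lim[OF g h tendsto_const[of 1] el] by simp
  then have "(\<lambda>n. Lp_mod M p (\<lambda>x. g x + e n *\<^sub>R h x)) \<longlonglongrightarrow> Lp_mod M p g"
    by (rule Lp_mod_tendsto[of M p g "\<lambda>n x. g x + e n *\<^sub>R h x", OF finite_M exponents(2) g gL])
  then have evg: "\<forall>\<^sub>F n in sequentially. 0 < Lp_mod M p (\<lambda>x. g x + e n *\<^sub>R h x)"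
    by (rule order_tendstoD(1)) (rule nontrivial_gradient[OF W nt])
  have "\<forall>\<^sub>F n in sequentially. J (1 - \<delta>) n < J 1 n \<and> J (1 + \<delta>) n < J 1 n \<and> 0 < Lp_mod M p (\<lambda>x. g x + e n *\<^sub>R h x)"
    by (intro eventually_conj ev evg) (use \<delta>(1,2) in auto)
  then obtain n where n: "J (1 - \<delta>) n < J 1 n" "J (1 + \<delta>) n < J 1 n" "0 < Lp_mod M p (\<lambda>x. g x + e n *\<^sub>R h x)"
    using eventually_happens'[OF sequentially_bot] by blast
  have Ww: "W0 p (\<lambda>x. u x + e n * v x) (\<lambda>x. g x + e n *\<^sub>R h x)" using W0_add[OF exponents(3) W Wv] .
  \<comment> \<open>For dilations in \<open>{1 - \<delta>..1 + \<delta>}\<close> the energy drops by at least \<open>(1 - \<delta>) * e n * \<bar>N\<bar> / 2\<close>.\<close>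
  define b where "b = level + (1 - \<delta>) * e n * (N / 2)"
  have near: "J t n \<le> b" if t: "\<bar>t - 1\<bar> \<le> \<delta>" for t
  proof -
    have t0: "t > 0" "1 - \<delta> \<le> t" using t \<delta>(1,2) by (auto simp: abs_le_iff)
    have "J t n \<le> \<Phi> (\<lambda>x. t * u x) (\<lambda>x. t *\<^sub>R g x) + t * e n * (DP (\<lambda>x. t *\<^sub>R (g x + e n *\<^sub>R h x)) h - DQ (\<lambda>x. t * u x) v)"
      unfolding J_def by (rule \<Phi>_perturb_le[OF W Wv t0(1) e(1)])
    also have "\<dots> \<le> level + t * e n * (N / 2)"
      using max[OF t0(1)] lvl \<delta>(3)[OF t e[of n]] t0(1) e(1)[of n] by (intro add_mono mult_left_mono) auto
    also have "\<dots> \<le> b"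
    proof -
      have "(1 - \<delta>) * e n \<le> t * e n" using t0(2) e(1)[of n] by (intro mult_right_mono) auto
      then have "t * e n * (N / 2) \<le> (1 - \<delta>) * e n * (N / 2)" by (rule mult_right_mono_neg) (use N in simp)
      then show ?thesis by (simp add: b_def)
    qed
    finally show ?thesis .
  qed
  have all: "J t n \<le> b" if t: "t > 0" for t
  proof (cases "\<bar>t - 1\<bar> \<le> \<delta>")
    case True then show ?thesis by (rule near)
  next
    case False
    then consider "t \<le> 1 - \<delta>" | "1 + \<delta> \<le> t" by (auto simp: abs_le_iff not_le)
    then show ?thesis
    proof cases
      case 1
      have "J t n \<le> J (1 - \<delta>) n"
        unfolding J_def by (rule ray_monotone[OF Ww _ _ t]) (use n(1) 1 \<delta>(1,2) in \<open>auto simp: J_def\<close>)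
      also have "\<dots> \<le> b" using \<delta>(1) by (intro near) auto
      finally show ?thesis .
    next
      case 2
      have "J t n \<le> J (1 + \<delta>) n"
        unfolding J_def by (rule ray_monotone[OF Ww _ _ t]) (use n(2) 2 \<delta>(1,2) in \<open>auto simp: J_def\<close>)
      also have "\<dots> \<le> b" using \<delta>(1) by (intro near) auto
      finally show ?thesis .
    qed
  qed
  have "b \<in> ray_bounds" by (rule ray_boundsI[OF Ww n(3)]) (use all in \<open>simp add: J_def\<close>)
  then have "level \<le> b" by (rule level_le)
  moreover have "(1 - \<delta>) * e n * (N / 2) < 0"
    using \<delta>(2) e(1)[of n] N by (intro mult_pos_neg mult_pos_pos) auto
  ultimately show False by (simp add: b_def)
qed

text \<open>
  Any competitor with \<open>DP h h = DQ v v\<close> maximises the energy on its ray, so its energy belongs to \<open>ray_bounds\<close>.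
\<close>

theorem ground_state:
  assumes ne: "\<Omega> \<noteq> {}"
  shows "\<exists>u g. W0 p u g \<and> Lp_mod M p u > 0 \<and> (\<forall>x. 0 \<le> u x) \<and>
    (\<forall>v h. W0 p v h \<longrightarrow> DP g h = DQ u v) \<and>
    (\<forall>v h. W0 p v h \<and> Lp_mod M p v > 0 \<and> DP h h = DQ v v \<longrightarrow> \<Phi> u g \<le> \<Phi> v h)"
proof -
  obtain w gw where w: "W0 p w gw" "Lp_mod M p w > 0" "\<And>t. t > 0 \<Longrightarrow> \<Phi> (\<lambda>x. t * w x) (\<lambda>x. t *\<^sub>R gw x) \<le> level"
    using minimizing_ray[OF ne] by blast
  obtain ga where ga: "W0 p (\<lambda>x. \<bar>w x\<bar>) ga" "\<And>t. t > 0 \<Longrightarrow> P (\<lambda>x. t *\<^sub>R ga x) \<le> P (\<lambda>x. t *\<^sub>R gw x)"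
    using abs_function[OF w(1)] by blast
  have nta: "Lp_mod M p (\<lambda>x. \<bar>w x\<bar>) > 0" using w(2) by (simp add: Lp_mod_def)
  have ray: "\<Phi> (\<lambda>x. t * \<bar>w x\<bar>) (\<lambda>x. t *\<^sub>R ga x) \<le> level" if t: "t > 0" for t
  proof -
    have "F (t * \<bar>w x\<bar>) = F (t * w x)" for x using F_even[of "t * w x"] by (cases "w x \<ge> 0") auto
    then have "Q (\<lambda>x. t * \<bar>w x\<bar>) = Q (\<lambda>x. t * w x)" by (simp add: Q_def)
    then show ?thesis using w(3)[OF t] ga(2)[OF t] by (simp add: \<Phi>_def)
  qed
  obtain t0 where t0: "t0 > 0" "\<And>t. t > 0 \<Longrightarrow> \<Phi> (\<lambda>x. t * \<bar>w x\<bar>) (\<lambda>x. t *\<^sub>R ga x) \<le> \<Phi> (\<lambda>x. t0 * \<bar>w x\<bar>) (\<lambda>x. t0 *\<^sub>R ga x)"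
    using ray_sup_attained[OF ga(1) nta] by blast
  define u where "u x = t0 * \<bar>w x\<bar>" for x
  define g where "g x = t0 *\<^sub>R ga x" for x
  have W: "W0 p u g" unfolding u_def g_def by (rule scaled[OF ga(1)])
  have nt: "Lp_mod M p u > 0"
    using Lp_scale(2)[OF W0_D(1)[OF ga(1)], of t0] nta t0(1) by (simp add: u_def[abs_def])
  have max: "\<Phi> (\<lambda>x. t * u x) (\<lambda>x. t *\<^sub>R g x) \<le> \<Phi> u g" if "t > 0" for t
    using t0(2)[of "t * t0"] that t0(1) by (simp add: u_def[abs_def] g_def[abs_def] mult.assoc)
  have "\<Phi> u g \<in> ray_bounds" by (rule ray_boundsI[OF W nontrivial_gradient[OF W nt] max])
  then have "level \<le> \<Phi> u g" by (rule level_le)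
  moreover have "\<Phi> u g \<le> level" using ray[OF t0(1)] by (simp add: u_def[abs_def] g_def[abs_def])
  ultimately have lvl: "\<Phi> u g = level" by simp
  have crit: "DP g h = DQ u v" if Wv: "W0 p v h" for v h
  proof -
    have "DP g (\<lambda>x. (-1) *\<^sub>R h x) = - DP g h" "DQ u (\<lambda>x. (-1) * v x) = - DQ u v"
      by (simp_all add: DP_def DQ_def)
    then show ?thesis
      using no_descent[OF W nt max lvl Wv] no_descent[OF W nt max lvl scaled[OF Wv, of "-1"]] by linarith
  qed
  have least: "\<Phi> u g \<le> \<Phi> v h" if Wv: "W0 p v h" "Lp_mod M p v > 0" "DP h h = DQ v v" for v h
  proof -
    have "\<Phi> v h \<in> ray_bounds"
      by (rule ray_boundsI[OF Wv(1) nontrivial_gradient[OF Wv(1,2)]]) (use ray_le(1)[OF Wv(1)] Wv(3) in simp)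
    then show ?thesis unfolding lvl by (rule level_le)
  qed
  have "\<forall>x. 0 \<le> u x" using t0(1) by (simp add: u_def)
  with W nt crit least show ?thesis by blast
qed

end

section \<open>The principal part\<close>

lemma primitive_0 [simp]: "primitive g 0 = 0"
  by (simp add: primitive_def)

lemma conjugate_growth:
  fixes y c s r :: real
  assumes y: "0 \<le> y" "y \<le> c * max 1 s powr (r - 1)" and c: "0 \<le> c" and r: "1 < r" and s: "0 \<le> s"
  shows "y powr (r / (r - 1)) \<le> c powr (r / (r - 1)) * (1 + s powr r)"
proof -
  have "y powr (r / (r - 1)) \<le> (c * max 1 s powr (r - 1)) powr (r / (r - 1))"
    using y r by (intro powr_mono2) auto
  also have "\<dots> = c powr (r / (r - 1)) * max 1 s powr r"
    using r by (simp add: powr_mult powr_powr)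
  also have "\<dots> \<le> c powr (r / (r - 1)) * (1 + s powr r)"
    using s by (intro mult_left_mono) (auto simp: max_def)
  finally show ?thesis .
qed

locale principal_part =
  fixes a :: "real \<Rightarrow> real" and p q k0 k1 :: real
  assumes pq: "1 < q" "q \<le> p" and k: "0 < k0" "0 < k1"
    and a_cont: "\<And>t. 0 < t \<Longrightarrow> isCont a t"
    and a_lower: "\<And>t. 0 < t \<Longrightarrow> k0 * (1 + t powr ((q - p) / p)) \<le> a t"
    and a_upper: "\<And>t. 0 < t \<Longrightarrow> a t \<le> k1 * (1 + t powr ((q - p) / p))"
    and a_antimono: "\<And>s t. 0 < s \<Longrightarrow> s \<le> t \<Longrightarrow> a t \<le> a s"
    and flux_convex: "convex_on {0<..} (\<lambda>s. a (s powr p) * s powr p)"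
begin

lemma p_pos: "0 < p" "1 < p" "p \<noteq> 0" "q \<noteq> 0" "0 < q" using pq by auto

abbreviation "A \<equiv> primitive a"

lemma a_pos: "0 < a t" if "0 < t"
proof -
  have "0 < k0 * (1 + t powr ((q - p) / p))" using k(1) by (intro mult_pos_pos add_pos_nonneg) auto
  then show ?thesis using a_lower[OF that] by linarith
qed

text \<open>
  The antiderivative of \<open>1 + t powr ((q - p) / p)\<close> that vanishes at \<open>0\<close>.
\<close>

definition H :: "real \<Rightarrow> real" where "H t = t + p / q * t powr (q / p)"

lemma H_tendsto_0: "(H \<longlongrightarrow> 0) (at 0 within {0..})"
proof -
  have "(H \<longlongrightarrow> 0 + p / q * 0 powr (q / p)) (at 0 within {0..})"
    unfolding H_def[abs_def] using p_pos
    by (intro tendsto_add tendsto_mult tendsto_const tendsto_ident_at tendsto_powr') (auto simp: eventually_at_filter)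
  then show ?thesis by simp
qed

lemma H_derivative:
  assumes "0 < t" shows "(H has_real_derivative 1 + t powr ((q - p) / p)) (at t)"
proof -
  have "((\<lambda>t. t powr (q / p)) has_real_derivative (q / p) * t powr (q / p - 1)) (at t)"
    by (rule has_real_derivative_powr[OF assms])
  from DERIV_add[OF DERIV_ident DERIV_cmult[OF this, of "p / q"]]
  show ?thesis using p_pos by (simp add: H_def[abs_def] diff_divide_distrib)
qed

lemma H_integral:
  assumes T: "0 < T"
  shows "set_integrable lborel {0<..<T} (\<lambda>t. 1 + t powr ((q - p) / p))"
    "(LBINT t=ereal 0..ereal T. 1 + t powr ((q - p) / p)) = H T"
proof -
  have l0: "(H \<longlongrightarrow> H 0) (at_right 0)"
    using tendsto_within_subset[OF H_tendsto_0, of "{0<..}"] by (simp add: H_def subset_eq)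
  have lT: "(H \<longlongrightarrow> H T) (at_left T)"
    using DERIV_isCont[OF H_derivative[OF T]] unfolding isCont_def by (rule tendsto_within_subset) simp
  have c: "isCont (\<lambda>t. 1 + t powr ((q - p) / p)) x" if "0 < x" for x
    using that by (intro continuous_intros) auto
  have *: "ereal 0 < ereal T" using T by simp
  have l0': "((H \<circ> real_of_ereal) \<longlongrightarrow> H 0) (at_right (ereal 0))"
    and lT': "((H \<circ> real_of_ereal) \<longlongrightarrow> H T) (at_left (ereal T))"
    using l0 lT by (simp_all add: ereal_tendsto_simps1)
  have "set_integrable lborel (einterval (ereal 0) (ereal T)) (\<lambda>t. 1 + t powr ((q - p) / p))"
    and *: "(LBINT t=ereal 0..ereal T. 1 + t powr ((q - p) / p)) = H T - H 0"
    by (rule interval_integral_FTC_nonneg[OF * _ _ _ l0' lT']; use H_derivative c in simp)+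
  then show "set_integrable lborel {0<..<T} (\<lambda>t. 1 + t powr ((q - p) / p))" by (simp add: einterval_eq_Icc)
  show "(LBINT t=ereal 0..ereal T. 1 + t powr ((q - p) / p)) = H T" using * by (simp add: H_def)
qed

lemma a_integrable:
  assumes T: "0 < T" shows "set_integrable lborel {0<..<T} a"
proof (rule set_integrable_bound)
  show "set_integrable lborel {0<..<T} (\<lambda>t. k1 * (1 + t powr ((q - p) / p)))"
    using H_integral(1)[OF T] by simp
  have "continuous_on {0<..<T} a" using a_cont by (intro continuous_at_imp_continuous_on) auto
  then show "set_borel_measurable lborel {0<..<T} a"
    using borel_measurable_continuous_on_indicator[of "{0<..<T}" a] by (simp add: set_borel_measurable_def)
  show "AE t in lborel. t \<in> {0<..<T} \<longrightarrow> norm (a t) \<le> norm (k1 * (1 + t powr ((q - p) / p)))"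
    using a_upper a_pos by (auto intro!: AE_I2) (metis abs_le_D1 abs_of_pos order_trans abs_ge_self)
qed

lemma A_bounds:
  assumes t: "0 \<le> t" shows "k0 * H t \<le> A t" "A t \<le> k1 * H t"
proof -
  have "k0 * H t \<le> A t \<and> A t \<le> k1 * H t"
  proof (cases "t = 0")
    case False
    then have T: "0 < t" using t by simp
    have b: "set_integrable lborel {0<..<t} (\<lambda>t. c * (1 + t powr ((q - p) / p)))" for c
      using H_integral(1)[OF T] by simp
    have v: "(LBINT t:{0<..<t}. c * (1 + t powr ((q - p) / p))) = c * H t" for c
      using H_integral(2)[OF T] T by (simp add: interval_lebesgue_integral_le_eq einterval_eq_Icc)
    have A: "A t = (LBINT s:{0<..<t}. a s)"
      using T by (simp add: primitive_def interval_lebesgue_integral_le_eq einterval_eq_Icc)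
    show ?thesis unfolding A v[symmetric]
      using a_lower a_upper by (intro conjI set_integral_mono b a_integrable T) auto
  qed (simp add: H_def)
  then show "k0 * H t \<le> A t" "A t \<le> k1 * H t" by auto
qed

lemma A_derivative:
  assumes t: "0 < t" shows "(A has_real_derivative a t) (at t)"
proof -
  have "continuous_on {t/2..2*t} a" using a_cont t by (intro continuous_at_imp_continuous_on) auto
  then have "((\<lambda>u. LBINT y=ereal (t/2)..ereal u. a y) has_vector_derivative a t) (at t within {t/2..2*t})"
    using t by (intro interval_integral_FTC2) auto
  then have "((\<lambda>u. LBINT y=ereal (t/2)..ereal u. a y) has_real_derivative a t) (at t)"
    using t at_within_Icc_at[of "t/2" t "2*t"] by (simp add: has_real_derivative_iff_has_vector_derivative)
  then have d: "((\<lambda>u. A (t/2) + (LBINT y=ereal (t/2)..ereal u. a y)) has_real_derivative a t) (at t)"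
    by (auto intro!: derivative_eq_intros)
  show ?thesis
  proof (rule DERIV_cong_ev[THEN iffD1, OF refl _ refl d])
    have "A (t/2) + (LBINT y=ereal (t/2)..ereal u. a y) = A u" if u: "u \<in> {0<..}" for u
      unfolding primitive_def
    proof (rule interval_integral_sum)
      have "0 < max (t/2) u" using t by simp
      from a_integrable[OF this]
      show "interval_lebesgue_integrable lborel (min (ereal 0) (min (ereal (t/2)) (ereal u))) (max (ereal 0) (max (ereal (t/2)) (ereal u))) a"
        using t u by (auto simp: interval_lebesgue_integrable_def einterval_eq_Icc max_def min_def split: if_splits)
    qed
    then show "\<forall>\<^sub>F u in nhds t. A (t/2) + (LBINT y=ereal (t/2)..ereal u. a y) = A u"
      using t by (intro eventually_nhds_in_open[THEN eventually_mono, of "{0<..}"]) auto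
  qed
qed

lemma A_continuous: "continuous_on {0..} A"
  unfolding continuous_on_def
proof
  fix t :: real assume t: "t \<in> {0..}"
  show "(A \<longlongrightarrow> A t) (at t within {0..})"
  proof (cases "t = 0")
    case True
    have ev: "\<forall>\<^sub>F t in at 0 within {0..}. (0::real) \<le> t" by (simp add: eventually_at_filter)
    have "(A \<longlongrightarrow> 0) (at 0 within {0..})"
    proof (rule tendsto_sandwich)
      show "((\<lambda>t. k0 * H t) \<longlongrightarrow> 0) (at 0 within {0..})" "((\<lambda>t. k1 * H t) \<longlongrightarrow> 0) (at 0 within {0..})"
        using H_tendsto_0 by (auto intro: tendsto_mult_right_zero)
    qed (use ev A_bounds in \<open>auto elim: eventually_mono\<close>)
    then show ?thesis using True by simp
  next
    case False
    then have "isCont A t" using t by (intro DERIV_isCont[OF A_derivative]) auto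
    then show ?thesis unfolding isCont_def by (rule tendsto_within_subset) simp
  qed
qed

lemma A_concave:
  assumes st: "0 < s" "0 < t" shows "A t - A s \<le> a s * (t - s)"
proof (cases s t rule: linorder_cases)
  case less
  obtain z where z: "s < z" "z < t" "A t - A s = (t - s) * a z"
    using MVT2[OF less, of A a] A_derivative st by auto
  then show ?thesis using a_antimono[of s z] st less by (simp add: mult.commute mult_left_mono)
next
  case greater
  obtain z where z: "t < z" "z < s" "A s - A t = (s - t) * a z"
    using MVT2[OF greater, of A a] A_derivative st by auto
  have "(s - t) * a s \<le> (s - t) * a z" using a_antimono[of z s] z st by (intro mult_left_mono) auto
  then show ?thesis using z(3) by (simp add: algebra_simps)
qed simp

text \<open>
  The length of the vector field of the equation as a function of the length of the gradient.
\<close>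

definition flux :: "real \<Rightarrow> real" where "flux s = a (s powr p) * s powr (p - 1)"

lemma flux_nonneg: "0 \<le> flux s" if "0 \<le> s"
  using that a_pos[of "s powr p"] by (cases "s = 0") (auto simp: flux_def)

lemma flux_upper:
  assumes s: "0 < s" shows "flux s \<le> k1 * (s powr (p - 1) + s powr (q - 1))"
proof -
  have "flux s \<le> k1 * (1 + (s powr p) powr ((q - p) / p)) * s powr (p - 1)"
    unfolding flux_def using s by (intro mult_right_mono a_upper) auto
  also have "(s powr p) powr ((q - p) / p) = s powr (q - p)" using p_pos by (simp add: powr_powr)
  also have "k1 * (1 + s powr (q - p)) * s powr (p - 1) = k1 * (s powr (p - 1) + s powr (q - 1))"
    using powr_add[of s "q - p" "p - 1"] by (simp add: algebra_simps)
  finally show ?thesis .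
qed

lemma flux_mult: "0 < s \<Longrightarrow> flux s * s = a (s powr p) * s powr p"
  using powr_add[of s "p - 1" 1] by (simp add: flux_def mult.assoc)

text \<open>
  Convexity of \<open>h(s) = s * flux s\<close> on \<open>(0, \<infinity>)\<close> is used between \<open>e\<close> and \<open>s\<close>. As \<open>h(e) \<rightarrow> 0\<close> for \<open>e \<rightarrow> 0\<close>, the
  limit is the comparison of the slopes of \<open>h\<close> seen from the origin, which are the values of \<open>flux\<close>.
\<close>

lemma flux_mono:
  assumes rs: "0 < r" "r \<le> s" shows "flux r \<le> flux s"
proof (cases "r = s")
  case False
  then have less: "r < s" using rs by simp
  define h where "h s = a (s powr p) * s powr p" for s
  have h: "flux t * t = h t" if "0 < t" for t using flux_mult[OF that] by (simp add: h_def)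
  have h0: "(h \<longlongrightarrow> 0) (at_right 0)"
  proof (rule tendsto_sandwich[of "\<lambda>_. 0" h "at_right 0" "\<lambda>t. k1 * (t powr p + t powr q)"])
    have "((\<lambda>t. k1 * (t powr p + t powr q)) \<longlongrightarrow> k1 * (0 powr p + 0 powr q)) (at_right 0)"
      using p_pos by (intro tendsto_intros tendsto_powr') (auto simp: eventually_at_filter)
    then show "((\<lambda>t. k1 * (t powr p + t powr q)) \<longlongrightarrow> 0) (at_right 0)" by simp
    have "0 \<le> h t" if "0 < t" for t using a_pos[of "t powr p"] that by (auto simp: h_def intro: less_imp_le)
    then show "\<forall>\<^sub>F t in at_right 0. 0 \<le> h t" by (auto simp: eventually_at_filter)
    have "h t \<le> k1 * (t powr p + t powr q)" if t: "0 < t" for t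
    proof -
      have "flux t * t \<le> k1 * (t powr (p - 1) + t powr (q - 1)) * t" using flux_upper[OF t] t by (intro mult_right_mono) auto
      then show ?thesis using h[OF t] t powr_add[of t "p - 1" 1] powr_add[of t "q - 1" 1] by (simp add: algebra_simps)
    qed
    then show "\<forall>\<^sub>F t in at_right 0. h t \<le> k1 * (t powr p + t powr q)" by (auto simp: eventually_at_filter)
  qed simp
  have "\<forall>\<^sub>F e in at_right 0. h r \<le> (s - r) / (s - e) * h e + (r - e) / (s - e) * h s"
  proof (rule eventually_at_rightI[of 0 r])
    fix e assume e: "e \<in> {0<..<r}"
    define \<tau> where "\<tau> = (r - e) / (s - e)"
    have \<tau>: "0 \<le> \<tau>" "\<tau> \<le> 1" "1 - \<tau> = (s - r) / (s - e)" using e less by (auto simp: \<tau>_def field_simps)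
    have "(1 - \<tau>) * e + \<tau> * s = e + \<tau> * (s - e)" by (simp add: algebra_simps)
    also have "\<dots> = r" using e less by (simp add: \<tau>_def)
    finally have "h r \<le> (1 - \<tau>) * h e + \<tau> * h s"
      using convex_onD[OF flux_convex \<tau>(1,2), of e s] e less unfolding h_def by simp
    then show "h r \<le> (s - r) / (s - e) * h e + (r - e) / (s - e) * h s" using \<tau>(3) by (simp add: \<tau>_def)
  qed (use rs in simp)
  moreover have "((\<lambda>e. (s - r) / (s - e) * h e + (r - e) / (s - e) * h s) \<longlongrightarrow> (s - r) / (s - 0) * 0 + (r - 0) / (s - 0) * h s) (at_right 0)"
    using less rs by (intro tendsto_intros h0) auto
  ultimately have "h r \<le> (s - r) / (s - 0) * 0 + (r - 0) / (s - 0) * h s"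
    by (intro tendsto_lowerbound) auto
  then have "flux r * r \<le> (r / s) * (flux s * s)" using h less rs by simp
  then have "flux r * r \<le> flux s * r" using less rs by simp
  then show ?thesis using rs by simp
qed simp

definition \<Gamma> :: "'b::euclidean_space \<Rightarrow> real" where "\<Gamma> x = A (norm x powr p) / p"
definition V :: "'b::euclidean_space \<Rightarrow> 'b" where "V x = (a (norm x powr p) * norm x powr (p - 2)) *\<^sub>R x"

text \<open>
  The derivative of \<open>A (s powr p) / p\<close> is \<open>flux s\<close>, which is monotone. The end point \<open>r = 0\<close>, where the mean value
  theorem needs continuity only, is included.
\<close>

lemma profile_convex:
  assumes s: "0 < s" and r: "0 \<le> r"
  shows "A (s powr p) / p + flux s * (r - s) \<le> A (r powr p) / p"
proof -
  define G where "G s = A (s powr p) / p" for s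
  have "(G has_real_derivative flux t) (at t)" if t: "0 < t" for t
  proof -
    have "((\<lambda>t. A (t powr p)) has_real_derivative a (t powr p) * (p * t powr (p - 1))) (at t)"
      by (rule DERIV_chain2[OF A_derivative has_real_derivative_powr[OF t]]) (use t in simp)
    from DERIV_cdivide[OF this, of p] show ?thesis using p_pos by (simp add: G_def[abs_def] flux_def)
  qed
  note d = this
  have "continuous_on {0..} (\<lambda>t. A (t powr p))"
    by (rule continuous_on_compose2[OF A_continuous])
       (use p_pos in \<open>auto intro!: continuous_on_powr' continuous_on_id continuous_on_norm_id continuous_on_const\<close>)
  then have c: "continuous_on {0..} G" unfolding G_def[abs_def] by (intro continuous_intros) (use p_pos in auto)
  have "G s + flux s * (r - s) \<le> G r"
  proof (cases r s rule: linorder_cases)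
    case less
    obtain z where z: "r < z" "z < s" "G s - G r = (s - r) * flux z"
      using MVT[OF less continuous_on_subset[OF c]] d r
      by (smt (verit, ccfv_threshold) DERIV_unique atLeastAtMost_iff atLeast_iff real_differentiable_def subsetI)
    have "(s - r) * flux z \<le> (s - r) * flux s" using flux_mono[of z s] z r by (intro mult_left_mono) auto
    then show ?thesis using z(3) by (simp add: algebra_simps)
  next
    case greater
    obtain z where z: "s < z" "z < r" "G r - G s = (r - s) * flux z"
      using MVT2[OF greater, of G flux] d s by auto
    have "(r - s) * flux s \<le> (r - s) * flux z" using flux_mono[of s z] z s by (intro mult_left_mono) auto
    then show ?thesis using z(3) by (simp add: algebra_simps)
  qed simp
  then show ?thesis by (simp add: G_def)
qed

lemma profile_nonneg: "0 \<le> A (r powr p)"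
  using A_bounds(1)[of "r powr p"] k p_pos by (auto simp: H_def intro: order_trans[rotated])

lemma norm_V: "norm (V x) = flux (norm x)"
proof (cases "x = 0")
  case False
  then have "norm x powr (p - 2) * norm x = norm x powr (p - 1)"
    using powr_add[of "norm x" "p - 2" 1] by simp
  then show ?thesis using False a_pos[of "norm x powr p"] by (simp add: V_def flux_def abs_mult mult.assoc)
qed (simp add: V_def flux_def)

lemma V_inner: "V x \<bullet> x = flux (norm x) * norm x"
proof (cases "x = 0")
  case False
  then have "norm x powr (p - 2) * norm x = norm x powr (p - 1)"
    using powr_add[of "norm x" "p - 2" 1] by simp
  then show ?thesis by (simp add: V_def flux_def dot_square_norm power2_eq_square mult.assoc[symmetric])
qed (simp add: V_def)

text \<open>
  By the Cauchy-Schwarz inequality the claim reduces to the convexity of the radial profile.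
\<close>

lemma \<Gamma>_convex: "\<Gamma> x + V x \<bullet> (y - x) \<le> \<Gamma> y"
proof (cases "x = 0")
  case True
  then show ?thesis using profile_nonneg[of "norm y"] p_pos by (simp add: \<Gamma>_def V_def)
next
  case False
  have "V x \<bullet> y \<le> flux (norm x) * norm y" using norm_cauchy_schwarz[of "V x" y] by (simp add: norm_V)
  then have "V x \<bullet> (y - x) \<le> flux (norm x) * (norm y - norm x)"
    by (simp add: inner_diff_right V_inner right_diff_distrib)
  then show ?thesis using profile_convex[of "norm x" "norm y"] False unfolding \<Gamma>_def by simp
qed

lemma \<Gamma>_mono:
  fixes x y :: "'b::euclidean_space"
  assumes "norm x \<le> norm y" shows "\<Gamma> x \<le> \<Gamma> y"
proof (cases "x = 0")
  case True
  then show ?thesis using profile_nonneg[of "norm y"] p_pos by (simp add: \<Gamma>_def)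
next
  case False
  have "0 \<le> flux (norm x) * (norm y - norm x)" using assms by (intro mult_nonneg_nonneg flux_nonneg) auto
  then show ?thesis using profile_convex[of "norm x" "norm y"] False unfolding \<Gamma>_def by simp
qed

lemma \<Gamma>_bounds:
  fixes x :: "'b::euclidean_space"
  shows "k0 / p * (norm x powr p + norm x powr q) \<le> \<Gamma> x" "\<Gamma> x \<le> k1 * (norm x powr p + norm x powr q)"
proof -
  have H: "H (norm x powr p) = norm x powr p + p / q * norm x powr q"
    using p_pos by (simp add: H_def powr_powr)
  have pq1: "1 \<le> p / q" using pq by simp
  have "k0 * (norm x powr p + norm x powr q) \<le> A (norm x powr p)"
  proof (rule order_trans[OF mult_left_mono A_bounds(1)])
    show "norm x powr p + norm x powr q \<le> H (norm x powr p)"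
      unfolding H using mult_right_mono[OF pq1, of "norm x powr q"] by simp
  qed (use k in auto)
  then have "k0 * (norm x powr p + norm x powr q) / p \<le> A (norm x powr p) / p"
    using p_pos by (intro divide_right_mono) auto
  then show "k0 / p * (norm x powr p + norm x powr q) \<le> \<Gamma> x" by (simp add: \<Gamma>_def)
  have "A (norm x powr p) \<le> k1 * (norm x powr p + p / q * norm x powr q)"
    using A_bounds(2)[of "norm x powr p"] by (simp add: H)
  also have "\<dots> \<le> k1 * (p * norm x powr p + p * norm x powr q)"
  proof (intro mult_left_mono add_mono mult_right_mono)
    have "norm x powr p * 1 \<le> norm x powr p * p" using p_pos by (intro mult_left_mono) auto
    then show "norm x powr p \<le> p * norm x powr p" by (simp add: mult.commute)
    show "p / q \<le> p" using pq p_pos by (simp add: divide_le_eq)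
  qed (use k in auto)
  also have "\<dots> = p * (k1 * (norm x powr p + norm x powr q))" by (simp add: algebra_simps)
  finally show "\<Gamma> x \<le> k1 * (norm x powr p + norm x powr q)"
    using p_pos by (simp add: \<Gamma>_def divide_le_eq mult.commute)
qed

lemma \<Gamma>_continuous: "continuous_on UNIV (\<Gamma> :: 'b::euclidean_space \<Rightarrow> real)"
proof -
  have "continuous_on UNIV (\<lambda>x :: 'b. A (norm x powr p))"
    by (rule continuous_on_compose2[OF A_continuous])
       (use p_pos in \<open>auto intro!: continuous_on_powr' continuous_on_id continuous_on_norm_id continuous_on_const\<close>)
  then show ?thesis unfolding \<Gamma>_def[abs_def] by (intro continuous_intros) (use p_pos in auto)
qed

lemma V_continuous: "continuous_on UNIV (V :: 'b::euclidean_space \<Rightarrow> 'b)"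
  unfolding continuous_on_eq_continuous_at[OF open_UNIV]
proof
  fix x :: 'b
  show "isCont V x"
  proof (cases "x = 0")
    case True
    have "((\<lambda>y :: 'b. k1 * (norm y powr (p - 1) + norm y powr (q - 1))) \<longlongrightarrow> k1 * (norm (0::'b) powr (p - 1) + norm (0::'b) powr (q - 1))) (at 0)"
      using pq by (intro tendsto_intros tendsto_powr') auto
    then have l: "((\<lambda>y :: 'b. k1 * (norm y powr (p - 1) + norm y powr (q - 1))) \<longlongrightarrow> 0) (at 0)" by simp
    have "(V \<longlongrightarrow> (0::'b)) (at 0)"
    proof (rule Lim_null_comparison[OF _ l])
      show "\<forall>\<^sub>F y :: 'b in at 0. norm (V y) \<le> k1 * (norm y powr (p - 1) + norm y powr (q - 1))"
        using flux_upper by (auto simp: norm_V eventually_at_filter)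
    qed
    then show ?thesis using True by (simp add: isCont_def V_def)
  next
    case False
    have "isCont (\<lambda>x. a (norm x powr p)) x"
      by (rule isCont_o2[of x "\<lambda>x. norm x powr p" a]) (use False in \<open>auto intro!: a_cont continuous_intros\<close>)
    then show ?thesis unfolding V_def[abs_def] using False by (intro continuous_intros) auto
  qed
qed

lemma V_growth: "norm (V x) powr (p / (p - 1)) \<le> (2 * k1) powr (p / (p - 1)) * (1 + norm x powr p)"
proof (rule conjugate_growth)
  show "norm (V x) \<le> 2 * k1 * max 1 (norm x) powr (p - 1)"
  proof (cases "x = 0")
    case False
    have 1: "norm x powr (p - 1) \<le> max 1 (norm x) powr (p - 1)" using pq by (intro powr_mono2) auto
    have "norm x powr (q - 1) \<le> max 1 (norm x) powr (q - 1)" using pq by (intro powr_mono2) auto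
    also have "\<dots> \<le> max 1 (norm x) powr (p - 1)" using pq by (intro powr_mono) auto
    finally have "k1 * (norm x powr (p - 1) + norm x powr (q - 1)) \<le> k1 * (max 1 (norm x) powr (p - 1) + max 1 (norm x) powr (p - 1))"
      using 1 k by (intro mult_left_mono) auto
    then show ?thesis using flux_upper[of "norm x"] False by (simp add: norm_V)
  qed (use k in \<open>simp add: V_def\<close>)
qed (use k p_pos in auto)

text \<open>
  Concavity of \<open>A\<close> at the points \<open>s powr p\<close> and \<open>t powr p * s powr p\<close>.
\<close>

lemma \<Gamma>_dilate:
  assumes t: "0 < t" shows "\<Gamma> (t *\<^sub>R x) - \<Gamma> x \<le> (t powr p - 1) / p * (V x \<bullet> x)"
proof (cases "x = 0")
  case False
  define s where "s = norm x"
  have s: "0 < s" using False by (simp add: s_def)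
  have n: "norm (t *\<^sub>R x) powr p = t powr p * s powr p" using t by (simp add: s_def powr_mult)
  have "A (t powr p * s powr p) - A (s powr p) \<le> a (s powr p) * (t powr p * s powr p - s powr p)"
    using s t by (intro A_concave) auto
  also have "\<dots> = (t powr p - 1) * (flux s * s)" unfolding flux_mult[OF s] by (simp add: algebra_simps)
  finally have "(A (t powr p * s powr p) - A (s powr p)) / p \<le> (t powr p - 1) * (flux s * s) / p"
    using p_pos by (intro divide_right_mono) auto
  then show ?thesis unfolding \<Gamma>_def n V_inner by (simp add: s_def flip: diff_divide_distrib)
qed (simp add: \<Gamma>_def V_def)

end

section \<open>The reaction term\<close>

locale reaction_term =
  fixes f :: "real \<Rightarrow> real" and p q \<alpha> :: real
  assumes pq: "1 < q" "q \<le> p" "p < \<alpha>"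
    and f_odd: "\<And>t. f (- t) = - f t" and f_cont: "continuous_on UNIV f"
    and f_nonneg: "\<And>t. 0 \<le> t \<Longrightarrow> 0 \<le> f t"
    and f_zero: "((\<lambda>t. f t / t powr (q - 1)) \<longlongrightarrow> 0) (at_right 0)"
    and F_infinity: "filterlim (\<lambda>t. primitive f t / t powr p) at_top at_top"
    and f_infinity: "((\<lambda>t. f t / t powr (\<alpha> - 1)) \<longlongrightarrow> 0) at_top"
    and f_quotient: "strict_mono_on {0<..} (\<lambda>t. f t / t powr (p - 1))"
begin

abbreviation "F \<equiv> primitive f"

lemma f_0 [simp]: "f 0 = 0" using f_odd[of 0] by simp

lemma f_quotient_less: "0 < s \<Longrightarrow> s < t \<Longrightarrow> f s / s powr (p - 1) < f t / t powr (p - 1)"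
  using f_quotient by (auto simp: strict_mono_on_def monotone_on_def)

lemma f_mono_pos:
  assumes "0 < s" "s < t" shows "f s \<le> f t"
proof -
  have "f s = f s / s powr (p - 1) * s powr (p - 1)" using assms by simp
  also have "\<dots> \<le> f t / t powr (p - 1) * t powr (p - 1)"
    using f_quotient_less[OF assms] f_nonneg assms pq by (intro mult_mono powr_mono2) auto
  also have "\<dots> = f t" using assms by simp
  finally show ?thesis .
qed

text \<open>
  On the positive half-line \<open>f\<close> is the product of two nondecreasing nonnegative functions; the rest follows
  by oddness.
\<close>

lemma f_mono: "mono f"
proof (rule monoI)
  fix s t :: real assume "s \<le> t"
  then consider "s = t" | "0 < s" "s < t" | "s \<le> 0" "0 \<le> t" | "t < 0" "s < t" by fastforce
  then show "f s \<le> f t"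
  proof cases
    case 3 then show ?thesis using f_nonneg[of t] f_nonneg[of "- s"] by (simp add: f_odd)
  next
    case 4 then show ?thesis using f_mono_pos[of "- t" "- s"] by (simp add: f_odd)
  qed (auto intro: f_mono_pos)
qed

lemma F_derivative: "(F has_real_derivative f t) (at t)"
proof -
  define T where "T = \<bar>t\<bar> + 1"
  have T: "-T < t" "t < T" "0 < T" by (auto simp: T_def)
  have "(F has_vector_derivative f t) (at t within {-T..T})"
    unfolding primitive_def[abs_def] using T by (intro interval_integral_FTC2 continuous_on_subset[OF f_cont]) auto
  then show ?thesis using at_within_Icc_at[OF T(1,2)] by (simp add: has_real_derivative_iff_has_vector_derivative)
qed

lemma F_continuous: "continuous_on UNIV F"
  using DERIV_isCont[OF F_derivative] by (simp add: continuous_on_eq_continuous_at)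

lemma F_even: "F (- t) = F t"
proof -
  have "((\<lambda>t. F (- t) - F t) has_real_derivative 0) (at t)" for t
  proof -
    have "((\<lambda>t. F (- t)) has_real_derivative f (- t) * - 1) (at t)"
      by (rule DERIV_chain2[OF F_derivative]) (auto intro!: derivative_eq_intros)
    from DERIV_diff[OF this F_derivative[of t]] show ?thesis by (simp add: f_odd)
  qed
  from DERIV_isconst_all[of "\<lambda>t. F (- t) - F t" t 0, OF allI[OF this]] show ?thesis by simp
qed

lemma F_convex: "F s + f s * (t - s) \<le> F t"
proof (cases s t rule: linorder_cases)
  case less
  obtain z where z: "s < z" "z < t" "F t - F s = (t - s) * f z" using MVT2[OF less F_derivative] by blast
  have "(t - s) * f s \<le> (t - s) * f z" using z by (intro mult_left_mono monoD[OF f_mono]) auto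
  then show ?thesis using z(3) by (simp add: algebra_simps)
next
  case greater
  obtain z where z: "t < z" "z < s" "F s - F t = (s - t) * f z" using MVT2[OF greater F_derivative] by blast
  have "(s - t) * f z \<le> (s - t) * f s" using z by (intro mult_left_mono monoD[OF f_mono]) auto
  then show ?thesis using z(3) by (simp add: algebra_simps)
qed simp

lemma F_nonneg: "0 \<le> F t" using F_convex[of 0 t] by simp

lemma f_abs: "\<bar>f t\<bar> = f \<bar>t\<bar>"
  using f_nonneg[of t] f_nonneg[of "- t"] by (cases "0 \<le> t") (simp_all add: f_odd)

text \<open>
  The two limits control \<open>f\<close> near \<open>0\<close> and near \<open>\<infinity>\<close>. In between \<open>f\<close> is at most its value \<open>f R\<close> at the right
  end, and the power \<open>\<alpha> - 1\<close> of the argument is bounded away from \<open>0\<close>.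
\<close>

lemma f_bound:
  assumes e: "0 < e"
  shows "\<exists>C>0. \<forall>t. \<bar>f t\<bar> \<le> e * \<bar>t\<bar> powr (q - 1) + C * \<bar>t\<bar> powr (\<alpha> - 1)"
proof -
  have "\<forall>\<^sub>F t in at_right 0. f t / t powr (q - 1) < e" using f_zero e by (rule order_tendstoD)
  then obtain d where d: "0 < d" "\<And>t. 0 < t \<Longrightarrow> t < d \<Longrightarrow> f t / t powr (q - 1) < e"
    by (auto simp: eventually_at_right_field)
  have "\<forall>\<^sub>F t in at_top. f t / t powr (\<alpha> - 1) < 1" using f_infinity zero_less_one by (rule order_tendstoD)
  then obtain T where T: "\<And>t. T \<le> t \<Longrightarrow> f t / t powr (\<alpha> - 1) < 1" by (auto simp: eventually_at_top_linorder)
  define R where "R = max T d"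
  define C where "C = 1 + f R / d powr (\<alpha> - 1)"
  have fR: "0 \<le> f R" using d(1) by (intro f_nonneg) (simp add: R_def)
  have C: "1 \<le> C" "f R / d powr (\<alpha> - 1) \<le> C" using fR by (simp_all add: C_def)
  have pos: "f t \<le> e * t powr (q - 1) + C * t powr (\<alpha> - 1)" if t: "0 < t" for t
  proof -
    have n: "0 \<le> e * t powr (q - 1)" "0 \<le> C * t powr (\<alpha> - 1)" using e C(1) by auto
    consider "t < d" | "R \<le> t" | "d \<le> t" "t \<le> R" by linarith
    then show ?thesis
    proof cases
      case 1 then have "f t \<le> e * t powr (q - 1)" using d(2)[OF t] t by (simp add: divide_less_eq)
      then show ?thesis using n by linarith
    next
      case 2 then have "f t \<le> 1 * t powr (\<alpha> - 1)" using T[of t] t by (simp add: R_def divide_less_eq)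
      also have "\<dots> \<le> C * t powr (\<alpha> - 1)" using C(1) by (rule mult_right_mono) simp
      finally show ?thesis using n by linarith
    next
      case 3
      have "f t \<le> f R" using 3(2) by (rule monoD[OF f_mono])
      also have "\<dots> = f R / d powr (\<alpha> - 1) * d powr (\<alpha> - 1)" using d(1) by simp
      also have "\<dots> \<le> C * t powr (\<alpha> - 1)"
        using C(1,2) 3(1) d(1) pq by (intro mult_mono powr_mono2) auto
      finally show ?thesis using n by linarith
    qed
  qed
  have "\<bar>f t\<bar> \<le> e * \<bar>t\<bar> powr (q - 1) + C * \<bar>t\<bar> powr (\<alpha> - 1)" for t
    using pos[of "\<bar>t\<bar>"] by (cases "t = 0") (simp_all add: f_abs)
  then show ?thesis using C(1) by (intro exI[of _ C]) auto
qed

lemma F_small: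
  assumes e: "0 < e" shows "\<exists>C>0. \<forall>t. F t \<le> e * \<bar>t\<bar> powr q + C * \<bar>t\<bar> powr \<alpha>"
proof -
  obtain C where C: "0 < C" "\<And>t. \<bar>f t\<bar> \<le> e * \<bar>t\<bar> powr (q - 1) + C * \<bar>t\<bar> powr (\<alpha> - 1)"
    using f_bound[OF e] by blast
  have "F t \<le> e * \<bar>t\<bar> powr q + C * \<bar>t\<bar> powr \<alpha>" for t
  proof (cases "t = 0")
    case False
    have "F t \<le> f t * t" using F_convex[of t 0] by simp
    also have "\<dots> \<le> \<bar>f t\<bar> * \<bar>t\<bar>" using abs_ge_self[of "f t * t"] by (simp add: abs_mult)
    also have "\<dots> \<le> (e * \<bar>t\<bar> powr (q - 1) + C * \<bar>t\<bar> powr (\<alpha> - 1)) * \<bar>t\<bar>" using C(2) by (intro mult_right_mono) auto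
    also have "\<dots> = e * \<bar>t\<bar> powr q + C * \<bar>t\<bar> powr \<alpha>"
      using powr_add[of "\<bar>t\<bar>" "q - 1" 1] powr_add[of "\<bar>t\<bar>" "\<alpha> - 1" 1] False by (simp add: algebra_simps)
    finally show ?thesis .
  qed simp
  then show ?thesis using C(1) by blast
qed

lemma F_large: "\<exists>C. \<forall>t. L * \<bar>t\<bar> powr p - C \<le> F t"
proof -
  have "\<forall>\<^sub>F t in at_top. L \<le> F t / t powr p" using F_infinity by (simp add: filterlim_at_top)
  then obtain T0 where T0: "\<And>t. T0 \<le> t \<Longrightarrow> L \<le> F t / t powr p" by (auto simp: eventually_at_top_linorder)
  define T where "T = max T0 1"
  have "L * \<bar>t\<bar> powr p - \<bar>L\<bar> * T powr p \<le> F t" for t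
  proof (cases "T \<le> \<bar>t\<bar>")
    case True
    then have "L \<le> F \<bar>t\<bar> / \<bar>t\<bar> powr p" "0 < \<bar>t\<bar> powr p" using T0[of "\<bar>t\<bar>"] by (auto simp: T_def)
    then have "L * \<bar>t\<bar> powr p \<le> F \<bar>t\<bar>" by (simp add: le_divide_eq)
    also have "F \<bar>t\<bar> = F t" using F_even[of t] by (simp add: abs_if)
    finally show ?thesis by (simp add: add_increasing2 diff_le_eq)
  next
    case False
    have "L * \<bar>t\<bar> powr p \<le> \<bar>L\<bar> * \<bar>t\<bar> powr p" by (intro mult_right_mono) auto
    also have "\<dots> \<le> \<bar>L\<bar> * T powr p" using False pq by (intro mult_left_mono powr_mono2) auto
    finally show ?thesis using F_nonneg[of t] by linarith
  qed
  then show ?thesis by blast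
qed

lemma F_growth: "\<exists>C>0. \<forall>t. F t \<le> C * (1 + \<bar>t\<bar> powr \<alpha>)"
proof -
  obtain C where C: "0 < C" "\<And>t. F t \<le> 1 * \<bar>t\<bar> powr q + C * \<bar>t\<bar> powr \<alpha>"
    using F_small[OF zero_less_one] by blast
  have "F t \<le> (1 + C) * (1 + \<bar>t\<bar> powr \<alpha>)" for t
  proof -
    have "\<bar>t\<bar> powr q \<le> 1 + \<bar>t\<bar> powr \<alpha>" using powr_le_small_add[of "\<bar>t\<bar>" 1 q \<alpha>] pq by simp
    with C(2)[of t] C(1) show ?thesis by (simp add: algebra_simps)
  qed
  then show ?thesis using C(1) by (intro exI[of _ "1 + C"]) auto
qed

lemma f_growth: "\<exists>C>0. \<forall>t. \<bar>f t\<bar> powr (\<alpha> / (\<alpha> - 1)) \<le> C * (1 + \<bar>t\<bar> powr \<alpha>)"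
proof -
  obtain C where C: "0 < C" "\<And>t. \<bar>f t\<bar> \<le> 1 * \<bar>t\<bar> powr (q - 1) + C * \<bar>t\<bar> powr (\<alpha> - 1)"
    using f_bound[OF zero_less_one] by blast
  have "\<bar>f t\<bar> powr (\<alpha> / (\<alpha> - 1)) \<le> (1 + C) powr (\<alpha> / (\<alpha> - 1)) * (1 + \<bar>t\<bar> powr \<alpha>)" for t
  proof (rule conjugate_growth)
    have "\<bar>t\<bar> powr (q - 1) \<le> max 1 \<bar>t\<bar> powr (q - 1)" using pq by (intro powr_mono2) auto
    also have "\<dots> \<le> max 1 \<bar>t\<bar> powr (\<alpha> - 1)" using pq by (intro powr_mono) auto
    finally have 1: "\<bar>t\<bar> powr (q - 1) \<le> max 1 \<bar>t\<bar> powr (\<alpha> - 1)" .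
    have "C * \<bar>t\<bar> powr (\<alpha> - 1) \<le> C * max 1 \<bar>t\<bar> powr (\<alpha> - 1)"
      using pq C(1) by (intro mult_left_mono powr_mono2) auto
    then show "\<bar>f t\<bar> \<le> (1 + C) * max 1 \<bar>t\<bar> powr (\<alpha> - 1)" using 1 C(2)[of t] by (simp add: algebra_simps)
  qed (use C(1) pq in auto)
  then show ?thesis using C(1) by (intro exI[of _ "(1 + C) powr (\<alpha> / (\<alpha> - 1))"]) auto
qed

text \<open>
  The derivative of \<open>F (\<tau> * s) - \<tau> powr p / p * (f s * s)\<close> with respect to \<open>\<tau>\<close> is a positive multiple of the
  difference of \<open>f t / t powr (p - 1)\<close> between \<open>t = \<tau> * s\<close> and \<open>t = s\<close>, so it has the sign of \<open>\<tau> - 1\<close>.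
\<close>

lemma F_dilate_pos:
  assumes t: "0 < t" "t \<noteq> 1" and s: "0 < s"
  shows "(t powr p - 1) / p * (f s * s) < F (t * s) - F s"
proof -
  define D where "D \<tau> = F (\<tau> * s) - \<tau> powr p / p * (f s * s)" for \<tau>
  define D' where "D' \<tau> = f (\<tau> * s) * s - \<tau> powr (p - 1) * (f s * s)" for \<tau>
  have d: "(D has_real_derivative D' \<tau>) (at \<tau>)" if "0 < \<tau>" for \<tau>
  proof -
    have 1: "((\<lambda>\<tau>. F (\<tau> * s)) has_real_derivative f (\<tau> * s) * s) (at \<tau>)"
      by (rule DERIV_chain2[OF F_derivative]) (auto intro!: derivative_eq_intros)
    have 2: "((\<lambda>\<tau>. \<tau> powr p * (f s * s / p)) has_real_derivative p * \<tau> powr (p - 1) * (f s * s / p)) (at \<tau>)"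
      by (rule DERIV_cmult_right[OF has_real_derivative_powr[OF that]])
    show ?thesis using DERIV_diff[OF 1 2] pq by (simp add: D_def[abs_def] D'_def)
  qed
  have D': "D' \<tau> = s * s powr (p - 1) * \<tau> powr (p - 1) * (f (\<tau> * s) / (\<tau> * s) powr (p - 1) - f s / s powr (p - 1))"
    if "0 < \<tau>" for \<tau> using that s by (simp add: D'_def powr_mult field_simps)
  have "D 1 < D t"
  proof (cases "1 < t")
    case True
    obtain z where z: "1 < z" "z < t" "D t - D 1 = (t - 1) * D' z" using MVT2[OF True, of D D'] d by auto
    have "f s / s powr (p - 1) < f (z * s) / (z * s) powr (p - 1)" using z s by (intro f_quotient_less) auto
    then have "0 < D' z" using D'[of z] z s by simp
    then show ?thesis using z True by (smt (verit) mult_pos_pos)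
  next
    case False
    then have less: "t < 1" using t by simp
    obtain z where z: "t < z" "z < 1" "D 1 - D t = (1 - t) * D' z" using MVT2[OF less, of D D'] d t by auto
    have "f (z * s) / (z * s) powr (p - 1) < f s / s powr (p - 1)" using z t s by (intro f_quotient_less) auto
    then have "D' z < 0" using D'[of z] z t s by (simp add: mult_pos_neg)
    then show ?thesis using z less by (smt (verit) mult_pos_neg)
  qed
  then show ?thesis using pq by (simp add: D_def diff_divide_distrib left_diff_distrib)
qed

lemma F_dilate:
  assumes t: "0 < t" "t \<noteq> 1" and s: "s \<noteq> 0"
  shows "(t powr p - 1) / p * (f s * s) < F (t * s) - F s"
proof (cases "0 < s")
  case False
  then have "0 < - s" using s by simp
  from F_dilate_pos[OF t this] show ?thesis using F_even[of "t * s"] F_even[of s] by (simp add: f_odd)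
qed (rule F_dilate_pos[OF t])

end

text \<open>
  For \<open>p \<ge> N\<close> already \<open>N / p \<le> 1\<close>.
\<close>

lemma subcritical_exponent:
  assumes "0 < p" "p < \<alpha>" "ereal \<alpha> < sobolev_exponent N p"
  shows "N * (1 / p - 1 / \<alpha>) < 1"
proof (cases "p < N")
  case True
  then have "\<alpha> * (N - p) < N * p" using assms by (simp add: sobolev_exponent_def less_divide_eq)
  then have "N * (\<alpha> - p) < p * \<alpha>" by (simp add: algebra_simps)
  then show ?thesis using assms by (simp add: field_simps)
next
  case False
  have "N * (1 / p - 1 / \<alpha>) \<le> p * (1 / p - 1 / \<alpha>)"
    using False assms by (intro mult_right_mono) (auto simp: field_simps)
  also have "\<dots> < 1" using assms by (simp add: field_simps)
  finally show ?thesis .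
qed

section \<open>Ground states of the quasilinear problem\<close>

context variational begin

lemma \<Phi>_unique:
  assumes "W0 p w h" "W0 p w h'" shows "\<Phi> w h = \<Phi> w h'"
  using P_ray_unique[OF assms, of 1] by (simp add: \<Phi>_def)

lemma DP_cong_AE:
  assumes "g \<in> Lp M p" "g' \<in> Lp M p" "h \<in> Lp M p" "AE x in M. g x = g' x"
  shows "DP g h = DP g' h"
  unfolding DP_def
proof (rule integral_cong_AE)
  show "(\<lambda>x. V (g x) \<bullet> h x) \<in> borel_measurable M" "(\<lambda>x. V (g' x) \<bullet> h x) \<in> borel_measurable M"
    using DP_integrable[OF assms(1,3)] DP_integrable[OF assms(2,3)] by auto
  show "AE x in M. V (g x) \<bullet> h x = V (g' x) \<bullet> h x" using assms(4) by eventually_elim simp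
qed

lemma W1p_norm_eq_nrm: "W0 p v h \<Longrightarrow> W1p_norm \<Omega> p v = nrm v h"
  using W0_weak_gradient(3)[OF exponents(4)] by (simp add: nrm_def)

lemma nontrivial_iff:
  assumes u: "u \<in> Lp M p" shows "nontrivial_on \<Omega> u \<longleftrightarrow> 0 < Lp_mod M p u"
proof -
  have "Lp_mod M p u = 0 \<longleftrightarrow> (AE x in M. norm (u x) powr p = 0)"
    unfolding Lp_mod_def using u by (intro integral_nonneg_eq_0_iff_AE) (auto simp: Lp_def)
  then show ?thesis using Lp_mod_nonneg[of M p u] by (auto simp: nontrivial_on_def less_le)
qed

lemma stationary_imp_critical:
  assumes J: "\<And>u g. W0 p u g \<Longrightarrow> J u = \<Phi> u g" and W: "W0 p u g"
    and st: "\<And>v h. W0 p v h \<Longrightarrow> DP g h = DQ u v"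
  shows "critical_point \<Omega> p J u"
proof -
  have "\<exists>\<delta>>0. \<forall>v\<in>W01p \<Omega> p. W1p_norm \<Omega> p v < \<delta> \<longrightarrow> \<bar>J (\<lambda>x. u x + v x) - J u - 0\<bar> \<le> e * W1p_norm \<Omega> p v"
    if e: "e > 0" for e
  proof -
    obtain d where d: "d > 0" "\<And>v h. W0 p v h \<Longrightarrow> nrm v h < d \<Longrightarrow>
        \<bar>\<Phi> (\<lambda>x. u x + v x) (\<lambda>x. g x + h x) - \<Phi> u g - (DP g h - DQ u v)\<bar> \<le> e * nrm v h"
      using frechet[OF W e] by blast
    have "\<bar>J (\<lambda>x. u x + v x) - J u - 0\<bar> \<le> e * W1p_norm \<Omega> p v"
      if v: "v \<in> W01p \<Omega> p" "W1p_norm \<Omega> p v < d" for v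
    proof -
      obtain h where h: "W0 p v h" using v(1) by (auto simp: W01p_iff[OF exponents(4)])
      have "W0 p (\<lambda>x. u x + v x) (\<lambda>x. g x + h x)" using W0_add[OF exponents(3) W h, of 1] by simp
      then show ?thesis using d(2)[OF h] v(2) J[OF W] J st[OF h] by (simp add: W1p_norm_eq_nrm[OF h])
    qed
    with d(1) show ?thesis by blast
  qed
  then show ?thesis
    using W unfolding critical_point_def has_W01p_derivative_def W01p_iff[OF exponents(4)]
    by (auto intro!: exI[of _ 0])
qed

text \<open>
  For a small multiple \<open>s * u\<close> as increment, the two first order expansions of the energy at \<open>u\<close>, with derivative \<open>0\<close>
  and with derivative \<open>DP - DQ\<close>, differ by \<open>s * N\<close>, while both remainders are at most \<open>e * s\<close> times the
  norm of \<open>u\<close>.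
\<close>

lemma critical_imp_Nehari:
  assumes J: "\<And>u g. W0 p u g \<Longrightarrow> J u = \<Phi> u g" and W: "W0 p u g" and crit: "critical_point \<Omega> p J u"
  shows "DP g g = DQ u u"
proof (rule ccontr)
  define N where "N = DP g g - DQ u u"
  define n where "n = nrm u g"
  have n: "0 \<le> n" by (simp add: n_def nrm_nonneg)
  assume "\<not> ?thesis"
  then have N: "0 < \<bar>N\<bar>" by (simp add: N_def)
  define e where "e = \<bar>N\<bar> / (2 * (n + 1))"
  have e: "0 < e" using N n by (simp add: e_def)
  obtain d where d: "d > 0" "\<And>v h. W0 p v h \<Longrightarrow> nrm v h < d \<Longrightarrow>
      \<bar>\<Phi> (\<lambda>x. u x + v x) (\<lambda>x. g x + h x) - \<Phi> u g - (DP g h - DQ u v)\<bar> \<le> e * nrm v h"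
    using frechet[OF W e] by blast
  obtain d' where d': "d' > 0" "\<And>v. v \<in> W01p \<Omega> p \<Longrightarrow> W1p_norm \<Omega> p v < d' \<Longrightarrow>
      \<bar>J (\<lambda>x. u x + v x) - J u - 0\<bar> \<le> e * W1p_norm \<Omega> p v"
    using crit e unfolding critical_point_def has_W01p_derivative_def by blast
  define s where "s = min d d' / (n + 1)"
  have s: "0 < s" using d(1) d'(1) n by (simp add: s_def)
  have "s * n < s * (n + 1)" using s by simp
  also have "\<dots> = min d d'" using n by (simp add: s_def)
  finally have sn: "s * n < d" "s * n < d'" by auto
  define v where "v x = s * u x" for x
  define h where "h x = s *\<^sub>R g x" for x
  have Wv: "W0 p v h" unfolding v_def h_def by (rule scaled[OF W])
  have nv: "nrm v h = s * n" using nrm_scale[OF W, of s] s by (simp add: v_def[abs_def] h_def[abs_def] n_def)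
  have Ws: "W0 p (\<lambda>x. u x + v x) (\<lambda>x. g x + h x)" using W0_add[OF exponents(3) W Wv, of 1] by simp
  have "\<bar>\<Phi> (\<lambda>x. u x + v x) (\<lambda>x. g x + h x) - \<Phi> u g - (DP g h - DQ u v)\<bar> \<le> e * (s * n)"
    using d(2)[OF Wv] sn by (simp add: nv)
  moreover have "DP g h - DQ u v = s * N"
    by (simp add: DP_def DQ_def N_def v_def h_def right_diff_distrib mult.left_commute)
  moreover have "v \<in> W01p \<Omega> p" using Wv by (auto simp: W01p_iff[OF exponents(4)])
  then have "\<bar>\<Phi> (\<lambda>x. u x + v x) (\<lambda>x. g x + h x) - \<Phi> u g\<bar> \<le> e * (s * n)"
    using d'(2)[of v] sn J[OF Ws] J[OF W] by (simp add: W1p_norm_eq_nrm[OF Wv] nv)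
  ultimately have "\<bar>s * N\<bar> \<le> s * (2 * e * n)" by (simp add: abs_le_iff algebra_simps)
  then have "\<bar>N\<bar> \<le> 2 * e * n" using s by (simp add: abs_mult)
  also have "\<dots> < \<bar>N\<bar>" using N n by (simp add: e_def field_simps)
  finally show False by simp
qed

theorem W01p_ground_state:
  assumes ne: "\<Omega> \<noteq> {}" and J: "\<And>u g. W0 p u g \<Longrightarrow> J u = \<Phi> u g"
  shows "\<exists>u. u \<in> W01p \<Omega> p \<and> (\<forall>v\<in>W01p \<Omega> p. DP (weak_gradient \<Omega> u) (weak_gradient \<Omega> v) = DQ u v) \<and>
    nontrivial_ground_state \<Omega> p J u \<and> (\<forall>x. 0 \<le> u x)"
proof -
  obtain u g where u: "W0 p u g" "Lp_mod M p u > 0" "\<And>x. 0 \<le> u x" "\<And>v h. W0 p v h \<Longrightarrow> DP g h = DQ u v"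
    "\<And>v h. W0 p v h \<Longrightarrow> Lp_mod M p v > 0 \<Longrightarrow> DP h h = DQ v v \<Longrightarrow> \<Phi> u g \<le> \<Phi> v h"
    using ground_state[OF ne] by blast
  note wu = W0_weak_gradient[OF exponents(4) u(1)]
  have sol: "DP (weak_gradient \<Omega> u) (weak_gradient \<Omega> v) = DQ u v" if v: "v \<in> W01p \<Omega> p" for v
  proof -
    obtain h where "W0 p v h" using v by (auto simp: W01p_iff[OF exponents(4)])
    note wv = W0_weak_gradient(1)[OF exponents(4) this]
    show ?thesis unfolding u(4)[OF wv, symmetric]
      by (rule DP_cong_AE[OF W0_D(2)[OF wu(1)] W0_D(2)[OF u(1)] W0_D(2)[OF wv] wu(2)])
  qed
  have least: "J u \<le> J v" if v: "critical_point \<Omega> p J v" "nontrivial_on \<Omega> v" for v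
  proof -
    obtain h where h: "W0 p v h" using v(1) by (auto simp: critical_point_def W01p_iff[OF exponents(4)])
    have "Lp_mod M p v > 0" using v(2) by (simp add: nontrivial_iff[OF W0_D(1)[OF h]])
    then have "\<Phi> u g \<le> \<Phi> v h" by (rule u(5)[OF h _ critical_imp_Nehari[OF J h v(1)]])
    then show ?thesis by (simp add: J[OF u(1)] J[OF h])
  qed
  have "critical_point \<Omega> p J u" by (rule stationary_imp_critical[OF J u(1,4)])
  moreover have "nontrivial_on \<Omega> u" using u(2) by (simp add: nontrivial_iff[OF W0_D(1)[OF u(1)]])
  moreover have "u \<in> W01p \<Omega> p" using u(1) by (auto simp: W01p_iff[OF exponents(4)])
  ultimately show ?thesis using sol least u(3) unfolding nontrivial_ground_state_def by blast
qed

end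

theorem corollary2p1:
  fixes \<Omega> :: "'a::euclidean_space set"
    and f a :: "real \<Rightarrow> real"
    and p q :: real
  assumes dim: "DIM('a) \<ge> 3"
    and domain: "open \<Omega>" "connected \<Omega>" "\<Omega> \<noteq> {}" "bounded \<Omega>"
    and f_odd: "\<And>t. f (- t) = - f t"
    and f_C1: "f C1_differentiable_on UNIV"
    and f_nonneg: "\<And>t. t \<ge> 0 \<Longrightarrow> f t \<ge> 0"
    and a_nonneg: "\<And>t. t \<ge> 0 \<Longrightarrow> a t \<ge> 0"
    and a_C1: "a C1_differentiable_on {0<..}"
    and pq: "p \<ge> q" "q > 1"
    and h1: "\<exists>k0>0. \<exists>k1>0. \<forall>t>0.
        k0 * (1 + t powr ((q - p) / p)) \<le> a t \<and> a t \<le> k1 * (1 + t powr ((q - p) / p))"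
    and h2: "antimono_on {0<..} a"
    and h3: "convex_on {0<..} (\<lambda>t. a (t powr p) * t powr p)"
        "convex_on {0<..} (\<lambda>t. primitive a (t powr p) - a (t powr p) * t powr p)"
    and h4: "((\<lambda>t. f t / t powr (q - 1)) \<longlongrightarrow> 0) (at_right 0)"
    and h5: "filterlim (\<lambda>t. primitive f t / t powr p) at_top at_top"
    and h6: "\<exists>\<alpha>. p < \<alpha> \<and> ereal \<alpha> < sobolev_exponent (real DIM('a)) p \<and>
        ((\<lambda>t. f t / t powr (\<alpha> - 1)) \<longlongrightarrow> 0) at_top"
    and h7: "strict_mono_on {0<..} (\<lambda>t. f t / t powr (p - 1))"
  shows "\<exists>u0. weak_solution \<Omega> p a f u0 \<and>
              nontrivial_ground_state \<Omega> p (energy \<Omega> p a f) u0 \<and>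
              (AE x in lebesgue_on \<Omega>. u0 x \<ge> 0)"
proof -
  obtain k0 k1 where k: "0 < k0" "0 < k1" "\<And>t. 0 < t \<Longrightarrow> k0 * (1 + t powr ((q - p) / p)) \<le> a t"
    "\<And>t. 0 < t \<Longrightarrow> a t \<le> k1 * (1 + t powr ((q - p) / p))" using h1 by blast
  obtain \<alpha> where \<alpha>: "p < \<alpha>" "ereal \<alpha> < sobolev_exponent (real DIM('a)) p"
    "((\<lambda>t. f t / t powr (\<alpha> - 1)) \<longlongrightarrow> 0) at_top" using h6 by blast
  have a_cont: "isCont a t" if "0 < t" for t
    using C1_differentiable_imp_continuous_on[OF a_C1] that by (simp add: continuous_on_eq_continuous_at)
  interpret pp: principal_part a p q k0 k1
  proof
    show "a t \<le> a s" if "0 < s" "s \<le> t" for s t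
      using h2 that by (auto simp: monotone_on_def)
  qed (use pq k a_cont h3(1) in auto)
  interpret rt: reaction_term f p q \<alpha>
    by unfold_locales (use pq \<alpha> f_odd f_nonneg h4 h5 h7 C1_differentiable_imp_continuous_on[OF f_C1] in auto)
  obtain C1 where C1: "0 < C1" "\<And>t. primitive f t \<le> C1 * (1 + \<bar>t\<bar> powr \<alpha>)" using rt.F_growth by blast
  obtain C2 where C2: "0 < C2" "\<And>t. \<bar>f t\<bar> powr (\<alpha> / (\<alpha> - 1)) \<le> C2 * (1 + \<bar>t\<bar> powr \<alpha>)" using rt.f_growth by blast
  define C3 where "C3 = (2 * k1) powr (p / (p - 1))"
  define K where "K = k1 + C1 + C2 + C3"
  have K: "0 < K" "k1 \<le> K" "C1 \<le> K" "C2 \<le> K" "C3 \<le> K"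
    using k C1(1) C2(1) by (auto simp: K_def C3_def intro!: add_pos_nonneg)
  have raise: "x \<le> K * y" if "x \<le> c * y" "c \<le> K" "0 \<le> y" for c x y :: real
    using that mult_right_mono[of c K y] by linarith
  interpret vp: variational \<Omega> p q \<alpha> "k0 / p" K pp.\<Gamma> pp.V "primitive f" f
  proof
    show "pp.\<Gamma> x \<le> K * (norm x powr p + norm x powr q)" for x :: 'a
      by (rule raise[OF pp.\<Gamma>_bounds(2) K(2)]) simp
    show "norm (pp.V x) powr (p / (p - 1)) \<le> K * (1 + norm x powr p)" for x :: 'a
      by (rule raise[OF pp.V_growth[folded C3_def] K(5)]) simp
    show "\<bar>f t\<bar> powr (\<alpha> / (\<alpha> - 1)) \<le> K * (1 + \<bar>t\<bar> powr \<alpha>)" for t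
      by (rule raise[OF C2(2) K(4)]) simp
    show "primitive f t \<le> K * (1 + \<bar>t\<bar> powr \<alpha>)" for t
      by (rule raise[OF C1(2) K(3)]) simp
    show "real DIM('a) * (1 / p - 1 / \<alpha>) < 1"
      by (rule subcritical_exponent[OF pp.p_pos(1) \<alpha>(1,2)])
    show "\<exists>C. \<forall>t. primitive f t \<le> e * \<bar>t\<bar> powr q + C * \<bar>t\<bar> powr \<alpha>" if "0 < e" for e
      using rt.F_small[OF that] by blast
    show "pp.\<Gamma> x + pp.V x \<bullet> (y - x) \<le> pp.\<Gamma> y" for x y :: 'a by (rule pp.\<Gamma>_convex)
    show "norm x \<le> norm y \<Longrightarrow> pp.\<Gamma> x \<le> pp.\<Gamma> y" for x y :: 'a by (rule pp.\<Gamma>_mono)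
    show "0 < t \<Longrightarrow> pp.\<Gamma> (t *\<^sub>R x) - pp.\<Gamma> x \<le> (t powr p - 1) / p * (pp.V x \<bullet> x)" for t and x :: 'a
      by (rule pp.\<Gamma>_dilate)
    show "k0 / p * (norm x powr p + norm x powr q) \<le> pp.\<Gamma> x" for x :: 'a by (rule pp.\<Gamma>_bounds)
    show "\<exists>C. \<forall>t. L * \<bar>t\<bar> powr p - C \<le> primitive f t" for L by (rule rt.F_large)
    show "primitive f s + f s * (t - s) \<le> primitive f t" for s t by (rule rt.F_convex)
    show "0 < t \<Longrightarrow> t \<noteq> 1 \<Longrightarrow> s \<noteq> 0 \<Longrightarrow> (t powr p - 1) / p * (f s * s) < primitive f (t * s) - primitive f s" for s t
      by (rule rt.F_dilate)
    show "primitive f (- s) = primitive f s" for s by (rule rt.F_even)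
  qed (use domain pq \<alpha> k K pp.p_pos pp.\<Gamma>_continuous pp.V_continuous rt.F_continuous rt.f_cont in auto)
  have energy: "energy \<Omega> p a f u = vp.\<Phi> u g" if "vp.W0 p u g" for u g
  proof -
    have "energy \<Omega> p a f u = vp.\<Phi> u (weak_gradient \<Omega> u)"
      by (simp add: energy_def vp.\<Phi>_def vp.P_def vp.Q_def pp.\<Gamma>_def)
    then show ?thesis
      using vp.\<Phi>_unique[OF vp.W0_weak_gradient(1)[OF vp.exponents(4) that] that] by simp
  qed
  obtain u where u: "u \<in> W01p \<Omega> p" "\<forall>v\<in>W01p \<Omega> p. vp.DP (weak_gradient \<Omega> u) (weak_gradient \<Omega> v) = vp.DQ u v"
    "nontrivial_ground_state \<Omega> p (energy \<Omega> p a f) u" "\<forall>x. 0 \<le> u x"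
    using vp.W01p_ground_state[OF domain(3) energy] by blast
  have "weak_solution \<Omega> p a f u"
    using u(1,2) by (simp add: weak_solution_def vp.DP_def vp.DQ_def pp.V_def)
  with u(3,4) show ?thesis by blast
qed

end
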